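(* Let Assumptions M and U (stated in the context) hold, and let $\hat\Gamma_{LA}$ be the lag-augmented least squares estimator defined in the context. Then, as $n\to\infty$, $$\sqrt n\,\mathrm{vec}\big(\hat\Gamma_{LA}-\Gamma\big)\rightarrow_w\mathcal N\big(0,\Sigma^{-1}\otimes\Sigma\big)$$ uniformly over $\Theta$, where $\Gamma=\Gamma_\theta$ and $\Sigma=\Sigma_\theta$.
   Context: Notation. Fix $d\ge1$. $A^T$ is the conjugate transpose, $\sigma_{\max},\sigma_{\min}$ the largest and smallest singular values, $\|\cdot\|$ the Frobenius (Euclidean) norm, $S_d$ the set of $d\times d$ positive semidefinite matrices, $\mathrm{vec}$ column-stacking, $\otimes$ the Kronecker product. Uniform convergence in distribution. $d_{BL}(X,Y)=\sup_f|\mathbb Ef(X)-\mathbb Ef(Y)|$ over $f$ with values in $[-1,1]$ and Lipschitz constant at most $1$; $X_{n,\theta}\rightarrow_wY_{n,\theta}$ uniformly over $\Theta$ means $\lim_n\sup_{\theta\in\Theta}d_{BL}(X_{n,\theta},Y_{n,\theta})=0$ (here $Y_{n,\theta}$ has law $\mathcal N(0,\Sigma_\theta^{-1}\otimes\Sigma_\theta)$). Model. $\Theta\subset\mathbb R^{d\times d}\times S_d\times\mathbb R_+$; $\theta=(\Gamma_\theta,\Sigma_\theta,c_\theta)$; $\lambda_{\theta,i}$ are the distinct eigenvalues of $\Gamma_\theta$. $(X_{t,\theta})_{t\in\mathbb N}$, $(\epsilon_{t,\theta})_{t\in\mathbb N}$ ($\mathbb N\ni0$) are families of $\mathbb R^d$-valued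 processes on a probability space; $\mathcal F_{t,\theta}$ is the filtration generated by $\epsilon_{t,\theta}$. Assumption M. (1) $\epsilon_{t,\theta}$ is a stationary martingale difference sequence with respect to $\mathcal F_{t,\theta}$: $\sup_{t,\theta}\mathbb E\|\epsilon_{t,\theta}\|<\infty$ and $\mathbb E(\epsilon_{t,\theta}|\mathcal F_{t-1,\theta})=\mathbb E\epsilon_{0,\theta}=0$ for all $t\ge1$, $\theta\in\Theta$. (2) $\mathbb E(\epsilon_{t,\theta}\epsilon_{t,\theta}^T|\mathcal F_{t-1,\theta})=\mathbb E\epsilon_{0,\theta}\epsilon_{0,\theta}^T=\Sigma_\theta$ a.s. for all $t\ge1$, $\theta\in\Theta$. (3) There is a small $\delta>0$ such that $\mathbb E\|\epsilon_{t,\theta}\|^{2+\delta}\le c_\theta$ a.s. for all $t\in\mathbb N$, $\theta\in\Theta$. (4) $X_{t,\theta}=\Gamma_\theta X_{t-1,\theta}+\epsilon_{t,\theta}$ for $t\ge1$, $X_{0,\theta}=0$. Jordan-like matrices. For $\delta'>0$, $\mathcal J_d(\delta')\subset\mathbb C^{d\times d}$ is the set of $J=D+N$ with $D$ diagonal, $|D_{11}|\ge\dots\ge|D_{dd}|$, and $N$ zero except on the superdiagonal, where $N_{i,i+1}\in\{0,1\}$ if $|D_{ii}|\le\delta'$ and $N_{i,i+1}=0$ otherwise. Assumption U. (1) $\sup_\theta c_\theta<\infty$. (2) $\sup_\theta\{\sigma_{\max}(\Sigma_\theta)+\sigma_{\min}(\Sigma_\theta)^{-1}\}<\infty$. (3)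 There is a small $\alpha\in(0,1)$ such that, with $r_\alpha=(1-\alpha)(2-\alpha)/\alpha$, every eigenvalue satisfies $|\lambda_{\theta,i}|\le1$ and $|\lambda_{\theta,i}|\,|1-\lambda_{\theta,i}|\le r_\alpha(1-|\lambda_{\theta,i}|)$. (4) There exist $F_\theta\in\mathbb C^{d\times d}$ and $J_\theta\in\mathcal J_d(1-\alpha)$ with $F_\theta^{-1}\Gamma_\theta F_\theta=J_\theta$ and $\sup_\theta\{\sigma_{\max}(F_\theta)+\sigma_{\min}(F_\theta)^{-1}+\sigma_{\max}(J_\theta)\}<\infty$. Lag augmentation. $\bar X_t=(X_{t-1}^T,X_{t-2}^T)^T\in\mathbb R^{2d}$, $\hat\Pi_{LA}=\sum_{t=2}^nX_t\bar X_t^T\big(\sum_{t=2}^n\bar X_t\bar X_t^T\big)^{-1}\in\mathbb R^{d\times2d}$ is the least squares estimator in the regression of $X_t$ on $\bar X_t$, $D=(I_d,0)^T\in\mathbb R^{2d\times d}$, and $\hat\Gamma_{LA}=\hat\Pi_{LA}D$. *)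

theory Defs
  imports "HOL-Probability.Probability"
begin

text \<open>
  Rows and columns of $d \times d$ matrices are indexed by a finite type \<open>'d\<close>; it is linearly
  ordered where the position of the entries matters (superdiagonal, ordering of the diagonal).
\<close>

definition psd_matrices :: "(real^'d^'d) set" where
  "psd_matrices = {A. transpose A = A \<and> (\<forall>x. 0 \<le> x \<bullet> (A *v x))}"

definition complex_matrix :: "real^'n^'m \<Rightarrow> complex^'n^'m" where
  "complex_matrix A = (\<chi> i j. complex_of_real (A $ i $ j))"

definition conj_transpose :: "complex^'n^'m \<Rightarrow> complex^'m^'n" where
  "conj_transpose A = (\<chi> i j. cnj (A $ j $ i))"

definition eigenvalues :: "complex^'d^'d \<Rightarrow> complex set" where
  "eigenvalues A = {l. \<exists>v. v \<noteq> 0 \<and> A *v v = l *s v}"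

definition singular_values :: "complex^'d^'d \<Rightarrow> real set" where
  "singular_values A = {s. 0 \<le> s \<and> complex_of_real (s\<^sup>2) \<in> eigenvalues (conj_transpose A ** A)}"

definition sigma_max :: "complex^'d^'d \<Rightarrow> real" where
  "sigma_max A = Max (singular_values A)"

definition sigma_min :: "complex^'d^'d \<Rightarrow> real" where
  "sigma_min A = Min (singular_values A)"

definition outer :: "real^'m \<Rightarrow> real^'n \<Rightarrow> real^'n^'m" where
  "outer x y = (\<chi> i j. x $ i * y $ j)"

text \<open>
  Vectors of length $d^2$ are indexed by \<open>'d \<times> 'd\<close> in lexicographic order: \<open>(j, i)\<close> is the $i$-th
  place in the $j$-th block, that is, row $i$ of column $j$ in a stack of columns. The rows and
  columns of Kronecker products are indexed in the same way.
\<close>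

definition col_stack :: "real^'n^'m \<Rightarrow> real^('n \<times> 'm)" where
  "col_stack A = (\<chi> p. A $ snd p $ fst p)"

definition kronecker :: "real^'n^'m \<Rightarrow> real^'q^'p \<Rightarrow> real^('n \<times> 'q)^('m \<times> 'p)" where
  "kronecker A B = (\<chi> r s. A $ fst r $ fst s * B $ snd r $ snd s)"

definition diagonal :: "complex^'d^'d \<Rightarrow> bool" where
  "diagonal A \<longleftrightarrow> (\<forall>i j. i \<noteq> j \<longrightarrow> A $ i $ j = 0)"

definition next_index :: "'d::linorder \<Rightarrow> 'd \<Rightarrow> bool" where
  "next_index i j \<longleftrightarrow> i < j \<and> \<not> (\<exists>k. i < k \<and> k < j)"

definition jordan_like :: "real \<Rightarrow> (complex^('d::{finite,linorder})^('d::{finite,linorder})) set" where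
  "jordan_like \<delta>' = {D + N | D N.
     diagonal D \<and> (\<forall>i j. i \<le> j \<longrightarrow> cmod (D $ j $ j) \<le> cmod (D $ i $ i)) \<and>
     (\<forall>i j. \<not> next_index i j \<longrightarrow> N $ i $ j = 0) \<and>
     (\<forall>i j. next_index i j \<longrightarrow>
        (if cmod (D $ i $ i) \<le> \<delta>' then N $ i $ j \<in> {0, 1} else N $ i $ j = 0))}"

text \<open>The law $\mathcal N(m, V)$ for positive definite $V$.\<close>

definition multivariate_normal :: "real^'k \<Rightarrow> real^'k^'k \<Rightarrow> (real^'k) measure" where
  "multivariate_normal m V = density lborel (\<lambda>x. ennreal
     (exp (- ((x - m) \<bullet> (matrix_inv V *v (x - m))) / 2) / sqrt ((2 * pi) ^ CARD('k) * det V)))"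

text \<open>The bounded Lipschitz distance, as a function of the two laws.\<close>

definition d_BL :: "'b::metric_space measure \<Rightarrow> 'b measure \<Rightarrow> real" where
  "d_BL \<mu> \<nu> = (SUP f \<in> {f. range f \<subseteq> {-1..1} \<and> 1-lipschitz_on UNIV f}.
     \<bar>(\<integral>x. f x \<partial>\<mu>) - (\<integral>x. f x \<partial>\<nu>)\<bar>)"

definition uniformly_weakly_converges ::
    "'p set \<Rightarrow> (nat \<Rightarrow> 'p \<Rightarrow> 'b::metric_space measure) \<Rightarrow> (nat \<Rightarrow> 'p \<Rightarrow> 'b measure) \<Rightarrow> bool" where
  "uniformly_weakly_converges \<Theta> \<mu> \<nu> \<longleftrightarrow>
     (\<lambda>n. SUP \<theta>\<in>\<Theta>. ennreal (d_BL (\<mu> n \<theta>) (\<nu> n \<theta>))) \<longlonglongrightarrow> 0"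

definition generated_filtration ::
    "'w measure \<Rightarrow> (nat \<Rightarrow> 'w \<Rightarrow> 'b::topological_space) \<Rightarrow> nat \<Rightarrow> 'w measure" where
  "generated_filtration M Y t =
     sigma (space M) (\<Union>s\<in>{..t}. {Y s -` A \<inter> space M | A. A \<in> sets borel})"

definition cond_exp_vector ::
    "'w measure \<Rightarrow> 'w measure \<Rightarrow> ('w \<Rightarrow> real^'n) \<Rightarrow> 'w \<Rightarrow> real^'n" where
  "cond_exp_vector M F Y \<omega> = (\<chi> i. real_cond_exp M F (\<lambda>\<omega>. Y \<omega> $ i) \<omega>)"

definition cond_exp_matrix ::
    "'w measure \<Rightarrow> 'w measure \<Rightarrow> ('w \<Rightarrow> real^'n^'m) \<Rightarrow> 'w \<Rightarrow> real^'n^'m" where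
  "cond_exp_matrix M F Y \<omega> = (\<chi> i j. real_cond_exp M F (\<lambda>\<omega>. Y \<omega> $ i $ j) \<omega>)"

text \<open>
  Stationarity is read in the weak sense. For a martingale difference sequence with constant
  conditional covariance it holds automatically, and it follows from strict stationarity.
\<close>

definition weakly_stationary :: "'w measure \<Rightarrow> (nat \<Rightarrow> 'w \<Rightarrow> real^'n) \<Rightarrow> bool" where
  "weakly_stationary M Y \<longleftrightarrow>
     (\<forall>t. (\<integral>\<omega>. Y t \<omega> \<partial>M) = (\<integral>\<omega>. Y 0 \<omega> \<partial>M)) \<and>
     (\<forall>s t h. (\<integral>\<omega>. outer (Y (s + h) \<omega>) (Y (t + h) \<omega>) \<partial>M) = (\<integral>\<omega>. outer (Y s \<omega>) (Y t \<omega>) \<partial>M))"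

type_synonym 'd param = "(real^'d^'d) \<times> (real^'d^'d) \<times> real"

definition Gam :: "'d::finite param \<Rightarrow> real^'d^'d" where "Gam \<theta> = fst \<theta>"
definition Sig :: "'d::finite param \<Rightarrow> real^'d^'d" where "Sig \<theta> = fst (snd \<theta>)"
definition cc :: "'d::finite param \<Rightarrow> real" where "cc \<theta> = snd (snd \<theta>)"

definition parameter_space :: "'d::finite param set \<Rightarrow> bool" where
  "parameter_space \<Theta> \<longleftrightarrow> \<Theta> \<subseteq> UNIV \<times> psd_matrices \<times> {0..}"

definition assumption_M ::
    "'w measure \<Rightarrow> 'd::finite param set \<Rightarrow> ('d param \<Rightarrow> nat \<Rightarrow> 'w \<Rightarrow> real^'d)
      \<Rightarrow> ('d param \<Rightarrow> nat \<Rightarrow> 'w \<Rightarrow> real^'d) \<Rightarrow> bool" where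
  "assumption_M M \<Theta> \<epsilon> X \<longleftrightarrow>
     prob_space M \<and>
     (\<forall>\<theta>\<in>\<Theta>. \<forall>t. \<epsilon> \<theta> t \<in> borel_measurable M \<and> X \<theta> t \<in> borel_measurable M) \<and>
     (\<forall>\<theta>\<in>\<Theta>. weakly_stationary M (\<epsilon> \<theta>)) \<and>
     (SUP t. SUP \<theta>\<in>\<Theta>. \<integral>\<^sup>+\<omega>. ennreal (norm (\<epsilon> \<theta> t \<omega>)) \<partial>M) < \<infinity> \<and>
     (\<forall>\<theta>\<in>\<Theta>. (\<integral>\<omega>. \<epsilon> \<theta> 0 \<omega> \<partial>M) = 0) \<and>
     (\<forall>\<theta>\<in>\<Theta>. \<forall>t\<ge>1. AE \<omega> in M.
        cond_exp_vector M (generated_filtration M (\<epsilon> \<theta>) (t - 1)) (\<epsilon> \<theta> t) \<omega> = 0) \<and>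
     (\<forall>\<theta>\<in>\<Theta>. (\<integral>\<omega>. outer (\<epsilon> \<theta> 0 \<omega>) (\<epsilon> \<theta> 0 \<omega>) \<partial>M) = Sig \<theta>) \<and>
     (\<forall>\<theta>\<in>\<Theta>. \<forall>t\<ge>1. AE \<omega> in M.
        cond_exp_matrix M (generated_filtration M (\<epsilon> \<theta>) (t - 1))
          (\<lambda>\<omega>. outer (\<epsilon> \<theta> t \<omega>) (\<epsilon> \<theta> t \<omega>)) \<omega> = Sig \<theta>) \<and>
     (\<exists>\<delta>>0. \<forall>\<theta>\<in>\<Theta>. \<forall>t.
        (\<integral>\<^sup>+\<omega>. ennreal (norm (\<epsilon> \<theta> t \<omega>) powr (2 + \<delta>)) \<partial>M) \<le> ennreal (cc \<theta>)) \<and>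
     (\<forall>\<theta>\<in>\<Theta>. \<forall>\<omega>\<in>space M. X \<theta> 0 \<omega> = 0 \<and>
        (\<forall>t\<ge>1. X \<theta> t \<omega> = Gam \<theta> *v X \<theta> (t - 1) \<omega> + \<epsilon> \<theta> t \<omega>))"

text \<open>
  Reciprocals of smallest singular values are taken in \<^typ>\<open>ennreal\<close>, where the inverse of zero
  is infinite.
\<close>

definition assumption_U :: "'d::{finite,linorder} param set \<Rightarrow> bool" where
  "assumption_U \<Theta> \<longleftrightarrow>
     (SUP \<theta>\<in>\<Theta>. ennreal (cc \<theta>)) < \<infinity> \<and>
     (SUP \<theta>\<in>\<Theta>. ennreal (sigma_max (complex_matrix (Sig \<theta>)))
        + inverse (ennreal (sigma_min (complex_matrix (Sig \<theta>))))) < \<infinity> \<and>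
     (\<exists>\<alpha>. 0 < \<alpha> \<and> \<alpha> < 1 \<and>
        (\<forall>\<theta>\<in>\<Theta>. \<forall>l\<in>eigenvalues (complex_matrix (Gam \<theta>)).
           cmod l \<le> 1 \<and> cmod l * cmod (1 - l) \<le> ((1 - \<alpha>) * (2 - \<alpha>) / \<alpha>) * (1 - cmod l)) \<and>
        (\<exists>F J. (\<forall>\<theta>\<in>\<Theta>. invertible (F \<theta>) \<and> J \<theta> \<in> jordan_like (1 - \<alpha>) \<and>
                  matrix_inv (F \<theta>) ** complex_matrix (Gam \<theta>) ** F \<theta> = J \<theta>) \<and>
           (SUP \<theta>\<in>\<Theta>. ennreal (sigma_max (F \<theta>)) + inverse (ennreal (sigma_min (F \<theta>)))
              + ennreal (sigma_max (J \<theta>))) < \<infinity>))"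

text \<open>
  Vectors of length $2d$ are indexed by \<open>'d + 'd\<close>. On sample paths with a singular Gram matrix,
  \<^const>\<open>matrix_inv\<close> takes a fixed unspecified value, so the estimator is defined everywhere.
\<close>

definition lagged :: "(nat \<Rightarrow> real^'d) \<Rightarrow> nat \<Rightarrow> real^('d + 'd)" where
  "lagged x t = (\<chi> k. case k of Inl i \<Rightarrow> x (t - 1) $ i | Inr i \<Rightarrow> x (t - 2) $ i)"

definition Pi_LA :: "nat \<Rightarrow> (nat \<Rightarrow> real^'d) \<Rightarrow> real^('d + 'd)^'d" where
  "Pi_LA n x = (\<Sum>t=2..n. outer (x t) (lagged x t))
     ** matrix_inv (\<Sum>t=2..n. outer (lagged x t) (lagged x t))"

definition D_LA :: "real^'d^('d + 'd)" where
  "D_LA = (\<chi> k j. case k of Inl i \<Rightarrow> (if i = j then 1 else 0) | Inr _ \<Rightarrow> 0)"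

definition Gamma_LA :: "nat \<Rightarrow> (nat \<Rightarrow> real^'d) \<Rightarrow> real^'d^'d" where
  "Gamma_LA n x = Pi_LA n x ** D_LA"

end

theory Submission
  imports Defs "HOL-Real_Asymp.Real_Asymp"
begin

text \<open>
  Let \<open>\<epsilon>\<close> be the innovations and \<open>\<Sigma>\<close> their covariance. Since \<open>X (t - 1) = \<Gamma> X (t - 2) + \<epsilon> (t - 1)\<close>,
  a regression of \<open>X t\<close> on its two lags is a regression on the previous innovation and the second
  lag, and the block of coefficients that belongs to the first lag is the coefficient of the
  innovation. Hence the error of the estimator is \<open>A G\<^sup>-\<^sup>1\<close> with \<open>A = (\<Sum>t. \<epsilon> t \<epsilon> (t - 1)\<^sup>T)\<close> and
  \<open>G = (\<Sum>t. \<epsilon> (t - 1) \<epsilon> (t - 1)\<^sup>T)\<close>, up to a remainder that comes from the second lag. The summands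
  of \<open>A\<close> are martingale differences with a constant covariance, whatever the eigenvalues of \<open>\<Gamma>\<close> are;
  this is why stable, nearly integrated and integrated processes share the limit
  \<open>\<Sigma>\<^sup>-\<^sup>1 \<otimes> \<Sigma>\<close>.

  The second lag enters only through its products with innovations, measured in the metric of its
  own Gram matrix. With a unit ridge added to the Gram matrix, the mean of these self-normalised
  quantities is at most a multiple of the logarithm of a determinant (\<open>self_norm_expectation\<close>), thus
  of order \<open>ln n\<close> as soon as the process grows polynomially. The growth follows from the Jordan-like
  form: in a weighted maximum norm such a matrix is non-expansive, so that \<open>\<parallel>X t\<parallel>\<close> is at most a
  constant times \<open>\<Sum>s\<le>t. \<parallel>\<epsilon> s\<parallel>\<close> (\<open>autoregression_growth\<close>). The lemma \<open>lag_augmented_error\<close> is the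
  resulting deterministic estimate on an event whose probability tends to one.

  The central limit theorem for the leading term is proved with explicit bounds: first for the
  characteristic function (\<open>martingale_char_bound\<close>, \<open>noise_char_bound\<close>), then for the bounded Lipschitz
  distance, by Gaussian smoothing (\<open>char_close_imp_BL_close\<close>). Every constant that occurs depends only
  on the dimension and on the moments and norms that the assumptions bound over \<open>\<Theta>\<close>, and so the limit
  is uniform (\<open>uniform_BL_limit\<close>).
\<close>

section \<open>Linear change of variables for Lebesgue measure\<close>

lemma matrix_inv_mult:
  fixes A :: "'a::semiring_1^'n^'m"
  assumes "invertible A"
  shows "A ** matrix_inv A = mat 1" "matrix_inv A ** A = mat 1"
proof -
  have "\<exists>A'. A ** A' = mat 1 \<and> A' ** A = mat 1" using assms by (simp add: invertible_def)
  then have "A ** matrix_inv A = mat 1 \<and> matrix_inv A ** A = mat 1"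
    unfolding matrix_inv_def by (rule someI_ex)
  then show "A ** matrix_inv A = mat 1" "matrix_inv A ** A = mat 1" by auto
qed

lemma matrix_inv_unique:
  fixes A :: "'a::semiring_1^'n^'n"
  assumes "A ** B = mat 1" "B ** A = mat 1"
  shows "matrix_inv A = B"
proof -
  have inv: "invertible A" using assms by (auto simp: invertible_def)
  have "matrix_inv A = matrix_inv A ** (A ** B)" by (simp add: assms)
  also have "\<dots> = B" by (simp add: matrix_mul_assoc matrix_inv_mult[OF inv])
  finally show ?thesis .
qed

lemma borel_measurable_matrix_vector_mult [measurable]:
  fixes A :: "real^'n^'m"
  shows "(\<lambda>x. A *v x) \<in> borel_measurable borel"
  by (intro borel_measurable_continuous_onI linear_continuous_on)
     (simp add: linear_conv_bounded_linear[symmetric])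

lemma nn_integral_lborel_translate:
  fixes f :: "'a::euclidean_space \<Rightarrow> ennreal"
  assumes [measurable]: "f \<in> borel_measurable borel"
  shows "(\<integral>\<^sup>+x. f (t + x) \<partial>lborel) = (\<integral>\<^sup>+x. f x \<partial>lborel)"
proof -
  have "(\<integral>\<^sup>+x. f x \<partial>lborel)
     = (\<integral>\<^sup>+x. f x \<partial>density (distr lborel borel (\<lambda>x. t + 1 *\<^sub>R x)) (\<lambda>_. ennreal (\<bar>1\<bar> ^ DIM('a))))"
    by (subst lborel_affine[of 1 t, symmetric]) simp_all
  also have "\<dots> = (\<integral>\<^sup>+x. f (t + x) \<partial>lborel)"
    by (simp add: nn_integral_density nn_integral_distr)
  finally show ?thesis by simp
qed

text \<open>
  On a line parallel to the axis \<open>m\<close> the coordinate \<open>n\<close> is constant, so that the shear acts there as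
  a translation.
\<close>

lemma nn_integral_lborel_shear:
  fixes f :: "real^'n \<Rightarrow> ennreal" and m n :: 'n
  assumes [measurable]: "f \<in> borel_measurable borel" and mn: "m \<noteq> n"
  shows "(\<integral>\<^sup>+x. f (x + (x $ n) *\<^sub>R axis m 1) \<partial>lborel) = (\<integral>\<^sup>+x. f x \<partial>lborel)"
proof -
  \<comment> \<open>Any probability density on the line would do; it turns the integral over all of space into one
    over lines in direction \<open>m\<close>.\<close>
  define \<psi> :: "real \<Rightarrow> ennreal" where "\<psi> = indicator {0..1}"
  have [measurable]: "\<psi> \<in> borel_measurable borel" unfolding \<psi>_def by measurable
  have \<psi>1: "(\<integral>\<^sup>+s. \<psi> s \<partial>lborel) = 1" unfolding \<psi>_def by simp
  have [measurable]: "(\<lambda>x::real^'n. x $ i) \<in> borel_measurable borel" for i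
    by (intro borel_measurable_continuous_onI continuous_intros)
  \<comment> \<open>Integrating over all shifts in direction m forgets a shear in that direction.\<close>
  have key: "(\<integral>\<^sup>+x. h x \<partial>lborel) = (\<integral>\<^sup>+x. \<psi> (x $ m) * (\<integral>\<^sup>+s. h (- s *\<^sub>R axis m 1 + x) \<partial>lborel) \<partial>lborel)"
    if [measurable]: "h \<in> borel_measurable borel" for h :: "real^'n \<Rightarrow> ennreal"
  proof -
    have "(\<integral>\<^sup>+x. h x \<partial>lborel) = (\<integral>\<^sup>+x. (\<integral>\<^sup>+s. h x * \<psi> (x $ m + s) \<partial>lborel) \<partial>lborel)"
      by (subst nn_integral_cmult) (simp_all add: nn_integral_lborel_translate \<psi>1)
    also have "\<dots> = (\<integral>\<^sup>+s. (\<integral>\<^sup>+x. h x * \<psi> (x $ m + s) \<partial>lborel) \<partial>lborel)"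
      by (intro lborel_pair.Fubini') simp
    also have "\<dots> = (\<integral>\<^sup>+s. (\<integral>\<^sup>+x. h (- s *\<^sub>R axis m 1 + x) * \<psi> (x $ m) \<partial>lborel) \<partial>lborel)"
    proof (rule nn_integral_cong)
      fix s :: real
      show "(\<integral>\<^sup>+x. h x * \<psi> (x $ m + s) \<partial>lborel) = (\<integral>\<^sup>+x. h (- s *\<^sub>R axis m 1 + x) * \<psi> (x $ m) \<partial>lborel)"
        using nn_integral_lborel_translate[of "\<lambda>x. h x * \<psi> (x $ m + s)" "- s *\<^sub>R axis m 1"] by simp
    qed
    also have "\<dots> = (\<integral>\<^sup>+x. (\<integral>\<^sup>+s. h (- s *\<^sub>R axis m 1 + x) * \<psi> (x $ m) \<partial>lborel) \<partial>lborel)"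
      by (intro lborel_pair.Fubini') simp
    also have "\<dots> = (\<integral>\<^sup>+x. \<psi> (x $ m) * (\<integral>\<^sup>+s. h (- s *\<^sub>R axis m 1 + x) \<partial>lborel) \<partial>lborel)"
      by (rule nn_integral_cong, subst nn_integral_multc) (simp_all add: mult.commute)
    finally show ?thesis .
  qed
  have "(\<integral>\<^sup>+s. f ((- s *\<^sub>R axis m 1 + x) + ((- s *\<^sub>R axis m 1 + x) $ n) *\<^sub>R axis m 1) \<partial>lborel)
      = (\<integral>\<^sup>+s. f (- s *\<^sub>R axis m 1 + x) \<partial>lborel)" for x :: "real^'n"
  proof -
    have "(\<integral>\<^sup>+s. f ((- s *\<^sub>R axis m 1 + x) + ((- s *\<^sub>R axis m 1 + x) $ n) *\<^sub>R axis m 1) \<partial>lborel)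
       = (\<integral>\<^sup>+s. f (- (- x $ n + s) *\<^sub>R axis m 1 + x) \<partial>lborel)"
      using mn by (intro nn_integral_cong arg_cong[where f=f]) (auto simp: vec_eq_iff axis_def)
    also have "\<dots> = (\<integral>\<^sup>+s. f (- s *\<^sub>R axis m 1 + x) \<partial>lborel)"
      by (rule nn_integral_lborel_translate) simp
    finally show ?thesis .
  qed
  moreover have "(\<lambda>x. f (x + (x $ n) *\<^sub>R axis m 1)) \<in> borel_measurable borel" by simp
  ultimately show ?thesis
    by (simp add: key[of f] key[of "\<lambda>x. f (x + (x $ n) *\<^sub>R axis m 1)"])
qed

lemma nn_integral_lborel_swap:
  fixes f :: "real^'n \<Rightarrow> ennreal" and m n :: 'n
  assumes [measurable]: "f \<in> borel_measurable borel"
  shows "(\<integral>\<^sup>+x. f (\<chi> i. x $ Transposition.transpose m n i) \<partial>lborel) = (\<integral>\<^sup>+x. f x \<partial>lborel)"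
proof -
  let ?h = "\<lambda>v::real^'n. \<chi> i. v $ Transposition.transpose m n i"
  have [measurable]: "?h \<in> borel_measurable borel"
    by (intro borel_measurable_continuous_onI continuous_intros)
  have "lborel = distr lborel borel ?h"
  proof (rule lborel_eqI)
    fix l u :: "real^'n" assume le: "\<And>b. b \<in> Basis \<Longrightarrow> l \<bullet> b \<le> u \<bullet> b"
    have le': "l $ i \<le> u $ i" for i using le[of "axis i 1"] by (simp add: inner_axis axis_in_Basis_iff)
    have eq: "?h -` box l u = box (?h l) (?h u)"
      by (auto simp: mem_box_cart) (metis transpose_involutory)+
    have prod_eq: "(\<Prod>b\<in>Basis. (u - l) \<bullet> b) = (\<Prod>i\<in>UNIV. (u - l) $ i)" for u l :: "real^'n"
      unfolding Basis_vec_def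
      by (subst prod.UNION_disjoint)
         (auto simp: inner_axis axis_eq_axis)
    have "emeasure (distr lborel borel ?h) (box l u) = emeasure lborel (box (?h l) (?h u))"
      by (subst emeasure_distr) (simp_all add: eq)
    also have "\<dots> = (\<Prod>b\<in>Basis. (?h u - ?h l) \<bullet> b)"
      by (intro emeasure_lborel_box) (auto simp: Basis_vec_def inner_axis le')
    also have "\<dots> = (\<Prod>b\<in>Basis. (u - l) \<bullet> b)"
      unfolding prod_eq
      using prod.permute[OF permutes_swap_id[of m UNIV n], of "\<lambda>i. (u - l) $ i"]
      by (simp add: comp_def)
    finally show "emeasure (distr lborel borel ?h) (box l u) = (\<Prod>b\<in>Basis. (u - l) \<bullet> b)" .
  qed simp
  then have "(\<integral>\<^sup>+x. f x \<partial>lborel) = (\<integral>\<^sup>+x. f x \<partial>distr lborel borel ?h)" by simp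
  then show ?thesis by (simp add: nn_integral_distr)
qed

lemma det_shear:
  fixes m n :: "'n::finite"
  assumes "m \<noteq> n"
  shows "det (\<chi> i j. of_bool (i = m \<and> j = n \<or> i = j) :: real^'n^'n) = 1"
proof -
  have "(\<chi> i j. of_bool (i = m \<and> j = n \<or> i = j) :: real^'n^'n)
     = (\<chi> k. if k = m then row m (mat 1) + 1 *s row n (mat 1) else row k (mat 1))"
    using assms by (auto simp: vec_eq_iff row_def mat_def)
  then show ?thesis using det_row_operation[OF assms, of "mat 1 :: real^'n^'n" 1] by simp
qed

text \<open>
  Change of variables for an arbitrary index type: every matrix is a product of shears, swaps and
  diagonal matrices, and each kind scales Lebesgue measure by its determinant.
\<close>

lemma nn_integral_lborel_linear:
  fixes A :: "real^'n^'n" and f :: "real^'n \<Rightarrow> ennreal"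
  assumes "det A \<noteq> 0" and "f \<in> borel_measurable borel"
  shows "(\<integral>\<^sup>+x. f x \<partial>lborel) = ennreal \<bar>det A\<bar> * (\<integral>\<^sup>+x. f (A *v x) \<partial>lborel)"
proof -
  define P where "P A \<longleftrightarrow> (det A \<noteq> 0 \<longrightarrow> (\<forall>f\<in>borel_measurable borel.
     (\<integral>\<^sup>+x. f x \<partial>lborel) = ennreal \<bar>det A\<bar> * (\<integral>\<^sup>+x. f (A *v x) \<partial>lborel)))" for A :: "real^'n^'n"
  have "P A"
  proof (rule induct_matrix_elementary_alt[of P])
    fix A B :: "real^'n^'n" assume AB: "P A" "P B"
    show "P (A ** B)" unfolding P_def
    proof (intro impI ballI)
      fix f :: "real^'n \<Rightarrow> ennreal"
      assume d: "det (A ** B) \<noteq> 0" and f[measurable]: "f \<in> borel_measurable borel"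
      have "(\<integral>\<^sup>+x. f x \<partial>lborel) = ennreal \<bar>det A\<bar> * (\<integral>\<^sup>+x. f (A *v x) \<partial>lborel)"
        by (rule AB(1)[unfolded P_def, rule_format]) (use d f in \<open>simp_all add: det_mul\<close>)
      also have "(\<integral>\<^sup>+x. f (A *v x) \<partial>lborel) = ennreal \<bar>det B\<bar> * (\<integral>\<^sup>+x. f (A *v (B *v x)) \<partial>lborel)"
        by (rule AB(2)[unfolded P_def, rule_format]) (use d f in \<open>simp_all add: det_mul\<close>)
      finally show "(\<integral>\<^sup>+x. f x \<partial>lborel) = ennreal \<bar>det (A ** B)\<bar> * (\<integral>\<^sup>+x. f ((A ** B) *v x) \<partial>lborel)"
        by (simp add: det_mul abs_mult ennreal_mult' mult.assoc matrix_vector_mul_assoc)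
    qed
  next
    fix A :: "real^'n^'n" and i assume "row i A = 0"
    then show "P A" by (simp add: det_zero_row P_def)
  next
    fix A :: "real^'n^'n" assume diag: "\<And>i j. i \<noteq> j \<Longrightarrow> A $ i $ j = 0"
    show "P A" unfolding P_def
    proof (intro impI ballI)
      fix f :: "real^'n \<Rightarrow> ennreal"
      assume d: "det A \<noteq> 0" and f[measurable]: "f \<in> borel_measurable borel"
      have det: "det A = (\<Prod>i\<in>UNIV. A $ i $ i)" using diag by (rule det_diagonal)
      \<comment> \<open>The scale factors of a diagonal matrix, indexed by the basis vectors instead of the coordinates.\<close>
      define c :: "real^'n \<Rightarrow> real" where "c b = A $ (THE i. b = axis i 1) $ (THE i. b = axis i 1)" for b
      have c_axis: "c (axis i 1) = A $ i $ i" for i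
      proof -
        have "(THE k. (axis i 1 :: real^'n) = axis k 1) = i" by (auto simp: axis_eq_axis)
        then show ?thesis by (simp add: c_def)
      qed
      have cb: "c b \<noteq> 0" if "b \<in> Basis" for b
        using that d det by (auto simp: Basis_vec_def c_axis)
      have T: "(\<Sum>j\<in>Basis. (c j * (x \<bullet> j)) *\<^sub>R j) = A *v x" for x
      proof -
        have "(\<Sum>j\<in>Basis. (c j * (x \<bullet> j)) *\<^sub>R j) = (\<Sum>i\<in>UNIV. (A $ i $ i * x $ i) *\<^sub>R axis i 1)"
          unfolding Basis_vec_def
          by (subst sum.UNION_disjoint) (auto simp: axis_eq_axis c_axis inner_axis)
        also have "\<dots> = A *v x"
        proof -
          have "A $ i $ j * x $ j = (if j = i then A $ i $ i * x $ i else 0)" for i j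
            using diag[of i j] by auto
          then have "(\<Sum>j\<in>UNIV. A $ i $ j * x $ j) = (\<Sum>j\<in>UNIV. if j = i then A $ i $ i * x $ i else 0)" for i
            by (intro sum.cong refl)
          then have "(\<Sum>j\<in>UNIV. A $ i $ j * x $ j) = A $ i $ i * x $ i" for i
            by simp
          then show ?thesis
            by (simp add: vec_eq_iff matrix_vector_mult_def axis_def if_distrib[of "\<lambda>x. _ * x"] cong: if_cong)
        qed
        finally show ?thesis .
      qed
      have pr: "(\<Prod>j\<in>Basis. \<bar>c j\<bar>) = \<bar>det A\<bar>"
        unfolding Basis_vec_def det abs_prod
        by (subst prod.UNION_disjoint) (auto simp: axis_eq_axis c_axis)
      show "(\<integral>\<^sup>+x. f x \<partial>lborel) = ennreal \<bar>det A\<bar> * (\<integral>\<^sup>+x. f (A *v x) \<partial>lborel)"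
      proof -
        have "(\<integral>\<^sup>+x. f x \<partial>lborel)
          = (\<integral>\<^sup>+x. f x \<partial>density (distr lborel borel (\<lambda>x. A *v x)) (\<lambda>_. ennreal \<bar>det A\<bar>))"
          using lborel_affine_euclidean[of c 0, OF cb] by (simp add: T pr)
        also have "\<dots> = ennreal \<bar>det A\<bar> * (\<integral>\<^sup>+x. f (A *v x) \<partial>lborel)"
          by (simp add: nn_integral_density nn_integral_distr nn_integral_cmult)
        finally show ?thesis .
      qed
    qed
  next
    fix m n :: 'n assume "m \<noteq> n"
    have d: "\<bar>det (\<chi> i j. mat 1 $ i $ Transposition.transpose m n j :: real^'n^'n)\<bar> = 1"
      by (simp add: det_permute_columns permutes_swap_id sign_swap_id abs_mult)
    have e: "(\<chi> i j. mat 1 $ i $ Transposition.transpose m n j :: real^'n^'n) *v x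
        = (\<chi> i. x $ Transposition.transpose m n i)" for x
    proof -
      have "(\<chi> i j. mat 1 $ i $ Transposition.transpose m n j :: real^'n^'n) $ i $ j
          = (if j = Transposition.transpose m n i then 1 else 0)" for i j
        by (auto simp: mat_def)
      then show ?thesis
        by (simp add: vec_eq_iff matrix_vector_mult_def if_distrib[of "\<lambda>x. x * _"] cong: if_cong)
    qed
    show "P (\<chi> i j. mat 1 $ i $ Transposition.transpose m n j)" unfolding P_def by (simp only: d e) (simp add: nn_integral_lborel_swap)
  next
    fix m n :: 'n assume mn: "m \<noteq> n"
    have e: "(\<chi> i j. of_bool (i = m \<and> j = n \<or> i = j) :: real^'n^'n) *v x = x + (x $ n) *\<^sub>R axis m 1" for x
    proof -
      have "(\<chi> i j. of_bool (i = m \<and> j = n \<or> i = j) :: real^'n^'n) $ i $ j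
          = (if j = i then 1 else 0) + (if j = n then of_bool (i = m) else 0)" for i j
        using mn by auto
      then show ?thesis
        by (simp add: vec_eq_iff matrix_vector_mult_def algebra_simps sum.distrib axis_def
            if_distrib[of "\<lambda>x. _ * x"] cong: if_cong)
    qed
    show "P (\<chi> i j. of_bool (i = m \<and> j = n \<or> i = j))"
      unfolding P_def by (simp only: det_shear[OF mn] e) (simp add: nn_integral_lborel_shear[OF _ mn])
  qed
  then show ?thesis using assms unfolding P_def by blast
qed

section \<open>Gaussian laws as linear images of the standard Gaussian law\<close>

lemma
  fixes g :: "'n::finite \<Rightarrow> real \<Rightarrow> 'a::{real_normed_field,banach,second_countable_topology}"
  assumes g: "\<And>i. integrable lborel (g i)"
  shows integrable_lborel_prod_cart: "integrable lborel (\<lambda>x::real^'n. \<Prod>i\<in>UNIV. g i (x $ i))"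
    and integral_lborel_prod_cart:
      "(\<integral>x. (\<Prod>i\<in>UNIV. g i (x $ i)) \<partial>(lborel::(real^'n) measure)) = (\<Prod>i\<in>UNIV. \<integral>t. g i t \<partial>lborel)"
proof -
  interpret product_sigma_finite "\<lambda>b::real^'n. lborel :: real measure"
    by standard
  define ix :: "real^'n \<Rightarrow> 'n" where "ix b = (THE i. b = axis i 1)" for b
  have ix: "ix (axis i 1) = i" for i
    unfolding ix_def by (auto simp: axis_eq_axis)
  have reindex: "(\<Prod>b\<in>Basis. h (ix b)) = (\<Prod>i\<in>UNIV. h i)" for h :: "'n \<Rightarrow> 'a"
    unfolding Basis_vec_def
    by (subst prod.UNION_disjoint) (auto simp: axis_eq_axis ix)
  have gm [measurable]: "g i \<in> borel_measurable borel" for i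
    using g[of i] by (auto dest: borel_measurable_integrable)
  let ?T = "\<lambda>f. \<Sum>b\<in>Basis. f b *\<^sub>R (b::real^'n)"
  have Tm [measurable]: "?T \<in> borel_measurable (\<Pi>\<^sub>M b\<in>(Basis::(real^'n) set). lborel)"
    by (intro borel_measurable_sum borel_measurable_scaleR) (auto intro!: measurable_component_singleton)
  have nthm [measurable]: "(\<lambda>x::real^'n. x $ i) \<in> borel_measurable borel" for i
    by (intro borel_measurable_continuous_onI continuous_intros)
  have Tb: "?T f $ (ix b) = f b" if "b \<in> Basis" for f b
  proof -
    have "?T f $ ix b = ?T f \<bullet> b" using that by (auto simp: Basis_vec_def ix inner_axis)
    also have "\<dots> = f b" using that by (simp add: inner_sum_left inner_Basis if_distrib[of "\<lambda>x. _ * x"] cong: if_cong)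
    finally show ?thesis .
  qed
  have eq: "(\<Prod>i\<in>UNIV. g i (?T f $ i)) = (\<Prod>b\<in>Basis. g (ix b) (f b))" for f
  proof -
    have "(\<Prod>i\<in>UNIV. g i (?T f $ i)) = (\<Prod>b\<in>Basis. g (ix b) (?T f $ ix b))"
      by (rule reindex[symmetric])
    also have "\<dots> = (\<Prod>b\<in>Basis. g (ix b) (f b))"
      by (intro prod.cong refl) (simp only: Tb)
    finally show ?thesis .
  qed
  have I: "integrable (\<Pi>\<^sub>M b\<in>(Basis::(real^'n) set). lborel) (\<lambda>f. \<Prod>b\<in>Basis. g (ix b) (f b))"
    by (intro product_integrable_prod) (auto simp: g)
  show "integrable lborel (\<lambda>x::real^'n. \<Prod>i\<in>UNIV. g i (x $ i))"
    unfolding lborel_eq[where 'a="real^'n"]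
    by (subst integrable_distr_eq) (simp_all only: eq I, simp_all)
  have "(\<integral>x. (\<Prod>i\<in>UNIV. g i (x $ i)) \<partial>(lborel::(real^'n) measure))
     = (\<integral>f. (\<Prod>b\<in>Basis. g (ix b) (f b)) \<partial>(\<Pi>\<^sub>M b\<in>(Basis::(real^'n) set). lborel))"
    unfolding lborel_eq[where 'a="real^'n"]
    by (subst integral_distr) (simp_all only: eq, simp_all)
  also have "\<dots> = (\<Prod>b\<in>Basis. \<integral>t. g (ix b) t \<partial>lborel)"
    by (intro product_integral_prod) (auto simp: g)
  also have "\<dots> = (\<Prod>i\<in>UNIV. \<integral>t. g i t \<partial>lborel)" by (rule reindex)
  finally show "(\<integral>x. (\<Prod>i\<in>UNIV. g i (x $ i)) \<partial>(lborel::(real^'n) measure)) = (\<Prod>i\<in>UNIV. \<integral>t. g i t \<partial>lborel)" .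
qed

lemma inner_transpose_matrix:
  fixes B :: "real^'n^'m"
  shows "x \<bullet> (transpose B *v y) = (B *v x) \<bullet> y"
  by (metis dot_lmul_matrix transpose_matrix_vector inner_commute)

definition std_gauss_density :: "real^'n \<Rightarrow> real" where
  "std_gauss_density x = exp (- (x \<bullet> x) / 2) / sqrt ((2 * pi) ^ CARD('n))"

abbreviation std_gauss :: "(real^'n) measure" where
  "std_gauss \<equiv> density lborel (\<lambda>x. ennreal (std_gauss_density x))"

lemma std_gauss_density_prod:
  "std_gauss_density (x::real^'n) = (\<Prod>i\<in>UNIV. std_normal_density (x $ i))"
  unfolding std_gauss_density_def std_normal_density_def inner_vec_def
  by (simp add: prod_dividef real_sqrt_mult power_mult_distrib real_sqrt_power exp_sum[symmetric] sum_negf sum_divide_distrib power2_eq_square)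

lemma std_gauss_density_nonneg [simp]: "0 \<le> std_gauss_density x"
  by (simp add: std_gauss_density_def)

lemma std_gauss_density_measurable [measurable]: "std_gauss_density \<in> borel_measurable borel"
  unfolding std_gauss_density_def by measurable

lemma integrable_std_gauss_density: "integrable lborel (std_gauss_density :: real^'n \<Rightarrow> real)"
  using integrable_lborel_prod_cart[of "\<lambda>i::'n. std_normal_density"]
  by (simp add: std_gauss_density_prod[abs_def] integrable_std_normal_moment_abs[of 0, simplified])

lemma prob_space_std_gauss: "prob_space (std_gauss :: (real^'n) measure)"
proof
  have "(\<integral>x. std_gauss_density x \<partial>(lborel :: (real^'n) measure)) = 1"
    using integral_lborel_prod_cart[of "\<lambda>i::'n. std_normal_density"] integral_std_normal_moment_even[of 0]
    by (simp add: std_gauss_density_prod[abs_def] integrable_std_normal_moment_abs[of 0, simplified])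
  then have "(\<integral>\<^sup>+x. ennreal (std_gauss_density x) \<partial>(lborel :: (real^'n) measure)) = 1"
    by (subst nn_integral_eq_integral) (auto simp: integrable_std_gauss_density)
  then show "emeasure std_gauss (space (std_gauss :: (real^'n) measure)) = 1"
    by (simp add: emeasure_density)
qed

lemma char_std_gauss:
  fixes u :: "real^'n"
  shows "(CLINT x|std_gauss. iexp (u \<bullet> x)) = of_real (exp (- (u \<bullet> u) / 2))"
proof -
  let ?g = "\<lambda>i t. std_normal_density t *\<^sub>R iexp (u $ i * t)"
  have gint: "integrable lborel (?g i)" for i
  proof (rule Bochner_Integration.integrable_bound[OF integrable_std_normal_moment_abs[of 0]])
    show "AE t in lborel. norm (?g i t) \<le> norm (std_normal_density t * \<bar>t\<bar> ^ 0)"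
      by (simp add: norm_mult)
  qed measurable
  have "(CLINT x|std_gauss. iexp (u \<bullet> x)) = (\<integral>x. std_gauss_density x *\<^sub>R iexp (u \<bullet> x) \<partial>lborel)"
    by (subst integral_density) auto
  also have "\<dots> = (\<integral>x. (\<Prod>i\<in>UNIV. ?g i (x $ i)) \<partial>lborel)"
  proof (rule Bochner_Integration.integral_cong[OF refl])
    fix x :: "real^'n"
    show "std_gauss_density x *\<^sub>R iexp (u \<bullet> x) = (\<Prod>i\<in>UNIV. ?g i (x $ i))"
      by (simp add: std_gauss_density_prod scaleR_conv_of_real prod.distrib exp_sum[symmetric] inner_vec_def
          sum_distrib_left)
  qed
  also have "\<dots> = (\<Prod>i\<in>UNIV. \<integral>t. ?g i t \<partial>lborel)"
    by (rule integral_lborel_prod_cart) (rule gint)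
  also have "\<dots> = (\<Prod>i\<in>UNIV. of_real (exp (- (u $ i)\<^sup>2 / 2)))"
  proof (rule prod.cong[OF refl])
    fix i
    have "(\<integral>t. ?g i t \<partial>lborel) = char std_normal_distribution (u $ i)"
      unfolding char_def by (subst integral_density) (auto simp: normal_density_nonneg)
    then show "(\<integral>t. ?g i t \<partial>lborel) = of_real (exp (- (u $ i)\<^sup>2 / 2))"
      by (simp add: char_std_normal_distribution)
  qed
  also have "\<dots> = of_real (exp (- (u \<bullet> u) / 2))"
    by (simp add: inner_vec_def exp_sum[symmetric] sum_negf sum_divide_distrib power2_eq_square of_real_prod[symmetric]
        del: of_real_prod)
  finally show ?thesis .
qed

lemma second_moment_std_gauss:
  "integrable std_gauss (\<lambda>x::real^'n. (norm x)\<^sup>2)"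
  "(\<integral>x. (norm x)\<^sup>2 \<partial>(std_gauss::(real^'n) measure)) = real CARD('n)"
proof -
  let ?g = "\<lambda>j i t. if i = j then std_normal_density t * t ^ 2 else std_normal_density t"
  have gint: "integrable lborel (?g j i)" for i j :: 'n
    using integrable_std_normal_moment_abs[of 0, simplified] integrable_std_normal_moment[of 2]
    by (cases "i = j") auto
  have gval: "(\<integral>t. ?g j i t \<partial>lborel) = 1" for i j :: 'n
    using integral_std_normal_moment_even[of 0] integral_std_normal_moment_even[of 1]
    by (cases "i = j") auto
  have e: "std_gauss_density x * (x $ j)\<^sup>2 = (\<Prod>i\<in>UNIV. ?g j i (x $ i))" for x :: "real^'n" and j
    unfolding std_gauss_density_prod
    by (subst (1 2) prod.remove[of _ j]) (auto intro!: prod.cong)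
  have I: "integrable lborel (\<lambda>x::real^'n. std_gauss_density x * (x $ j)\<^sup>2)"
    and V: "(\<integral>x. std_gauss_density x * (x $ j)\<^sup>2 \<partial>(lborel::(real^'n) measure)) = 1" for j
    unfolding e using integrable_lborel_prod_cart[of "?g j", OF gint] integral_lborel_prod_cart[of "?g j", OF gint]
    by (simp_all add: gval)
  have n: "std_gauss_density x *\<^sub>R (norm x)\<^sup>2 = (\<Sum>j\<in>UNIV. std_gauss_density x * (x $ j)\<^sup>2)" for x :: "real^'n"
    unfolding power2_norm_eq_inner inner_vec_def by (simp add: sum_distrib_left power2_eq_square)
  show "integrable std_gauss (\<lambda>x::real^'n. (norm x)\<^sup>2)"
    by (subst integrable_density) (simp_all only: n, auto simp: I)
  show "(\<integral>x. (norm x)\<^sup>2 \<partial>(std_gauss::(real^'n) measure)) = real CARD('n)"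
    by (subst integral_density) (simp_all only: n, auto simp: I V)
qed

text \<open>
  Under the substitution \<open>x = A z\<close> the quadratic form of the inverse covariance becomes \<open>\<parallel>z\<parallel>\<^sup>2\<close>, and the
  factor \<open>\<bar>det A\<bar>\<close> cancels the square root of the determinant of the covariance.
\<close>

lemma multivariate_normal_eq_distr:
  fixes A :: "real^'n^'n"
  assumes inv: "invertible A"
  shows "multivariate_normal 0 (A ** transpose A) = distr std_gauss borel (\<lambda>x. A *v x)"
proof -
  let ?V = "A ** transpose A"
  have dA: "det A \<noteq> 0" using inv by (simp add: invertible_det_nz)
  let ?B = "matrix_inv A"
  have AB: "A ** ?B = mat 1" "?B ** A = mat 1" using matrix_inv_mult[OF inv] by auto
  have ABt: "transpose A ** transpose ?B = mat 1" "transpose ?B ** transpose A = mat 1"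
    by (simp_all add: matrix_transpose_mul[symmetric] AB)
  have Vinv: "matrix_inv ?V = transpose ?B ** ?B"
  proof (rule matrix_inv_unique)
    have "?V ** (transpose ?B ** ?B) = A ** (transpose A ** transpose ?B) ** ?B" by (simp add: matrix_mul_assoc)
    then show "?V ** (transpose ?B ** ?B) = mat 1" by (simp add: ABt AB)
    have "(transpose ?B ** ?B) ** ?V = transpose ?B ** (?B ** A) ** transpose A" by (simp add: matrix_mul_assoc)
    then show "(transpose ?B ** ?B) ** ?V = mat 1" by (simp add: ABt AB)
  qed
  have q: "(A *v x) \<bullet> (matrix_inv ?V *v (A *v x)) = x \<bullet> x" for x
  proof -
    have "(A *v x) \<bullet> (matrix_inv ?V *v (A *v x)) = (?B *v (A *v x)) \<bullet> (?B *v (A *v x))"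
      unfolding Vinv by (simp only: matrix_vector_mul_assoc[symmetric] inner_transpose_matrix)
    also have "\<dots> = x \<bullet> x" by (simp add: matrix_vector_mul_assoc AB)
    finally show ?thesis .
  qed
  have d: "\<bar>det A\<bar> * (exp (- ((A *v x - 0) \<bullet> (matrix_inv ?V *v (A *v x - 0))) / 2) / sqrt ((2 * pi) ^ CARD('n) * det ?V))
       = std_gauss_density x" for x
    using dA unfolding diff_zero q std_gauss_density_def
    by (simp add: det_mul real_sqrt_mult field_simps)
  have m [measurable]: "(\<lambda>x. matrix_inv ?V *v x) \<in> borel_measurable borel" by simp
  show ?thesis
  proof (rule measure_eqI)
    fix S assume "S \<in> sets (multivariate_normal 0 ?V)"
    then have S [measurable]: "S \<in> sets borel" by (simp add: multivariate_normal_def)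
    have "emeasure (multivariate_normal 0 ?V) S = (\<integral>\<^sup>+x. ennreal (exp (- ((x - 0) \<bullet> (matrix_inv ?V *v (x - 0))) / 2)
         / sqrt ((2 * pi) ^ CARD('n) * det ?V)) * indicator S x \<partial>lborel)"
      unfolding multivariate_normal_def by (subst emeasure_density) auto
    also have "\<dots> = \<bar>det A\<bar> * (\<integral>\<^sup>+x. ennreal (exp (- ((A *v x - 0) \<bullet> (matrix_inv ?V *v (A *v x - 0))) / 2)
         / sqrt ((2 * pi) ^ CARD('n) * det ?V)) * indicator S (A *v x) \<partial>lborel)"
      by (rule nn_integral_lborel_linear[OF dA]) simp
    also have "\<dots> = (\<integral>\<^sup>+x. \<bar>det A\<bar> * (ennreal (exp (- ((A *v x - 0) \<bullet> (matrix_inv ?V *v (A *v x - 0))) / 2)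
         / sqrt ((2 * pi) ^ CARD('n) * det ?V)) * indicator S (A *v x)) \<partial>lborel)"
      by (rule nn_integral_cmult[symmetric]) simp
    also have "\<dots> = (\<integral>\<^sup>+x. ennreal (std_gauss_density x) * indicator S (A *v x) \<partial>lborel)"
      by (intro nn_integral_cong, subst mult.assoc[symmetric], subst ennreal_mult'[symmetric]) (simp, simp only: d)
    also have "\<dots> = emeasure (distr std_gauss borel (\<lambda>x. A *v x)) S"
      by (simp add: emeasure_distr emeasure_density indicator_def vimage_def)
    finally show "emeasure (multivariate_normal 0 ?V) S = emeasure (distr std_gauss borel (\<lambda>x. A *v x)) S" .
  qed (simp add: multivariate_normal_def)
qed

section \<open>From characteristic functions to the bounded Lipschitz distance\<close>

abbreviation char_vec :: "(real^'k) measure \<Rightarrow> real^'k \<Rightarrow> complex" where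
  "char_vec P u \<equiv> (CLINT x|P. iexp (u \<bullet> x))"

text \<open>
  Averaging over a Gaussian shift costs \<open>\<sigma>\<close> times the mean length of the shift, since \<open>f\<close> is
  Lipschitz. Cutting \<open>f\<close> off outside a ball costs the probability of the complement, which the second
  moments bound.
\<close>

lemma gaussian_smoothing_error:
  fixes P :: "(real^'k) measure" and f :: "real^'k \<Rightarrow> real"
  assumes P: "prob_space P" and setsP: "sets P = sets borel"
    and m2: "integrable P (\<lambda>x. (norm x)\<^sup>2)" "(\<integral>x. (norm x)\<^sup>2 \<partial>P) \<le> B"
    and f: "\<And>x. \<bar>f x\<bar> \<le> 1" "1-lipschitz_on UNIV f" and \<sigma>: "\<sigma> > 0" and R: "R > 0"
  shows "\<bar>(\<integral>x. f x \<partial>P) - (\<integral>x. (\<integral>z. f (x + \<sigma> *\<^sub>R z) * indicator (cball 0 R) (x + \<sigma> *\<^sub>R z) \<partial>std_gauss) \<partial>P)\<bar>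
    \<le> \<sigma> * (1 + real CARD('k)) + (2 * B + 2 * \<sigma>\<^sup>2 * real CARD('k)) / R\<^sup>2"
proof -
  note setsP [measurable_cong]
  interpret P: prob_space P by fact
  interpret N: prob_space "std_gauss :: (real^'k) measure" by (rule prob_space_std_gauss)
  interpret PN: pair_prob_space P "std_gauss :: (real^'k) measure" ..
  have fm [measurable]: "f \<in> borel_measurable borel"
    using f(2) by (intro borel_measurable_continuous_onI lipschitz_on_continuous_on)
  define h where "h y = f y * indicator (cball 0 R) y" for y
  have [measurable]: "h \<in> borel_measurable borel" unfolding h_def[abs_def]
    by (intro borel_measurable_times fm borel_measurable_indicator) simp
  let ?k = "real CARD('k)"
  define D where "D x z = f x - h (x + \<sigma> *\<^sub>R z)" for x z
  have [measurable]: "(\<lambda>(x, z). D x z) \<in> borel_measurable (P \<Otimes>\<^sub>M std_gauss)"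
    unfolding D_def by measurable
  have hb: "\<bar>h y\<bar> \<le> 1" for y using f(1)[of y] by (auto simp: indicator_def h_def)
  have ih: "integrable std_gauss (\<lambda>z. h (x + \<sigma> *\<^sub>R z))" for x
    using hb by (intro N.integrable_const_bound[where B=1]) auto
  have iD: "integrable std_gauss (D x)" for x
    unfolding D_def by (intro Bochner_Integration.integrable_diff ih) auto
  have ptw: "\<bar>D x z\<bar> \<le> \<sigma> * (1 + (norm z)\<^sup>2) + (2 * (norm x)\<^sup>2 + 2 * \<sigma>\<^sup>2 * (norm z)\<^sup>2) / R\<^sup>2" for x z
  proof -
    let ?y = "x + \<sigma> *\<^sub>R z"
    have "\<bar>f x - f ?y\<bar> \<le> norm (\<sigma> *\<^sub>R z)"
      using lipschitz_onD[OF f(2), of x ?y] by (simp add: dist_norm)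
    also have "\<dots> \<le> \<sigma> * (1 + (norm z)\<^sup>2)"
    proof -
      have "norm z \<le> 1 + (norm z)\<^sup>2" by (smt (verit) power2_eq_square mult_le_cancel_left1 norm_ge_zero zero_le_power2)
      then show ?thesis using \<sigma> by (simp add: mult_left_mono)
    qed
    finally have 1: "\<bar>f x - f ?y\<bar> \<le> \<sigma> * (1 + (norm z)\<^sup>2)" .
    have 2: "\<bar>f ?y - h ?y\<bar> \<le> (norm ?y)\<^sup>2 / R\<^sup>2"
    proof (cases "?y \<in> cball 0 R")
      case False
      then have "R\<^sup>2 \<le> (norm ?y)\<^sup>2" using R by (intro power_mono) auto
      then have "1 \<le> (norm ?y)\<^sup>2 / R\<^sup>2" using R by simp
      then show ?thesis using f(1)[of ?y] False by (auto simp: h_def)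
    qed (simp add: h_def)
    have "(norm ?y)\<^sup>2 \<le> (norm x + norm (\<sigma> *\<^sub>R z))\<^sup>2" by (intro power_mono norm_triangle_ineq) auto
    also have "\<dots> \<le> 2 * (norm x)\<^sup>2 + 2 * (norm (\<sigma> *\<^sub>R z))\<^sup>2"
      using sum_squares_bound[of "norm x" "norm (\<sigma> *\<^sub>R z)"] by (simp add: power2_sum)
    also have "\<dots> = 2 * (norm x)\<^sup>2 + 2 * \<sigma>\<^sup>2 * (norm z)\<^sup>2" by (simp add: power_mult_distrib)
    finally have "(norm ?y)\<^sup>2 / R\<^sup>2 \<le> (2 * (norm x)\<^sup>2 + 2 * \<sigma>\<^sup>2 * (norm z)\<^sup>2) / R\<^sup>2"
      by (intro divide_right_mono) auto
    with 1 2 show ?thesis unfolding D_def by linarith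
  qed
  have inner: "\<bar>\<integral>z. D x z \<partial>std_gauss\<bar> \<le> \<sigma> * (1 + ?k) + (2 * (norm x)\<^sup>2 + 2 * \<sigma>\<^sup>2 * ?k) / R\<^sup>2" for x
  proof -
    have "\<bar>\<integral>z. D x z \<partial>std_gauss\<bar> \<le> (\<integral>z. \<bar>D x z\<bar> \<partial>std_gauss)"
      by (rule integral_abs_bound)
    also have "\<dots> \<le> (\<integral>z. \<sigma> * (1 + (norm z)\<^sup>2) + (2 * (norm x)\<^sup>2 + 2 * \<sigma>\<^sup>2 * (norm z)\<^sup>2) / R\<^sup>2 \<partial>(std_gauss::(real^'k) measure))"
      using iD[of x] ptw second_moment_std_gauss(1)[where 'n='k]
      by (intro integral_mono) (auto simp del: distrib_left_numeral)
    also have "\<dots> = \<sigma> * (1 + ?k) + (2 * (norm x)\<^sup>2 + 2 * \<sigma>\<^sup>2 * ?k) / R\<^sup>2"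
      using second_moment_std_gauss[where 'n='k] N.prob_space
      by (simp add: add_divide_distrib)
    finally show ?thesis .
  qed
  have if': "integrable P f" using f(1) by (intro P.integrable_const_bound[where B=1]) auto
  have ihh: "integrable P (\<lambda>x. \<integral>z. h (x + \<sigma> *\<^sub>R z) \<partial>std_gauss)"
  proof (rule P.integrable_const_bound[where B=1])
    show "AE x in P. norm (\<integral>z. h (x + \<sigma> *\<^sub>R z) \<partial>std_gauss) \<le> 1"
    proof (rule AE_I2)
      fix x
      have "norm (\<integral>z. h (x + \<sigma> *\<^sub>R z) \<partial>std_gauss) \<le> (\<integral>z. norm (h (x + \<sigma> *\<^sub>R z)) \<partial>std_gauss)"
        by (rule integral_norm_bound)
      also have "\<dots> \<le> (\<integral>z. 1 \<partial>(std_gauss::(real^'k) measure))"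
        using hb ih[of x] by (intro integral_mono) (auto simp del: integral_const)
      also have "\<dots> = 1" using N.prob_space by simp
      finally show "norm (\<integral>z. h (x + \<sigma> *\<^sub>R z) \<partial>std_gauss) \<le> 1" .
    qed
  qed measurable
  have Dint: "(\<integral>z. D x z \<partial>std_gauss) = f x - (\<integral>z. h (x + \<sigma> *\<^sub>R z) \<partial>std_gauss)" for x
    unfolding D_def using N.prob_space
    by (subst Bochner_Integration.integral_diff) (auto intro: ih)
  have "(\<integral>x. f x \<partial>P) - (\<integral>x. (\<integral>z. h (x + \<sigma> *\<^sub>R z) \<partial>std_gauss) \<partial>P) = (\<integral>x. (\<integral>z. D x z \<partial>std_gauss) \<partial>P)"
    unfolding Dint by (rule Bochner_Integration.integral_diff[symmetric]) (rule if' ihh)+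
  also have "\<bar>\<dots>\<bar> \<le> (\<integral>x. \<bar>\<integral>z. D x z \<partial>std_gauss\<bar> \<partial>P)" by (rule integral_abs_bound)
  also have "\<dots> \<le> (\<integral>x. \<sigma> * (1 + ?k) + (2 * (norm x)\<^sup>2 + 2 * \<sigma>\<^sup>2 * ?k) / R\<^sup>2 \<partial>P)"
    using inner m2(1) if' ihh by (intro integral_mono) (auto simp: Dint)
  also have "\<dots> = \<sigma> * (1 + ?k) + (2 * (\<integral>x. (norm x)\<^sup>2 \<partial>P) + 2 * \<sigma>\<^sup>2 * ?k) / R\<^sup>2"
    using m2(1) P.prob_space by (simp add: add_divide_distrib)
  also have "\<dots> \<le> \<sigma> * (1 + ?k) + (2 * B + 2 * \<sigma>\<^sup>2 * ?k) / R\<^sup>2"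
    using m2(2) by (intro add_left_mono divide_right_mono) auto
  finally show ?thesis unfolding h_def .
qed

text \<open>
  The Lebesgue density of the sum of a vector with law \<open>P\<close> and \<open>\<sigma>\<close> times an independent standard
  Gaussian vector.
\<close>

definition smoothed_density :: "real \<Rightarrow> (real^'k) measure \<Rightarrow> real^'k \<Rightarrow> real" where
  "smoothed_density \<sigma> P y = (\<integral>x. std_gauss_density ((1 / \<sigma>) *\<^sub>R (y - x)) / \<sigma> ^ CARD('k) \<partial>P)"

lemma std_gauss_density_le: "std_gauss_density (x::real^'k) \<le> 1 / sqrt ((2 * pi) ^ CARD('k))"
  unfolding std_gauss_density_def by (intro divide_right_mono) auto

lemma integral_smoothed:
  fixes P :: "(real^'k) measure" and h :: "real^'k \<Rightarrow> real"
  assumes P: "prob_space P" and setsP: "sets P = sets borel"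
    and h: "integrable lborel h" and \<sigma>: "\<sigma> > 0"
  shows "(\<integral>x. (\<integral>z. h (x + \<sigma> *\<^sub>R z) \<partial>std_gauss) \<partial>P) = (\<integral>y. h y * smoothed_density \<sigma> P y \<partial>lborel)"
    and "integrable lborel (\<lambda>y. h y * smoothed_density \<sigma> P y)"
proof -
  note setsP [measurable_cong]
  interpret P: prob_space P by fact
  interpret LP: pair_sigma_finite lborel P ..
  have [measurable]: "h \<in> borel_measurable borel" using h by (auto dest: borel_measurable_integrable)
  let ?n = "\<lambda>w. std_gauss_density ((1 / \<sigma>) *\<^sub>R w) / \<sigma> ^ CARD('k) :: real"
  let ?c = "1 / sqrt ((2 * pi) ^ CARD('k)) / \<sigma> ^ CARD('k)"
  have nb: "0 \<le> ?n w" "?n w \<le> ?c" for w :: "real^'k"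
    using \<sigma> by (simp, intro divide_right_mono[OF std_gauss_density_le]) (use \<sigma> in simp)
  have inner: "(\<integral>z. h (x + \<sigma> *\<^sub>R z) \<partial>std_gauss) = (\<integral>y. h y * ?n (y - x) \<partial>lborel)" for x
  proof -
    have "(\<integral>y. h y * ?n (y - x) \<partial>lborel)
       = (\<integral>y. h y * ?n (y - x) \<partial>density (distr lborel borel (\<lambda>z. x + \<sigma> *\<^sub>R z)) (\<lambda>_. ennreal (\<bar>\<sigma>\<bar> ^ DIM(real^'k))))"
      using \<sigma> by (subst lborel_affine[of \<sigma> x, symmetric]) auto
    also have "\<dots> = (\<integral>z. \<sigma> ^ CARD('k) * (h (x + \<sigma> *\<^sub>R z) * ?n (\<sigma> *\<^sub>R z)) \<partial>lborel)"
      using \<sigma> by (subst integral_density, simp, simp, simp, subst integral_distr) simp_all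
    also have "\<dots> = (\<integral>z. std_gauss_density z *\<^sub>R h (x + \<sigma> *\<^sub>R z) \<partial>lborel)"
      using \<sigma> by (intro Bochner_Integration.integral_cong) auto
    also have "\<dots> = (\<integral>z. h (x + \<sigma> *\<^sub>R z) \<partial>std_gauss)"
      by (rule integral_density[symmetric]) auto
    finally show ?thesis by simp
  qed
  have c0: "0 \<le> \<bar>h y\<bar> * ?c" for y using \<sigma> by simp
  have iy: "integrable P (\<lambda>x. h y * ?n (y - x))" for y
  proof (rule P.integrable_const_bound[where B="\<bar>h y\<bar> * ?c"])
    show "AE x in P. norm (h y * ?n (y - x)) \<le> \<bar>h y\<bar> * ?c"
    proof (rule AE_I2)
      fix x
      have "norm (h y * ?n (y - x)) = \<bar>h y\<bar> * ?n (y - x)" using nb(1)[of "y - x"] \<sigma> by (simp add: abs_mult)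
      also have "\<dots> \<le> \<bar>h y\<bar> * ?c" by (intro mult_left_mono nb) auto
      finally show "norm (h y * ?n (y - x)) \<le> \<bar>h y\<bar> * ?c" .
    qed
  qed measurable
  have nn: "norm (h y * ?n (y - x)) = \<bar>h y\<bar> * ?n (y - x)" for x y
    using nb(1)[of "y - x"] \<sigma> by (simp add: abs_mult)
  have bnd: "(\<integral>x. norm (h y * ?n (y - x)) \<partial>P) \<le> \<bar>h y\<bar> * ?c" for y
  proof -
    have "(\<integral>x. norm (h y * ?n (y - x)) \<partial>P) \<le> (\<integral>x. \<bar>h y\<bar> * ?c \<partial>P)"
    proof (rule integral_mono)
      show "integrable P (\<lambda>x. norm (h y * ?n (y - x)))" by (rule integrable_norm[OF iy])
      show "norm (h y * ?n (y - x)) \<le> \<bar>h y\<bar> * ?c" for x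
        unfolding nn by (intro mult_left_mono nb) auto
    qed simp
    then show ?thesis using P.prob_space by simp
  qed
  have I: "integrable (lborel \<Otimes>\<^sub>M P) (\<lambda>(y, x). h y * ?n (y - x))"
  proof (rule LP.Fubini_integrable)
    show "integrable lborel (\<lambda>y. \<integral>x. norm (case (y, x) of (y, x) \<Rightarrow> h y * ?n (y - x)) \<partial>P)"
    proof (rule Bochner_Integration.integrable_bound)
      show "integrable lborel (\<lambda>y. \<bar>h y\<bar> * ?c)" using h by auto
      show "AE y in lborel. norm (\<integral>x. norm (case (y, x) of (y, x) \<Rightarrow> h y * ?n (y - x)) \<partial>P) \<le> norm (\<bar>h y\<bar> * ?c)"
      proof (rule AE_I2)
        fix y
        have "0 \<le> (\<integral>x. norm (h y * ?n (y - x)) \<partial>P)" by (rule integral_nonneg_AE) auto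
        then have "\<bar>\<integral>x. norm (h y * ?n (y - x)) \<partial>P\<bar> \<le> \<bar>\<bar>h y\<bar> * ?c\<bar>"
          unfolding abs_of_nonneg[OF c0] using bnd[of y] by linarith
        then show "norm (\<integral>x. norm (case (y, x) of (y, x) \<Rightarrow> h y * ?n (y - x)) \<partial>P) \<le> norm (\<bar>h y\<bar> * ?c)"
          by (simp only: prod.case real_norm_def)
      qed
    qed measurable
    show "AE y in lborel. integrable P (\<lambda>x. case (y, x) of (y, x) \<Rightarrow> h y * ?n (y - x))"
      using iy by simp
  qed measurable
  have eq: "(\<integral>x. h y * ?n (y - x) \<partial>P) = h y * smoothed_density \<sigma> P y" for y
    unfolding smoothed_density_def by (rule integral_mult_right_zero)
  show "(\<integral>x. (\<integral>z. h (x + \<sigma> *\<^sub>R z) \<partial>std_gauss) \<partial>P) = (\<integral>y. h y * smoothed_density \<sigma> P y \<partial>lborel)"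
    unfolding inner eq[symmetric]
    using LP.Fubini_integral[OF I] by simp
  show "integrable lborel (\<lambda>y. h y * smoothed_density \<sigma> P y)"
    using LP.integrable_fst[OF I] by (simp only: eq)
qed

text \<open>
  Up to scaling, the Gaussian density is its own Fourier transform. Fubini's theorem turns this into
  an inversion formula in which the Gaussian weight makes the integral converge for every \<open>P\<close>.
\<close>

lemma smoothed_density_char:
  fixes P :: "(real^'k) measure"
  assumes P: "prob_space P" and setsP: "sets P = sets borel" and \<sigma>: "\<sigma> > 0"
  shows "of_real (smoothed_density \<sigma> P y) = of_real (1 / sqrt ((2 * pi) ^ CARD('k)) / \<sigma> ^ CARD('k)) *
     (CLINT u|std_gauss. iexp (((1 / \<sigma>) *\<^sub>R y) \<bullet> u) * char_vec P (- (1 / \<sigma>) *\<^sub>R u))"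
proof -
  note setsP [measurable_cong]
  interpret P: prob_space P by fact
  interpret N: prob_space "std_gauss :: (real^'k) measure" by (rule prob_space_std_gauss)
  interpret PN: pair_prob_space P "std_gauss :: (real^'k) measure" ..
  let ?n = "\<lambda>w. std_gauss_density ((1 / \<sigma>) *\<^sub>R w) / \<sigma> ^ CARD('k) :: real"
  define c :: real where "c = 1 / sqrt ((2 * pi) ^ CARD('k)) / \<sigma> ^ CARD('k)"
  have n: "complex_of_real (?n w) = of_real c * char_vec std_gauss ((1 / \<sigma>) *\<^sub>R w)" for w :: "real^'k"
    by (simp only: char_std_gauss) (simp add: c_def std_gauss_density_def)
  have I: "integrable (P \<Otimes>\<^sub>M std_gauss) (\<lambda>(x, u). iexp (((1 / \<sigma>) *\<^sub>R (y - x)) \<bullet> u))"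
    by (rule PN.integrable_const_bound[where B=1]) (auto simp: split_beta)
  have "of_real (smoothed_density \<sigma> P y) = (CLINT x|P. of_real (?n (y - x)))"
    unfolding smoothed_density_def by (rule integral_complex_of_real[symmetric])
  also have "\<dots> = of_real c * (CLINT x|P. char_vec std_gauss ((1 / \<sigma>) *\<^sub>R (y - x)))"
    unfolding n by (rule integral_mult_right_zero)
  also have "(CLINT x|P. char_vec std_gauss ((1 / \<sigma>) *\<^sub>R (y - x)))
     = (CLINT u|std_gauss. (CLINT x|P. iexp (((1 / \<sigma>) *\<^sub>R (y - x)) \<bullet> u)))"
    using PN.Fubini_integral[OF I] by simp
  also have "\<dots> = (CLINT u|std_gauss. iexp (((1 / \<sigma>) *\<^sub>R y) \<bullet> u) * char_vec P (- (1 / \<sigma>) *\<^sub>R u))"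
  proof (rule Bochner_Integration.integral_cong[OF refl])
    fix u
    have "iexp (((1 / \<sigma>) *\<^sub>R (y - x)) \<bullet> u) = iexp (((1 / \<sigma>) *\<^sub>R y) \<bullet> u) * iexp ((- (1 / \<sigma>) *\<^sub>R u) \<bullet> x)" for x
      by (simp add: exp_add[symmetric] inner_diff_left inner_commute algebra_simps diff_divide_distrib)
    then show "(CLINT x|P. iexp (((1 / \<sigma>) *\<^sub>R (y - x)) \<bullet> u)) = iexp (((1 / \<sigma>) *\<^sub>R y) \<bullet> u) * char_vec P (- (1 / \<sigma>) *\<^sub>R u)"
      by (simp only: integral_mult_right_zero)
  qed
  finally show ?thesis unfolding c_def .
qed

lemma char_vec_le_1:
  assumes "prob_space P" shows "cmod (char_vec P u) \<le> 1"
proof -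
  interpret prob_space P by fact
  have "cmod (char_vec P u) \<le> (\<integral>x. cmod (iexp (u \<bullet> x)) \<partial>P)" by (rule integral_norm_bound)
  also have "\<dots> = 1" using prob_space by simp
  finally show ?thesis .
qed

text \<open>
  Outside the ball of radius \<open>K\<close> the characteristic functions differ by at most \<open>2 \<le> 2 \<parallel>u\<parallel>\<^sup>2 / K\<^sup>2\<close>,
  and the second moment of the Gaussian weight bounds the contribution.
\<close>

lemma smoothed_density_diff:
  fixes P Q :: "(real^'k) measure"
  assumes P: "prob_space P" "sets P = sets borel" and Q: "prob_space Q" "sets Q = sets borel"
    and \<sigma>: "\<sigma> > 0" and K: "K > 0" and \<delta>: "\<delta> \<ge> 0"
    and close: "\<And>u. norm u \<le> K \<Longrightarrow> cmod (char_vec P u - char_vec Q u) \<le> \<delta>"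
  shows "\<bar>smoothed_density \<sigma> P y - smoothed_density \<sigma> Q y\<bar>
    \<le> 1 / sqrt ((2 * pi) ^ CARD('k)) / \<sigma> ^ CARD('k) * (\<delta> + 2 * real CARD('k) / (K * \<sigma>)\<^sup>2)"
proof -
  note P(2) [measurable_cong] Q(2) [measurable_cong]
  interpret P: prob_space P by fact
  interpret Q: prob_space Q by fact
  interpret N: prob_space "std_gauss :: (real^'k) measure" by (rule prob_space_std_gauss)
  define c :: real where "c = 1 / sqrt ((2 * pi) ^ CARD('k)) / \<sigma> ^ CARD('k)"
  have c: "c \<ge> 0" using \<sigma> by (simp add: c_def)
  let ?e = "\<lambda>u. iexp (((1 / \<sigma>) *\<^sub>R y) \<bullet> u)"
  let ?s = "\<lambda>u. - (1 / \<sigma>) *\<^sub>R (u::real^'k)"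
  have iP: "integrable std_gauss (\<lambda>u. ?e u * char_vec P (?s u))"
    by (rule N.integrable_const_bound[where B=1], rule AE_I2)
       (simp only: norm_mult norm_exp_i_times mult_1 char_vec_le_1[OF P(1)], measurable)
  have iQ: "integrable std_gauss (\<lambda>u. ?e u * char_vec Q (?s u))"
    by (rule N.integrable_const_bound[where B=1], rule AE_I2)
       (simp only: norm_mult norm_exp_i_times mult_1 char_vec_le_1[OF Q(1)], measurable)
  have ptw: "cmod (char_vec P u - char_vec Q u) \<le> \<delta> + 2 * (norm u)\<^sup>2 / K\<^sup>2" for u
  proof (cases "norm u \<le> K")
    case True
    then show ?thesis using close[OF True] by (smt (verit) divide_nonneg_nonneg zero_le_power2)
  next
    case False
    have "K\<^sup>2 \<le> (norm u)\<^sup>2" using False K by (intro power_mono) auto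
    then have "1 \<le> (norm u)\<^sup>2 / K\<^sup>2" using K by simp
    moreover have "cmod (char_vec P u - char_vec Q u) \<le> 2"
      using norm_triangle_ineq4[of "char_vec P u" "char_vec Q u"] char_vec_le_1[OF P(1), of u] char_vec_le_1[OF Q(1), of u]
      by linarith
    ultimately show ?thesis using \<delta> by simp
  qed
  define D where "D u = ?e u * char_vec P (?s u) - ?e u * char_vec Q (?s u)" for u
  have iD: "integrable std_gauss D"
    unfolding D_def by (rule Bochner_Integration.integrable_diff[OF iP iQ])
  have Dle: "cmod (D u) \<le> \<delta> + 2 * (norm u)\<^sup>2 / (K * \<sigma>)\<^sup>2" for u
  proof -
    have cancel: "cmod (z * a - z * b) = cmod (a - b)" if "cmod z = 1" for z a b
      using that by (metis mult_1 norm_mult right_diff_distrib)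
    have "cmod (D u) = cmod (char_vec P (?s u) - char_vec Q (?s u))"
      unfolding D_def by (rule cancel) (rule norm_exp_i_times)
    also have "\<dots> \<le> \<delta> + 2 * (norm (?s u))\<^sup>2 / K\<^sup>2" by (rule ptw)
    also have "\<dots> = \<delta> + 2 * (norm u)\<^sup>2 / (K * \<sigma>)\<^sup>2" using \<sigma> by (simp add: power_divide power_mult_distrib)
    finally show ?thesis .
  qed
  have "of_real (smoothed_density \<sigma> P y - smoothed_density \<sigma> Q y) = of_real c * (CLINT u|std_gauss. D u)"
    unfolding D_def of_real_diff smoothed_density_char[OF P \<sigma>] smoothed_density_char[OF Q \<sigma>] c_def[symmetric]
    by (subst Bochner_Integration.integral_diff[OF iP iQ]) (rule right_diff_distrib[symmetric])
  then have "\<bar>smoothed_density \<sigma> P y - smoothed_density \<sigma> Q y\<bar> = c * cmod (CLINT u|std_gauss. D u)"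
    using c by (metis norm_of_real norm_mult abs_of_nonneg)
  moreover have "cmod (CLINT u|std_gauss. D u) \<le> \<delta> + 2 * real CARD('k) / (K * \<sigma>)\<^sup>2"
  proof -
    have "cmod (CLINT u|std_gauss. D u) \<le> (\<integral>u. cmod (D u) \<partial>std_gauss)" by (rule integral_norm_bound)
    also have "\<dots> \<le> (\<integral>u. \<delta> + 2 * (norm u)\<^sup>2 / (K * \<sigma>)\<^sup>2 \<partial>(std_gauss::(real^'k) measure))"
      using second_moment_std_gauss(1)[where 'n='k]
      by (intro integral_mono Dle integrable_norm iD) auto
    also have "\<dots> = \<delta> + 2 * real CARD('k) / (K * \<sigma>)\<^sup>2"
      using second_moment_std_gauss[where 'n='k] N.prob_space by simp
    finally show ?thesis .
  qed
  ultimately show ?thesis unfolding c_def[symmetric] using c by (simp add: mult_left_mono)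
qed

text \<open>
  A quantitative continuity theorem: with second moments bounded, closeness of the characteristic
  functions on a large ball forces closeness in the bounded Lipschitz distance. Both laws are
  smoothed by a small Gaussian, whose Fourier transform is integrable, so that the smoothed
  densities are uniformly close and only a ball of finite volume matters.
\<close>

lemma char_close_imp_BL_close:
  fixes B e :: real
  assumes e: "e > 0" and B: "B \<ge> 0"
  obtains \<delta> K where "\<delta> > 0" "K > 0"
    "\<And>(P::(real^'k) measure) Q f. prob_space P \<Longrightarrow> sets P = sets borel \<Longrightarrow> prob_space Q \<Longrightarrow> sets Q = sets borel
      \<Longrightarrow> integrable P (\<lambda>x. (norm x)\<^sup>2) \<Longrightarrow> (\<integral>x. (norm x)\<^sup>2 \<partial>P) \<le> B
      \<Longrightarrow> integrable Q (\<lambda>x. (norm x)\<^sup>2) \<Longrightarrow> (\<integral>x. (norm x)\<^sup>2 \<partial>Q) \<le> B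
      \<Longrightarrow> (\<And>u. norm u \<le> K \<Longrightarrow> cmod (char_vec P u - char_vec Q u) \<le> \<delta>)
      \<Longrightarrow> (\<And>x. \<bar>f x\<bar> \<le> 1) \<Longrightarrow> 1-lipschitz_on UNIV f
      \<Longrightarrow> \<bar>(\<integral>x. f x \<partial>P) - (\<integral>x. f x \<partial>Q)\<bar> \<le> e"
proof -
  let ?k = "real CARD('k)"
  \<comment> \<open>For each of the two laws, smoothing and cutting off cost \<open>e / 10\<close> each; the smoothed densities
    on the ball, of volume \<open>v\<close>, contribute \<open>e / 5\<close>.\<close>
  define \<sigma> where "\<sigma> = (e / 10) / (1 + ?k)"
  have \<sigma>: "\<sigma> > 0" using e by (simp add: \<sigma>_def add_pos_nonneg)
  have \<sigma>e: "\<sigma> * (1 + ?k) = e / 10"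
  proof -
    have "1 + ?k \<noteq> 0" by (smt (verit) of_nat_0_le_iff)
    moreover have "a / b * b = a" if "b \<noteq> 0" for a b :: real using that by simp
    ultimately show ?thesis unfolding \<sigma>_def by blast
  qed
  define W where "W = 2 * B + 2 * \<sigma>\<^sup>2 * ?k"
  have W: "W \<ge> 0" using B by (simp add: W_def)
  define R where "R = sqrt (10 * (W + 1) / e)"
  have R: "R > 0" using e W by (simp add: R_def)
  have WR: "W / R\<^sup>2 \<le> e / 10"
  proof -
    have R2: "R\<^sup>2 = 10 * (W + 1) / e" unfolding R_def using e W by (intro real_sqrt_pow2) (auto intro!: divide_nonneg_pos)
    show ?thesis unfolding R2 using e W by (simp add: field_simps)
  qed
  define v where "v = measure lborel (cball (0::real^'k) R)"
  define c :: real where "c = 1 / sqrt ((2 * pi) ^ CARD('k)) / \<sigma> ^ CARD('k)"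
  have c: "c \<ge> 0" using \<sigma> by (simp add: c_def)
  have v: "v \<ge> 0" by (simp add: v_def)
  have vc: "v * c \<ge> 0" using v c by simp
  define a where "a = v * c + 1"
  have a: "a > 0" using vc by (simp add: a_def)
  define \<delta> where "\<delta> = e / (10 * a)"
  have \<delta>: "\<delta> > 0" using e a by (simp add: \<delta>_def)
  define K where "K = sqrt (20 * ?k * a / e) / \<sigma>"
  have kpos: "?k > 0" by simp
  have K: "K > 0" using e a \<sigma> kpos by (simp add: K_def)
  have K2: "2 * ?k / (K * \<sigma>)\<^sup>2 = \<delta>"
  proof -
    have "(K * \<sigma>)\<^sup>2 = 20 * ?k * a / e"
      using \<sigma> e a by (simp add: K_def)
    then show ?thesis using kpos e a by (simp add: \<delta>_def)
  qed
  have vcd: "v * (c * (\<delta> + \<delta>)) \<le> e / 5"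
  proof -
    have "v * (c * (\<delta> + \<delta>)) = (v * c / a) * (e / 5)" using a by (simp add: \<delta>_def)
    also have "\<dots> \<le> 1 * (e / 5)" using vc e a by (intro mult_right_mono) (auto simp: a_def)
    finally show ?thesis by simp
  qed
  show thesis
  proof (rule that[OF \<delta> K])
    fix P Q :: "(real^'k) measure" and f :: "real^'k \<Rightarrow> real"
    assume P: "prob_space P" "sets P = sets borel" and Q: "prob_space Q" "sets Q = sets borel"
      and mP: "integrable P (\<lambda>x. (norm x)\<^sup>2)" "(\<integral>x. (norm x)\<^sup>2 \<partial>P) \<le> B"
      and mQ: "integrable Q (\<lambda>x. (norm x)\<^sup>2)" "(\<integral>x. (norm x)\<^sup>2 \<partial>Q) \<le> B"
      and close: "\<And>u. norm u \<le> K \<Longrightarrow> cmod (char_vec P u - char_vec Q u) \<le> \<delta>"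
      and f: "\<And>x. \<bar>f x\<bar> \<le> 1" "1-lipschitz_on UNIV f"
    have fm [measurable]: "f \<in> borel_measurable borel"
      using f(2) by (intro borel_measurable_continuous_onI lipschitz_on_continuous_on)
    define h where "h = (\<lambda>y. f y * indicator (cball 0 R) y)"
    have hle: "\<bar>h y\<bar> \<le> indicator (cball 0 R) y" for y
      using f(1)[of y] by (auto simp: h_def indicator_def)
    have ind: "integrable lborel (indicator (cball (0::real^'k) R) :: _ \<Rightarrow> real)"
      by (rule integrable_real_indicator) (simp, simp only: infinity_ennreal_def[symmetric] emeasure_lborel_cball_finite)
    have [measurable]: "h \<in> borel_measurable borel" unfolding h_def
      by (intro borel_measurable_times fm borel_measurable_indicator) simp
    have ih: "integrable lborel h"
    proof (rule Bochner_Integration.integrable_bound[OF ind])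
      show "AE x in lborel. norm (h x) \<le> norm (indicator (cball 0 R) x :: real)"
        using hle by (intro AE_I2) simp
    qed simp
    let ?I = "\<lambda>P. (\<integral>y. h y * smoothed_density \<sigma> P y \<partial>lborel)"
    have eP: "\<bar>(\<integral>x. f x \<partial>P) - ?I P\<bar> \<le> e / 10 + e / 10"
      using gaussian_smoothing_error[OF P mP f \<sigma> R] integral_smoothed(1)[OF P ih \<sigma>] \<sigma>e WR
      unfolding h_def W_def[symmetric] by linarith
    have eQ: "\<bar>(\<integral>x. f x \<partial>Q) - ?I Q\<bar> \<le> e / 10 + e / 10"
      using gaussian_smoothing_error[OF Q mQ f \<sigma> R] integral_smoothed(1)[OF Q ih \<sigma>] \<sigma>e WR
      unfolding h_def W_def[symmetric] by linarith
    note iP = integral_smoothed(2)[OF P ih \<sigma>] and iQ = integral_smoothed(2)[OF Q ih \<sigma>]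
    have "\<bar>?I P - ?I Q\<bar> = \<bar>\<integral>y. h y * smoothed_density \<sigma> P y - h y * smoothed_density \<sigma> Q y \<partial>lborel\<bar>"
      by (subst Bochner_Integration.integral_diff[OF iP iQ]) simp
    also have "\<dots> \<le> (\<integral>y. \<bar>h y * smoothed_density \<sigma> P y - h y * smoothed_density \<sigma> Q y\<bar> \<partial>lborel)"
      by (rule integral_abs_bound)
    also have "\<dots> \<le> (\<integral>y. indicator (cball 0 R) y * (c * (\<delta> + \<delta>)) \<partial>(lborel::(real^'k) measure))"
    proof (rule integral_mono)
      show "integrable lborel (\<lambda>y. \<bar>h y * smoothed_density \<sigma> P y - h y * smoothed_density \<sigma> Q y\<bar>)"
        using iP iQ by (intro integrable_abs Bochner_Integration.integrable_diff)
      show "integrable lborel (\<lambda>y::real^'k. indicator (cball 0 R) y * (c * (\<delta> + \<delta>)))"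
        using ind by (intro integrable_mult_left) auto
      fix y
      have "\<bar>h y * smoothed_density \<sigma> P y - h y * smoothed_density \<sigma> Q y\<bar>
        = \<bar>h y\<bar> * \<bar>smoothed_density \<sigma> P y - smoothed_density \<sigma> Q y\<bar>"
        by (simp add: right_diff_distrib[symmetric] abs_mult)
      also have "\<dots> \<le> indicator (cball 0 R) y * (c * (\<delta> + \<delta>))"
        using smoothed_density_diff[OF P Q \<sigma> K less_imp_le[OF \<delta>] close, of y] hle[of y] c \<delta>
        unfolding K2 c_def[symmetric] by (intro mult_mono) auto
      finally show "\<bar>h y * smoothed_density \<sigma> P y - h y * smoothed_density \<sigma> Q y\<bar>
        \<le> indicator (cball 0 R) y * (c * (\<delta> + \<delta>))" .
    qed
    also have "\<dots> = v * (c * (\<delta> + \<delta>))" by (simp add: v_def)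
    also have "\<dots> \<le> e / 5" by (rule vcd)
    finally show "\<bar>(\<integral>x. f x \<partial>P) - (\<integral>x. f x \<partial>Q)\<bar> \<le> e" using eP eQ e by linarith
  qed
qed

section \<open>Determinants, measurable matrix operations and positive forms\<close>

(* Rewriting transpose A *v x to x v* A would hide the instances of inner_transpose_matrix. *)
declare transpose_matrix_vector [simp del]

lemma matrix_add_rdistrib':
  fixes A B :: "'a::semiring_1^'n^'m"
  shows "(A + B) ** C = A ** C + B ** C"
  by (simp add: vec_eq_iff matrix_matrix_mult_def sum.distrib distrib_right)

text \<open>
  The matrix determinant lemma. A rotation that takes \<open>x\<close> to an axis leaves a matrix that differs from
  the identity in one column only, and Cramer's lemma gives its determinant.
\<close>

lemma det_one_plus_outer:
  fixes u x :: "real^'n"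
  shows "det (mat 1 + outer u x) = 1 + u \<bullet> x"
proof -
  obtain k :: 'n where True by simp
  have nx: "norm (norm x *\<^sub>R (axis k 1 :: real^'n)) = norm x" by (simp add: norm_axis_1)
  obtain f :: "real^'n \<Rightarrow> real^'n" where f: "orthogonal_transformation f" "f (norm x *\<^sub>R axis k 1) = x"
    by (rule orthogonal_transformation_exists[OF nx])
  define Q where "Q = matrix f"
  have lin: "linear f" using f by (simp add: orthogonal_transformation)
  have Q: "orthogonal_matrix Q" using f by (simp add: Q_def orthogonal_transformation_matrix)
  have OO: "transpose Q ** Q = mat 1" "Q ** transpose Q = mat 1" using Q by (auto simp: orthogonal_matrix_def)
  have Ox: "transpose Q *v x = norm x *\<^sub>R axis k 1"
  proof -
    have "x = Q *v (norm x *\<^sub>R axis k 1)" using f lin by (simp add: Q_def matrix_works)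
    then have "transpose Q *v x = (transpose Q ** Q) *v (norm x *\<^sub>R axis k 1)" by (metis matrix_vector_mul_assoc)
    then show ?thesis by (simp add: OO)
  qed
  define u' where "u' = transpose Q *v u"
  have eq: "transpose Q ** (mat 1 + outer u x) ** Q = mat 1 + outer u' (norm x *\<^sub>R axis k 1)"
  proof -
    have "transpose Q ** outer u x ** Q = outer u' (transpose Q *v x)"
      by (simp add: vec_eq_iff matrix_matrix_mult_def outer_def u'_def matrix_vector_mult_def transpose_def
          sum_distrib_left sum_distrib_right mult_ac)
    then show ?thesis by (simp add: matrix_add_ldistrib matrix_add_rdistrib' OO Ox)
  qed
  have "det (mat 1 + outer u x) = det (transpose Q) * det (mat 1 + outer u x) * det Q"
    using arg_cong[OF OO(1), of det] by (simp add: det_mul mult.commute)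
  also have "\<dots> = det (mat 1 + outer u' (norm x *\<^sub>R axis k 1))"
    by (simp add: eq[symmetric] det_mul)
  also have "mat 1 + outer u' (norm x *\<^sub>R axis k 1)
     = (\<chi> i j. if j = k then (mat 1 *v (axis k 1 + norm x *\<^sub>R u')) $ i else mat 1 $ i $ j)"
    by (simp only: matrix_vector_mul_lid) (auto simp: vec_eq_iff outer_def mat_def axis_def)
  also have "det \<dots> = (axis k 1 + norm x *\<^sub>R u') $ k * det (mat 1 :: real^'n^'n)"
    by (rule cramer_lemma)
  also have "\<dots> = 1 + u' \<bullet> (norm x *\<^sub>R axis k 1)" by (simp add: inner_axis)
  also have "u' \<bullet> (norm x *\<^sub>R axis k 1) = u \<bullet> (Q *v (norm x *\<^sub>R axis k 1))"
    unfolding u'_def by (metis inner_transpose_matrix inner_commute)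
  also have "Q *v (norm x *\<^sub>R axis k 1) = x" using f lin by (simp add: Q_def matrix_works)
  finally show ?thesis .
qed

lemma abs_det_le:
  fixes A :: "real^'n^'n"
  assumes "\<And>i j. \<bar>A $ i $ j\<bar> \<le> B"
  shows "\<bar>det A\<bar> \<le> fact CARD('n) * B ^ CARD('n)"
proof -
  have "\<bar>det A\<bar> \<le> (\<Sum>p | p permutes (UNIV::'n set). \<bar>of_int (sign p) * (\<Prod>i\<in>UNIV. A $ i $ p i)\<bar>)"
    unfolding det_def by (rule sum_abs)
  also have "\<dots> \<le> (\<Sum>p | p permutes (UNIV::'n set). B ^ CARD('n))"
  proof (rule sum_mono)
    fix p :: "'n \<Rightarrow> 'n"
    have "\<bar>of_int (sign p) * (\<Prod>i\<in>UNIV. A $ i $ p i)\<bar> = (\<Prod>i\<in>UNIV. \<bar>A $ i $ p i\<bar>)"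
      by (simp add: abs_mult sign_def abs_prod)
    also have "\<dots> \<le> (\<Prod>i\<in>(UNIV::'n set). B)" by (intro prod_mono) (auto simp: assms)
    finally show "\<bar>of_int (sign p) * (\<Prod>i\<in>UNIV. A $ i $ p i)\<bar> \<le> B ^ CARD('n)" by simp
  qed
  also have "\<dots> = fact CARD('n) * B ^ CARD('n)"
    by (simp add: card_permutations[OF refl])
  finally show ?thesis .
qed

lemma borel_measurable_vecI:
  fixes f :: "'a \<Rightarrow> 'b::euclidean_space^'n"
  assumes "\<And>i. (\<lambda>x. f x $ i) \<in> borel_measurable M"
  shows "f \<in> borel_measurable M"
proof (subst borel_measurable_euclidean_space, rule ballI)
  fix b :: "'b^'n" assume "b \<in> Basis"
  then obtain i c where b: "b = axis i c" by (auto simp: Basis_vec_def)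
  show "(\<lambda>x. f x \<bullet> b) \<in> borel_measurable M"
    unfolding b inner_axis by (intro borel_measurable_inner assms) simp
qed

lemma borel_measurable_vec_nth_comp [measurable]:
  fixes f :: "'a \<Rightarrow> 'b::euclidean_space^'n"
  assumes [measurable]: "f \<in> borel_measurable M"
  shows "(\<lambda>x. f x $ i) \<in> borel_measurable M"
proof -
  have "(\<lambda>v::'b^'n. v $ i) \<in> borel_measurable borel"
    by (intro borel_measurable_continuous_onI continuous_intros)
  from measurable_compose[OF assms this] show ?thesis .
qed

lemma borel_measurable_det [measurable]:
  fixes f :: "'a \<Rightarrow> real^'n^'n"
  assumes [measurable]: "f \<in> borel_measurable M"
  shows "(\<lambda>x. det (f x)) \<in> borel_measurable M"
  unfolding det_def by measurable

lemma matrix_inv_cramer: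
  fixes A :: "real^'n^'n"
  assumes "det A \<noteq> 0"
  shows "matrix_inv A = (\<chi> i j. det (\<chi> k l. if l = i then axis j 1 $ k else A $ k $ l) / det A)"
proof -
  have inv: "invertible A" using assms by (simp add: invertible_det_nz)
  have "matrix_inv A *v axis j 1 = (\<chi> i. det (\<chi> k l. if l = i then axis j 1 $ k else A $ k $ l) / det A)" for j
    by (subst cramer[OF assms, symmetric]) (simp add: matrix_vector_mul_assoc matrix_inv_mult[OF inv])
  then show ?thesis
    by (simp add: vec_eq_iff matrix_vector_mult_basis column_def)
qed

lemma det_zero: "det (0 :: real^'n^'n) = 0"
  by (rule det_zero_row(1)[of undefined]) (simp add: row_def vec_eq_iff)

text \<open>
  On the invertible matrices the inverse is a rational function of the entries, by Cramer's rule.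
\<close>

lemma borel_measurable_matrix_inv [measurable]:
  fixes f :: "'a \<Rightarrow> real^'n^'n"
  assumes [measurable]: "f \<in> borel_measurable M"
  shows "(\<lambda>x. matrix_inv (f x)) \<in> borel_measurable M"
proof -
  have eq: "matrix_inv A = (if det A \<noteq> 0
      then (\<chi> i j. det (\<chi> k l. if l = i then axis j 1 $ k else A $ k $ l) / det A)
      else matrix_inv (0::real^'n^'n))" for A :: "real^'n^'n"
  proof (cases "det A = 0")
    case True
    \<comment> \<open>All singular matrices share the same arbitrary value.\<close>
    have "\<not> (\<exists>B. A ** B = mat 1 \<and> B ** A = mat 1)" "\<not> (\<exists>B. (0::real^'n^'n) ** B = mat 1 \<and> B ** 0 = mat 1)"
      using True invertible_det_nz[of A] invertible_det_nz[of "0::real^'n^'n"]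
      unfolding invertible_def by (simp_all add: det_zero)
    then have "(\<lambda>B. A ** B = mat 1 \<and> B ** A = mat 1) = (\<lambda>B. (0::real^'n^'n) ** B = mat 1 \<and> B ** 0 = mat 1)"
      by blast
    then show ?thesis using True unfolding matrix_inv_def by simp
  qed (simp add: matrix_inv_cramer)
  have [measurable]: "(\<lambda>x. \<chi> k l. if l = i then axis j 1 $ k else f x $ k $ l) \<in> borel_measurable M" for i j :: 'n
  proof (intro borel_measurable_vecI)
    fix k l :: 'n
    show "(\<lambda>x. (\<chi> k l. if l = i then axis j 1 $ k else f x $ k $ l) $ k $ l) \<in> borel_measurable M"
      by (cases "l = i") simp_all
  qed
  have [measurable]: "(\<lambda>x. (\<chi> i j. det (\<chi> k l. if l = i then axis j 1 $ k else f x $ k $ l) / det (f x)) :: real^'n^'n) \<in> borel_measurable M"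
    by (intro borel_measurable_vecI) simp
  show ?thesis by (subst eq) measurable
qed

lemma borel_measurable_outer [measurable]:
  assumes [measurable]: "f \<in> borel_measurable M" "g \<in> borel_measurable M"
  shows "(\<lambda>x. outer (f x) (g x)) \<in> borel_measurable M"
  by (intro borel_measurable_vecI) (simp add: outer_def)

lemma borel_measurable_matrix_vector_mult_comp [measurable]:
  fixes f :: "'a \<Rightarrow> real^'n^'m"
  assumes [measurable]: "f \<in> borel_measurable M" "g \<in> borel_measurable M"
  shows "(\<lambda>x. f x *v g x) \<in> borel_measurable M"
  by (intro borel_measurable_vecI) (simp add: matrix_vector_mult_def)

lemma borel_measurable_matrix_matrix_mult [measurable]:
  fixes f :: "'a \<Rightarrow> real^'n^'m" and g :: "'a \<Rightarrow> real^'k^'n"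
  assumes [measurable]: "f \<in> borel_measurable M" "g \<in> borel_measurable M"
  shows "(\<lambda>x. f x ** g x) \<in> borel_measurable M"
  by (intro borel_measurable_vecI) (simp add: matrix_matrix_mult_def)

lemma outer_mult_vec: "outer x y *v v = (y \<bullet> v) *\<^sub>R x"
  by (simp add: vec_eq_iff outer_def matrix_vector_mult_def inner_vec_def sum_distrib_left sum_distrib_right mult_ac)

lemma matrix_mult_outer: "A ** outer x y = outer (A *v x) y"
  by (simp add: vec_eq_iff outer_def matrix_vector_mult_def matrix_matrix_mult_def sum_distrib_left sum_distrib_right mult_ac)

lemma inner_matrix_symmetric:
  fixes A :: "real^'n^'n"
  assumes "transpose A = A"
  shows "x \<bullet> (A *v y) = (A *v x) \<bullet> y"
  using inner_transpose_matrix[of x A y] assms by simp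

lemma psd_cauchy_schwarz:
  fixes A :: "real^'n^'n"
  assumes sym: "transpose A = A" and psd: "\<And>x. 0 \<le> x \<bullet> (A *v x)"
  shows "(u \<bullet> (A *v v))\<^sup>2 \<le> (u \<bullet> (A *v u)) * (v \<bullet> (A *v v))"
proof -
  let ?a = "u \<bullet> (A *v u)" and ?b = "u \<bullet> (A *v v)" and ?c = "v \<bullet> (A *v v)"
  have vu: "v \<bullet> (A *v u) = ?b" using inner_matrix_symmetric[OF sym, of v u] by (simp add: inner_commute)
  have q: "0 \<le> s\<^sup>2 * ?a + 2 * s * t * ?b + t\<^sup>2 * ?c" for s t
    using psd[of "s *\<^sub>R u + t *\<^sub>R v"] vu
    by (simp add: matrix_vector_right_distrib matrix_vector_mult_scaleR inner_add_left inner_add_right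
        power2_eq_square algebra_simps)
  show ?thesis
  proof (cases "?a = 0")
    case True
    have "?b = 0"
    proof (rule ccontr)
      assume b: "?b \<noteq> 0"
      have "0 \<le> 2 * (- (?c + 1) / (2 * ?b)) * 1 * ?b + 1\<^sup>2 * ?c"
        using q[of "- (?c + 1) / (2 * ?b)" 1] True by simp
      then show False using b by (simp add: field_simps)
    qed
    then show ?thesis using True by simp
  next
    case False
    then have a: "?a > 0" using psd[of u] by simp
    have "0 \<le> ?b\<^sup>2 * ?a + 2 * ?b * (- ?a) * ?b + (- ?a)\<^sup>2 * ?c" by (rule q)
    then have "0 \<le> ?a * (?a * ?c - ?b\<^sup>2)" by (simp add: power2_eq_square algebra_simps)
    then show ?thesis using a by (simp add: zero_le_mult_iff)
  qed
qed

section \<open>Self-normalised quadratic forms\<close>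

text \<open>
  The unit ridge makes the Gram matrix invertible before enough regressors have been collected.
\<close>

definition ridge_gram :: "(nat \<Rightarrow> real^'n) \<Rightarrow> nat \<Rightarrow> real^'n^'n" where
  "ridge_gram x t = mat 1 + (\<Sum>s<t. outer (x s) (x s))"

lemma ridge_gram_Suc: "ridge_gram x (Suc t) = ridge_gram x t + outer (x t) (x t)"
  by (simp add: ridge_gram_def)

lemma transpose_outer_self: "transpose (outer x x) = outer x x"
  by (simp add: vec_eq_iff outer_def transpose_def mult.commute)

lemma transpose_sum_matrix: "transpose (\<Sum>i\<in>I. A i) = (\<Sum>i\<in>I. transpose (A i :: real^'n^'m))"
  by (simp add: vec_eq_iff transpose_def)

lemma transpose_add_matrix: "transpose (A + B) = transpose A + transpose (B :: real^'n^'m)"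
  by (simp add: vec_eq_iff transpose_def)

lemma sum_matrix_vector: "(\<Sum>i\<in>I. A i) *v v = (\<Sum>i\<in>I. A i *v (v :: real^'n))"
  by (induction I rule: infinite_finite_induct) (simp_all add: matrix_vector_mult_add_rdistrib)

lemma ridge_gram_sym: "transpose (ridge_gram x t) = ridge_gram x t"
  by (simp add: ridge_gram_def transpose_add_matrix transpose_sum_matrix transpose_outer_self)

lemma ridge_gram_form: "v \<bullet> (ridge_gram x t *v v) = v \<bullet> v + (\<Sum>s<t. (x s \<bullet> v)\<^sup>2)"
  by (simp add: ridge_gram_def matrix_vector_mult_add_rdistrib sum_matrix_vector outer_mult_vec
      inner_add_right inner_sum_right power2_eq_square inner_commute)

lemma ridge_gram_form_ge: "v \<bullet> v \<le> v \<bullet> (ridge_gram x t *v v)"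
  by (simp add: ridge_gram_form sum_nonneg)

lemma invertible_if_form_pos:
  fixes A :: "real^'n^'n"
  assumes "\<And>v. v \<noteq> 0 \<Longrightarrow> 0 < v \<bullet> (A *v v)"
  shows "invertible A"
proof -
  have "\<forall>v. A *v v = 0 \<longrightarrow> v = 0" using assms by (metis inner_zero_right less_irrefl)
  then show ?thesis using matrix_left_invertible_ker[of A] invertible_left_inverse[of A] by blast
qed

lemma ridge_gram_invertible: "invertible (ridge_gram x t)"
  by (rule invertible_if_form_pos) (metis inner_gt_zero_iff less_le_trans ridge_gram_form_ge)

lemma matrix_inv_transpose_sym:
  fixes A :: "real^'n^'n"
  assumes "invertible A" "transpose A = A"
  shows "transpose (matrix_inv A) = matrix_inv A"
proof (rule matrix_inv_unique[symmetric])
  show "A ** transpose (matrix_inv A) = mat 1"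
    using matrix_inv_mult(2)[OF assms(1)] by (metis assms(2) matrix_transpose_mul transpose_mat)
  show "transpose (matrix_inv A) ** A = mat 1"
    using matrix_inv_mult(1)[OF assms(1)] by (metis assms(2) matrix_transpose_mul transpose_mat)
qed

lemma ridge_inv_sym: "transpose (matrix_inv (ridge_gram x t)) = matrix_inv (ridge_gram x t)"
  by (rule matrix_inv_transpose_sym[OF ridge_gram_invertible ridge_gram_sym])

lemma ridge_mult_inv: "ridge_gram x t *v (matrix_inv (ridge_gram x t) *v v) = v"
  by (simp add: matrix_vector_mul_assoc matrix_inv_mult[OF ridge_gram_invertible])

lemma ridge_inv_mult: "matrix_inv (ridge_gram x t) *v (ridge_gram x t *v v) = v"
  by (simp add: matrix_vector_mul_assoc matrix_inv_mult[OF ridge_gram_invertible])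

lemma ridge_inv_nonneg: "0 \<le> v \<bullet> (matrix_inv (ridge_gram x t) *v v)"
proof -
  let ?y = "matrix_inv (ridge_gram x t) *v v"
  have "0 \<le> ?y \<bullet> (ridge_gram x t *v ?y)" by (metis inner_ge_zero order_trans ridge_gram_form_ge)
  then show ?thesis by (simp add: ridge_mult_inv inner_commute)
qed

text \<open>
  The Gram matrix includes the regressor itself; this keeps the leverage below one.
\<close>

definition leverage :: "(nat \<Rightarrow> real^'n) \<Rightarrow> nat \<Rightarrow> real" where
  "leverage x t = x t \<bullet> (matrix_inv (ridge_gram x (Suc t)) *v x t)"

text \<open>
  Measured in the metric of its own Gram matrix, the sum does not grow with the regressors.
\<close>

definition self_norm :: "(nat \<Rightarrow> real^'n) \<Rightarrow> (nat \<Rightarrow> real) \<Rightarrow> nat \<Rightarrow> real" where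
  "self_norm x e t = (\<Sum>s<t. e s *\<^sub>R x s) \<bullet> (matrix_inv (ridge_gram x t) *v (\<Sum>s<t. e s *\<^sub>R x s))"

text \<open>
  Let \<open>b\<close> be the form of the old inverse Gram matrix at the new regressor. The new regressor multiplies
  the determinant by \<open>1 + b\<close> and has leverage \<open>b / (1 + b) \<le> ln (1 + b)\<close>.
\<close>

lemma leverage_det:
  fixes x :: "nat \<Rightarrow> real^'n"
  shows "det (ridge_gram x t) > 0"
    and "0 \<le> leverage x t" "leverage x t \<le> 1"
    and "leverage x t \<le> ln (det (ridge_gram x (Suc t))) - ln (det (ridge_gram x t))"
proof -
  define b where "b t = x t \<bullet> (matrix_inv (ridge_gram x t) *v x t)" for t
  have b: "b t \<ge> 0" for t unfolding b_def by (rule ridge_inv_nonneg)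
  have det: "det (ridge_gram x (Suc t)) = det (ridge_gram x t) * (1 + b t)" for t
  proof -
    have "ridge_gram x (Suc t) = ridge_gram x t ** (mat 1 + outer (matrix_inv (ridge_gram x t) *v x t) (x t))"
      by (simp add: ridge_gram_Suc matrix_add_ldistrib matrix_mult_outer ridge_mult_inv)
    then show ?thesis by (simp add: det_mul det_one_plus_outer b_def inner_commute)
  qed
  have pos: "det (ridge_gram x t) > 0" for t
  proof (induction t)
    case 0
    then show ?case by (simp add: ridge_gram_def)
  next
    case (Suc t)
    then show ?case using b[of t] by (simp add: det)
  qed
  have lev: "leverage x t = b t / (1 + b t)"
  proof -
    let ?y = "matrix_inv (ridge_gram x t) *v x t"
    have "ridge_gram x (Suc t) *v ?y = (1 + b t) *\<^sub>R x t"
      by (simp add: ridge_gram_Suc matrix_vector_mult_add_rdistrib ridge_mult_inv outer_mult_vec b_def scaleR_add_left)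
    then have "?y = (1 + b t) *\<^sub>R (matrix_inv (ridge_gram x (Suc t)) *v x t)"
      by (metis ridge_inv_mult matrix_vector_mult_scaleR)
    then have "b t = (1 + b t) * leverage x t"
      unfolding leverage_def b_def by (metis inner_scaleR_right)
    then show ?thesis using b[of t] by (simp add: field_simps)
  qed
  show "det (ridge_gram x t) > 0" by (rule pos)
  show "0 \<le> leverage x t" "leverage x t \<le> 1" using b[of t] by (simp_all add: lev)
  have "ln (inverse (1 + b t)) \<le> inverse (1 + b t) - 1"
    using b[of t] by (intro ln_le_minus_one) simp
  moreover have "ln (inverse (1 + b t)) = - ln (1 + b t)" by (rule ln_inverse)
  moreover have "inverse (1 + b t) - 1 = - leverage x t" using b[of t] by (simp add: lev field_simps)
  ultimately have "leverage x t \<le> ln (1 + b t)" by linarith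
  then show "leverage x t \<le> ln (det (ridge_gram x (Suc t))) - ln (det (ridge_gram x t))"
    using pos[of t] b[of t] by (simp add: det ln_mult)
qed

text \<open>
  The logarithms of the determinants telescope, and the determinant is polynomial in the regressors.
  So polynomial growth of the regressors makes the sum of the leverages logarithmic in \<open>n\<close>.
\<close>

lemma sum_leverage_le:
  fixes x :: "nat \<Rightarrow> real^'n"
  shows "(\<Sum>t<n. leverage x t) \<le> ln (fact CARD('n)) + CARD('n) * ln (1 + (\<Sum>s<n. (norm (x s))\<^sup>2))"
proof -
  let ?T = "1 + (\<Sum>s<n. (norm (x s))\<^sup>2)"
  have T: "?T \<ge> 1" by (simp add: sum_nonneg)
  have "(\<Sum>t<n. leverage x t) \<le> (\<Sum>t<n. ln (det (ridge_gram x (Suc t))) - ln (det (ridge_gram x t)))"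
    by (intro sum_mono leverage_det)
  also have "\<dots> = ln (det (ridge_gram x n)) - ln (det (ridge_gram x 0))"
    by (rule sum_lessThan_telescope)
  also have "\<dots> = ln (det (ridge_gram x n))" by (simp add: ridge_gram_def)
  also have "\<dots> \<le> ln (fact CARD('n) * ?T ^ CARD('n))"
  proof -
    have "\<bar>ridge_gram x n $ i $ j\<bar> \<le> ?T" for i j
    proof -
      have e: "ridge_gram x n $ i $ j = (if i = j then 1 else 0) + (\<Sum>s<n. x s $ i * x s $ j)"
        by (simp add: ridge_gram_def mat_def outer_def)
      have c: "\<bar>x s $ i * x s $ j\<bar> \<le> (norm (x s))\<^sup>2" for s
        using mult_mono[OF component_le_norm_cart[of "x s" i] component_le_norm_cart[of "x s" j]]
        by (simp add: abs_mult power2_eq_square)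
      have "\<bar>\<Sum>s<n. x s $ i * x s $ j\<bar> \<le> (\<Sum>s<n. (norm (x s))\<^sup>2)"
        by (rule order_trans[OF sum_abs sum_mono]) (rule c)
      then show ?thesis unfolding e by auto
    qed
    then have "\<bar>det (ridge_gram x n)\<bar> \<le> fact CARD('n) * ?T ^ CARD('n)" by (rule abs_det_le)
    then show ?thesis using leverage_det(1)[of x n] by (subst ln_le_cancel_iff) auto
  qed
  also have "\<dots> = ln (fact CARD('n)) + CARD('n) * ln ?T"
    using T by (simp add: ln_mult ln_realpow)
  finally show ?thesis .
qed

text \<open>
  The form of the inverse of \<open>V\<close> at \<open>w\<close> is the maximum of \<open>2 (w \<bullet> p) - p \<bullet> V p\<close> over all \<open>p\<close>, so it
  decreases when a regressor is added to \<open>V\<close>.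
\<close>

lemma ridge_inv_antimono:
  "w \<bullet> (matrix_inv (ridge_gram x (Suc t)) *v w) \<le> w \<bullet> (matrix_inv (ridge_gram x t) *v w)"
proof -
  let ?V = "ridge_gram x t" and ?V' = "ridge_gram x (Suc t)"
  let ?p = "matrix_inv ?V' *v w"
  have 1: "w \<bullet> ?p = ?p \<bullet> (?V' *v ?p)" by (simp add: ridge_mult_inv inner_commute)
  have le: "?p \<bullet> (?V *v ?p) \<le> ?p \<bullet> (?V' *v ?p)"
    by (simp add: ridge_gram_form)
  have psd: "0 \<le> v \<bullet> (?V *v v)" for v by (metis inner_ge_zero order_trans ridge_gram_form_ge)
  let ?q = "matrix_inv ?V *v w"
  have "0 \<le> (?p - ?q) \<bullet> (?V *v (?p - ?q))" by (rule psd)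
  also have "\<dots> = ?p \<bullet> (?V *v ?p) - 2 * (w \<bullet> ?p) + w \<bullet> ?q"
    using inner_matrix_symmetric[OF ridge_gram_sym, of ?q x t ?p]
    by (simp add: matrix_vector_mult_diff_distrib inner_diff_left inner_diff_right ridge_mult_inv inner_commute)
  finally show ?thesis using 1 le by linarith
qed

lemma ridge_inv_cauchy_schwarz:
  "(w \<bullet> (matrix_inv (ridge_gram x t) *v v))\<^sup>2
     \<le> (w \<bullet> (matrix_inv (ridge_gram x t) *v w)) * (v \<bullet> (matrix_inv (ridge_gram x t) *v v))"
  by (rule psd_cauchy_schwarz[OF ridge_inv_sym ridge_inv_nonneg])

lemma self_norm_nonneg: "0 \<le> self_norm x e t"
  unfolding self_norm_def by (rule ridge_inv_nonneg)

text \<open>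
  This is how self-normalised sums control cross products: by the Cauchy-Schwarz inequality for the
  Gram matrix and its inverse, they bound the products relative to the quadratic form of the regressors.
\<close>

lemma self_norm_form: "(\<Sum>s<t. e s * (x s \<bullet> v))\<^sup>2 \<le> self_norm x e t * (v \<bullet> v + (\<Sum>s<t. (x s \<bullet> v)\<^sup>2))"
proof -
  let ?w = "\<Sum>s<t. e s *\<^sub>R x s"
  have "(?w \<bullet> v)\<^sup>2 \<le> self_norm x e t * (v \<bullet> (ridge_gram x t *v v))"
    using ridge_inv_cauchy_schwarz[of ?w x t "ridge_gram x t *v v"]
    by (simp add: ridge_inv_mult self_norm_def inner_commute)
  then show ?thesis by (simp add: inner_sum_left ridge_gram_form)
qed

definition cross_term :: "(nat \<Rightarrow> real^'n) \<Rightarrow> (nat \<Rightarrow> real) \<Rightarrow> nat \<Rightarrow> real" where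
  "cross_term x e t = x t \<bullet> (matrix_inv (ridge_gram x (Suc t)) *v (\<Sum>s<t. e s *\<^sub>R x s))"

text \<open>
  The new term is expanded in the new Gram matrix, in which the old sum has become shorter.
\<close>

lemma self_norm_Suc:
  "self_norm x e (Suc t) \<le> self_norm x e t + 2 * (e t * cross_term x e t) + (e t)\<^sup>2 * leverage x t"
proof -
  let ?w = "\<Sum>s<t. e s *\<^sub>R x s" and ?I = "matrix_inv (ridge_gram x (Suc t))"
  have "self_norm x e (Suc t) = ?w \<bullet> (?I *v ?w) + 2 * (e t * cross_term x e t) + (e t)\<^sup>2 * leverage x t"
    using inner_matrix_symmetric[OF ridge_inv_sym, of ?w x "Suc t" "x t"]
    by (simp add: self_norm_def cross_term_def leverage_def matrix_vector_right_distrib matrix_vector_mult_scaleR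
        inner_add_left inner_add_right power2_eq_square inner_commute algebra_simps)
  then show ?thesis using ridge_inv_antimono[of ?w x t] by (simp add: self_norm_def)
qed

lemma cross_term_sq: "(cross_term x e t)\<^sup>2 \<le> self_norm x e t"
proof -
  let ?w = "\<Sum>s<t. e s *\<^sub>R x s" and ?I = "matrix_inv (ridge_gram x (Suc t))"
  have "(cross_term x e t)\<^sup>2 \<le> leverage x t * (?w \<bullet> (?I *v ?w))"
    unfolding cross_term_def leverage_def by (rule ridge_inv_cauchy_schwarz)
  also have "\<dots> \<le> 1 * (?w \<bullet> (?I *v ?w))"
    by (intro mult_right_mono leverage_det ridge_inv_nonneg)
  also have "\<dots> \<le> self_norm x e t" unfolding self_norm_def by (simp only: mult_1 ridge_inv_antimono)
  finally show ?thesis .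
qed

lemma borel_measurable_ridge_gram [measurable]:
  assumes "\<And>s. s < t \<Longrightarrow> x s \<in> borel_measurable M"
  shows "(\<lambda>\<omega>. ridge_gram (\<lambda>s. x s \<omega>) t) \<in> borel_measurable M"
  unfolding ridge_gram_def
  by (intro borel_measurable_add borel_measurable_sum borel_measurable_outer borel_measurable_const) (use assms in auto)

lemma borel_measurable_leverage:
  assumes "\<And>s. s \<le> t \<Longrightarrow> x s \<in> borel_measurable M"
  shows "(\<lambda>\<omega>. leverage (\<lambda>s. x s \<omega>) t) \<in> borel_measurable M"
  unfolding leverage_def
  by (intro borel_measurable_inner borel_measurable_matrix_vector_mult_comp borel_measurable_matrix_inv
      borel_measurable_ridge_gram) (use assms in auto)

lemma borel_measurable_self_norm:
  assumes "\<And>s. s < t \<Longrightarrow> x s \<in> borel_measurable M" "\<And>s. s < t \<Longrightarrow> e s \<in> borel_measurable M"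
  shows "(\<lambda>\<omega>. self_norm (\<lambda>s. x s \<omega>) (\<lambda>s. e s \<omega>) t) \<in> borel_measurable M"
  unfolding self_norm_def
  by (intro borel_measurable_inner borel_measurable_matrix_vector_mult_comp borel_measurable_matrix_inv
      borel_measurable_ridge_gram borel_measurable_sum borel_measurable_scaleR) (use assms in auto)

lemma borel_measurable_cross_term:
  assumes "\<And>s. s \<le> t \<Longrightarrow> x s \<in> borel_measurable M" "\<And>s. s < t \<Longrightarrow> e s \<in> borel_measurable M"
  shows "(\<lambda>\<omega>. cross_term (\<lambda>s. x s \<omega>) (\<lambda>s. e s \<omega>) t) \<in> borel_measurable M"
  unfolding cross_term_def
  by (intro borel_measurable_inner borel_measurable_matrix_vector_mult_comp borel_measurable_matrix_inv
      borel_measurable_ridge_gram borel_measurable_sum borel_measurable_scaleR) (use assms in auto)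

text \<open>
  The self-normalised martingale bound: the quadratic form grows in mean by the noise variance
  times the leverage of the new regressor, because the cross term is a martingale difference.
\<close>

lemma (in prob_space) self_norm_expectation:
  fixes x :: "nat \<Rightarrow> 'a \<Rightarrow> real^'n" and e :: "nat \<Rightarrow> 'a \<Rightarrow> real"
  assumes G: "\<And>t. subalgebra M (G t)"
    and x: "\<And>s t. s \<le> t \<Longrightarrow> x s \<in> borel_measurable (G t)"
    and e: "\<And>s t. s < t \<Longrightarrow> e s \<in> borel_measurable (G t)"
    and e2: "\<And>t. integrable M (\<lambda>\<omega>. (e t \<omega>)\<^sup>2)"
    and orth: "\<And>Z t. Z \<in> borel_measurable (G t) \<Longrightarrow> integrable M (\<lambda>\<omega>. Z \<omega> * e t \<omega>)
      \<Longrightarrow> (\<integral>\<omega>. Z \<omega> * e t \<omega> \<partial>M) = 0"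
    and var: "\<And>Z t. Z \<in> borel_measurable (G t) \<Longrightarrow> (\<And>\<omega>. 0 \<le> Z \<omega>) \<Longrightarrow> (\<And>\<omega>. Z \<omega> \<le> 1)
      \<Longrightarrow> (\<integral>\<omega>. Z \<omega> * (e t \<omega>)\<^sup>2 \<partial>M) \<le> v * (\<integral>\<omega>. Z \<omega> \<partial>M)"
    and v: "0 \<le> v"
    and x2: "\<And>t. integrable M (\<lambda>\<omega>. (norm (x t \<omega>))\<^sup>2)"
    and B: "(\<Sum>t<n. \<integral>\<omega>. (norm (x t \<omega>))\<^sup>2 \<partial>M) \<le> B"
  shows "integrable M (\<lambda>\<omega>. self_norm (\<lambda>s. x s \<omega>) (\<lambda>s. e s \<omega>) n)"
    and "(\<integral>\<omega>. self_norm (\<lambda>s. x s \<omega>) (\<lambda>s. e s \<omega>) n \<partial>M) \<le> v * (ln (fact CARD('n)) + CARD('n) * ln (1 + B))"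
proof -
  let ?q = "\<lambda>t \<omega>. self_norm (\<lambda>s. x s \<omega>) (\<lambda>s. e s \<omega>) t"
  let ?a = "\<lambda>t \<omega>. leverage (\<lambda>s. x s \<omega>) t"
  let ?z = "\<lambda>t \<omega>. cross_term (\<lambda>s. x s \<omega>) (\<lambda>s. e s \<omega>) t"
  have xM: "x t \<in> borel_measurable M" for t by (rule measurable_from_subalg[OF G x[of t t]]) simp
  have eM: "e t \<in> borel_measurable M" for t by (rule measurable_from_subalg[OF G e[of t "Suc t"]]) simp
  have qM: "?q t \<in> borel_measurable M" for t by (intro borel_measurable_self_norm xM eM)
  have aG: "?a t \<in> borel_measurable (G t)" for t by (intro borel_measurable_leverage x)
  have aM: "?a t \<in> borel_measurable M" for t by (intro borel_measurable_leverage xM)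
  have zG: "?z t \<in> borel_measurable (G t)" for t by (intro borel_measurable_cross_term x e)
  have zM: "?z t \<in> borel_measurable M" for t by (intro borel_measurable_cross_term xM eM)
  have a_int: "integrable M (?a t)" for t
    by (rule integrable_const_bound[where B=1]) (auto intro!: AE_I2 simp: abs_of_nonneg leverage_det(2,3) aM)
  have main: "integrable M (?q t) \<and> (\<integral>\<omega>. ?q t \<omega> \<partial>M) \<le> v * (\<Sum>s<t. \<integral>\<omega>. ?a s \<omega> \<partial>M)" for t
  proof (induction t)
    case 0
    have "?q 0 = (\<lambda>\<omega>. 0)" by (simp add: self_norm_def)
    then show ?case by simp
  next
    case (Suc t)
    then have qi: "integrable M (?q t)" by simp
    have z2: "integrable M (\<lambda>\<omega>. (?z t \<omega>)\<^sup>2)"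
    proof (rule Bochner_Integration.integrable_bound[OF qi])
      show "(\<lambda>\<omega>. (?z t \<omega>)\<^sup>2) \<in> borel_measurable M" using zM by (rule borel_measurable_power)
      show "AE \<omega> in M. norm ((?z t \<omega>)\<^sup>2) \<le> norm (?q t \<omega>)"
        by (intro AE_I2) (simp add: abs_of_nonneg self_norm_nonneg cross_term_sq)
    qed
    have ze: "integrable M (\<lambda>\<omega>. ?z t \<omega> * e t \<omega>)"
    proof (rule Bochner_Integration.integrable_bound[OF Bochner_Integration.integrable_add[OF z2 e2[of t]]])
      show "(\<lambda>\<omega>. ?z t \<omega> * e t \<omega>) \<in> borel_measurable M" by (intro borel_measurable_times zM eM)
      show "AE \<omega> in M. norm (?z t \<omega> * e t \<omega>) \<le> norm ((?z t \<omega>)\<^sup>2 + (e t \<omega>)\<^sup>2)"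
      proof (rule AE_I2)
        fix \<omega>
        have "2 * (\<bar>?z t \<omega>\<bar> * \<bar>e t \<omega>\<bar>) \<le> (?z t \<omega>)\<^sup>2 + (e t \<omega>)\<^sup>2"
          using sum_squares_bound[of "\<bar>?z t \<omega>\<bar>" "\<bar>e t \<omega>\<bar>"] by simp
        moreover have "0 \<le> \<bar>?z t \<omega>\<bar> * \<bar>e t \<omega>\<bar>" by simp
        ultimately show "norm (?z t \<omega> * e t \<omega>) \<le> norm ((?z t \<omega>)\<^sup>2 + (e t \<omega>)\<^sup>2)"
          unfolding real_norm_def abs_mult by linarith
      qed
    qed
    have ea: "integrable M (\<lambda>\<omega>. ?a t \<omega> * (e t \<omega>)\<^sup>2)"
    proof (rule Bochner_Integration.integrable_bound[OF e2[of t]])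
      show "(\<lambda>\<omega>. ?a t \<omega> * (e t \<omega>)\<^sup>2) \<in> borel_measurable M"
        by (intro borel_measurable_times borel_measurable_power aM eM)
      show "AE \<omega> in M. norm (?a t \<omega> * (e t \<omega>)\<^sup>2) \<le> norm ((e t \<omega>)\<^sup>2)"
        by (intro AE_I2) (simp add: abs_mult abs_of_nonneg leverage_det(2,3) mult_left_le_one_le)
    qed
    let ?b = "\<lambda>\<omega>. ?q t \<omega> + 2 * (?z t \<omega> * e t \<omega>) + ?a t \<omega> * (e t \<omega>)\<^sup>2"
    have bi: "integrable M ?b" using qi ze ea by (intro Bochner_Integration.integrable_add integrable_mult_right)
    have le: "?q (Suc t) \<omega> \<le> ?b \<omega>" for \<omega>
      using self_norm_Suc[of "\<lambda>s. x s \<omega>" "\<lambda>s. e s \<omega>" t] by (simp add: mult_ac)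
    have i1: "integrable M (?q (Suc t))"
    proof (rule Bochner_Integration.integrable_bound[OF bi qM], rule AE_I2)
      show "norm (?q (Suc t) \<omega>) \<le> norm (?b \<omega>)" for \<omega>
        using le[of \<omega>] self_norm_nonneg[of "\<lambda>s. x s \<omega>" "\<lambda>s. e s \<omega>" "Suc t"] by auto
    qed
    have "(\<integral>\<omega>. ?q (Suc t) \<omega> \<partial>M) \<le> (\<integral>\<omega>. ?b \<omega> \<partial>M)"
      by (rule integral_mono[OF i1 bi le])
    also have "\<dots> = (\<integral>\<omega>. ?q t \<omega> \<partial>M) + 2 * (\<integral>\<omega>. ?z t \<omega> * e t \<omega> \<partial>M) + (\<integral>\<omega>. ?a t \<omega> * (e t \<omega>)\<^sup>2 \<partial>M)"
      using qi ze ea by simp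
    also have "(\<integral>\<omega>. ?z t \<omega> * e t \<omega> \<partial>M) = 0" by (rule orth[OF zG ze])
    also have "(\<integral>\<omega>. ?a t \<omega> * (e t \<omega>)\<^sup>2 \<partial>M) \<le> v * (\<integral>\<omega>. ?a t \<omega> \<partial>M)"
      by (rule var[OF aG]) (rule leverage_det)+
    finally show ?case using Suc i1 by (simp add: distrib_left)
  qed
  then show "integrable M (?q n)" by simp
  let ?T = "\<lambda>\<omega>. \<Sum>s<n. (norm (x s \<omega>))\<^sup>2"
  have Ti: "integrable M ?T" using x2 by (intro Bochner_Integration.integrable_sum)
  have B0: "0 \<le> B" using B by (smt (verit) sum_nonneg integral_nonneg_AE AE_I2 zero_le_power2)
  have T0: "0 \<le> ?T \<omega>" for \<omega> by (simp add: sum_nonneg)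
  have "(\<integral>\<omega>. ?q n \<omega> \<partial>M) \<le> v * (\<Sum>s<n. \<integral>\<omega>. ?a s \<omega> \<partial>M)" using main by simp
  also have "(\<Sum>s<n. \<integral>\<omega>. ?a s \<omega> \<partial>M) = (\<integral>\<omega>. (\<Sum>s<n. ?a s \<omega>) \<partial>M)"
    by (rule Bochner_Integration.integral_sum[symmetric]) (rule a_int)
  \<comment> \<open>Jensen's inequality for the logarithm, by its tangent at \<open>1 + B\<close>.\<close>
  also have "v * \<dots> \<le> v * (\<integral>\<omega>. ln (fact CARD('n)) + CARD('n) * (ln (1 + B) + ((1 + ?T \<omega>) / (1 + B) - 1)) \<partial>M)"
  proof (intro mult_left_mono integral_mono v)
    show "integrable M (\<lambda>\<omega>. \<Sum>s<n. ?a s \<omega>)" by (intro Bochner_Integration.integrable_sum a_int)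
    show "integrable M (\<lambda>\<omega>. ln (fact CARD('n)) + CARD('n) * (ln (1 + B) + ((1 + ?T \<omega>) / (1 + B) - 1)))"
      using Ti by auto
    fix \<omega>
    have "ln (1 + ?T \<omega>) \<le> ln (1 + B) + ((1 + ?T \<omega>) / (1 + B) - 1)"
    proof -
      have "ln ((1 + ?T \<omega>) / (1 + B)) \<le> (1 + ?T \<omega>) / (1 + B) - 1"
        using B0 T0[of \<omega>] by (intro ln_le_minus_one divide_pos_pos) linarith+
      moreover have "ln ((1 + ?T \<omega>) / (1 + B)) = ln (1 + ?T \<omega>) - ln (1 + B)"
        using B0 T0[of \<omega>] by (subst ln_div) auto
      ultimately show ?thesis by linarith
    qed
    then show "(\<Sum>s<n. ?a s \<omega>) \<le> ln (fact CARD('n)) + CARD('n) * (ln (1 + B) + ((1 + ?T \<omega>) / (1 + B) - 1))"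
      using sum_leverage_le[of "\<lambda>s. x s \<omega>" n] by (smt (verit) mult_left_mono of_nat_0_le_iff)
  qed
  also have "(\<integral>\<omega>. ln (fact CARD('n)) + CARD('n) * (ln (1 + B) + ((1 + ?T \<omega>) / (1 + B) - 1)) \<partial>M)
     = ln (fact CARD('n)) + CARD('n) * (ln (1 + B) + ((1 + (\<integral>\<omega>. ?T \<omega> \<partial>M)) / (1 + B) - 1))"
    using Ti prob_space by simp
  also have "v * \<dots> \<le> v * (ln (fact CARD('n)) + CARD('n) * ln (1 + B))"
  proof -
    have "(\<integral>\<omega>. ?T \<omega> \<partial>M) = (\<Sum>t<n. \<integral>\<omega>. (norm (x t \<omega>))\<^sup>2 \<partial>M)"
      by (rule Bochner_Integration.integral_sum) (rule x2)
    then have "(1 + (\<integral>\<omega>. ?T \<omega> \<partial>M)) / (1 + B) - 1 \<le> 0" using B B0 by simp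
    then show ?thesis using v by (intro mult_left_mono add_left_mono) auto
  qed
  finally show "(\<integral>\<omega>. ?q n \<omega> \<partial>M) \<le> v * (ln (fact CARD('n)) + CARD('n) * ln (1 + B))" .
qed

section \<open>Singular values\<close>

lemma linear_coefficient_zero:
  fixes b c :: real
  assumes "\<And>t. 0 \<le> 2 * t * b + t\<^sup>2 * c"
  shows "b = 0"
proof (rule ccontr)
  assume b: "b \<noteq> 0"
  define s where "s = 1 / (1 + \<bar>c\<bar>)"
  have s: "s > 0" "s * \<bar>c\<bar> < 1" by (auto simp: s_def)
  have "0 \<le> 2 * (- s * b) * b + (- s * b)\<^sup>2 * c" by (rule assms)
  also have "\<dots> = s * b\<^sup>2 * (s * c - 2)" by (simp add: power2_eq_square algebra_simps)
  finally have "0 \<le> s * b\<^sup>2 * (s * c - 2)" .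
  moreover have "0 < s * b\<^sup>2" using s b by simp
  ultimately have "0 \<le> s * c - 2" by (meson mult_pos_neg not_le)
  moreover have "s * c \<le> s * \<bar>c\<bar>" using s by (intro mult_left_mono) auto
  ultimately show False using s by linarith
qed

text \<open>
  A minimiser of the quadratic form on the unit sphere is an eigenvector, because the first variation
  of the form minus its minimum times the squared norm vanishes there.
\<close>

lemma self_adjoint_min_eigenvector:
  fixes S :: "'a::euclidean_space \<Rightarrow> 'a"
  assumes lin: "linear S" and sa: "\<And>x y. x \<bullet> S y = S x \<bullet> y"
  shows "\<exists>v. norm v = 1 \<and> S v = (v \<bullet> S v) *\<^sub>R v \<and> (\<forall>y. (v \<bullet> S v) * (y \<bullet> y) \<le> y \<bullet> S y)"
proof -
  obtain b :: 'a where b: "b \<in> Basis" using nonempty_Basis by blast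
  have cont: "continuous_on (sphere 0 1) (\<lambda>x. x \<bullet> S x)"
    by (intro continuous_on_inner continuous_on_id linear_continuous_on linear_conv_bounded_linear[THEN iffD1] lin)
  have "\<exists>v\<in>sphere 0 1. \<forall>y\<in>sphere 0 1. v \<bullet> S v \<le> y \<bullet> S y"
    by (rule continuous_attains_inf[OF compact_sphere _ cont]) (use b in \<open>auto intro!: exI[of _ b]\<close>)
  then obtain v where v: "norm v = 1" and min: "\<And>y. norm y = 1 \<Longrightarrow> v \<bullet> S v \<le> y \<bullet> S y" by auto
  let ?m = "v \<bullet> S v"
  have le: "?m * (y \<bullet> y) \<le> y \<bullet> S y" for y
  proof (cases "y = 0")
    case False
    have "?m \<le> (y /\<^sub>R norm y) \<bullet> S (y /\<^sub>R norm y)" using False by (intro min) simp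
    also have "\<dots> = (y \<bullet> S y) / (y \<bullet> y)"
      using False by (simp add: linear_scale[OF lin] power2_norm_eq_inner[symmetric] power2_eq_square divide_inverse mult_ac)
    finally show ?thesis using False by (simp add: field_simps)
  qed (simp add: linear_0[OF lin])
  have zero: "y \<bullet> (S v - ?m *\<^sub>R v) = 0" for y
  proof (rule linear_coefficient_zero)
    fix t
    have vv: "v \<bullet> v = 1" using v by (simp add: norm_eq_1)
    have "0 \<le> (v + t *\<^sub>R y) \<bullet> S (v + t *\<^sub>R y) - ?m * ((v + t *\<^sub>R y) \<bullet> (v + t *\<^sub>R y))" using le by simp
    also have "\<dots> = 2 * t * (y \<bullet> (S v - ?m *\<^sub>R v)) + t\<^sup>2 * (y \<bullet> S y - ?m * (y \<bullet> y))"
      using sa[of v y] vv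
      by (simp add: linear_add[OF lin] linear_scale[OF lin] inner_add_left inner_add_right inner_diff_right
          power2_eq_square inner_commute algebra_simps)
    finally show "0 \<le> 2 * t * (y \<bullet> (S v - ?m *\<^sub>R v)) + t\<^sup>2 * (y \<bullet> S y - ?m * (y \<bullet> y))" .
  qed
  have "S v - ?m *\<^sub>R v = 0" using zero[of "S v - ?m *\<^sub>R v"] by simp
  then have "S v = ?m *\<^sub>R v" by simp
  then show ?thesis using v le by blast
qed

lemma conj_transpose_adjoint:
  fixes F :: "complex^'n^'m"
  shows "x \<bullet> (conj_transpose F *v y) = (F *v x) \<bullet> y"
proof -
  have "x \<bullet> (conj_transpose F *v y) = (\<Sum>i\<in>UNIV. \<Sum>j\<in>UNIV. x $ i \<bullet> (cnj (F $ j $ i) * y $ j))"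
    by (simp add: inner_vec_def conj_transpose_def matrix_vector_mult_def inner_sum_right)
  also have "\<dots> = (\<Sum>j\<in>UNIV. \<Sum>i\<in>UNIV. x $ i \<bullet> (cnj (F $ j $ i) * y $ j))" by (rule sum.swap)
  also have "\<dots> = (\<Sum>j\<in>UNIV. \<Sum>i\<in>UNIV. (F $ j $ i * x $ i) \<bullet> y $ j)"
    by (intro sum.cong refl) (simp add: inner_complex_def algebra_simps)
  also have "\<dots> = (F *v x) \<bullet> y" by (simp add: inner_vec_def matrix_vector_mult_def inner_sum_left)
  finally show ?thesis .
qed

lemma linear_complex_matrix_vector: "linear (\<lambda>x. (F :: complex^'n^'m) *v x)"
  by (rule linearI) (simp_all add: vec_eq_iff matrix_vector_mult_def sum.distrib distrib_left
      scaleR_sum_right)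

lemma of_real_smult_vec: "complex_of_real c *s v = c *\<^sub>R v"
  by (simp add: vec_eq_iff scaleR_conv_of_real[symmetric])

lemma
  fixes F :: "complex^'n^'n"
  shows gram_form: "x \<bullet> ((conj_transpose F ** F) *v y) = (F *v x) \<bullet> (F *v y)"
    and gram_self_adjoint: "x \<bullet> ((conj_transpose F ** F) *v y) = ((conj_transpose F ** F) *v x) \<bullet> y"
proof -
  show g: "x \<bullet> ((conj_transpose F ** F) *v y) = (F *v x) \<bullet> (F *v y)" for x y
    by (simp add: matrix_vector_mul_assoc[symmetric] conj_transpose_adjoint)
  show "x \<bullet> ((conj_transpose F ** F) *v y) = ((conj_transpose F ** F) *v x) \<bullet> y"
    using g[of x y] g[of y x] by (simp add: inner_commute)
qed

text \<open>
  Eigenvectors of a self-adjoint map for different eigenvalues are orthogonal, hence linearly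
  independent. Finiteness gives \<open>Max\<close> and \<open>Min\<close> of the singular values their meaning.
\<close>

lemma finite_singular_values: "finite (singular_values (F :: complex^'n^'n))"
proof -
  let ?H = "conj_transpose F ** F"
  have "\<forall>s\<in>singular_values F. \<exists>v. v \<noteq> 0 \<and> ?H *v v = s\<^sup>2 *\<^sub>R v"
    by (auto simp: singular_values_def eigenvalues_def of_real_smult_vec simp del: of_real_power)
  then obtain v where v: "\<And>s. s \<in> singular_values F \<Longrightarrow> v s \<noteq> 0 \<and> ?H *v v s = s\<^sup>2 *\<^sub>R v s"
    by metis
  have orth: "v s \<bullet> v t = 0" if "s \<in> singular_values F" "t \<in> singular_values F" "s \<noteq> t" for s t
  proof -
    have "t\<^sup>2 * (v s \<bullet> v t) = s\<^sup>2 * (v s \<bullet> v t)"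
      using gram_self_adjoint[of "v s" F "v t"] v[OF that(1)] v[OF that(2)] by simp
    moreover have "t\<^sup>2 \<noteq> s\<^sup>2" using that by (auto simp: singular_values_def)
    ultimately show ?thesis by simp
  qed
  have inj: "inj_on v (singular_values F)"
    using orth v by (intro inj_onI) (metis inner_eq_zero_iff)
  have "pairwise orthogonal (v ` singular_values F)"
    using orth by (auto simp: pairwise_def orthogonal_def)
  moreover have "0 \<notin> v ` singular_values F" using v by auto
  ultimately have "independent (v ` singular_values F)" by (rule pairwise_orthogonal_independent)
  then have "finite (v ` singular_values F)" by (rule independent_imp_finite)
  then show ?thesis using inj by (rule finite_imageD)
qed

text \<open>
  The complex vectors form a real Euclidean space in which \<open>F\<^sup>* F\<close> is self-adjoint. The extreme values
  of its form on the unit sphere are eigenvalues, that is, squares of singular values.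
\<close>

lemma singular_value_bounds:
  fixes F :: "complex^'n^'n"
  shows "norm (F *v x) \<le> sigma_max F * norm x" "sigma_min F * norm x \<le> norm (F *v x)"
    and "0 \<le> sigma_max F" "0 \<le> sigma_min F"
proof -
  let ?H = "conj_transpose F ** F"
  have linH: "linear (\<lambda>x. ?H *v x)" by (rule linear_complex_matrix_vector)
  have sing: "sqrt \<mu> \<in> singular_values F" if "?H *v v = \<mu> *\<^sub>R v" "norm v = 1" "0 \<le> \<mu>" for \<mu> v
    using that by (auto simp: singular_values_def eigenvalues_def of_real_smult_vec simp del: of_real_power intro!: exI[of _ v])
  have q: "y \<bullet> (?H *v y) = (norm (F *v y))\<^sup>2" for y by (simp add: gram_form power2_norm_eq_inner)
  obtain v :: "complex^'n" where v: "norm v = 1" "?H *v v = (v \<bullet> (?H *v v)) *\<^sub>R v"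
      and vle: "\<And>y. (v \<bullet> (?H *v v)) * (y \<bullet> y) \<le> y \<bullet> (?H *v y)"
    using self_adjoint_min_eigenvector[OF linH gram_self_adjoint] by auto
  define \<mu> where "\<mu> = v \<bullet> (?H *v v)"
  have \<mu>: "0 \<le> \<mu>" by (simp add: \<mu>_def q)
  have s1: "sqrt \<mu> \<in> singular_values F" using v \<mu> by (intro sing[of v]) (auto simp: \<mu>_def)
  \<comment> \<open>The largest eigenvalue is found as the smallest one of the negative.\<close>
  have lin': "linear (\<lambda>x. - (?H *v x))" using linH by (rule linear_compose_neg)
  have sa': "x \<bullet> - (?H *v y) = - (?H *v x) \<bullet> y" for x y using gram_self_adjoint[of x F y] by simp
  obtain u :: "complex^'n" where u: "norm u = 1" "- (?H *v u) = (u \<bullet> - (?H *v u)) *\<^sub>R u"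
      and ule: "\<And>y. (u \<bullet> - (?H *v u)) * (y \<bullet> y) \<le> y \<bullet> - (?H *v y)"
    using self_adjoint_min_eigenvector[OF lin' sa'] by auto
  define \<nu> where "\<nu> = u \<bullet> (?H *v u)"
  have \<nu>: "0 \<le> \<nu>" by (simp add: \<nu>_def q)
  have "?H *v u = \<nu> *\<^sub>R u" using u(2) by (simp add: \<nu>_def)
  then have s2: "sqrt \<nu> \<in> singular_values F" using u \<nu> by (intro sing[of u])
  have max: "sqrt \<nu> \<le> sigma_max F" unfolding sigma_max_def by (rule Max_ge[OF finite_singular_values s2])
  have min: "sigma_min F \<le> sqrt \<mu>" unfolding sigma_min_def by (rule Min_le[OF finite_singular_values s1])
  show "0 \<le> sigma_max F" using max real_sqrt_ge_zero[OF \<nu>] by linarith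
  have "sigma_min F \<in> singular_values F"
    unfolding sigma_min_def using s1 by (intro Min_in finite_singular_values) auto
  then show "0 \<le> sigma_min F" by (simp add: singular_values_def)
  have "(norm (F *v x))\<^sup>2 \<le> \<nu> * (x \<bullet> x)" using ule[of x] by (simp add: \<nu>_def q)
  then have "norm (F *v x) \<le> sqrt \<nu> * norm x"
    using real_sqrt_le_mono[of "(norm (F *v x))\<^sup>2" "\<nu> * (x \<bullet> x)"] by (simp add: real_sqrt_mult norm_eq_sqrt_inner)
  then show "norm (F *v x) \<le> sigma_max F * norm x" using max by (meson mult_right_mono norm_ge_zero order_trans)
  have "\<mu> * (x \<bullet> x) \<le> (norm (F *v x))\<^sup>2" using vle[of x] by (simp add: \<mu>_def q)
  then have "sqrt \<mu> * norm x \<le> norm (F *v x)"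
    using real_sqrt_le_mono[of "\<mu> * (x \<bullet> x)" "(norm (F *v x))\<^sup>2"] by (simp add: real_sqrt_mult norm_eq_sqrt_inner)
  then show "sigma_min F * norm x \<le> norm (F *v x)" using min by (meson mult_right_mono norm_ge_zero order_trans)
qed

definition complex_vector :: "real^'n \<Rightarrow> complex^'n" where
  "complex_vector x = (\<chi> i. complex_of_real (x $ i))"

lemma norm_complex_vector: "norm (complex_vector x) = norm x"
  by (simp add: complex_vector_def norm_vec_def L2_set_def)

lemma complex_vector_mult: "complex_matrix A *v complex_vector x = complex_vector (A *v x)"
  by (simp add: vec_eq_iff complex_vector_def complex_matrix_def matrix_vector_mult_def)

lemma complex_vector_add: "complex_vector (x + y) = complex_vector x + complex_vector y"
  by (simp add: vec_eq_iff complex_vector_def)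

text \<open>
  At a unit eigenvector of the smallest eigenvalue the matrix stretches by exactly that eigenvalue,
  which is therefore at least the smallest singular value.
\<close>

lemma psd_form_ge_sigma_min:
  fixes A :: "real^'n^'n"
  assumes "A \<in> psd_matrices"
  shows "sigma_min (complex_matrix A) * (x \<bullet> x) \<le> x \<bullet> (A *v x)"
proof -
  have sym: "transpose A = A" and psd: "\<And>x. 0 \<le> x \<bullet> (A *v x)" using assms by (auto simp: psd_matrices_def)
  obtain v :: "real^'n" where v: "norm v = 1" "A *v v = (v \<bullet> (A *v v)) *\<^sub>R v"
      and le: "\<And>y. (v \<bullet> (A *v v)) * (y \<bullet> y) \<le> y \<bullet> (A *v y)"
    using self_adjoint_min_eigenvector[of "\<lambda>x. A *v x", OF matrix_vector_mul_linear inner_matrix_symmetric[OF sym]]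
    by auto
  have "sigma_min (complex_matrix A) * norm (complex_vector v) \<le> norm (complex_matrix A *v complex_vector v)"
    by (rule singular_value_bounds)
  then have "sigma_min (complex_matrix A) \<le> norm (A *v v)"
    by (simp add: norm_complex_vector complex_vector_mult v(1))
  also have "\<dots> = v \<bullet> (A *v v)"
    using v psd[of v] by (metis abs_of_nonneg mult.right_neutral norm_scaleR)
  finally have "sigma_min (complex_matrix A) * (x \<bullet> x) \<le> (v \<bullet> (A *v v)) * (x \<bullet> x)"
    by (intro mult_right_mono) auto
  then show ?thesis using le[of x] by linarith
qed

section \<open>Jordan-like recursions\<close>

definition index_rank :: "'d::{finite,linorder} \<Rightarrow> nat" where
  "index_rank i = card {k. k < i}"

lemma rank_strict_mono: "i < j \<Longrightarrow> index_rank i < index_rank j"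
  unfolding index_rank_def by (intro psubset_card_mono) auto

lemma rank_next:
  assumes "next_index i j"
  shows "index_rank j = Suc (index_rank i)"
proof -
  have "{k. k < j} = insert i {k. k < i}"
    using assms by (auto simp: next_index_def) (metis linorder_neqE)
  then show ?thesis by (simp add: index_rank_def)
qed

lemma rank_less: "index_rank (i :: 'd::{finite,linorder}) < CARD('d)"
  unfolding index_rank_def by (intro psubset_card_mono) auto

text \<open>
  A permutation preserves the sum of the positions, so it cannot raise any of them without lowering
  another.
\<close>

lemma permutation_increasing_id:
  fixes p :: "'d::{finite,linorder} \<Rightarrow> 'd"
  assumes p: "p permutes UNIV" and le: "\<And>i. i \<le> p i"
  shows "p i = i"
proof -
  have "(\<Sum>i\<in>(UNIV::'d set). index_rank i) = (\<Sum>i\<in>(UNIV::'d set). index_rank (p i))"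
    using sum.permute[OF p, of index_rank] by (simp add: comp_def)
  moreover have "index_rank j \<le> index_rank (p j)" for j
    using le[of j] rank_strict_mono[of j "p j"] by (cases "j = p j") (auto simp: less_le)
  ultimately have "index_rank i = index_rank (p i)" by (intro sum_mono_inv[of index_rank UNIV]) auto
  then show ?thesis using le[of i] rank_strict_mono[of i "p i"] by (cases "i = p i") (auto simp: less_le)
qed

text \<open>
  In the Leibniz expansion of the determinant of \<open>A - A\<^sub>k\<^sub>k\<close> a permutation either picks an entry below the
  diagonal, or is the identity and picks the zero at \<open>(k, k)\<close>.
\<close>

lemma upper_triangular_eigenvalue:
  fixes A :: "complex^('d::{finite,linorder})^('d::{finite,linorder})"
  assumes ut: "\<And>i j. j < i \<Longrightarrow> A $ i $ j = 0"
  shows "A $ k $ k \<in> eigenvalues A"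
proof -
  let ?B = "A - mat (A $ k $ k)"
  have "det ?B = 0"
    unfolding det_def
  proof (intro sum.neutral ballI)
    fix p :: "'d \<Rightarrow> 'd" assume "p \<in> {p. p permutes UNIV}"
    then have p: "p permutes UNIV" by simp
    have "\<exists>i. ?B $ i $ p i = 0"
    proof (cases "\<forall>i. i \<le> p i")
      case True
      then have "p k = k" by (intro permutation_increasing_id[OF p]) auto
      then show ?thesis by (intro exI[of _ k]) (simp add: mat_def)
    next
      case False
      then obtain i where "p i < i" by (auto simp: not_le)
      then show ?thesis using ut by (intro exI[of _ i]) (auto simp: mat_def)
    qed
    then have "(\<Prod>i\<in>UNIV. ?B $ i $ p i) = 0" by (intro prod_zero) auto
    then show "of_int (sign p) * (\<Prod>i\<in>UNIV. ?B $ i $ p i) = 0" by simp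
  qed
  then have "\<not> invertible ?B" by (simp add: invertible_det_nz)
  then obtain v where v: "?B *v v = 0" "v \<noteq> 0"
    using matrix_left_invertible_ker[of ?B] invertible_left_inverse[of ?B] by blast
  have "mat c *v v = c *s v" for c
    by (simp add: vec_eq_iff matrix_vector_mult_def mat_def if_distrib[of "\<lambda>x. x * _"] cong: if_cong)
  then have "A *v v = A $ k $ k *s v" using v(1) by (simp add: matrix_vector_mult_diff_rdistrib)
  then show ?thesis using v(2) by (auto simp: eigenvalues_def)
qed

lemma jordan_like_cases:
  assumes "J \<in> jordan_like \<delta>"
  shows "j < i \<Longrightarrow> J $ i $ j = 0"
    and "i \<noteq> j \<Longrightarrow> \<not> next_index i j \<Longrightarrow> J $ i $ j = 0"
    and "next_index i j \<Longrightarrow> cmod (J $ i $ i) \<le> \<delta> \<Longrightarrow> cmod (J $ i $ j) \<le> 1"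
    and "next_index i j \<Longrightarrow> \<not> cmod (J $ i $ i) \<le> \<delta> \<Longrightarrow> J $ i $ j = 0"
proof -
  obtain D N where J: "J = D + N" and D: "diagonal D"
    and N0: "\<And>i j. \<not> next_index i j \<Longrightarrow> N $ i $ j = 0"
    and N1: "\<And>i j. next_index i j \<Longrightarrow> (if cmod (D $ i $ i) \<le> \<delta> then N $ i $ j \<in> {0, 1} else N $ i $ j = 0)"
    using assms by (auto simp: jordan_like_def)
  have ii: "J $ i $ i = D $ i $ i" for i using N0[of i i] by (simp add: J next_index_def)
  have ij: "J $ i $ j = N $ i $ j" if "i \<noteq> j" for i j using D that by (simp add: J diagonal_def)
  show "j < i \<Longrightarrow> J $ i $ j = 0" 
    using ij[of i j] N0[of i j] less_asym[of i j] by (auto simp: next_index_def)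
  show "i \<noteq> j \<Longrightarrow> \<not> next_index i j \<Longrightarrow> J $ i $ j = 0" using ij N0 by simp
  show "next_index i j \<Longrightarrow> cmod (J $ i $ i) \<le> \<delta> \<Longrightarrow> cmod (J $ i $ j) \<le> 1"
    using ij[of i j] N1[of i j] by (auto simp: ii next_index_def)
  show "next_index i j \<Longrightarrow> \<not> cmod (J $ i $ i) \<le> \<delta> \<Longrightarrow> J $ i $ j = 0"
    using ij[of i j] N1[of i j] by (auto simp: ii next_index_def)
qed

lemma next_index_unique: "next_index i j \<Longrightarrow> next_index i k \<Longrightarrow> j = k"
  by (auto simp: next_index_def) (metis linorder_neqE)

text \<open>
  In the maximum norm that weights a coordinate by the power \<open>(1 / \<alpha>) ^ index_rank\<close>, a Jordan-like
  matrix is non-expansive: off-diagonal ones occur only where \<open>\<bar>D\<^sub>i\<^sub>i\<bar> \<le> 1 - \<alpha>\<close>, and the weights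
  scale them down to \<open>\<alpha>\<close>.
\<close>

lemma jordan_like_nonexpansive:
  fixes J :: "complex^('d::{finite,linorder})^('d::{finite,linorder})"
  assumes J: "J \<in> jordan_like (1 - \<alpha>)" and \<alpha>: "0 < \<alpha>" "\<alpha> < 1"
    and D: "\<And>i. cmod (J $ i $ i) \<le> 1"
    and y: "\<And>i. (1 / \<alpha>) ^ index_rank i * cmod (y $ i) \<le> b"
  shows "(1 / \<alpha>) ^ index_rank i * cmod ((J *v y) $ i) \<le> b"
proof -
  let ?w = "\<lambda>i. (1 / \<alpha>) ^ index_rank (i::'d)"
  have w: "?w i > 0" for i using \<alpha> by simp
  have b: "0 \<le> b" using y[of i] w[of i] by (smt (verit) norm_ge_zero mult_nonneg_nonneg)
  show ?thesis
  proof (cases "\<exists>j. next_index i j \<and> cmod (J $ i $ i) \<le> 1 - \<alpha>")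
    case True
    then obtain j where j: "next_index i j" and Di: "cmod (J $ i $ i) \<le> 1 - \<alpha>" by auto
    have ne: "i \<noteq> j" using j by (auto simp: next_index_def)
    have off: "J $ i $ k = 0" if "k \<noteq> i" "k \<noteq> j" for k
      using jordan_like_cases(2)[OF J, of i k] next_index_unique[OF j, of k] that by blast
    have "(J *v y) $ i = (\<Sum>k\<in>UNIV. J $ i $ k * y $ k)" by (simp add: matrix_vector_mult_def)
    also have "\<dots> = (\<Sum>k\<in>{i, j}. J $ i $ k * y $ k)"
      by (intro sum.mono_neutral_right) (auto simp: off)
    also have "\<dots> = J $ i $ i * y $ i + J $ i $ j * y $ j" using ne by simp
    also have "cmod \<dots> \<le> cmod (J $ i $ i) * cmod (y $ i) + cmod (J $ i $ j) * cmod (y $ j)"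
      by (metis norm_triangle_ineq norm_mult)
    also have "\<dots> \<le> (1 - \<alpha>) * cmod (y $ i) + 1 * cmod (y $ j)"
      using Di jordan_like_cases(3)[OF J j Di] by (intro add_mono mult_right_mono) auto
    finally have "?w i * cmod ((J *v y) $ i) \<le> ?w i * ((1 - \<alpha>) * cmod (y $ i) + 1 * cmod (y $ j))"
      using w[of i] by (intro mult_left_mono) auto
    also have "\<dots> = (1 - \<alpha>) * (?w i * cmod (y $ i)) + \<alpha> * (?w j * cmod (y $ j))"
      using \<alpha> by (simp add: rank_next[OF j] algebra_simps)
    also have "\<dots> \<le> (1 - \<alpha>) * b + \<alpha> * b" using \<alpha> y by (intro add_mono mult_left_mono) auto
    finally show ?thesis by (simp add: algebra_simps)
  next
    case False
    have off: "J $ i $ k = 0" if "k \<noteq> i" for k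
      using jordan_like_cases(2)[OF J, of i k] jordan_like_cases(4)[OF J, of i k] that False by blast
    have "(J *v y) $ i = (\<Sum>k\<in>UNIV. J $ i $ k * y $ k)" by (simp add: matrix_vector_mult_def)
    also have "\<dots> = (\<Sum>k\<in>{i}. J $ i $ k * y $ k)"
      by (intro sum.mono_neutral_right) (auto simp: off)
    finally have "cmod ((J *v y) $ i) \<le> 1 * cmod (y $ i)" 
      using mult_right_mono[OF D[of i], of "cmod (y $ i)"] by (simp add: norm_mult)
    then have "?w i * cmod ((J *v y) $ i) \<le> ?w i * cmod (y $ i)" using w[of i] by (intro mult_left_mono) auto
    then show ?thesis using y[of i] by linarith
  qed
qed

text \<open>
  Non-expansiveness makes the recursion add up its inputs; the constant is the price of passing from
  the weighted maximum norm to the Euclidean one.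
\<close>

lemma jordan_like_recursion_bound:
  fixes J :: "complex^('d::{finite,linorder})^('d::{finite,linorder})" and y g :: "nat \<Rightarrow> complex^('d::{finite,linorder})"
  assumes J: "J \<in> jordan_like (1 - \<alpha>)" and \<alpha>: "0 < \<alpha>" "\<alpha> < 1"
    and D: "\<And>i. cmod (J $ i $ i) \<le> 1"
    and y0: "y 0 = 0" and rec: "\<And>t. y (Suc t) = J *v y t + g (Suc t)"
  shows "norm (y t) \<le> real CARD('d) * (1 / \<alpha>) ^ CARD('d) * (\<Sum>s=1..t. norm (g s))"
proof -
  let ?w = "\<lambda>i. (1 / \<alpha>) ^ index_rank (i::'d)" and ?W = "(1 / \<alpha>) ^ CARD('d)"
  have w1: "1 \<le> ?w i" for i using \<alpha> by (intro one_le_power) simp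
  have wW: "?w i \<le> ?W" for i
    using \<alpha> rank_less[of i] by (intro power_increasing) auto
  have bound: "?w i * cmod (y t $ i) \<le> ?W * (\<Sum>s=1..t. norm (g s))" for i t
  proof (induction t arbitrary: i)
    case 0
    then show ?case by (simp add: y0)
  next
    case (Suc t)
    have "cmod (y (Suc t) $ i) \<le> cmod ((J *v y t) $ i) + cmod (g (Suc t) $ i)"
      by (simp add: rec norm_triangle_ineq)
    then have "?w i * cmod (y (Suc t) $ i) \<le> ?w i * (cmod ((J *v y t) $ i) + cmod (g (Suc t) $ i))"
      using w1[of i] by (intro mult_left_mono) auto
    also have "\<dots> = ?w i * cmod ((J *v y t) $ i) + ?w i * cmod (g (Suc t) $ i)" by (simp add: distrib_left)
    also have "\<dots> \<le> ?W * (\<Sum>s=1..t. norm (g s)) + ?W * norm (g (Suc t))"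
      using wW[of i] w1[of i] Finite_Cartesian_Product.norm_nth_le[of "g (Suc t)" i]
      by (intro add_mono jordan_like_nonexpansive[OF J \<alpha> D Suc] mult_mono) auto
    finally show ?case by (simp add: distrib_left)
  qed
  have "norm (y t) \<le> (\<Sum>i\<in>UNIV. cmod (y t $ i))" unfolding norm_vec_def by (rule L2_set_le_sum) simp
  also have "\<dots> \<le> (\<Sum>i\<in>(UNIV::'d set). ?W * (\<Sum>s=1..t. norm (g s)))"
  proof (rule sum_mono)
    fix i
    have "cmod (y t $ i) \<le> ?w i * cmod (y t $ i)" using w1[of i] by (simp add: mult_left_le_imp_le mult_le_cancel_right1)
    then show "cmod (y t $ i) \<le> ?W * (\<Sum>s=1..t. norm (g s))" using bound[of i t] by linarith
  qed
  finally show ?thesis by simp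
qed

section \<open>Factorisation of the limiting covariance\<close>

text \<open>
  A basis orthonormal for the form of a positive definite matrix serves as a square root: it
  factorises the matrix and its inverse. In the Gram-Schmidt step the next vector is chosen
  orthogonal to the images \<open>A v\<^sub>j\<close>, which is possible as long as they do not span the space.
\<close>

lemma form_orthonormal_basis:
  fixes A :: "real^'n^'n"
  assumes sym: "transpose A = A" and pos: "\<And>x. x \<noteq> 0 \<Longrightarrow> 0 < x \<bullet> (A *v x)"
  obtains P :: "real^'n^'n" where "transpose P ** A ** P = mat 1"
proof -
  have "\<exists>v :: 'n \<Rightarrow> real^'n. \<forall>i\<in>S. \<forall>j\<in>S. v i \<bullet> (A *v v j) = (if i = j then 1 else 0)" if "finite S" for S
    using that
  proof (induction S rule: finite_induct)
    case empty
    then show ?case by simp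
  next
    case (insert a S)
    then obtain v where v: "\<And>i j. i \<in> S \<Longrightarrow> j \<in> S \<Longrightarrow> v i \<bullet> (A *v v j) = (if i = j then 1 else 0)" by auto
    let ?W = "(\<lambda>j. A *v v j) ` S"
    have "card S < CARD('n)" using insert(2) by (intro psubset_card_mono) auto
    then have "dim (span ?W) < DIM(real^'n)"
      using dim_le_card'[of ?W] card_image_le[of S "\<lambda>j. A *v v j"] insert(1) by (simp add: dim_span)
    then obtain w where w: "w \<noteq> 0" "\<And>y. y \<in> span ?W \<Longrightarrow> orthogonal w y"
      using orthogonal_to_subspace_exists[of "span ?W"] by (metis span_span)
    define c where "c = sqrt (w \<bullet> (A *v w))"
    have c: "c > 0" "c * c = w \<bullet> (A *v w)" using pos[OF w(1)] by (simp_all add: c_def)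
    define u where "u = w /\<^sub>R c"
    have uj: "u \<bullet> (A *v v j) = 0" if "j \<in> S" for j
      using w(2)[of "A *v v j"] that by (auto simp: u_def orthogonal_def span_base)
    have ju: "v j \<bullet> (A *v u) = 0" if "j \<in> S" for j
      using uj[OF that] inner_matrix_symmetric[OF sym, of "v j" u] by (simp add: inner_commute)
    have uu: "u \<bullet> (A *v u) = 1"
    proof -
      have "u \<bullet> (A *v u) = inverse c * (inverse c * (w \<bullet> (A *v w)))"
        by (simp add: u_def matrix_vector_mult_scaleR)
      then show ?thesis using c(1) unfolding c(2)[symmetric] by (simp add: field_simps)
    qed
    show ?case
      by (rule exI[of _ "v(a := u)"]) (use v uj ju uu insert(2) in auto)
  qed
  from this[OF finite[of "UNIV"]] obtain v :: "'n \<Rightarrow> real^'n"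
    where v: "\<And>i j. v i \<bullet> (A *v v j) = (if i = j then 1 else 0)" by auto
  define P :: "real^'n^'n" where "P = (\<chi> i j. v j $ i)"
  have "(transpose P ** A ** P) $ i $ j = v i \<bullet> (A *v v j)" for i j
  proof -
    have "transpose P ** A ** P = transpose P ** (A ** P)" by (simp only: matrix_mul_assoc)
    then show ?thesis
      by (simp add: P_def transpose_def inner_vec_def matrix_matrix_mult_def matrix_vector_mult_def)
  qed
  then have "transpose P ** A ** P = mat 1" by (simp add: vec_eq_iff v mat_def)
  then show thesis by (rule that)
qed

lemma kronecker_mult:
  "kronecker A B ** kronecker C D = kronecker (A ** C) (B ** D)"
  by (simp add: vec_eq_iff kronecker_def matrix_matrix_mult_def sum_product UNIV_Times_UNIV[symmetric]
      sum.cartesian_product' mult_ac del: UNIV_Times_UNIV)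

lemma transpose_kronecker: "transpose (kronecker A B) = kronecker (transpose A) (transpose B)"
  by (simp add: vec_eq_iff kronecker_def transpose_def)

lemma kronecker_mat_1: "kronecker (mat 1) (mat 1) = mat 1"
  by (auto simp: vec_eq_iff kronecker_def mat_def prod_eq_iff)

lemma kronecker_inv_factor:
  fixes A :: "real^'n^'n"
  assumes sym: "transpose A = A" and pos: "\<And>x. x \<noteq> 0 \<Longrightarrow> 0 < x \<bullet> (A *v x)"
  obtains B :: "real^('n \<times> 'n)^('n \<times> 'n)" where "invertible B" "kronecker (matrix_inv A) A = B ** transpose B"
proof -
  obtain P :: "real^'n^'n" where P: "transpose P ** A ** P = mat 1" by (rule form_orthonormal_basis[OF sym pos])
  have "invertible P" using P invertible_left_inverse by blast
  note PI = matrix_inv_mult[OF this]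
  let ?Q = "matrix_inv P"
  have tPI: "transpose ?Q ** transpose P = mat 1" "transpose P ** transpose ?Q = mat 1"
    by (simp_all add: matrix_transpose_mul[symmetric] PI)
  have A: "A = transpose ?Q ** ?Q"
  proof -
    have "A = (transpose ?Q ** transpose P) ** A ** (P ** ?Q)" by (simp add: PI tPI)
    also have "\<dots> = transpose ?Q ** (transpose P ** A ** P) ** ?Q" by (simp only: matrix_mul_assoc)
    finally show ?thesis by (simp add: P)
  qed
  have Ai: "matrix_inv A = P ** transpose P"
  proof (rule matrix_inv_unique)
    have "A ** (P ** transpose P) = transpose ?Q ** (?Q ** P) ** transpose P" by (subst A) (simp only: matrix_mul_assoc)
    then show "A ** (P ** transpose P) = mat 1" by (simp add: PI tPI)
    have "(P ** transpose P) ** A = P ** (transpose P ** transpose ?Q) ** ?Q" by (subst A) (simp only: matrix_mul_assoc)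
    then show "(P ** transpose P) ** A = mat 1" by (simp add: PI tPI)
  qed
  let ?B = "kronecker P (transpose ?Q)"
  have "kronecker ?Q (transpose P) ** ?B = mat 1" by (simp add: kronecker_mult PI tPI kronecker_mat_1)
  then have "invertible ?B" using invertible_left_inverse by blast
  moreover have "kronecker (matrix_inv A) A = ?B ** transpose ?B"
    unfolding Ai by (simp add: transpose_kronecker kronecker_mult A[symmetric])
  ultimately show thesis by (rule that)
qed

section \<open>A law of large numbers in mean for martingale differences\<close>

text \<open>
  The smoothed absolute value \<open>sqrt (a\<^sup>2 + x\<^sup>2)\<close> has slope at most one and curvature at most \<open>1 / a\<close>. The
  first bound suits small increments, the second one large increments.
\<close>

lemma sqrt_quadratic_step:
  fixes a s y :: real
  assumes a: "a > 0"
  defines "\<phi> \<equiv> \<lambda>x. sqrt (a\<^sup>2 + x\<^sup>2)"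
  shows "\<phi> (s + y) \<le> \<phi> s + (s / \<phi> s) * y + y\<^sup>2 / (2 * a)"
    and "\<phi> (s + y) \<le> \<phi> s + (s / \<phi> s) * y + 2 * \<bar>y\<bar>"
proof -
  have pos: "\<phi> x > 0" for x using a by (simp add: \<phi>_def add_pos_nonneg)
  have ge: "a \<le> \<phi> x" "\<bar>x\<bar> \<le> \<phi> x" for x using a by (auto simp: \<phi>_def intro!: real_le_rsqrt)
  have sq: "(\<phi> x)\<^sup>2 = a\<^sup>2 + x\<^sup>2" for x by (simp add: \<phi>_def)
  have "(\<phi> (s + y))\<^sup>2 = (\<phi> s)\<^sup>2 + (2 * s * y + y\<^sup>2)" by (simp add: sq power2_sum)
  also have "\<dots> \<le> (\<phi> s + (2 * s * y + y\<^sup>2) / (2 * \<phi> s))\<^sup>2"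
    using pos[of s] by (simp add: power2_sum)
  finally have "(\<phi> (s + y))\<^sup>2 \<le> (\<phi> s + (2 * s * y + y\<^sup>2) / (2 * \<phi> s))\<^sup>2" .
  moreover have "0 \<le> \<phi> s + (2 * s * y + y\<^sup>2) / (2 * \<phi> s)"
  proof -
    have "0 \<le> (\<phi> s)\<^sup>2 + (\<phi> (s + y))\<^sup>2" by simp
    also have "\<dots> = 2 * (\<phi> s)\<^sup>2 + (2 * s * y + y\<^sup>2)" by (simp add: sq power2_sum)
    also have "\<dots> = (\<phi> s + (2 * s * y + y\<^sup>2) / (2 * \<phi> s)) * (2 * \<phi> s)"
    proof -
      have "2 * f\<^sup>2 + h = (f + h / (2 * f)) * (2 * f)" if "f > 0" for f h :: real
        using that by (simp add: field_simps power2_eq_square)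
      then show ?thesis using pos[of s] by blast
    qed
    finally show ?thesis using pos[of s] by (simp add: zero_le_mult_iff)
  qed
  ultimately have "\<phi> (s + y) \<le> \<phi> s + (2 * s * y + y\<^sup>2) / (2 * \<phi> s)" by (rule power2_le_imp_le)
  also have "\<dots> = \<phi> s + (s / \<phi> s) * y + y\<^sup>2 / (2 * \<phi> s)" using pos[of s] by (simp add: field_simps)
  also have "\<dots> \<le> \<phi> s + (s / \<phi> s) * y + y\<^sup>2 / (2 * a)"
    using ge(1)[of s] a pos[of s] by (intro add_left_mono divide_left_mono) auto
  finally show "\<phi> (s + y) \<le> \<phi> s + (s / \<phi> s) * y + y\<^sup>2 / (2 * a)" .
  have "\<phi> (s + y) \<le> \<phi> s + \<bar>y\<bar>"
  proof (rule power2_le_imp_le)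
    have "s * y \<le> \<phi> s * \<bar>y\<bar>"
      by (rule order_trans[OF abs_ge_self]) (simp add: abs_mult mult_right_mono ge)
    then show "(\<phi> (s + y))\<^sup>2 \<le> (\<phi> s + \<bar>y\<bar>)\<^sup>2" by (simp add: sq power2_sum)
  qed (use pos[of s] in simp)
  moreover have "- \<bar>y\<bar> \<le> (s / \<phi> s) * y"
  proof -
    have "\<bar>(s / \<phi> s) * y\<bar> \<le> 1 * \<bar>y\<bar>"
      unfolding abs_mult using ge(2)[of s] pos[of s] by (intro mult_right_mono) auto
    then show ?thesis by linarith
  qed
  ultimately show "\<phi> (s + y) \<le> \<phi> s + (s / \<phi> s) * y + 2 * \<bar>y\<bar>" by linarith
qed

lemma min_quadratic_linear_le_powr:
  fixes a y p :: real
  assumes a: "a > 0" and p: "1 \<le> p" "p \<le> 2"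
  shows "min (y\<^sup>2 / (2 * a)) (2 * \<bar>y\<bar>) \<le> 2 * \<bar>y\<bar> powr p * a powr (1 - p)"
proof (cases "y = 0")
  case False
  then have y: "\<bar>y\<bar> > 0" by simp
  show ?thesis
  proof (cases "\<bar>y\<bar> \<le> a")
    case True
    have "y\<^sup>2 = \<bar>y\<bar> powr p * \<bar>y\<bar> powr (2 - p)"
      using y by (simp add: powr_add[symmetric])
    also have "\<dots> \<le> \<bar>y\<bar> powr p * a powr (2 - p)"
      using True p by (intro mult_left_mono powr_mono2) auto
    also have "a powr (2 - p) = a * a powr (1 - p)"
      using a powr_add[of a 1 "1 - p"] by simp
    finally have "y\<^sup>2 / (2 * a) \<le> \<bar>y\<bar> powr p * (a * a powr (1 - p)) / (2 * a)"
      using a by (intro divide_right_mono) auto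
    also have "\<dots> = \<bar>y\<bar> powr p * a powr (1 - p) / 2" using a by simp
    also have "\<dots> \<le> 2 * \<bar>y\<bar> powr p * a powr (1 - p)" using a y by simp
    finally show ?thesis by linarith
  next
    case False
    have "\<bar>y\<bar> = \<bar>y\<bar> powr p * \<bar>y\<bar> powr (1 - p)" using y by (simp add: powr_add[symmetric])
    also have "\<dots> \<le> \<bar>y\<bar> powr p * a powr (1 - p)"
      using False p a by (intro mult_left_mono powr_mono2') auto
    finally show ?thesis by linarith
  qed
qed simp

text \<open>
  Along the partial sums, the mean of the smoothed absolute value grows only by its second-order
  error, because its slope is a bounded function of the past and the increments are orthogonal to
  such functions. For \<open>p > 1\<close> the choice \<open>a = n powr (1 / p)\<close> makes the bound of smaller order than \<open>n\<close>.
\<close>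

lemma (in prob_space) martingale_L1_bound:
  fixes Y :: "nat \<Rightarrow> 'a \<Rightarrow> real"
  assumes G: "\<And>t. subalgebra M (G t)"
    and Y: "\<And>s t. s < t \<Longrightarrow> Y s \<in> borel_measurable (G t)"
    and Yi: "\<And>t. integrable M (Y t)"
    and orth: "\<And>Z t. Z \<in> borel_measurable (G t) \<Longrightarrow> (\<And>\<omega>. \<bar>Z \<omega>\<bar> \<le> 1) \<Longrightarrow> (\<integral>\<omega>. Z \<omega> * Y t \<omega> \<partial>M) = 0"
    and p: "1 \<le> p" "p \<le> 2"
    and Yp: "\<And>t. integrable M (\<lambda>\<omega>. \<bar>Y t \<omega>\<bar> powr p)" "\<And>t. (\<integral>\<omega>. \<bar>Y t \<omega>\<bar> powr p \<partial>M) \<le> C"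
    and a: "a > 0"
  shows "(\<integral>\<omega>. \<bar>\<Sum>t<n. Y t \<omega>\<bar> \<partial>M) \<le> a + real n * (2 * C * a powr (1 - p))"
proof -
  define \<phi> where "\<phi> x = sqrt (a\<^sup>2 + x\<^sup>2)" for x :: real
  define S where "S n \<omega> = (\<Sum>t<n. Y t \<omega>)" for n \<omega>
  have pos: "\<phi> x > 0" for x using a by (simp add: \<phi>_def add_pos_nonneg)
  have ge: "\<bar>x\<bar> \<le> \<phi> x" for x using a by (auto simp: \<phi>_def intro!: real_le_rsqrt)
  have le: "\<phi> x \<le> a + \<bar>x\<bar>" for x
    unfolding \<phi>_def using a by (intro real_le_lsqrt) (auto simp: power2_sum)
  have [measurable]: "\<phi> \<in> borel_measurable borel" unfolding \<phi>_def by measurable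
  have SG: "S t \<in> borel_measurable (G t)" for t
    unfolding S_def[abs_def] by (intro borel_measurable_sum Y) simp
  have Si: "integrable M (S t)" for t
    unfolding S_def[abs_def] by (intro Bochner_Integration.integrable_sum Yi)
  have \<phi>i: "integrable M (\<lambda>\<omega>. \<phi> (S t \<omega>))" for t
  proof (rule Bochner_Integration.integrable_bound)
    show "integrable M (\<lambda>\<omega>. a + \<bar>S t \<omega>\<bar>)" using Si by auto
    show "(\<lambda>\<omega>. \<phi> (S t \<omega>)) \<in> borel_measurable M" using Si[of t] by (auto dest: borel_measurable_integrable)
    show "AE \<omega> in M. norm (\<phi> (S t \<omega>)) \<le> norm (a + \<bar>S t \<omega>\<bar>)"
      using le pos a by (intro AE_I2) (simp add: abs_of_pos)
  qed
  have step: "(\<integral>\<omega>. \<phi> (S t \<omega>) \<partial>M) \<le> a + real t * (2 * C * a powr (1 - p))" for t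
  proof (induction t)
    case 0
    then show ?case using a prob_space by (simp add: S_def \<phi>_def)
  next
    case (Suc t)
    let ?Z = "\<lambda>\<omega>. S t \<omega> / \<phi> (S t \<omega>)"
    have ZG: "?Z \<in> borel_measurable (G t)"
      using SG[of t] by (intro borel_measurable_divide measurable_compose[OF SG]) auto
    have Z1: "\<bar>?Z \<omega>\<bar> \<le> 1" for \<omega> using ge[of "S t \<omega>"] pos[of "S t \<omega>"] by auto
    have ZM: "?Z \<in> borel_measurable M" by (rule measurable_from_subalg[OF G ZG])
    have ZYi: "integrable M (\<lambda>\<omega>. ?Z \<omega> * Y t \<omega>)"
    proof (rule Bochner_Integration.integrable_bound[OF Yi[of t]])
      show "(\<lambda>\<omega>. ?Z \<omega> * Y t \<omega>) \<in> borel_measurable M"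
        using Yi[of t] by (intro borel_measurable_times ZM) (auto dest: borel_measurable_integrable)
      show "AE \<omega> in M. norm (?Z \<omega> * Y t \<omega>) \<le> norm (Y t \<omega>)"
      proof (rule AE_I2)
        fix \<omega> show "norm (?Z \<omega> * Y t \<omega>) \<le> norm (Y t \<omega>)"
          using mult_right_mono[OF Z1[of \<omega>], of "\<bar>Y t \<omega>\<bar>"] by (simp only: real_norm_def abs_mult) simp
      qed
    qed
    have "(\<integral>\<omega>. \<phi> (S (Suc t) \<omega>) \<partial>M)
      \<le> (\<integral>\<omega>. \<phi> (S t \<omega>) + ?Z \<omega> * Y t \<omega> + 2 * \<bar>Y t \<omega>\<bar> powr p * a powr (1 - p) \<partial>M)"
    proof (rule integral_mono[OF \<phi>i])
      show "integrable M (\<lambda>\<omega>. \<phi> (S t \<omega>) + ?Z \<omega> * Y t \<omega> + 2 * \<bar>Y t \<omega>\<bar> powr p * a powr (1 - p))"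
        using \<phi>i ZYi Yp(1) by (intro Bochner_Integration.integrable_add integrable_mult_left integrable_mult_right)
      fix \<omega>
      have "\<phi> (S (Suc t) \<omega>) = \<phi> (S t \<omega> + Y t \<omega>)" by (simp add: S_def)
      then show "\<phi> (S (Suc t) \<omega>) \<le> \<phi> (S t \<omega>) + ?Z \<omega> * Y t \<omega> + 2 * \<bar>Y t \<omega>\<bar> powr p * a powr (1 - p)"
        using sqrt_quadratic_step[OF a, of "S t \<omega>" "Y t \<omega>"] min_quadratic_linear_le_powr[OF a p, of "Y t \<omega>"]
        unfolding \<phi>_def by linarith
    qed
    also have "\<dots> = (\<integral>\<omega>. \<phi> (S t \<omega>) \<partial>M) + (\<integral>\<omega>. ?Z \<omega> * Y t \<omega> \<partial>M) + 2 * (\<integral>\<omega>. \<bar>Y t \<omega>\<bar> powr p \<partial>M) * a powr (1 - p)"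
      using \<phi>i ZYi Yp(1)[of t] by simp
    also have "(\<integral>\<omega>. ?Z \<omega> * Y t \<omega> \<partial>M) = 0" by (rule orth[OF ZG Z1])
    also have "2 * (\<integral>\<omega>. \<bar>Y t \<omega>\<bar> powr p \<partial>M) * a powr (1 - p) \<le> 2 * C * a powr (1 - p)"
      using Yp(2)[of t] by (intro mult_right_mono mult_left_mono) auto
    finally show ?case using Suc by (simp add: algebra_simps)
  qed
  have "(\<integral>\<omega>. \<bar>S n \<omega>\<bar> \<partial>M) \<le> (\<integral>\<omega>. \<phi> (S n \<omega>) \<partial>M)"
    using Si \<phi>i ge by (intro integral_mono) auto
  then show ?thesis using step[of n] unfolding S_def by linarith
qed

section \<open>A quantitative martingale central limit theorem\<close>

lemma iexp_remainder:
  "cmod (iexp x - 1 - \<i> * of_real x + of_real (x\<^sup>2 / 2)) \<le> min (x\<^sup>2) (\<bar>x\<bar> ^ 3)"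
proof -
  have e: "(\<Sum>k\<le>2. (\<i> * complex_of_real x) ^ k / fact k) = 1 + \<i> * of_real x - of_real (x\<^sup>2 / 2)"
  proof -
    have "(\<Sum>k\<le>2. g k) = g 0 + g 1 + g 2" for g :: "nat \<Rightarrow> complex" by (simp add: numeral_2_eq_2)
    moreover have "(\<i> * complex_of_real x)\<^sup>2 = - of_real (x\<^sup>2)" by (simp add: power_mult_distrib)
    ultimately show ?thesis by simp
  qed
  have "cmod (iexp x - (\<Sum>k\<le>2. (\<i> * complex_of_real x) ^ k / fact k)) \<le> \<bar>x\<bar> ^ Suc 2 / fact (Suc 2)"
    by (rule iexp_approx1)
  moreover have "\<bar>x\<bar> ^ Suc 2 / fact (Suc 2) \<le> \<bar>x\<bar> ^ Suc 2 / 1"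
    by (intro divide_left_mono fact_ge_1) auto
  moreover have "\<bar>x\<bar> ^ Suc 2 / 1 = \<bar>x\<bar> ^ 3" by simp
  moreover have "cmod (iexp x - (\<Sum>k\<le>2. (\<i> * complex_of_real x) ^ k / fact k)) \<le> 2 * \<bar>x\<bar> ^ 2 / fact 2"
    by (rule iexp_approx2)
  ultimately show ?thesis unfolding e by (simp add: algebra_simps)
qed

lemma exp_minus_remainder:
  fixes x :: real
  assumes "0 \<le> x"
  shows "\<bar>1 - x - exp (- x)\<bar> \<le> x\<^sup>2"
proof -
  have "1 - x \<le> exp (- x)" using exp_ge_add_one_self[of "- x"] by simp
  moreover have "exp (- x) \<le> 1 - x + x\<^sup>2"
  proof -
    have "exp (- x) = 1 / exp x" by (simp add: exp_minus field_simps)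
    also have "\<dots> \<le> 1 / (1 + x)" using assms by (intro divide_left_mono) (auto intro: exp_ge_add_one_self)
    also have "\<dots> \<le> 1 - x + x\<^sup>2"
    proof -
      have "1 \<le> (1 - x + x\<^sup>2) * (1 + x)" using assms by (simp add: power2_eq_square algebra_simps)
      then show ?thesis using assms by (simp add: field_simps)
    qed
    finally show ?thesis .
  qed
  ultimately show ?thesis by auto
qed

lemma abs_exp_minus_one_le:
  fixes y :: real
  assumes "\<bar>y\<bar> \<le> 1"
  shows "\<bar>exp y - 1\<bar> \<le> 2 * \<bar>y\<bar>"
proof (cases "0 \<le> y")
  case True
  then have "exp y \<le> 1 + y + y\<^sup>2" using assms by (intro exp_bound) auto
  moreover have "y\<^sup>2 \<le> y" using True assms by (simp add: power2_eq_square mult_left_le)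
  ultimately show ?thesis using True exp_ge_add_one_self[of y] by linarith
next
  case False
  then have "exp y < 1" by simp
  then show ?thesis using False exp_ge_add_one_self[of y] by linarith
qed

lemma (in prob_space) orth_complex:
  fixes Y :: "'a \<Rightarrow> real" and W :: "'a \<Rightarrow> real"
  assumes G: "subalgebra M G"
    and orth: "\<And>Z. Z \<in> borel_measurable G \<Longrightarrow> (\<exists>B. \<forall>\<omega>. \<bar>Z \<omega>\<bar> \<le> B) \<Longrightarrow> (\<integral>\<omega>. Z \<omega> * Y \<omega> \<partial>M) = (\<integral>\<omega>. Z \<omega> * W \<omega> \<partial>M)"
    and Z: "Z \<in> borel_measurable G" "\<And>\<omega>. cmod (Z \<omega>) \<le> B"
    and YW: "integrable M Y" "integrable M W"
  shows "(CLINT \<omega>|M. Z \<omega> * of_real (Y \<omega>)) = (CLINT \<omega>|M. Z \<omega> * of_real (W \<omega>))"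
proof -
  have ZM: "Z \<in> borel_measurable M" by (rule measurable_from_subalg[OF G Z(1)])
  have int: "integrable M (\<lambda>\<omega>. Z \<omega> * of_real (V \<omega>))" if "integrable M V" for V
  proof (rule Bochner_Integration.integrable_bound)
    show "integrable M (\<lambda>\<omega>. B * V \<omega>)" using that by simp
    show "(\<lambda>\<omega>. Z \<omega> * of_real (V \<omega>)) \<in> borel_measurable M"
      using that ZM by (auto dest: borel_measurable_integrable)
    show "AE \<omega> in M. norm (Z \<omega> * of_real (V \<omega>)) \<le> norm (B * V \<omega>)"
    proof (rule AE_I2)
      fix \<omega>
      have "cmod (Z \<omega>) * \<bar>V \<omega>\<bar> \<le> \<bar>B\<bar> * \<bar>V \<omega>\<bar>" using Z(2)[of \<omega>] by (intro mult_right_mono) auto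
      then show "norm (Z \<omega> * of_real (V \<omega>)) \<le> norm (B * V \<omega>)" by (simp add: norm_mult abs_mult)
    qed
  qed
  have Re: "(\<integral>\<omega>. Re (Z \<omega>) * Y \<omega> \<partial>M) = (\<integral>\<omega>. Re (Z \<omega>) * W \<omega> \<partial>M)"
    using Z by (intro orth borel_measurable_Re exI[of _ B] allI order_trans[OF abs_Re_le_cmod]) auto
  have Im: "(\<integral>\<omega>. Im (Z \<omega>) * Y \<omega> \<partial>M) = (\<integral>\<omega>. Im (Z \<omega>) * W \<omega> \<partial>M)"
    using Z by (intro orth borel_measurable_Im exI[of _ B] allI order_trans[OF abs_Im_le_cmod]) auto
  show ?thesis
  proof (rule complex_eqI)
    show "Re (CLINT \<omega>|M. Z \<omega> * of_real (Y \<omega>)) = Re (CLINT \<omega>|M. Z \<omega> * of_real (W \<omega>))"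
      using Re int[OF YW(1)] int[OF YW(2)] by (simp flip: integral_Re)
    show "Im (CLINT \<omega>|M. Z \<omega> * of_real (Y \<omega>)) = Im (CLINT \<omega>|M. Z \<omega> * of_real (W \<omega>))"
      using Im int[OF YW(1)] int[OF YW(2)] by (simp flip: integral_Im)
  qed
qed

text \<open>
  The martingale central limit theorem in the form of an explicit bound on the characteristic
  function. The accumulated conditional variance \<open>T\<close> is compensated inside the exponential, and
  the increments are stopped before \<open>T\<close> exceeds \<open>C\<close>, which keeps the compensator bounded.
\<close>

lemma (in prob_space) martingale_char_bound:
  fixes \<zeta> v :: "nat \<Rightarrow> 'a \<Rightarrow> real"
  assumes G: "\<And>t. subalgebra M (G t)"
    and \<zeta>: "\<And>s t. s < t \<Longrightarrow> \<zeta> s \<in> borel_measurable (G t)"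
    and v: "\<And>s t. s \<le> t \<Longrightarrow> v s \<in> borel_measurable (G t)" "\<And>t \<omega>. 0 \<le> v t \<omega>"
    and \<zeta>2: "\<And>t. integrable M (\<lambda>\<omega>. (\<zeta> t \<omega>)\<^sup>2)" and vi: "\<And>t. integrable M (v t)"
    and orth: "\<And>Z t. Z \<in> borel_measurable (G t) \<Longrightarrow> (\<exists>B. \<forall>\<omega>. \<bar>Z \<omega>\<bar> \<le> B) \<Longrightarrow> (\<integral>\<omega>. Z \<omega> * \<zeta> t \<omega> \<partial>M) = 0"
    and var: "\<And>Z t. Z \<in> borel_measurable (G t) \<Longrightarrow> (\<exists>B. \<forall>\<omega>. \<bar>Z \<omega>\<bar> \<le> B)
      \<Longrightarrow> (\<integral>\<omega>. Z \<omega> * (\<zeta> t \<omega>)\<^sup>2 \<partial>M) = (\<integral>\<omega>. Z \<omega> * v t \<omega> \<partial>M)"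
    and \<tau>: "0 \<le> \<tau>" "\<tau> + 1 \<le> C" and \<eta>: "0 < \<eta>" "\<eta> \<le> 1"
  shows "cmod ((CLINT \<omega>|M. iexp (\<Sum>t<n. \<zeta> t \<omega>)) - of_real (exp (- \<tau> / 2)))
    \<le> exp C * (\<Sum>t<n. (\<integral>\<omega>. min ((\<zeta> t \<omega>)\<^sup>2) (\<bar>\<zeta> t \<omega>\<bar> ^ 3) \<partial>M) + (\<integral>\<omega>. (min (v t \<omega>) C)\<^sup>2 \<partial>M))
      + \<eta> + (1 + exp C) * prob {\<omega> \<in> space M. \<bar>(\<Sum>t<n. v t \<omega>) - \<tau>\<bar> > \<eta>}"
proof -
  have C: "C > 0" using \<tau> by linarith
  have \<zeta>M [measurable]: "\<zeta> t \<in> borel_measurable M" for t by (rule measurable_from_subalg[OF G \<zeta>[of t "Suc t"]]) simp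
  have vM [measurable]: "v t \<in> borel_measurable M" for t by (rule measurable_from_subalg[OF G v(1)[of t t]]) simp
  have \<zeta>i: "integrable M (\<zeta> t)" for t
    by (rule square_integrable_imp_integrable[OF \<zeta>M \<zeta>2])
  define T where "T t \<omega> = (\<Sum>s<t. v s \<omega>)" for t \<omega>
  \<comment> \<open>An increment is kept if the accumulated variance, its own included, is at most \<open>C\<close>; this is
    known before the increment occurs.\<close>
  define I where "I t \<omega> = (if T (Suc t) \<omega> \<le> C then 1 else 0 :: real)" for t \<omega>
  define z where "z t \<omega> = I t \<omega> * \<zeta> t \<omega>" for t \<omega>
  define w where "w t \<omega> = I t \<omega> * v t \<omega>" for t \<omega>
  define S' where "S' t \<omega> = (\<Sum>s<t. z s \<omega>)" for t \<omega>
  define T' where "T' t \<omega> = (\<Sum>s<t. w s \<omega>)" for t \<omega>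
  \<comment> \<open>If the increments were Gaussian given the past, \<open>\<Phi>\<close> would be a martingale. The factor \<open>H\<close> is
    the part of the next value that is known one step ahead.\<close>
  define \<Phi> where "\<Phi> t \<omega> = iexp (S' t \<omega>) * of_real (exp (T' t \<omega> / 2))" for t \<omega>
  define H where "H t \<omega> = \<Phi> t \<omega> * of_real (exp (w t \<omega> / 2))" for t \<omega>
  have I01: "I t \<omega> = 0 \<or> I t \<omega> = 1" for t \<omega> by (simp add: I_def)
  have TG: "T t \<in> borel_measurable (G u)" if "t \<le> Suc u" for t u
    unfolding T_def[abs_def] using that by (intro borel_measurable_sum v) auto
  have IG: "I t \<in> borel_measurable (G u)" if "t \<le> u" for t u
  proof -
    have [measurable]: "T (Suc t) \<in> borel_measurable (G u)" using TG that by simp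
    show ?thesis unfolding I_def[abs_def] by measurable
  qed
  have zG: "z s \<in> borel_measurable (G t)" if "s < t" for s t
    unfolding z_def[abs_def] using that by (intro borel_measurable_times IG \<zeta>) auto
  have wG: "w s \<in> borel_measurable (G t)" if "s \<le> t" for s t
    unfolding w_def[abs_def] using that by (intro borel_measurable_times IG v) auto
  have S'G: "S' t \<in> borel_measurable (G t)" for t
    unfolding S'_def[abs_def] by (intro borel_measurable_sum zG) auto
  have T'G: "T' t \<in> borel_measurable (G t)" for t
    unfolding T'_def[abs_def] by (intro borel_measurable_sum wG) auto
  have \<Phi>G: "\<Phi> t \<in> borel_measurable (G t)" for t
  proof -
    note S'G[of t, measurable] T'G[of t, measurable]
    show ?thesis unfolding \<Phi>_def[abs_def] by measurable
  qed
  have HG: "H t \<in> borel_measurable (G t)" for t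
  proof -
    note \<Phi>G[of t, measurable] wG[of t t, measurable]
    show ?thesis unfolding H_def[abs_def] by measurable
  qed
  have [measurable]: "S' t \<in> borel_measurable M" "T' t \<in> borel_measurable M" "T t \<in> borel_measurable M"
    "I t \<in> borel_measurable M" "z t \<in> borel_measurable M" "w t \<in> borel_measurable M"
    "\<Phi> t \<in> borel_measurable M" "H t \<in> borel_measurable M" for t
    using measurable_from_subalg[OF G S'G[of t]] measurable_from_subalg[OF G T'G[of t]]
      measurable_from_subalg[OF G TG[of t t]] measurable_from_subalg[OF G IG[of t t]]
      measurable_from_subalg[OF G zG[of t "Suc t"]] measurable_from_subalg[OF G wG[of t t]]
      measurable_from_subalg[OF G \<Phi>G[of t]] measurable_from_subalg[OF G HG[of t]] by auto
  have w0: "0 \<le> w t \<omega>" for t \<omega> using I01[of t \<omega>] v(2) by (auto simp: w_def)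
  have Tmono: "T s \<omega> \<le> T t \<omega>" if "s \<le> t" for s t \<omega>
    unfolding T_def using that v(2) by (intro sum_mono2) auto
  have wv: "w t \<omega> \<le> v t \<omega>" for t \<omega> using I01[of t \<omega>] v(2) by (auto simp: w_def)
  have T'le: "T' t \<omega> \<le> T t \<omega>" for t \<omega> unfolding T'_def T_def by (intro sum_mono wv)
  have T'C: "T' t \<omega> \<le> C" for t \<omega>
  proof (induction t)
    case 0
    then show ?case using C by (simp add: T'_def)
  next
    case (Suc t)
    show ?case
    proof (cases "T (Suc t) \<omega> \<le> C")
      case True
      then show ?thesis using T'le[of "Suc t" \<omega>] by linarith
    next
      case False
      then show ?thesis using Suc by (simp add: T'_def w_def I_def)
    qed
  qed
  have wC: "w t \<omega> \<le> min (v t \<omega>) C" for t \<omega>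
  proof -
    have "w t \<omega> \<le> T' (Suc t) \<omega>" unfolding T'_def using w0 by (simp add: sum_nonneg)
    then show ?thesis using wv T'C[of "Suc t" \<omega>] by simp
  qed
  have H_norm: "cmod (H t \<omega>) = exp (T' (Suc t) \<omega> / 2)" for t \<omega>
    by (simp add: H_def \<Phi>_def norm_mult T'_def add_divide_distrib exp_add)
  have H_le: "cmod (H t \<omega>) \<le> exp C" for t \<omega>
    unfolding H_norm using T'C[of "Suc t" \<omega>] C by simp
  have \<Phi>_le: "cmod (\<Phi> t \<omega>) \<le> exp C" for t \<omega>
    using T'C[of t \<omega>] C by (simp add: \<Phi>_def norm_mult)
  have \<Phi>i: "integrable M (\<Phi> t)" for t
    by (rule integrable_const_bound[where B="exp C"]) (auto simp: \<Phi>_le)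
  have Hi: "integrable M (H t)" for t
    by (rule integrable_const_bound[where B="exp C"]) (auto simp: H_le)
  define r where "r x = iexp x - 1 - \<i> * of_real x + of_real (x\<^sup>2 / 2)" for x :: real
  have [measurable]: "r \<in> borel_measurable borel" unfolding r_def[abs_def] by measurable
  let ?E = "\<lambda>t. (\<integral>\<omega>. min ((\<zeta> t \<omega>)\<^sup>2) (\<bar>\<zeta> t \<omega>\<bar> ^ 3) \<partial>M) + (\<integral>\<omega>. (min (v t \<omega>) C)\<^sup>2 \<partial>M)"
  have mi: "integrable M (\<lambda>\<omega>. min ((\<zeta> t \<omega>)\<^sup>2) (\<bar>\<zeta> t \<omega>\<bar> ^ 3))" for t
    by (rule Bochner_Integration.integrable_bound[OF \<zeta>2[of t]]) auto
  have wi: "integrable M (\<lambda>\<omega>. (min (v t \<omega>) C)\<^sup>2)" for t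
  proof (rule integrable_const_bound[where B="C\<^sup>2"])
    show "AE \<omega> in M. norm ((min (v t \<omega>) C)\<^sup>2) \<le> C\<^sup>2"
      using v(2) C by (intro AE_I2) (auto intro!: power_mono)
  qed measurable
  have nb: "cmod (CLINT \<omega>|M. f \<omega>) \<le> (\<integral>\<omega>. g \<omega> \<partial>M)"
    if "integrable M f" "integrable M g" "\<And>\<omega>. cmod (f \<omega>) \<le> g \<omega>" for f g
    by (rule order_trans[OF integral_norm_bound integral_mono]) (use that in auto)
  have lin5: "(CLINT \<omega>|M. a \<omega> + \<i> * b \<omega> - (1 / 2) * c \<omega> + (1 / 2) * d \<omega> + f \<omega>)
     = (CLINT \<omega>|M. a \<omega>) + \<i> * (CLINT \<omega>|M. b \<omega>) - (1 / 2) * (CLINT \<omega>|M. c \<omega>)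
        + (1 / 2) * (CLINT \<omega>|M. d \<omega>) + (CLINT \<omega>|M. f \<omega>)"
    if "integrable M a" "integrable M b" "integrable M c" "integrable M d" "integrable M f" for a b c d f :: "'a \<Rightarrow> complex"
    using that by simp
  have step: "cmod ((CLINT \<omega>|M. \<Phi> (Suc t) \<omega>) - (CLINT \<omega>|M. \<Phi> t \<omega>)) \<le> exp C * ?E t" for t
  proof -
    have r_le: "cmod (H t \<omega> * r (z t \<omega>)) \<le> exp C * min ((\<zeta> t \<omega>)\<^sup>2) (\<bar>\<zeta> t \<omega>\<bar> ^ 3)" for \<omega>
    proof -
      have "cmod (r (z t \<omega>)) \<le> min ((z t \<omega>)\<^sup>2) (\<bar>z t \<omega>\<bar> ^ 3)" unfolding r_def by (rule iexp_remainder)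
      also have "\<dots> \<le> min ((\<zeta> t \<omega>)\<^sup>2) (\<bar>\<zeta> t \<omega>\<bar> ^ 3)" using I01[of t \<omega>] by (auto simp: z_def)
      finally show ?thesis unfolding norm_mult using H_le[of t \<omega>] by (intro mult_mono) auto
    qed
    let ?c = "\<lambda>\<omega>. H t \<omega> * of_real (1 - w t \<omega> / 2 - exp (- (w t \<omega> / 2)))"
    have c_le: "cmod (?c \<omega>) \<le> exp C * (min (v t \<omega>) C)\<^sup>2" for \<omega>
    proof -
      have "\<bar>1 - w t \<omega> / 2 - exp (- (w t \<omega> / 2))\<bar> \<le> (w t \<omega> / 2)\<^sup>2" using w0 by (intro exp_minus_remainder) simp
      also have "\<dots> \<le> (min (v t \<omega>) C)\<^sup>2" using w0[of t \<omega>] wC[of t \<omega>] by (intro power_mono) auto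
      finally show ?thesis unfolding norm_mult norm_of_real using H_le[of t \<omega>] by (intro mult_mono) auto
    qed
    have r_int: "integrable M (\<lambda>\<omega>. H t \<omega> * r (z t \<omega>))"
    proof (rule Bochner_Integration.integrable_bound[OF integrable_mult_right[OF mi[of t], of "exp C"]])
      show "AE \<omega> in M. norm (H t \<omega> * r (z t \<omega>)) \<le> norm (exp C * min ((\<zeta> t \<omega>)\<^sup>2) (\<bar>\<zeta> t \<omega>\<bar> ^ 3))"
        by (intro AE_I2 order_trans[OF r_le]) simp
    qed measurable
    have c_int: "integrable M ?c"
    proof (rule Bochner_Integration.integrable_bound[OF integrable_mult_right[OF wi[of t], of "exp C"]])
      show "AE \<omega> in M. norm (?c \<omega>) \<le> norm (exp C * (min (v t \<omega>) C)\<^sup>2)"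
        by (intro AE_I2 order_trans[OF c_le]) simp
    qed measurable
    have HI_le: "cmod (H t \<omega> * of_real (I t \<omega>)) \<le> exp C" for \<omega>
      using I01[of t \<omega>] H_le[of t \<omega>] by (auto simp: norm_mult)
    have HIG: "(\<lambda>\<omega>. H t \<omega> * of_real (I t \<omega>)) \<in> borel_measurable (G t)"
    proof -
      note HG[of t, measurable] IG[of t t, measurable]
      show ?thesis by measurable
    qed
    have a_eq: "(CLINT \<omega>|M. (H t \<omega> * of_real (I t \<omega>)) * of_real (\<zeta> t \<omega>)) = (CLINT \<omega>|M. (H t \<omega> * of_real (I t \<omega>)) * of_real 0)"
      by (rule orth_complex[OF G _ HIG HI_le \<zeta>i]) (auto simp: orth)
    have b_eq: "(CLINT \<omega>|M. (H t \<omega> * of_real (I t \<omega>)) * of_real ((\<zeta> t \<omega>)\<^sup>2)) = (CLINT \<omega>|M. (H t \<omega> * of_real (I t \<omega>)) * of_real (v t \<omega>))"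
      by (rule orth_complex[OF G _ HIG HI_le \<zeta>2 vi]) (auto simp: var)
    have HIm: "integrable M (\<lambda>\<omega>. (H t \<omega> * of_real (I t \<omega>)) * of_real (V \<omega>))" if "integrable M V" for V
    proof (rule Bochner_Integration.integrable_bound[OF integrable_mult_right[OF that, of "exp C"]])
      show "(\<lambda>\<omega>. (H t \<omega> * of_real (I t \<omega>)) * of_real (V \<omega>)) \<in> borel_measurable M"
        using that by (auto dest: borel_measurable_integrable)
      show "AE \<omega> in M. norm ((H t \<omega> * of_real (I t \<omega>)) * of_real (V \<omega>)) \<le> norm (exp C * V \<omega>)"
      proof (rule AE_I2)
        fix \<omega> show "norm ((H t \<omega> * of_real (I t \<omega>)) * of_real (V \<omega>)) \<le> norm (exp C * V \<omega>)"
          unfolding norm_mult[of "H t \<omega> * of_real (I t \<omega>)"] norm_mult[of "exp C"] norm_of_real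
          using HI_le[of \<omega>] by (intro mult_mono) auto
      qed
    qed
    let ?A = "\<lambda>\<omega>. (H t \<omega> * of_real (I t \<omega>)) * of_real (\<zeta> t \<omega>)"
    let ?B = "\<lambda>\<omega>. (H t \<omega> * of_real (I t \<omega>)) * of_real ((\<zeta> t \<omega>)\<^sup>2)"
    let ?D = "\<lambda>\<omega>. (H t \<omega> * of_real (I t \<omega>)) * of_real (v t \<omega>)"
    have II: "I t \<omega> * I t \<omega> = I t \<omega>" for \<omega> using I01[of t \<omega>] by auto
    \<comment> \<open>Second-order expansion: the term in \<open>?A\<close> has mean zero, the terms in \<open>?B\<close> and \<open>?D\<close> cancel in
      mean, and the others are the remainders.\<close>
    have decomp: "\<Phi> (Suc t) \<omega> - \<Phi> t \<omega> = H t \<omega> * r (z t \<omega>) + \<i> * ?A \<omega> - (1 / 2) * ?B \<omega> + (1 / 2) * ?D \<omega> + ?c \<omega>" for \<omega>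
    proof -
      have 1: "\<Phi> (Suc t) \<omega> = H t \<omega> * iexp (z t \<omega>)"
        by (simp add: \<Phi>_def H_def S'_def T'_def distrib_left exp_add add_divide_distrib)
      have 2: "\<Phi> t \<omega> = H t \<omega> * of_real (exp (- (w t \<omega> / 2)))"
        by (simp add: H_def exp_minus)
      have 3: "(z t \<omega>)\<^sup>2 = I t \<omega> * (\<zeta> t \<omega>)\<^sup>2" unfolding z_def power2_eq_square using II[of \<omega>] by (metis mult.assoc mult.left_commute)
      show ?thesis unfolding 1 2 r_def 3 by (simp add: z_def w_def algebra_simps)
    qed
    have "(CLINT \<omega>|M. \<Phi> (Suc t) \<omega>) - (CLINT \<omega>|M. \<Phi> t \<omega>) = (CLINT \<omega>|M. \<Phi> (Suc t) \<omega> - \<Phi> t \<omega>)"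
      by (rule Bochner_Integration.integral_diff[OF \<Phi>i \<Phi>i, symmetric])
    also have "\<dots> = (CLINT \<omega>|M. H t \<omega> * r (z t \<omega>)) + \<i> * (CLINT \<omega>|M. ?A \<omega>) - (1 / 2) * (CLINT \<omega>|M. ?B \<omega>)
        + (1 / 2) * (CLINT \<omega>|M. ?D \<omega>) + (CLINT \<omega>|M. ?c \<omega>)"
      unfolding decomp
      by (rule lin5) (intro r_int c_int HIm \<zeta>i \<zeta>2 vi)+
    also have "\<dots> = (CLINT \<omega>|M. H t \<omega> * r (z t \<omega>)) + (CLINT \<omega>|M. ?c \<omega>)"
      unfolding a_eq b_eq by simp
    finally have "cmod ((CLINT \<omega>|M. \<Phi> (Suc t) \<omega>) - (CLINT \<omega>|M. \<Phi> t \<omega>))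
      \<le> cmod (CLINT \<omega>|M. H t \<omega> * r (z t \<omega>)) + cmod (CLINT \<omega>|M. ?c \<omega>)"
      by (simp only: norm_triangle_ineq)
    also have "cmod (CLINT \<omega>|M. H t \<omega> * r (z t \<omega>)) \<le> (\<integral>\<omega>. exp C * min ((\<zeta> t \<omega>)\<^sup>2) (\<bar>\<zeta> t \<omega>\<bar> ^ 3) \<partial>M)"
      by (rule nb[OF r_int integrable_mult_right[OF mi] r_le])
    also have "cmod (CLINT \<omega>|M. ?c \<omega>) \<le> (\<integral>\<omega>. exp C * (min (v t \<omega>) C)\<^sup>2 \<partial>M)"
      by (rule nb[OF c_int integrable_mult_right[OF wi] c_le])
    finally show ?thesis by (simp add: distrib_left)
  qed
  have \<Phi>_bound: "cmod ((CLINT \<omega>|M. \<Phi> n \<omega>) - 1) \<le> exp C * (\<Sum>t<n. ?E t)" for n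
  proof (induction n)
    case 0
    then show ?case using prob_space by (simp add: \<Phi>_def S'_def T'_def)
  next
    case (Suc n)
    have "cmod ((CLINT \<omega>|M. \<Phi> (Suc n) \<omega>) - 1)
       \<le> cmod ((CLINT \<omega>|M. \<Phi> (Suc n) \<omega>) - (CLINT \<omega>|M. \<Phi> n \<omega>)) + cmod ((CLINT \<omega>|M. \<Phi> n \<omega>) - 1)"
      using norm_triangle_ineq[of "(CLINT \<omega>|M. \<Phi> (Suc n) \<omega>) - (CLINT \<omega>|M. \<Phi> n \<omega>)" "(CLINT \<omega>|M. \<Phi> n \<omega>) - 1"] by simp
    then show ?case using step[of n] Suc by (simp add: distrib_left)
  qed
  define e where "e \<omega> = iexp (\<Sum>t<n. \<zeta> t \<omega>)" for \<omega>
  have [measurable]: "e \<in> borel_measurable M" unfolding e_def[abs_def] by measurable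
  have ei: "integrable M e"
    by (rule integrable_const_bound[where B=1]) (auto simp: e_def)
  define A where "A = {\<omega> \<in> space M. \<bar>(\<Sum>t<n. v t \<omega>) - \<tau>\<bar> > \<eta>}"
  have [measurable]: "A \<in> sets M" unfolding A_def by measurable
  let ?k = "of_real (exp (- \<tau> / 2)) :: complex"
  have k1: "cmod ?k \<le> 1" using \<tau>(1) by simp
  have close: "cmod (e \<omega> - ?k * \<Phi> n \<omega>) \<le> \<eta> + (1 + exp C) * indicator A \<omega>" if \<omega>: "\<omega> \<in> space M" for \<omega>
  proof (cases "\<omega> \<in> A")
    case True
    have "cmod (e \<omega> - ?k * \<Phi> n \<omega>) \<le> cmod (e \<omega>) + cmod ?k * cmod (\<Phi> n \<omega>)"
      by (metis norm_triangle_ineq4 norm_mult)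
    also have "\<dots> \<le> 1 + 1 * exp C"
      using k1 \<Phi>_le[of n \<omega>] by (intro add_mono mult_mono) (auto simp: e_def)
    finally show ?thesis using True \<eta> by simp
  next
    case False
    then have d: "\<bar>T n \<omega> - \<tau>\<bar> \<le> \<eta>" using \<omega> by (simp add: A_def T_def)
    then have "T n \<omega> \<le> C" using \<tau> \<eta> by linarith
    \<comment> \<open>Here nothing is ever stopped, so that the stopped sums are the original ones.\<close>
    then have "I s \<omega> = 1" if "s < n" for s
      using Tmono[of "Suc s" n \<omega>] that by (simp add: I_def)
    then have S: "S' n \<omega> = (\<Sum>t<n. \<zeta> t \<omega>)" and TT: "T' n \<omega> = T n \<omega>"
      by (simp_all add: S'_def T'_def T_def z_def w_def)
    have kk: "?k * of_real (exp (T n \<omega> / 2)) = of_real (exp ((T n \<omega> - \<tau>) / 2))"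
      unfolding of_real_mult[symmetric] exp_add[symmetric] by (simp add: diff_divide_distrib)
    have "e \<omega> - ?k * \<Phi> n \<omega> = e \<omega> - ?k * (e \<omega> * of_real (exp (T n \<omega> / 2)))"
      by (simp only: \<Phi>_def S TT e_def)
    also have "\<dots> = e \<omega> * (1 - ?k * of_real (exp (T n \<omega> / 2)))"
      by (simp only: right_diff_distrib mult_1_right mult.left_commute)
    also have "cmod \<dots> = cmod (e \<omega>) * cmod (1 - of_real (exp ((T n \<omega> - \<tau>) / 2)))"
      unfolding kk by (rule norm_mult)
    also have "\<dots> = \<bar>exp ((T n \<omega> - \<tau>) / 2) - 1\<bar>"
    proof -
      have "cmod (1 - of_real y) = \<bar>y - 1\<bar>" for y :: real
        by (metis abs_minus_commute norm_of_real of_real_1 of_real_diff)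
      then show ?thesis by (simp add: e_def)
    qed
    also have "\<dots> \<le> 2 * \<bar>(T n \<omega> - \<tau>) / 2\<bar>" using d \<eta> by (intro abs_exp_minus_one_le) auto
    also have "\<dots> \<le> \<eta>" using d by simp
    finally show ?thesis using False by simp
  qed
  have iA: "integrable M (indicator A :: 'a \<Rightarrow> real)"
    by (rule integrable_const_bound[where B=1]) (auto simp: indicator_def)
  have ki: "integrable M (\<lambda>\<omega>. ?k * \<Phi> n \<omega>)" using \<Phi>i by simp
  have "cmod ((CLINT \<omega>|M. e \<omega>) - ?k * (CLINT \<omega>|M. \<Phi> n \<omega>)) = cmod (CLINT \<omega>|M. e \<omega> - ?k * \<Phi> n \<omega>)"
    by (subst Bochner_Integration.integral_diff[OF ei ki]) simp
  also have "\<dots> \<le> (\<integral>\<omega>. cmod (e \<omega> - ?k * \<Phi> n \<omega>) \<partial>M)" by (rule integral_norm_bound)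
  also have "\<dots> \<le> (\<integral>\<omega>. \<eta> + (1 + exp C) * indicator A \<omega> \<partial>M)"
  proof (rule integral_mono[OF integrable_norm[OF Bochner_Integration.integrable_diff[OF ei ki]] _ close])
    show "integrable M (\<lambda>\<omega>. \<eta> + (1 + exp C) * indicator A \<omega>)" using iA by simp
  qed
  also have "\<dots> = \<eta> + (1 + exp C) * prob A"
    using prob_space iA by (simp add: Int_absorb2[OF sets.sets_into_space])
  finally have 1: "cmod ((CLINT \<omega>|M. e \<omega>) - ?k * (CLINT \<omega>|M. \<Phi> n \<omega>)) \<le> \<eta> + (1 + exp C) * prob A" .
  have "cmod (?k * (CLINT \<omega>|M. \<Phi> n \<omega>) - ?k) = cmod ?k * cmod ((CLINT \<omega>|M. \<Phi> n \<omega>) - 1)"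
    by (simp only: norm_mult[symmetric] right_diff_distrib mult_1_right)
  also have "\<dots> \<le> 1 * (exp C * (\<Sum>t<n. ?E t))" using k1 \<Phi>_bound by (intro mult_mono) auto
  finally have 2: "cmod (?k * (CLINT \<omega>|M. \<Phi> n \<omega>) - ?k) \<le> exp C * (\<Sum>t<n. ?E t)" by simp
  have "cmod ((CLINT \<omega>|M. e \<omega>) - ?k)
     \<le> cmod ((CLINT \<omega>|M. e \<omega>) - ?k * (CLINT \<omega>|M. \<Phi> n \<omega>)) + cmod (?k * (CLINT \<omega>|M. \<Phi> n \<omega>) - ?k)"
    using norm_triangle_ineq[of "(CLINT \<omega>|M. e \<omega>) - ?k * (CLINT \<omega>|M. \<Phi> n \<omega>)" "?k * (CLINT \<omega>|M. \<Phi> n \<omega>) - ?k"] by simp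
  then show ?thesis using 1 2 unfolding e_def A_def by linarith
qed

section \<open>The algebra of lag augmentation\<close>

lemma norm_matrix_vector_le:
  fixes A :: "real^'n^'m"
  shows "norm (A *v x) \<le> norm A * norm x"
proof -
  have "(norm (A *v x))\<^sup>2 = (\<Sum>i\<in>UNIV. (A $ i \<bullet> x)\<^sup>2)"
    unfolding power2_norm_eq_inner inner_vec_def[of "A *v x"]
    by (simp add: matrix_vector_mult_def inner_vec_def power2_eq_square)
  also have "\<dots> \<le> (\<Sum>i\<in>UNIV. (norm (A $ i))\<^sup>2 * (norm x)\<^sup>2)"
    using Cauchy_Schwarz_ineq by (intro sum_mono) (simp add: power2_norm_eq_inner)
  also have "\<dots> = (norm A)\<^sup>2 * (norm x)\<^sup>2"
    unfolding power2_norm_eq_inner[of A] inner_vec_def[of A] by (simp add: sum_distrib_right power2_norm_eq_inner)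
  also have "\<dots> = (norm A * norm x)\<^sup>2" by (simp add: power_mult_distrib)
  finally show ?thesis by (rule power2_le_imp_le) simp
qed

lemma norm_transpose: "norm (transpose A) = norm (A :: real^'n^'m)"
proof -
  have "(norm (transpose A))\<^sup>2 = (norm A)\<^sup>2"
    unfolding power2_norm_eq_inner inner_vec_def by (simp add: transpose_def, rule sum.swap)
  then show ?thesis by (simp add: power2_eq_iff_nonneg)
qed

lemma norm_matrix_le_transpose_mult:
  fixes E :: "real^'n^'m"
  assumes "\<And>b. norm (transpose E *v b) \<le> \<xi> * norm b"
  shows "norm E \<le> real CARD('m) * \<xi>"
proof -
  have row: "norm (E $ i) \<le> \<xi>" for i
    using assms[of "axis i 1"] by (simp add: matrix_vector_mult_basis column_def transpose_def norm_axis_1)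
  have "norm E \<le> (\<Sum>i\<in>UNIV. norm (E $ i))" unfolding norm_vec_def[of E] by (rule L2_set_le_sum) simp
  also have "\<dots> \<le> (\<Sum>i\<in>(UNIV::'m set). \<xi>)" by (intro sum_mono row)
  finally show ?thesis by simp
qed

definition cross :: "(nat \<Rightarrow> real^'m) \<Rightarrow> (nat \<Rightarrow> real^'n) \<Rightarrow> nat \<Rightarrow> real^'n^'m" where
  "cross e x m = (\<Sum>s<m. outer (e s) (x s))"

lemma cross_mult_vec: "cross e x m *v v = (\<Sum>s<m. (x s \<bullet> v) *\<^sub>R e s)"
  by (simp add: cross_def sum_matrix_vector outer_mult_vec)

lemma inner_cross: "b \<bullet> (cross e x m *v v) = (\<Sum>s<m. (e s \<bullet> b) * (x s \<bullet> v))"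
  by (simp add: cross_mult_vec inner_sum_right inner_commute mult.commute)

lemma transpose_cross: "transpose (cross e x m) = cross x e m"
  by (simp add: cross_def transpose_sum_matrix) (simp add: vec_eq_iff outer_def transpose_def mult.commute)

definition total_self_norm :: "(nat \<Rightarrow> real^'n) \<Rightarrow> (nat \<Rightarrow> real^'d) \<Rightarrow> nat \<Rightarrow> real" where
  "total_self_norm x e m = (\<Sum>i\<in>UNIV. self_norm x (\<lambda>s. e s $ i) m)"

lemma total_self_norm_nonneg: "0 \<le> total_self_norm x e m"
  unfolding total_self_norm_def by (intro sum_nonneg self_norm_nonneg)

lemma norm_cross_le:
  "(norm (cross e x m *v v))\<^sup>2 \<le> total_self_norm x e m * (v \<bullet> v + (\<Sum>s<m. (x s \<bullet> v)\<^sup>2))"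
proof -
  have "(norm (cross e x m *v v))\<^sup>2 = (\<Sum>i\<in>UNIV. (\<Sum>s<m. e s $ i * (x s \<bullet> v))\<^sup>2)"
    unfolding power2_norm_eq_inner inner_vec_def[of "cross e x m *v v"]
    by (simp add: cross_mult_vec power2_eq_square mult.commute)
  also have "\<dots> \<le> (\<Sum>i\<in>UNIV. self_norm x (\<lambda>s. e s $ i) m * (v \<bullet> v + (\<Sum>s<m. (x s \<bullet> v)\<^sup>2)))"
    by (intro sum_mono self_norm_form)
  finally show ?thesis by (simp add: total_self_norm_def sum_distrib_right)
qed

definition fst_block :: "real^('d + 'd) \<Rightarrow> real^'d" where "fst_block p = (\<chi> i. p $ Inl i)"
definition snd_block :: "real^('d + 'd) \<Rightarrow> real^'d" where "snd_block p = (\<chi> i. p $ Inr i)"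

lemma inner_blocks: "p \<bullet> q = fst_block p \<bullet> fst_block q + snd_block p \<bullet> snd_block q"
  unfolding inner_vec_def fst_block_def snd_block_def UNIV_Plus_UNIV[symmetric]
  by (simp add: sum.Plus del: UNIV_Plus_UNIV)

lemma blocks_zero: "fst_block p = 0 \<Longrightarrow> snd_block p = 0 \<Longrightarrow> p = 0"
proof -
  assume "fst_block p = 0" "snd_block p = 0"
  then have "p $ k = 0" for k by (cases k) (auto simp: fst_block_def snd_block_def vec_eq_iff)
  then show ?thesis by (simp add: vec_eq_iff)
qed

lemma lagged_blocks: "fst_block (lagged x t) = x (t - 1)" "snd_block (lagged x t) = x (t - 2)"
  by (simp_all add: fst_block_def snd_block_def lagged_def vec_eq_iff)

lemma D_LA_transpose: "transpose D_LA *v p = fst_block p"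
proof (subst vec_eq_iff, rule allI)
  fix i
  have "(transpose D_LA *v p) $ i = (\<Sum>k\<in>UNIV <+> UNIV. D_LA $ k $ i * p $ k)"
    by (simp add: matrix_vector_mult_def transpose_def)
  also have "\<dots> = p $ Inl i"
    by (subst sum.Plus) (simp_all add: D_LA_def if_distrib[of "\<lambda>x. x * _"] cong: if_cong)
  finally show "(transpose D_LA *v p) $ i = fst_block p $ i" by (simp add: fst_block_def)
qed

text \<open>
  Applied to one linear combination \<open>b\<close> of the equations, the regression has a scalar response.
\<close>

lemma Gamma_LA_normal_equations:
  fixes x :: "nat \<Rightarrow> real^'d" and m :: nat and b :: "real^'d"
  defines "l \<equiv> \<lambda>s. lagged x (s + 2)"
  assumes inv: "invertible (cross l l m)"
  obtains \<pi> where "transpose (Gamma_LA (m + 1) x) *v b = fst_block \<pi>"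
    and "(\<Sum>s<m. (x (s + 2) \<bullet> b - l s \<bullet> \<pi>) *\<^sub>R l s) = 0"
proof -
  let ?G = "cross l l m" and ?H = "cross (\<lambda>s. x (s + 2)) l m"
  have sh: "(\<Sum>t=2..m + 1. f t) = (\<Sum>s<m. f (s + 2))" for f :: "nat \<Rightarrow> 'x::comm_monoid_add"
    by (rule sum.reindex_bij_witness[of _ "\<lambda>s. s + 2" "\<lambda>t. t - 2"]) (auto intro!: arg_cong[of _ _ f])
  have Pi: "Pi_LA (m + 1) x = ?H ** matrix_inv ?G"
    unfolding Pi_LA_def sh cross_def l_def ..
  define \<pi> where "\<pi> = transpose (Pi_LA (m + 1) x) *v b"
  have symG: "transpose ?G = ?G" by (rule transpose_cross)
  have "?G *v \<pi> = (?G ** matrix_inv ?G) *v (transpose ?H *v b)"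
    unfolding \<pi>_def Pi by (simp add: matrix_transpose_mul matrix_inv_transpose_sym[OF inv symG] matrix_vector_mul_assoc matrix_mul_assoc)
  then have "?G *v \<pi> = transpose ?H *v b" by (simp add: matrix_inv_mult[OF inv])
  then have "(\<Sum>s<m. (l s \<bullet> \<pi>) *\<^sub>R l s) = (\<Sum>s<m. (x (s + 2) \<bullet> b) *\<^sub>R l s)"
    by (simp add: transpose_cross cross_mult_vec)
  then have 2: "(\<Sum>s<m. (x (s + 2) \<bullet> b - l s \<bullet> \<pi>) *\<^sub>R l s) = 0"
    by (simp add: scaleR_diff_left sum_subtractf)
  have 1: "transpose (Gamma_LA (m + 1) x) *v b = fst_block \<pi>"
    by (simp add: Gamma_LA_def matrix_transpose_mul \<pi>_def matrix_vector_mul_assoc[symmetric] D_LA_transpose)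
  show thesis by (rule that[OF 1 2])
qed

text \<open>
  On the event described by the hypotheses, the estimator is the least squares coefficient of the
  current innovation on the previous one up to an error of order \<open>\<kappa> + \<eta>\<close>. Regressing on two lags
  is the same as regressing on the previous innovation and the second lag, and the second lag
  enters only through the self-normalised quantities, whose bound \<open>\<kappa> sqrt n\<close> is negligible.
\<close>

lemma lag_augmented_error:
  fixes X e :: "nat \<Rightarrow> real^'d" and \<Gamma> S :: "real^'d^'d" and n m :: nat
  assumes rec: "\<And>t. X (Suc t) = \<Gamma> *v X t + e (Suc t)"
    and nm: "n = m + 1" "m = k + 1"
    and sym: "transpose S = S" and c: "c > 0" and S: "\<And>x. c * (x \<bullet> x) \<le> x \<bullet> (S *v x)"
    and G: "\<And>v. norm (transpose \<Gamma> *v v) \<le> G * norm v"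
    and U: "norm (cross (\<lambda>s. e (s + 1)) (\<lambda>s. e (s + 1)) m - real n *\<^sub>R S) \<le> real n * \<eta>"
    and U': "norm (cross (\<lambda>s. e (s + 1)) (\<lambda>s. e (s + 1)) k - real n *\<^sub>R S) \<le> real n * \<eta>"
    and q1: "total_self_norm X (\<lambda>s. e (s + 1)) m \<le> \<kappa> * sqrt n"
    and q1': "total_self_norm X (\<lambda>s. e (s + 1)) k \<le> \<kappa> * sqrt n"
    and q2: "total_self_norm X (\<lambda>s. e (s + 2)) m \<le> \<kappa> * sqrt n"
    and A: "norm (cross (\<lambda>s. e (s + 2)) (\<lambda>s. e (s + 1)) m) \<le> a * sqrt n"
    and \<eta>: "0 \<le> \<eta>" "\<eta> \<le> c / 4" and \<kappa>: "0 \<le> \<kappa>" "8 * (\<kappa> * sqrt n) \<le> c * n"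
    and large: "4 * (G\<^sup>2 + 1) \<le> c * n" "2 * (a + 2 * \<kappa>) \<le> c * sqrt n"
  shows "norm (sqrt n *\<^sub>R (Gamma_LA n X - \<Gamma>)
       - (1 / sqrt n) *\<^sub>R (cross (\<lambda>s. e (s + 2)) (\<lambda>s. e (s + 1)) m ** matrix_inv S))
    \<le> real CARD('d) * ((4 * \<kappa> + 2 * \<eta> * (a + 2 * \<kappa>) / c) / c)"
proof -
  define q where "q = \<kappa> * sqrt n"
  define e1 where "e1 = (\<lambda>s. e (s + 1))"
  define e2 where "e2 = (\<lambda>s. e (s + 2))"
  define Z where "Z v = (\<Sum>s<m. (X s \<bullet> v)\<^sup>2)" for v
  have n0: "real n > 0" using nm by simp
  have sq: "sqrt n > 0" "sqrt n * sqrt n = n" using n0 by auto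
  have q0: "0 \<le> q" using \<kappa> by (simp add: q_def)
  have qc: "8 * q \<le> c * n" using \<kappa> by (simp add: q_def)
  have Z0: "0 \<le> Z v" for v by (simp add: Z_def sum_nonneg)
  have Ulow: "(c - \<eta>) * n * (v \<bullet> v) \<le> v \<bullet> (C *v v)" if "norm (C - real n *\<^sub>R S) \<le> real n * \<eta>" for C v
  proof -
    have "\<bar>v \<bullet> ((C - real n *\<^sub>R S) *v v)\<bar> \<le> norm v * norm ((C - real n *\<^sub>R S) *v v)" by (rule Cauchy_Schwarz_ineq2)
    also have "\<dots> \<le> norm v * (real n * \<eta> * norm v)"
      by (intro mult_left_mono order_trans[OF norm_matrix_vector_le] mult_right_mono that) auto
    also have "\<dots> = \<eta> * n * (v \<bullet> v)" by (simp add: power2_norm_eq_inner[symmetric] power2_eq_square)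
    finally have "- (\<eta> * n * (v \<bullet> v)) \<le> v \<bullet> (C *v v) - n * (v \<bullet> (S *v v))"
      by (simp add: matrix_vector_mult_diff_rdistrib inner_diff_right scaleR_matrix_vector_assoc[symmetric])
    moreover have "n * (c * (v \<bullet> v)) \<le> n * (v \<bullet> (S *v v))" using S n0 by (intro mult_left_mono) auto
    ultimately show ?thesis by (simp add: algebra_simps)
  qed
  \<comment> \<open>The Gram matrix of the second lag dominates the identity: one step of the recursion turns
     its quadratic form into that of the innovations, up to a completed square.\<close>
  have Zge: "v \<bullet> v \<le> Z v" for v
  proof -
    let ?a = "transpose \<Gamma> *v v"
    define y where "y = sqrt (?a \<bullet> ?a + (\<Sum>s<k. (X s \<bullet> ?a)\<^sup>2))"
    have y2: "y\<^sup>2 = ?a \<bullet> ?a + (\<Sum>s<k. (X s \<bullet> ?a)\<^sup>2)" and y0: "0 \<le> y" by (auto simp: y_def sum_nonneg)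
    have step: "X (Suc s) \<bullet> v = X s \<bullet> ?a + e1 s \<bullet> v" for s
      using inner_transpose_matrix[of "X s" \<Gamma> v] by (simp add: rec e1_def inner_add_left)
    have "(norm (cross e1 X k *v ?a))\<^sup>2 \<le> q * y\<^sup>2"
      unfolding y2 using q1' by (intro order_trans[OF norm_cross_le] mult_right_mono) (auto simp: q_def e1_def sum_nonneg)
    then have "norm (cross e1 X k *v ?a) \<le> sqrt q * y"
      using y0 q0 by (metis real_le_rsqrt real_sqrt_mult real_sqrt_unique)
    then have cr: "\<bar>v \<bullet> (cross e1 X k *v ?a)\<bar> \<le> norm v * (sqrt q * y)"
      by (intro order_trans[OF Cauchy_Schwarz_ineq2] mult_left_mono) auto
    have "Z v = (X 0 \<bullet> v)\<^sup>2 + (\<Sum>s<k. (X (Suc s) \<bullet> v)\<^sup>2)"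
      unfolding Z_def nm by (simp add: sum.lessThan_Suc_shift del: sum.lessThan_Suc)
    also have "\<dots> \<ge> (\<Sum>s<k. (X s \<bullet> ?a)\<^sup>2) + 2 * (v \<bullet> (cross e1 X k *v ?a)) + v \<bullet> (cross e1 e1 k *v v)"
    proof -
      have "(\<Sum>s<k. (X (Suc s) \<bullet> v)\<^sup>2)
        = (\<Sum>s<k. (X s \<bullet> ?a)\<^sup>2 + 2 * ((e1 s \<bullet> v) * (X s \<bullet> ?a)) + (e1 s \<bullet> v) * (e1 s \<bullet> v))"
        unfolding step by (intro sum.cong refl) (simp add: power2_eq_square algebra_simps)
      then show ?thesis unfolding inner_cross by (simp add: sum.distrib sum_distrib_left)
    qed
    finally have 1: "(\<Sum>s<k. (X s \<bullet> ?a)\<^sup>2) + 2 * (v \<bullet> (cross e1 X k *v ?a)) + v \<bullet> (cross e1 e1 k *v v) \<le> Z v" .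
    have aa: "?a \<bullet> ?a \<le> G\<^sup>2 * (v \<bullet> v)"
      using power_mono[OF G[of v], of 2] by (simp add: power_mult_distrib power2_norm_eq_inner)
    have "0 \<le> (y - norm v * sqrt q)\<^sup>2" by simp
    then have 2: "2 * (norm v * (sqrt q * y)) \<le> y\<^sup>2 + q * (v \<bullet> v)"
      using q0 by (simp add: power2_diff power_mult_distrib power2_norm_eq_inner mult_ac)
    have 3: "(c - \<eta>) * n * (v \<bullet> v) \<le> v \<bullet> (cross e1 e1 k *v v)" unfolding e1_def by (rule Ulow[OF U'])
    have "(c - \<eta>) * n * (v \<bullet> v) - q * (v \<bullet> v) - G\<^sup>2 * (v \<bullet> v) \<le> Z v"
      using 1 2 3 cr aa y2 by linarith
    moreover have "v \<bullet> v * 1 \<le> v \<bullet> v * ((c - \<eta>) * n - q - G\<^sup>2)"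
    proof (intro mult_left_mono)
      have "\<eta> * n \<le> c / 4 * n" using \<eta> n0 by (intro mult_right_mono) auto
      moreover have "0 \<le> c * n" using c by simp
      ultimately show "1 \<le> (c - \<eta>) * n - q - G\<^sup>2" using qc large(1) by (simp add: algebra_simps)
    qed simp
    ultimately show ?thesis by (simp add: algebra_simps)
  qed
  have Wle: "norm (cross f X m *v v) \<le> sqrt (2 * q) * sqrt (Z v)" if "total_self_norm X f m \<le> q" for f v
  proof -
    have "(norm (cross f X m *v v))\<^sup>2 \<le> q * (v \<bullet> v + Z v)"
      unfolding Z_def using that by (intro order_trans[OF norm_cross_le] mult_right_mono) (auto simp: sum_nonneg)
    also have "\<dots> \<le> q * (2 * Z v)" using Zge[of v] q0 by (intro mult_left_mono) auto
    finally have "(norm (cross f X m *v v))\<^sup>2 \<le> (2 * q) * Z v" by simp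
    then have "norm (cross f X m *v v) \<le> sqrt ((2 * q) * Z v)" by (rule real_le_rsqrt)
    then show ?thesis by (simp only: real_sqrt_mult)
  qed
  have W1: "norm (cross e1 X m *v v) \<le> sqrt (2 * q) * sqrt (Z v)" for v
    using q1 by (intro Wle) (simp add: q_def e1_def)
  have W2: "norm (cross e2 X m *v v) \<le> sqrt (2 * q) * sqrt (Z v)" for v
    using q2 by (intro Wle) (simp add: q_def e2_def)
  let ?l = "\<lambda>s. lagged X (s + 2)"
  \<comment> \<open>The change of regressors: a coefficient vector for two lags, read as one for the previous
    innovation and the second lag.\<close>
  have l: "?l s \<bullet> \<pi> = e1 s \<bullet> fst_block \<pi> + X s \<bullet> (transpose \<Gamma> *v fst_block \<pi> + snd_block \<pi>)" for s \<pi>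
    using inner_transpose_matrix[of "X s" \<Gamma> "fst_block \<pi>"]
    by (simp add: inner_blocks lagged_blocks rec e1_def inner_add_left inner_add_right)
  have inv: "invertible (cross ?l ?l m)"
  proof (rule invertible_if_form_pos)
    fix \<pi> :: "real^('d + 'd)" assume \<pi>: "\<pi> \<noteq> 0"
    define p where "p = fst_block \<pi>"
    define r where "r = transpose \<Gamma> *v p + snd_block \<pi>"
    have "\<pi> \<bullet> (cross ?l ?l m *v \<pi>) = (\<Sum>s<m. (e1 s \<bullet> p + X s \<bullet> r)\<^sup>2)"
      by (simp only: inner_cross l p_def[symmetric] r_def[symmetric] power2_eq_square)
    also have "\<dots> = p \<bullet> (cross e1 e1 m *v p) + 2 * (p \<bullet> (cross e1 X m *v r)) + Z r"
    proof -
      have "(\<Sum>s<m. (e1 s \<bullet> p + X s \<bullet> r)\<^sup>2)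
        = (\<Sum>s<m. (e1 s \<bullet> p) * (e1 s \<bullet> p) + 2 * ((e1 s \<bullet> p) * (X s \<bullet> r)) + (X s \<bullet> r)\<^sup>2)"
        by (intro sum.cong refl) (simp add: power2_eq_square algebra_simps)
      then show ?thesis unfolding inner_cross Z_def by (simp add: sum.distrib sum_distrib_left)
    qed
    finally have eq: "\<pi> \<bullet> (cross ?l ?l m *v \<pi>) = p \<bullet> (cross e1 e1 m *v p) + 2 * (p \<bullet> (cross e1 X m *v r)) + Z r" .
    have u: "(c - \<eta>) * n * (p \<bullet> p) \<le> p \<bullet> (cross e1 e1 m *v p)" unfolding e1_def by (rule Ulow[OF U])
    have w: "\<bar>p \<bullet> (cross e1 X m *v r)\<bar> \<le> norm p * (sqrt (2 * q) * sqrt (Z r))"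
      using W1 by (intro order_trans[OF Cauchy_Schwarz_ineq2] mult_left_mono) auto
    show "0 < \<pi> \<bullet> (cross ?l ?l m *v \<pi>)"
    proof (cases "p = 0")
      case True
      then have "r \<noteq> 0" using \<pi> blocks_zero[of \<pi>] by (auto simp: p_def r_def)
      then have "0 < Z r" using Zge[of r] by (meson inner_gt_zero_iff less_le_trans)
      then show ?thesis unfolding eq using True by simp
    next
      case False
      have "0 \<le> (sqrt (Z r) - norm p * sqrt (2 * q))\<^sup>2" by simp
      then have "2 * (norm p * (sqrt (2 * q) * sqrt (Z r))) \<le> Z r + 2 * q * (p \<bullet> p)"
        using q0 Z0[of r] by (simp add: power2_diff power_mult_distrib power2_norm_eq_inner mult_ac)
      then have "(c - \<eta>) * n * (p \<bullet> p) - 2 * q * (p \<bullet> p) \<le> \<pi> \<bullet> (cross ?l ?l m *v \<pi>)"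
        unfolding eq using u w by linarith
      moreover have "0 < (p \<bullet> p) * ((c - \<eta>) * n - 2 * q)"
      proof (intro mult_pos_pos)
        have "\<eta> * n \<le> c / 4 * n" using \<eta> n0 by (intro mult_right_mono) auto
        moreover have "0 < c * n" using c n0 by simp
        ultimately show "0 < (c - \<eta>) * n - 2 * q" using qc by (simp add: algebra_simps)
      qed (use False in simp)
      ultimately show ?thesis by (simp add: algebra_simps)
    qed
  qed
  let ?A = "cross e2 e1 m"
  let ?err = "sqrt n *\<^sub>R (Gamma_LA n X - \<Gamma>) - (1 / sqrt n) *\<^sub>R (?A ** matrix_inv S)"
  let ?\<xi> = "(4 * \<kappa> + 2 * \<eta> * (a + 2 * \<kappa>) / c) / c"
  have Sinv: "invertible S"
    using S c by (intro invertible_if_form_pos) (metis inner_gt_zero_iff less_le_trans mult_pos_pos)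
  have Slow: "c * norm x \<le> norm (S *v x)" for x
  proof (cases "x = 0")
    case False
    have "c * (norm x * norm x) \<le> norm x * norm (S *v x)"
      using S[of x] Cauchy_Schwarz_ineq2[of x "S *v x"] by (simp add: power2_norm_eq_inner[symmetric] power2_eq_square)
    then have "norm x * (c * norm x) \<le> norm x * norm (S *v x)" by (simp add: mult_ac)
    then show ?thesis using False by simp
  qed simp
  have "norm (transpose ?err *v b) \<le> ?\<xi> * norm b" for b
  proof -
    obtain \<pi> where \<pi>: "transpose (Gamma_LA (m + 1) X) *v b = fst_block \<pi>"
      and ne: "(\<Sum>s<m. (X (s + 2) \<bullet> b - ?l s \<bullet> \<pi>) *\<^sub>R ?l s) = 0"
      by (rule Gamma_LA_normal_equations[OF inv, of b])
    \<comment> \<open>The errors of the coefficients of the previous innovation and of the second lag, and the residual.\<close>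
    define p where "p = fst_block \<pi> - transpose \<Gamma> *v b"
    define r where "r = transpose \<Gamma> *v fst_block \<pi> + snd_block \<pi> - transpose \<Gamma> *v (transpose \<Gamma> *v b)"
    define \<rho> where "\<rho> s = e2 s \<bullet> b - e1 s \<bullet> p - X s \<bullet> r" for s
    have res: "X (s + 2) \<bullet> b - ?l s \<bullet> \<pi> = \<rho> s" for s
    proof -
      have "X (s + 2) \<bullet> b = X (Suc s) \<bullet> (transpose \<Gamma> *v b) + e2 s \<bullet> b"
        using inner_transpose_matrix[of "X (Suc s)" \<Gamma> b] by (simp add: rec[of "Suc s"] e2_def inner_add_left)
      also have "X (Suc s) \<bullet> (transpose \<Gamma> *v b) = X s \<bullet> (transpose \<Gamma> *v (transpose \<Gamma> *v b)) + e1 s \<bullet> (transpose \<Gamma> *v b)"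
        using inner_transpose_matrix[of "X s" \<Gamma> "transpose \<Gamma> *v b"] by (simp add: rec[of s] e1_def inner_add_left)
      finally show ?thesis
        unfolding l \<rho>_def p_def r_def by (simp add: inner_diff_right inner_add_right)
    qed
    have orth: "(\<Sum>s<m. \<rho> s * (?l s \<bullet> h)) = 0" for h
    proof -
      have "(\<Sum>s<m. \<rho> s *\<^sub>R ?l s) \<bullet> h = 0" using ne by (simp only: res inner_zero_left)
      then show ?thesis by (simp add: inner_sum_left)
    qed
    have orthX: "(\<Sum>s<m. \<rho> s * (X s \<bullet> g)) = 0" for g
    proof -
      let ?h = "(\<chi> k. case k of Inl i \<Rightarrow> 0 | Inr i \<Rightarrow> g $ i) :: real^('d + 'd)"
      have "fst_block ?h = 0" "snd_block ?h = g" by (simp_all add: fst_block_def snd_block_def vec_eq_iff)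
      then show ?thesis using orth[of ?h, unfolded l] by simp
    qed
    have orthe: "(\<Sum>s<m. \<rho> s * (e1 s \<bullet> g)) = 0" for g
    proof -
      let ?h = "(\<chi> k. case k of Inl i \<Rightarrow> g $ i | Inr i \<Rightarrow> 0) :: real^('d + 'd)"
      have "fst_block ?h = g" "snd_block ?h = 0" by (simp_all add: fst_block_def snd_block_def vec_eq_iff)
      then have "(\<Sum>s<m. \<rho> s * (e1 s \<bullet> g + X s \<bullet> (transpose \<Gamma> *v g))) = 0" using orth[of ?h, unfolded l] by simp
      then show ?thesis using orthX[of "transpose \<Gamma> *v g"] by (simp add: distrib_left sum.distrib)
    qed
    \<comment> \<open>Orthogonality of the residual to the second lag determines the length of the fitted error \<open>r\<close>,
      orthogonality to the innovations then determines \<open>p\<close>.\<close>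
    have Zr: "Z r = b \<bullet> (cross e2 X m *v r) - p \<bullet> (cross e1 X m *v r)"
      using orthX[of r] unfolding inner_cross Z_def \<rho>_def
      by (simp add: left_diff_distrib sum_subtractf power2_eq_square)
    have Up: "cross e1 e1 m *v p = transpose ?A *v b - cross e1 X m *v r"
    proof -
      have "g \<bullet> (cross e1 e1 m *v p - (transpose ?A *v b - cross e1 X m *v r)) = 0" for g
      proof -
        have "(\<Sum>s<m. (e2 s \<bullet> b) * (e1 s \<bullet> g)) - (\<Sum>s<m. (e1 s \<bullet> p) * (e1 s \<bullet> g)) - (\<Sum>s<m. (X s \<bullet> r) * (e1 s \<bullet> g)) = 0"
          using orthe[of g] unfolding \<rho>_def by (simp add: left_diff_distrib sum_subtractf)
        then show ?thesis
          unfolding inner_diff_right transpose_cross inner_cross by (simp add: mult.commute)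
      qed
      then show ?thesis by (metis inner_eq_zero_iff right_minus_eq)
    qed
    have sZ: "sqrt (Z r) \<le> sqrt (2 * q) * (norm b + norm p)"
    proof -
      have "Z r \<le> norm b * (sqrt (2 * q) * sqrt (Z r)) + norm p * (sqrt (2 * q) * sqrt (Z r))"
        using Zr order_trans[OF Cauchy_Schwarz_ineq2[of b "cross e2 X m *v r"] mult_left_mono[OF W2 norm_ge_zero[of b]]]
          order_trans[OF Cauchy_Schwarz_ineq2[of p "cross e1 X m *v r"] mult_left_mono[OF W1 norm_ge_zero[of p]]]
        by linarith
      then have zz: "sqrt (Z r) * sqrt (Z r) \<le> sqrt (Z r) * (sqrt (2 * q) * (norm b + norm p))"
        using Z0[of r] by (simp add: algebra_simps)
      show ?thesis
      proof (cases "Z r = 0")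
        case False
        then have "0 < sqrt (Z r)" using Z0[of r] by simp
        then show ?thesis using zz by (simp only: mult_le_cancel_left_pos)
      qed (use q0 in simp)
    qed
    have Wr: "norm (cross e1 X m *v r) \<le> 2 * q * (norm b + norm p)"
    proof -
      have "norm (cross e1 X m *v r) \<le> sqrt (2 * q) * (sqrt (2 * q) * (norm b + norm p))"
        using sZ q0 by (intro order_trans[OF W1] mult_left_mono) auto
      also have "\<dots> = 2 * q * (norm b + norm p)" using q0 by (simp add: mult.assoc[symmetric])
      finally show ?thesis .
    qed
    define E where "E = cross e1 e1 m - real n *\<^sub>R S"
    have En: "norm (E *v p) \<le> n * \<eta> * norm p"
      using U unfolding E_def e1_def by (intro order_trans[OF norm_matrix_vector_le] mult_right_mono) auto
    have nSp: "n *\<^sub>R (S *v p) = transpose ?A *v b - cross e1 X m *v r - E *v p"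
      unfolding E_def matrix_vector_mult_diff_rdistrib Up[symmetric] by (simp add: scaleR_matrix_vector_assoc Up)
    have Ab: "norm (transpose ?A *v b) \<le> a * sqrt n * norm b"
      using A by (intro order_trans[OF norm_matrix_vector_le] mult_right_mono) (auto simp: norm_transpose e1_def e2_def)
    have a0: "0 \<le> a" using order_trans[OF norm_ge_zero A] sq by (simp add: zero_le_mult_iff)
    have p1: "c * n / 2 * norm p \<le> (a + 2 * \<kappa>) * sqrt n * norm b"
    proof -
      have "n * (c * norm p) \<le> n * norm (S *v p)" using Slow n0 by (intro mult_left_mono) auto
      also have "\<dots> = norm (n *\<^sub>R (S *v p))" by simp
      also have "\<dots> \<le> norm (transpose ?A *v b) + norm (cross e1 X m *v r) + norm (E *v p)"
        unfolding nSp by (intro order_trans[OF norm_triangle_ineq4] add_mono norm_triangle_ineq4) auto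
      also have "\<dots> \<le> a * sqrt n * norm b + 2 * q * (norm b + norm p) + n * \<eta> * norm p"
        by (intro add_mono Ab Wr En)
      finally have 1: "n * (c * norm p) \<le> a * sqrt n * norm b + 2 * q * norm b + (2 * q + n * \<eta>) * norm p"
        by (simp add: algebra_simps)
      have "\<eta> * n \<le> c / 4 * n" using \<eta> n0 by (intro mult_right_mono) auto
      then have "(2 * q + n * \<eta>) * norm p \<le> (c * n / 2) * norm p"
        using qc by (intro mult_right_mono) (simp_all add: mult.commute)
      then have "c * n / 2 * norm p \<le> a * sqrt n * norm b + 2 * q * norm b"
        using 1 by (simp add: algebra_simps)
      then show ?thesis by (simp add: q_def algebra_simps)
    qed
    have p2: "sqrt n * norm p \<le> 2 * (a + 2 * \<kappa>) / c * norm b"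
    proof -
      have "sqrt n * (c / 2 * (sqrt n * norm p)) \<le> sqrt n * ((a + 2 * \<kappa>) * norm b)"
        using p1 sq by (simp add: mult_ac)
      then have "c / 2 * (sqrt n * norm p) \<le> (a + 2 * \<kappa>) * norm b" using sq(1) by (simp only: mult_le_cancel_left_pos)
      then show ?thesis using c by (simp add: field_simps)
    qed
    \<comment> \<open>A crude bound on \<open>p\<close>, sufficient inside the remainder terms.\<close>
    have p3: "norm p \<le> norm b"
    proof -
      have "2 * (a + 2 * \<kappa>) / c \<le> sqrt n" using large(2) c by (simp add: field_simps)
      then have "sqrt n * norm p \<le> sqrt n * norm b" using p2 by (smt (verit) mult_right_mono norm_ge_zero)
      then show ?thesis using sq(1) by simp
    qed
    have err: "transpose ?err *v b = sqrt n *\<^sub>R p - (1 / sqrt n) *\<^sub>R (matrix_inv S *v (transpose ?A *v b))"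
    proof -
      have "transpose ?err = sqrt n *\<^sub>R (transpose (Gamma_LA n X) - transpose \<Gamma>) - (1 / sqrt n) *\<^sub>R (matrix_inv S ** transpose ?A)"
        using matrix_transpose_mul[of ?A "matrix_inv S"] matrix_inv_transpose_sym[OF Sinv sym]
        by (simp add: vec_eq_iff transpose_def)
      then show ?thesis
        using \<pi> by (simp add: nm p_def matrix_vector_mult_diff_rdistrib scaleR_matrix_vector_assoc[symmetric] matrix_vector_mul_assoc)
    qed
    have "S *v (transpose ?err *v b) = (1 / sqrt n) *\<^sub>R (n *\<^sub>R (S *v p) - transpose ?A *v b)"
    proof -
      have "sqrt n = (1 / sqrt n) * n" using sq by (simp add: field_simps)
      then have "sqrt n *\<^sub>R (S *v p) = (1 / sqrt n) *\<^sub>R (n *\<^sub>R (S *v p))" by (simp only: scaleR_scaleR)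
      then show ?thesis unfolding err
        by (simp add: matrix_vector_mult_diff_distrib matrix_vector_mult_scaleR matrix_vector_mul_assoc[of S "matrix_inv S"]
            matrix_inv_mult[OF Sinv] scaleR_diff_right)
    qed
    also have "\<dots> = - ((1 / sqrt n) *\<^sub>R (cross e1 X m *v r + E *v p))"
      unfolding nSp by (simp add: scaleR_diff_right scaleR_add_right)
    finally have "norm (S *v (transpose ?err *v b)) = (1 / sqrt n) * norm (cross e1 X m *v r + E *v p)"
      using sq by simp
    also have "\<dots> \<le> (1 / sqrt n) * (2 * q * (norm b + norm p) + n * \<eta> * norm p)"
      using Wr En sq by (intro mult_left_mono order_trans[OF norm_triangle_ineq] add_mono) auto
    also have "\<dots> = 2 * \<kappa> * (norm b + norm p) + \<eta> * (sqrt n * norm p)"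
    proof -
      have "(1 / sqrt n) * n = sqrt n" "(1 / sqrt n) * sqrt n = 1" using sq by (simp_all add: field_simps)
      moreover have "g * (2 * (\<kappa> * w) * B + N * \<eta> * P) = 2 * \<kappa> * B * (g * w) + \<eta> * ((g * N) * P)"
        for g w B N P :: real by (simp add: distrib_left)
      ultimately show ?thesis unfolding q_def by (simp only: mult_1_right)
    qed
    also have "\<dots> \<le> 2 * \<kappa> * (norm b + norm b) + \<eta> * (2 * (a + 2 * \<kappa>) / c * norm b)"
      using p2 p3 \<kappa> \<eta> by (intro add_mono mult_left_mono) auto
    also have "\<dots> = (4 * \<kappa> + 2 * \<eta> * (a + 2 * \<kappa>) / c) * norm b" by (simp add: distrib_right)
    finally have "c * norm (transpose ?err *v b) \<le> (4 * \<kappa> + 2 * \<eta> * (a + 2 * \<kappa>) / c) * norm b"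
      using Slow[of "transpose ?err *v b"] by linarith
    then have "norm (transpose ?err *v b) \<le> ((4 * \<kappa> + 2 * \<eta> * (a + 2 * \<kappa>) / c) * norm b) / c"
      using c by (simp add: pos_le_divide_eq mult.commute)
    then show ?thesis by simp
  qed
  then show ?thesis unfolding e1_def e2_def by (rule norm_matrix_le_transpose_mult)
qed

section \<open>Moments of the noise\<close>

lemma space_generated_filtration [simp]: "space (generated_filtration M Y t) = space M"
  unfolding generated_filtration_def by (intro space_measure_of) auto

lemma sets_generated_filtration:
  "sets (generated_filtration M Y t) = sigma_sets (space M) (\<Union>s\<in>{..t}. {Y s -` A \<inter> space M | A. A \<in> sets borel})"
  unfolding generated_filtration_def by (intro sets_measure_of) auto

lemma generated_filtration_adapted:
  assumes "s \<le> t"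
  shows "Y s \<in> borel_measurable (generated_filtration M Y t)"
proof (rule measurableI)
  fix A :: "'b set" assume "A \<in> sets borel"
  then show "Y s -` A \<inter> space (generated_filtration M Y t) \<in> sets (generated_filtration M Y t)"
    unfolding sets_generated_filtration using assms by (auto intro!: sigma_sets.Basic)
qed auto

lemma subalgebra_generated_filtration:
  assumes "\<And>t. Y t \<in> borel_measurable M"
  shows "subalgebra M (generated_filtration M Y t)"
  unfolding subalgebra_def sets_generated_filtration
  using assms by (auto intro!: sets.sigma_sets_subset measurable_sets)

text \<open>
  The constants \<open>C\<close> and \<open>\<delta>\<close> are common to all parameters, and so is every bound derived from them.
\<close>

locale noise = prob_space +
  fixes \<epsilon> :: "nat \<Rightarrow> 'a \<Rightarrow> real^'d" and S :: "real^'d^'d" and C \<delta> :: real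
  assumes \<epsilon>_measurable [measurable]: "\<And>t. \<epsilon> t \<in> borel_measurable M"
    and mean_zero: "\<And>t i. AE \<omega> in M. real_cond_exp M (generated_filtration M \<epsilon> t) (\<lambda>\<omega>. \<epsilon> (Suc t) \<omega> $ i) \<omega> = 0"
    and covariance: "\<And>t i j. AE \<omega> in M.
      real_cond_exp M (generated_filtration M \<epsilon> t) (\<lambda>\<omega>. \<epsilon> (Suc t) \<omega> $ i * \<epsilon> (Suc t) \<omega> $ j) \<omega> = S $ i $ j"
    and moment: "\<And>t. (\<integral>\<^sup>+\<omega>. ennreal (norm (\<epsilon> t \<omega>) powr (2 + \<delta>)) \<partial>M) \<le> ennreal C"
    and C_nonneg: "0 \<le> C" and \<delta>: "0 < \<delta>" "\<delta> \<le> 1"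
begin

abbreviation F :: "nat \<Rightarrow> 'a measure" where "F \<equiv> generated_filtration M \<epsilon>"

lemma F_subalgebra: "subalgebra M (F t)"
  by (rule subalgebra_generated_filtration) (rule \<epsilon>_measurable)

lemma F_measurable_M: "f \<in> borel_measurable (F t) \<Longrightarrow> f \<in> borel_measurable M"
  by (rule measurable_from_subalg[OF F_subalgebra])

lemma \<epsilon>_adapted: "s \<le> t \<Longrightarrow> \<epsilon> s \<in> borel_measurable (F t)"
  by (rule generated_filtration_adapted)

lemma F_sigma_finite: "sigma_finite_subalgebra M (F t)"
  by (intro finite_measure_subalgebra_is_sigma_finite finite_measure_subalgebra.intro
      finite_measure_subalgebra_axioms.intro F_subalgebra) unfold_locales

lemma moment_integrable: "integrable M (\<lambda>\<omega>. norm (\<epsilon> t \<omega>) powr (2 + \<delta>))"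
  and moment_le: "(\<integral>\<omega>. norm (\<epsilon> t \<omega>) powr (2 + \<delta>) \<partial>M) \<le> C"
proof -
  have "(\<integral>\<^sup>+\<omega>. ennreal (norm (\<epsilon> t \<omega>) powr (2 + \<delta>)) \<partial>M) < \<infinity>"
    using moment[of t] by (simp add: le_less_trans)
  then show i: "integrable M (\<lambda>\<omega>. norm (\<epsilon> t \<omega>) powr (2 + \<delta>))" by (intro integrableI_bounded) auto
  have "ennreal (\<integral>\<omega>. norm (\<epsilon> t \<omega>) powr (2 + \<delta>) \<partial>M) \<le> ennreal C"
    using moment[of t] by (subst nn_integral_eq_integral[symmetric, OF i]) auto
  then show "(\<integral>\<omega>. norm (\<epsilon> t \<omega>) powr (2 + \<delta>) \<partial>M) \<le> C" using C_nonneg by simp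
qed

lemma square_le_powr: "x\<^sup>2 \<le> 1 + x powr (2 + \<delta>)" if "0 \<le> x" for x :: real
proof (cases "x \<le> 1")
  case True
  then have "x\<^sup>2 \<le> 1" using that by (simp add: power_le_one)
  then show ?thesis by (smt (verit) powr_ge_zero)
next
  case False
  then have "x powr 2 \<le> x powr (2 + \<delta>)" using \<delta> by (intro powr_mono) auto
  then show ?thesis using False by simp
qed

lemma square_integrable [simp, intro]: "integrable M (\<lambda>\<omega>. (norm (\<epsilon> t \<omega>))\<^sup>2)"
  and square_le: "(\<integral>\<omega>. (norm (\<epsilon> t \<omega>))\<^sup>2 \<partial>M) \<le> 1 + C"
proof -
  have i: "integrable M (\<lambda>\<omega>. 1 + norm (\<epsilon> t \<omega>) powr (2 + \<delta>))" using moment_integrable by simp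
  show "integrable M (\<lambda>\<omega>. (norm (\<epsilon> t \<omega>))\<^sup>2)"
    by (rule Bochner_Integration.integrable_bound[OF i]) (auto intro!: AE_I2 square_le_powr order_trans[OF square_le_powr])
  then have "(\<integral>\<omega>. (norm (\<epsilon> t \<omega>))\<^sup>2 \<partial>M) \<le> (\<integral>\<omega>. 1 + norm (\<epsilon> t \<omega>) powr (2 + \<delta>) \<partial>M)"
    using i by (intro integral_mono square_le_powr) auto
  also have "\<dots> \<le> 1 + C" using moment_integrable[of t] moment_le[of t] prob_space by simp
  finally show "(\<integral>\<omega>. (norm (\<epsilon> t \<omega>))\<^sup>2 \<partial>M) \<le> 1 + C" .
qed

lemma coord_prod_le: "\<bar>x $ i * x $ j\<bar> \<le> (norm (x :: real^'d))\<^sup>2"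
  using mult_mono[OF component_le_norm_cart[of x i] component_le_norm_cart[of x j]]
  by (simp add: abs_mult power2_eq_square)

lemma coord_prod_integrable: "integrable M (\<lambda>\<omega>. \<epsilon> t \<omega> $ i * \<epsilon> t \<omega> $ j)"
  by (rule Bochner_Integration.integrable_bound[OF square_integrable[of t]]) (auto intro!: AE_I2 simp: coord_prod_le)

lemma coord_square_integrable: "integrable M (\<lambda>\<omega>. (\<epsilon> t \<omega> $ i)\<^sup>2)"
  using coord_prod_integrable[of t i i] by (simp add: power2_eq_square)

lemma mean_orthogonal:
  assumes Z: "Z \<in> borel_measurable (F t)" and int: "integrable M (\<lambda>\<omega>. Z \<omega> * \<epsilon> (Suc t) \<omega> $ i)"
  shows "(\<integral>\<omega>. Z \<omega> * \<epsilon> (Suc t) \<omega> $ i \<partial>M) = 0"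
proof -
  interpret sigma_finite_subalgebra M "F t" by (rule F_sigma_finite)
  have "(\<integral>\<omega>. Z \<omega> * \<epsilon> (Suc t) \<omega> $ i \<partial>M) = (\<integral>\<omega>. Z \<omega> * real_cond_exp M (F t) (\<lambda>\<omega>. \<epsilon> (Suc t) \<omega> $ i) \<omega> \<partial>M)"
    by (rule real_cond_exp_intg(2)[OF int Z, symmetric]) simp
  also have "\<dots> = (\<integral>\<omega>. 0 \<partial>M)"
    using mean_zero[of t i] F_measurable_M[OF Z]
    by (intro integral_cong_AE) auto
  finally show ?thesis by simp
qed

lemma covariance_eq:
  assumes Z: "Z \<in> borel_measurable (F t)" and int: "integrable M (\<lambda>\<omega>. Z \<omega> * (\<epsilon> (Suc t) \<omega> $ i * \<epsilon> (Suc t) \<omega> $ j))"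
  shows "(\<integral>\<omega>. Z \<omega> * (\<epsilon> (Suc t) \<omega> $ i * \<epsilon> (Suc t) \<omega> $ j) \<partial>M) = S $ i $ j * (\<integral>\<omega>. Z \<omega> \<partial>M)"
proof -
  interpret sigma_finite_subalgebra M "F t" by (rule F_sigma_finite)
  have "(\<integral>\<omega>. Z \<omega> * (\<epsilon> (Suc t) \<omega> $ i * \<epsilon> (Suc t) \<omega> $ j) \<partial>M)
     = (\<integral>\<omega>. Z \<omega> * real_cond_exp M (F t) (\<lambda>\<omega>. \<epsilon> (Suc t) \<omega> $ i * \<epsilon> (Suc t) \<omega> $ j) \<omega> \<partial>M)"
    by (rule real_cond_exp_intg(2)[OF int Z, symmetric]) simp
  also have "\<dots> = (\<integral>\<omega>. Z \<omega> * S $ i $ j \<partial>M)"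
    using covariance[of t i j] F_measurable_M[OF Z]
    by (intro integral_cong_AE) auto
  finally show ?thesis by (simp add: mult.commute)
qed

lemma bounded_mult_integrable:
  assumes Z: "Z \<in> borel_measurable M" "\<And>\<omega>. \<bar>Z \<omega>\<bar> \<le> B" and Y: "integrable M Y"
  shows "integrable M (\<lambda>\<omega>. Z \<omega> * Y \<omega> :: real)"
proof (rule Bochner_Integration.integrable_bound)
  show "integrable M (\<lambda>\<omega>. B * Y \<omega>)" using Y by simp
  show "(\<lambda>\<omega>. Z \<omega> * Y \<omega>) \<in> borel_measurable M" using Z Y by (auto dest: borel_measurable_integrable)
  show "AE \<omega> in M. norm (Z \<omega> * Y \<omega>) \<le> norm (B * Y \<omega>)"
  proof (rule AE_I2)
    fix \<omega>
    have "\<bar>Z \<omega>\<bar> * \<bar>Y \<omega>\<bar> \<le> \<bar>B\<bar> * \<bar>Y \<omega>\<bar>" using Z(2)[of \<omega>] by (intro mult_right_mono) auto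
    then show "norm (Z \<omega> * Y \<omega>) \<le> norm (B * Y \<omega>)" by (simp add: abs_mult)
  qed
qed

lemma S_eq: "S $ i $ j = (\<integral>\<omega>. \<epsilon> (Suc t) \<omega> $ i * \<epsilon> (Suc t) \<omega> $ j \<partial>M)"
  using covariance_eq[of "\<lambda>_. 1" t i j] coord_prod_integrable[of "Suc t" i j] prob_space by simp

lemma S_sym: "transpose S = S"
  by (simp add: vec_eq_iff transpose_def S_eq[of _ _ 0] mult.commute)

lemma S_entry_le: "\<bar>S $ i $ j\<bar> \<le> 1 + C"
proof -
  have "\<bar>S $ i $ j\<bar> \<le> (\<integral>\<omega>. \<bar>\<epsilon> 1 \<omega> $ i * \<epsilon> 1 \<omega> $ j\<bar> \<partial>M)"
    using S_eq[of i j 0] by (simp add: integral_abs_bound)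
  also have "\<dots> \<le> (\<integral>\<omega>. (norm (\<epsilon> 1 \<omega>))\<^sup>2 \<partial>M)"
    using coord_prod_integrable by (intro integral_mono coord_prod_le) auto
  finally show ?thesis using square_le[of 1] by linarith
qed

lemma trace_le: "(\<Sum>i\<in>UNIV. S $ i $ i) \<le> 1 + C"
proof -
  have "(\<Sum>i\<in>UNIV. S $ i $ i) = (\<integral>\<omega>. (norm (\<epsilon> 1 \<omega>))\<^sup>2 \<partial>M)"
    unfolding S_eq[of _ _ 0] power2_norm_eq_inner inner_vec_def
    by (subst Bochner_Integration.integral_sum) (auto simp: coord_prod_integrable)
  then show ?thesis using square_le[of 1] by simp
qed

lemma S_diag_nonneg: "0 \<le> S $ i $ i"
  unfolding S_eq[of _ _ 0] by (rule integral_nonneg_AE) auto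

text \<open>
  The weight \<open>Z\<close> is unbounded in the applications. The conditional covariance is applied to its
  truncations, and Fatou's lemma removes the truncation.
\<close>

lemma norm_sq_mult_le:
  assumes Z: "Z \<in> borel_measurable (F t)" "\<And>\<omega>. 0 \<le> Z \<omega>" and Zi: "integrable M Z"
  shows "integrable M (\<lambda>\<omega>. Z \<omega> * (norm (\<epsilon> (Suc t) \<omega>))\<^sup>2)"
    and "(\<integral>\<omega>. Z \<omega> * (norm (\<epsilon> (Suc t) \<omega>))\<^sup>2 \<partial>M) \<le> (1 + C) * (\<integral>\<omega>. Z \<omega> \<partial>M)"
proof -
  let ?E = "\<lambda>\<omega>. (norm (\<epsilon> (Suc t) \<omega>))\<^sup>2"
  define Zk where "Zk k \<omega> = min (Z \<omega>) (real k)" for k \<omega>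
  have ZkF: "Zk k \<in> borel_measurable (F t)" for k unfolding Zk_def[abs_def] using Z(1) by measurable
  have Zkb: "\<bar>Zk k \<omega>\<bar> \<le> real k" "0 \<le> Zk k \<omega>" "Zk k \<omega> \<le> Z \<omega>" for k \<omega> using Z(2)[of \<omega>] by (auto simp: Zk_def)
  have ZkM: "Zk k \<in> borel_measurable M" for k by (rule F_measurable_M[OF ZkF])
  have Zki: "integrable M (Zk k)" for k
    by (rule integrable_const_bound[where B="real k"]) (use Zkb ZkM in auto)
  have trace0: "0 \<le> (\<Sum>i\<in>UNIV. S $ i $ i)" by (intro sum_nonneg S_diag_nonneg)
  have ki: "integrable M (\<lambda>\<omega>. Zk k \<omega> * ?E \<omega>)" for k
    by (rule bounded_mult_integrable[OF ZkM Zkb(1)]) simp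
  have kv: "(\<integral>\<omega>. Zk k \<omega> * ?E \<omega> \<partial>M) \<le> (1 + C) * (\<integral>\<omega>. Z \<omega> \<partial>M)" for k
  proof -
    have "(\<integral>\<omega>. Zk k \<omega> * ?E \<omega> \<partial>M) = (\<integral>\<omega>. (\<Sum>i\<in>UNIV. Zk k \<omega> * (\<epsilon> (Suc t) \<omega> $ i * \<epsilon> (Suc t) \<omega> $ i)) \<partial>M)"
      unfolding power2_norm_eq_inner inner_vec_def by (simp add: sum_distrib_left)
    also have "\<dots> = (\<Sum>i\<in>UNIV. \<integral>\<omega>. Zk k \<omega> * (\<epsilon> (Suc t) \<omega> $ i * \<epsilon> (Suc t) \<omega> $ i) \<partial>M)"
      by (intro Bochner_Integration.integral_sum bounded_mult_integrable[OF ZkM Zkb(1)] coord_prod_integrable)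
    also have "\<dots> = (\<Sum>i\<in>UNIV. S $ i $ i) * (\<integral>\<omega>. Zk k \<omega> \<partial>M)"
      unfolding sum_distrib_right
      by (intro sum.cong refl covariance_eq ZkF bounded_mult_integrable[OF ZkM Zkb(1)] coord_prod_integrable)
    also have "\<dots> \<le> (1 + C) * (\<integral>\<omega>. Z \<omega> \<partial>M)"
    proof (rule mult_mono[OF trace_le])
      show "(\<integral>\<omega>. Zk k \<omega> \<partial>M) \<le> (\<integral>\<omega>. Z \<omega> \<partial>M)" by (intro integral_mono Zki Zi Zkb)
      show "0 \<le> (\<integral>\<omega>. Zk k \<omega> \<partial>M)" using Zkb(2) by (intro integral_nonneg_AE) auto
    qed (use C_nonneg in simp)
    finally show ?thesis .
  qed
  have lim: "(\<lambda>k. Zk k \<omega> * ?E \<omega>) \<longlonglongrightarrow> Z \<omega> * ?E \<omega>" for \<omega>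
  proof (rule tendsto_eventually, rule eventually_sequentiallyI[of "nat \<lceil>Z \<omega>\<rceil>"])
    fix k assume "nat \<lceil>Z \<omega>\<rceil> \<le> k"
    then have "Z \<omega> \<le> real k" by linarith
    then show "Zk k \<omega> * ?E \<omega> = Z \<omega> * ?E \<omega>" by (simp add: Zk_def)
  qed
  have ZEm: "(\<lambda>\<omega>. Z \<omega> * ?E \<omega>) \<in> borel_measurable M"
    using F_measurable_M[OF Z(1)] by measurable
  have ZE0: "0 \<le> Z \<omega> * ?E \<omega>" for \<omega> using Z(2) by simp
  have "(\<integral>\<^sup>+\<omega>. ennreal (Z \<omega> * ?E \<omega>) \<partial>M) \<le> liminf (\<lambda>k. \<integral>\<^sup>+\<omega>. ennreal (Zk k \<omega> * ?E \<omega>) \<partial>M)"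
  proof -
    have "(\<integral>\<^sup>+\<omega>. ennreal (Z \<omega> * ?E \<omega>) \<partial>M) = (\<integral>\<^sup>+\<omega>. liminf (\<lambda>k. ennreal (Zk k \<omega> * ?E \<omega>)) \<partial>M)"
      by (intro nn_integral_cong lim_imp_Liminf[symmetric] tendsto_ennrealI lim) simp
    also have "\<dots> \<le> liminf (\<lambda>k. \<integral>\<^sup>+\<omega>. ennreal (Zk k \<omega> * ?E \<omega>) \<partial>M)"
      by (intro nn_integral_liminf measurable_compose[OF borel_measurable_integrable[OF ki] measurable_ennreal])
    finally show ?thesis .
  qed
  also have "\<dots> \<le> ennreal ((1 + C) * (\<integral>\<omega>. Z \<omega> \<partial>M))"
  proof -
    have b: "(\<integral>\<^sup>+\<omega>. ennreal (Zk k \<omega> * ?E \<omega>) \<partial>M) \<le> ennreal ((1 + C) * (\<integral>\<omega>. Z \<omega> \<partial>M))" for k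
    proof -
      have "(\<integral>\<^sup>+\<omega>. ennreal (Zk k \<omega> * ?E \<omega>) \<partial>M) = ennreal (\<integral>\<omega>. Zk k \<omega> * ?E \<omega> \<partial>M)"
        using Zkb(2) by (intro nn_integral_eq_integral ki) auto
      also have "\<dots> \<le> ennreal ((1 + C) * (\<integral>\<omega>. Z \<omega> \<partial>M))" by (intro ennreal_leI kv)
      finally show ?thesis .
    qed
    have "liminf (\<lambda>k. \<integral>\<^sup>+\<omega>. ennreal (Zk k \<omega> * ?E \<omega>) \<partial>M) \<le> liminf (\<lambda>k::nat. ennreal ((1 + C) * (\<integral>\<omega>. Z \<omega> \<partial>M)))"
      by (intro Liminf_mono always_eventually allI b)
    also have "\<dots> = ennreal ((1 + C) * (\<integral>\<omega>. Z \<omega> \<partial>M))" by (rule Liminf_const) simp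
    finally show ?thesis .
  qed
  finally have le: "(\<integral>\<^sup>+\<omega>. ennreal (Z \<omega> * ?E \<omega>) \<partial>M) \<le> ennreal ((1 + C) * (\<integral>\<omega>. Z \<omega> \<partial>M))" .
  show i: "integrable M (\<lambda>\<omega>. Z \<omega> * ?E \<omega>)"
    using le ZE0 by (intro integrableI_bounded ZEm) (auto intro: le_less_trans)
  have "ennreal (\<integral>\<omega>. Z \<omega> * ?E \<omega> \<partial>M) \<le> ennreal ((1 + C) * (\<integral>\<omega>. Z \<omega> \<partial>M))"
    using le ZE0 by (subst nn_integral_eq_integral[symmetric, OF i]) auto
  moreover have "0 \<le> (1 + C) * (\<integral>\<omega>. Z \<omega> \<partial>M)"
    using C_nonneg Z(2) by (intro mult_nonneg_nonneg integral_nonneg_AE) auto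
  ultimately show "(\<integral>\<omega>. Z \<omega> * ?E \<omega> \<partial>M) \<le> (1 + C) * (\<integral>\<omega>. Z \<omega> \<partial>M)" by simp
qed

text \<open>
  A product of two coordinates has moments of order \<open>1 + \<delta> / 2 > 1\<close> only; hence a law of large
  numbers in mean rather than in mean square.
\<close>

lemma lln_entry:
  assumes n: "n \<ge> 1"
  shows "(\<integral>\<omega>. \<bar>\<Sum>s<n. \<epsilon> (Suc s) \<omega> $ i * \<epsilon> (Suc s) \<omega> $ j - S $ i $ j\<bar> \<partial>M)
    \<le> (1 + 8 * (C + (1 + C)\<^sup>2)) * real n powr (1 / (1 + \<delta> / 2))"
proof -
  define p where "p = 1 + \<delta> / 2"
  have p: "1 \<le> p" "p \<le> 2" "p > 0" using \<delta> by (auto simp: p_def)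
  define Y where "Y s \<omega> = \<epsilon> (Suc s) \<omega> $ i * \<epsilon> (Suc s) \<omega> $ j - S $ i $ j" for s \<omega>
  have Yi: "integrable M (Y s)" for s unfolding Y_def[abs_def] using coord_prod_integrable prob_space by simp
  let ?K = "4 * (C + (1 + C)\<^sup>2)"
  have ptw: "\<bar>Y s \<omega>\<bar> powr p \<le> 4 * (norm (\<epsilon> (Suc s) \<omega>) powr (2 + \<delta>) + (1 + C)\<^sup>2)" for s \<omega>
  proof -
    let ?u = "(norm (\<epsilon> (Suc s) \<omega>))\<^sup>2"
    have "\<bar>Y s \<omega>\<bar> \<le> ?u + (1 + C)"
      unfolding Y_def using coord_prod_le[of "\<epsilon> (Suc s) \<omega>" i j] S_entry_le[of i j] by linarith
    also have "\<dots> \<le> 2 * max ?u (1 + C)" by (simp add: max_def)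
    finally have "\<bar>Y s \<omega>\<bar> powr p \<le> (2 * max ?u (1 + C)) powr p" using p by (intro powr_mono2) auto
    also have "\<dots> = 2 powr p * max ?u (1 + C) powr p" using C_nonneg by (simp add: powr_mult)
    also have "\<dots> \<le> 2 powr 2 * (?u powr p + (1 + C) powr p)"
      using p C_nonneg by (intro mult_mono powr_mono) (auto simp: max_def)
    also have "?u powr p = norm (\<epsilon> (Suc s) \<omega>) powr (2 + \<delta>)"
    proof -
      have "?u powr p = (norm (\<epsilon> (Suc s) \<omega>) powr 2) powr p" by simp
      also have "\<dots> = norm (\<epsilon> (Suc s) \<omega>) powr (2 + \<delta>)" unfolding powr_powr by (simp add: p_def distrib_left)
      finally show ?thesis .
    qed
    also have "(1 + C) powr p \<le> (1 + C)\<^sup>2"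
      using p C_nonneg powr_mono[of p 2 "1 + C"] by simp
    finally show ?thesis by simp
  qed
  have Ypm: "(\<lambda>\<omega>. \<bar>Y s \<omega>\<bar> powr p) \<in> borel_measurable M" for s
    using borel_measurable_integrable[OF Yi[of s]] by measurable
  have Bi: "integrable M (\<lambda>\<omega>. 4 * (norm (\<epsilon> (Suc s) \<omega>) powr (2 + \<delta>) + (1 + C)\<^sup>2))" for s
    using moment_integrable[of "Suc s"] by simp
  have Ypi: "integrable M (\<lambda>\<omega>. \<bar>Y s \<omega>\<bar> powr p)" for s
    by (rule Bochner_Integration.integrable_bound[OF Bi[of s] Ypm]) (use ptw in \<open>auto intro!: AE_I2 intro: order_trans[OF _ abs_ge_self]\<close>)
  have Ype: "(\<integral>\<omega>. \<bar>Y s \<omega>\<bar> powr p \<partial>M) \<le> ?K" for s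
  proof -
    have "(\<integral>\<omega>. \<bar>Y s \<omega>\<bar> powr p \<partial>M) \<le> (\<integral>\<omega>. 4 * (norm (\<epsilon> (Suc s) \<omega>) powr (2 + \<delta>) + (1 + C)\<^sup>2) \<partial>M)"
      by (intro integral_mono Ypi Bi ptw)
    also have "\<dots> = 4 * ((\<integral>\<omega>. norm (\<epsilon> (Suc s) \<omega>) powr (2 + \<delta>) \<partial>M) + (1 + C)\<^sup>2)"
      using moment_integrable[of "Suc s"] prob_space by simp
    also have "\<dots> \<le> ?K" using moment_le[of "Suc s"] by simp
    finally show ?thesis .
  qed
  \<comment> \<open>This choice makes the two terms of the general bound equal up to a constant.\<close>
  define a where "a = real n powr (1 / p)"
  have a: "a > 0" using n by (simp add: a_def)
  have "(\<integral>\<omega>. \<bar>\<Sum>s<n. Y s \<omega>\<bar> \<partial>M) \<le> a + real n * (2 * ?K * a powr (1 - p))"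
  proof (rule martingale_L1_bound[where G=F and p=p])
    show "Y s \<in> borel_measurable (F t)" if "s < t" for s t
    proof -
      have [measurable]: "\<epsilon> (Suc s) \<in> borel_measurable (F t)" using that by (intro \<epsilon>_adapted) simp
      show ?thesis unfolding Y_def[abs_def] by measurable
    qed
    show "(\<integral>\<omega>. Z \<omega> * Y t \<omega> \<partial>M) = 0" if Z: "Z \<in> borel_measurable (F t)" "\<And>\<omega>. \<bar>Z \<omega>\<bar> \<le> 1" for Z t
    proof -
      note i = bounded_mult_integrable[OF F_measurable_M[OF Z(1)] Z(2) coord_prod_integrable[of "Suc t" i j]]
      have Zi: "integrable M Z" using bounded_mult_integrable[OF F_measurable_M[OF Z(1)] Z(2), of "\<lambda>_. 1"] by simp
      have "(\<integral>\<omega>. Z \<omega> * Y t \<omega> \<partial>M) = (\<integral>\<omega>. Z \<omega> * (\<epsilon> (Suc t) \<omega> $ i * \<epsilon> (Suc t) \<omega> $ j) - Z \<omega> * S $ i $ j \<partial>M)"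
        by (simp add: Y_def right_diff_distrib)
      also have "\<dots> = 0" using i Zi covariance_eq[OF Z(1) i] by simp
      finally show ?thesis .
    qed
  qed (use F_subalgebra Yi p Ypi Ype a in auto)
  also have "\<dots> = (1 + 2 * ?K) * real n powr (1 / p)"
  proof -
    have "real n * a powr (1 - p) = real n powr 1 * real n powr ((1 / p) * (1 - p))"
      using n by (simp add: a_def powr_powr)
    also have "\<dots> = real n powr (1 / p)"
      unfolding powr_add[symmetric] using p by (simp add: field_simps)
    finally have "real n * a powr (1 - p) = a" by (simp only: a_def)
    moreover have "a + real n * (2 * K * x) = a + 2 * K * (real n * x)" for K x :: real by simp
    ultimately show ?thesis unfolding a_def[symmetric] by (simp only:) (simp add: distrib_right)
  qed
  finally show ?thesis unfolding Y_def p_def by simp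
qed

end

section \<open>Products of successive innovations\<close>

lemma norm_matrix_le_entries: "norm (A :: real^'n^'m) \<le> (\<Sum>i\<in>UNIV. \<Sum>j\<in>UNIV. \<bar>A $ i $ j\<bar>)"
proof -
  have "norm A \<le> (\<Sum>i\<in>UNIV. norm (A $ i))" unfolding norm_vec_def[of A] by (rule L2_set_le_sum) simp
  also have "\<dots> \<le> (\<Sum>i\<in>UNIV. \<Sum>j\<in>UNIV. \<bar>A $ i $ j\<bar>)" by (intro sum_mono norm_le_l1_cart)
  finally show ?thesis .
qed

lemma norm_matrix_mult_le: "norm (A ** B) \<le> norm A * norm (B :: real^'n^'k)" for A :: "real^'k^'m"
proof -
  have "(norm (A ** B))\<^sup>2 = (\<Sum>i\<in>UNIV. (norm (transpose B *v (A $ i)))\<^sup>2)"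
    unfolding power2_norm_eq_inner inner_vec_def[of "A ** B"]
    by (intro sum.cong refl arg_cong2[of _ _ _ _ inner]; simp add: vec_eq_iff matrix_matrix_mult_def matrix_vector_mult_def transpose_def mult.commute)
  also have "\<dots> \<le> (\<Sum>i\<in>UNIV. (norm B * norm (A $ i))\<^sup>2)"
    by (intro sum_mono power_mono) (use norm_matrix_vector_le[of "transpose B"] norm_transpose[of B] in auto)
  also have "\<dots> = (norm A * norm B)\<^sup>2"
    unfolding power_mult_distrib power2_norm_eq_inner[of A] inner_vec_def[of A]
    by (simp add: sum_distrib_left power2_norm_eq_inner mult.commute)
  finally show ?thesis by (rule power2_le_imp_le) simp
qed

lemma norm_cross_product_le: "\<bar>x\<bar> * \<bar>y\<bar> \<le> x\<^sup>2 + y\<^sup>2" for x y :: real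
proof -
  have "2 * (\<bar>x\<bar> * \<bar>y\<bar>) \<le> x\<^sup>2 + y\<^sup>2"
    using sum_squares_bound[of "\<bar>x\<bar>" "\<bar>y\<bar>"] by (simp only: mult.assoc power2_abs)
  moreover have "0 \<le> \<bar>x\<bar> * \<bar>y\<bar>" by simp
  ultimately show ?thesis by linarith
qed

context noise
begin

lemma F_mono: "s \<le> t \<Longrightarrow> subalgebra (F t) (F s)"
  unfolding subalgebra_def sets_generated_filtration space_generated_filtration
  by (intro conjI refl sigma_sets_mono' UN_mono) auto

text \<open>
  The previous and the current innovation in the \<open>s\<close>-th summand of the leading term.
\<close>

definition e1 :: "nat \<Rightarrow> 'a \<Rightarrow> real^'d" where "e1 s = \<epsilon> (Suc s)"
definition e2 :: "nat \<Rightarrow> 'a \<Rightarrow> real^'d" where "e2 s = \<epsilon> (Suc (Suc s))"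

lemma e_measurable [measurable]: "e1 s \<in> borel_measurable M" "e2 s \<in> borel_measurable M"
  by (simp_all add: e1_def e2_def)

lemma e_adapted: "s \<le> t \<Longrightarrow> e1 s \<in> borel_measurable (F (Suc t))" "s < t \<Longrightarrow> e2 s \<in> borel_measurable (F (Suc t))"
  by (auto simp: e1_def e2_def intro!: \<epsilon>_adapted)

lemma e1_sq_integrable: "integrable M (\<lambda>\<omega>. (norm (e1 s \<omega>))\<^sup>2)"
  by (simp add: e1_def)

lemma products_integrable: "integrable M (\<lambda>\<omega>. (norm (e1 s \<omega>))\<^sup>2 * (norm (e2 s \<omega>))\<^sup>2)"
  and products_le: "(\<integral>\<omega>. (norm (e1 s \<omega>))\<^sup>2 * (norm (e2 s \<omega>))\<^sup>2 \<partial>M) \<le> (1 + C)\<^sup>2"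
proof -
  have Z: "(\<lambda>\<omega>. (norm (e1 s \<omega>))\<^sup>2) \<in> borel_measurable (F (Suc s))"
    using e_adapted(1)[of s s] by measurable
  note * = norm_sq_mult_le[OF Z _ e1_sq_integrable]
  show "integrable M (\<lambda>\<omega>. (norm (e1 s \<omega>))\<^sup>2 * (norm (e2 s \<omega>))\<^sup>2)" unfolding e2_def by (rule *(1)) simp
  have "(\<integral>\<omega>. (norm (e1 s \<omega>))\<^sup>2 * (norm (e2 s \<omega>))\<^sup>2 \<partial>M) \<le> (1 + C) * (\<integral>\<omega>. (norm (e1 s \<omega>))\<^sup>2 \<partial>M)"
    unfolding e2_def by (rule *(2)) simp
  also have "\<dots> \<le> (1 + C) * (1 + C)" unfolding e1_def by (intro mult_left_mono square_le) (use C_nonneg in simp)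
  finally show "(\<integral>\<omega>. (norm (e1 s \<omega>))\<^sup>2 * (norm (e2 s \<omega>))\<^sup>2 \<partial>M) \<le> (1 + C)\<^sup>2" by (simp add: power2_eq_square)
qed

lemma cross_entry: "cross e x m $ i $ j = (\<Sum>s<m. e s $ i * x s $ j)"
  by (simp add: cross_def outer_def)

text \<open>
  The summands are orthogonal, since each one has mean zero given its past.
\<close>

lemma second_moment_entry:
  defines "A \<equiv> \<lambda>m \<omega>. cross (\<lambda>s. e2 s \<omega>) (\<lambda>s. e1 s \<omega>) m"
  shows "integrable M (\<lambda>\<omega>. (A m \<omega> $ i $ j)\<^sup>2) \<and> (\<integral>\<omega>. (A m \<omega> $ i $ j)\<^sup>2 \<partial>M) \<le> real m * (1 + C)\<^sup>2"
proof (induction m)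
  case 0
  then show ?case by (simp add: A_def cross_entry)
next
  case (Suc m)
  let ?M = "\<lambda>\<omega>. A m \<omega> $ i $ j" and ?D = "\<lambda>\<omega>. e2 m \<omega> $ i * e1 m \<omega> $ j"
  have Mi: "integrable M (\<lambda>\<omega>. (?M \<omega>)\<^sup>2)" using Suc by simp
  have MF: "?M \<in> borel_measurable (F (Suc m))"
    unfolding A_def cross_entry by (intro borel_measurable_sum borel_measurable_times borel_measurable_vec_nth_comp e_adapted) auto
  have MM: "?M \<in> borel_measurable M" by (rule F_measurable_M[OF MF])
  have Dle: "(?D \<omega>)\<^sup>2 \<le> (norm (e1 m \<omega>))\<^sup>2 * (norm (e2 m \<omega>))\<^sup>2" for \<omega>
    using mult_mono[OF power_mono[OF component_le_norm_cart[of "e1 m \<omega>" j], of 2] power_mono[OF component_le_norm_cart[of "e2 m \<omega>" i], of 2]]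
    by (simp add: power_mult_distrib mult.commute)
  have Di: "integrable M (\<lambda>\<omega>. (?D \<omega>)\<^sup>2)"
    by (rule Bochner_Integration.integrable_bound[OF products_integrable[of m]]) (auto intro!: AE_I2 order_trans[OF Dle])
  have MDi: "integrable M (\<lambda>\<omega>. ?M \<omega> * ?D \<omega>)"
  proof (rule Bochner_Integration.integrable_bound[OF Bochner_Integration.integrable_add[OF Mi Di]])
    show "(\<lambda>\<omega>. ?M \<omega> * ?D \<omega>) \<in> borel_measurable M" using MM by measurable
    show "AE \<omega> in M. norm (?M \<omega> * ?D \<omega>) \<le> norm ((?M \<omega>)\<^sup>2 + (?D \<omega>)\<^sup>2)"
      unfolding real_norm_def abs_mult[of "A _ _ $ _ $ _"]
      by (intro AE_I2 order_trans[OF norm_cross_product_le abs_ge_self])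
  qed
  have MD0: "(\<integral>\<omega>. ?M \<omega> * ?D \<omega> \<partial>M) = 0"
  proof -
    have "(\<lambda>\<omega>. ?M \<omega> * e1 m \<omega> $ j) \<in> borel_measurable (F (Suc m))"
      by (rule borel_measurable_times[OF MF borel_measurable_vec_nth_comp[OF e_adapted(1)]]) simp
    from mean_orthogonal[OF this, of i] MDi show ?thesis
      by (simp add: e2_def mult_ac)
  qed
  have eq: "(A (Suc m) \<omega> $ i $ j)\<^sup>2 = (?M \<omega>)\<^sup>2 + 2 * (?M \<omega> * ?D \<omega>) + (?D \<omega>)\<^sup>2" for \<omega>
    by (simp add: A_def cross_entry power2_sum)
  have "(\<integral>\<omega>. (?D \<omega>)\<^sup>2 \<partial>M) \<le> (1 + C)\<^sup>2"
    by (rule order_trans[OF integral_mono[OF Di products_integrable Dle] products_le])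
  then show ?case unfolding eq using Mi Di MDi MD0 Suc by (simp add: distrib_right)
qed

lemma second_moment_cross:
  "integrable M (\<lambda>\<omega>. (norm (cross (\<lambda>s. e2 s \<omega>) (\<lambda>s. e1 s \<omega>) m))\<^sup>2)"
  "(\<integral>\<omega>. (norm (cross (\<lambda>s. e2 s \<omega>) (\<lambda>s. e1 s \<omega>) m))\<^sup>2 \<partial>M) \<le> (real CARD('d))\<^sup>2 * (real m * (1 + C)\<^sup>2)"
proof -
  let ?A = "\<lambda>\<omega>. cross (\<lambda>s. e2 s \<omega>) (\<lambda>s. e1 s \<omega>) m"
  have eq: "(norm (?A \<omega>))\<^sup>2 = (\<Sum>i\<in>UNIV. \<Sum>j\<in>UNIV. (?A \<omega> $ i $ j)\<^sup>2)" for \<omega>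
    unfolding power2_norm_eq_inner inner_vec_def by (simp add: power2_eq_square)
  show "integrable M (\<lambda>\<omega>. (norm (?A \<omega>))\<^sup>2)"
    unfolding eq using second_moment_entry[of m] by (intro Bochner_Integration.integrable_sum) auto
  have "(\<integral>\<omega>. (norm (?A \<omega>))\<^sup>2 \<partial>M) = (\<Sum>i\<in>UNIV. \<Sum>j\<in>UNIV. (\<integral>\<omega>. (?A \<omega> $ i $ j)\<^sup>2 \<partial>M))"
    unfolding eq using second_moment_entry[of m]
    by (subst Bochner_Integration.integral_sum; (intro sum.cong refl Bochner_Integration.integral_sum Bochner_Integration.integrable_sum)?) auto
  also have "\<dots> \<le> (\<Sum>i\<in>(UNIV::'d set). \<Sum>j\<in>(UNIV::'d set). real m * (1 + C)\<^sup>2)"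
    using second_moment_entry[of m] by (intro sum_mono) auto
  finally show "(\<integral>\<omega>. (norm (?A \<omega>))\<^sup>2 \<partial>M) \<le> (real CARD('d))\<^sup>2 * (real m * (1 + C)\<^sup>2)"
    by (simp add: power2_eq_square)
qed

text \<open>
  The last term pays for centring at \<open>n\<close> covariances when there are \<open>n - 1\<close> or \<open>n - 2\<close> summands.
\<close>

definition lln_bound :: "nat \<Rightarrow> real" where
  "lln_bound n = (real CARD('d))\<^sup>2 * (1 + 8 * (C + (1 + C)\<^sup>2)) * real n powr (1 / (1 + \<delta> / 2)) + 2 * norm S"

lemma lln_cross:
  assumes n: "1 \<le> m" "m \<le> n" "n \<le> m + 2"
  defines "U \<equiv> \<lambda>\<omega>. cross (\<lambda>s. e1 s \<omega>) (\<lambda>s. e1 s \<omega>) m - real n *\<^sub>R S"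
  shows "integrable M (\<lambda>\<omega>. norm (U \<omega>))" "(\<integral>\<omega>. norm (U \<omega>) \<partial>M) \<le> lln_bound n"
proof -
  let ?D = "\<lambda>i j \<omega>. \<bar>\<Sum>s<m. \<epsilon> (Suc s) \<omega> $ i * \<epsilon> (Suc s) \<omega> $ j - S $ i $ j\<bar>"
  have Di: "integrable M (?D i j)" for i j
    by (intro integrable_abs Bochner_Integration.integrable_sum Bochner_Integration.integrable_diff coord_prod_integrable) simp
  have Um: "U \<in> borel_measurable M" unfolding U_def cross_def[abs_def] by measurable
  have le: "norm (U \<omega>) \<le> (\<Sum>i\<in>UNIV. \<Sum>j\<in>UNIV. ?D i j \<omega>) + 2 * norm S" for \<omega>
  proof -
    have "U \<omega> = (cross (\<lambda>s. e1 s \<omega>) (\<lambda>s. e1 s \<omega>) m - real m *\<^sub>R S) - (real n - real m) *\<^sub>R S"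
      by (simp add: U_def algebra_simps)
    also have "norm \<dots> \<le> norm (cross (\<lambda>s. e1 s \<omega>) (\<lambda>s. e1 s \<omega>) m - real m *\<^sub>R S) + norm ((real n - real m) *\<^sub>R S)"
      by (rule norm_triangle_ineq4)
    also have "norm ((real n - real m) *\<^sub>R S) \<le> 2 * norm S" using n by (simp add: mult_right_mono)
    also have "norm (cross (\<lambda>s. e1 s \<omega>) (\<lambda>s. e1 s \<omega>) m - real m *\<^sub>R S) \<le> (\<Sum>i\<in>UNIV. \<Sum>j\<in>UNIV. ?D i j \<omega>)"
      by (rule order_trans[OF norm_matrix_le_entries]) (simp add: cross_entry e1_def sum_subtractf)
    finally show ?thesis by simp
  qed
  have bi: "integrable M (\<lambda>\<omega>. (\<Sum>i\<in>UNIV. \<Sum>j\<in>UNIV. ?D i j \<omega>) + 2 * norm S)"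
    by (intro Bochner_Integration.integrable_add Bochner_Integration.integrable_sum Di) simp
  show Ui: "integrable M (\<lambda>\<omega>. norm (U \<omega>))"
    by (rule Bochner_Integration.integrable_bound[OF bi])
       (use Um le in \<open>auto intro!: AE_I2 order_trans[OF le abs_ge_self]\<close>)
  have "(\<integral>\<omega>. norm (U \<omega>) \<partial>M) \<le> (\<integral>\<omega>. (\<Sum>i\<in>UNIV. \<Sum>j\<in>UNIV. ?D i j \<omega>) + 2 * norm S \<partial>M)"
    by (intro integral_mono Ui bi le)
  also have "\<dots> = (\<Sum>i\<in>UNIV. \<Sum>j\<in>UNIV. \<integral>\<omega>. ?D i j \<omega> \<partial>M) + 2 * norm S"
  proof -
    have "(\<integral>\<omega>. (\<Sum>i\<in>UNIV. \<Sum>j\<in>UNIV. ?D i j \<omega>) \<partial>M) = (\<Sum>i\<in>UNIV. \<integral>\<omega>. (\<Sum>j\<in>UNIV. ?D i j \<omega>) \<partial>M)"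
      by (intro Bochner_Integration.integral_sum Bochner_Integration.integrable_sum Di)
    also have "\<dots> = (\<Sum>i\<in>UNIV. \<Sum>j\<in>UNIV. \<integral>\<omega>. ?D i j \<omega> \<partial>M)"
      by (intro sum.cong refl Bochner_Integration.integral_sum Di)
    finally show ?thesis
      using prob_space by (subst Bochner_Integration.integral_add) (auto intro!: Bochner_Integration.integrable_sum Di)
  qed
  also have "\<dots> \<le> (\<Sum>i\<in>(UNIV::'d set). \<Sum>j\<in>(UNIV::'d set). (1 + 8 * (C + (1 + C)\<^sup>2)) * real n powr (1 / (1 + \<delta> / 2))) + 2 * norm S"
  proof (intro add_right_mono sum_mono)
    fix i j :: 'd
    have "(\<integral>\<omega>. ?D i j \<omega> \<partial>M) \<le> (1 + 8 * (C + (1 + C)\<^sup>2)) * real m powr (1 / (1 + \<delta> / 2))"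
      by (rule lln_entry) (use n in simp)
    also have "\<dots> \<le> (1 + 8 * (C + (1 + C)\<^sup>2)) * real n powr (1 / (1 + \<delta> / 2))"
      using n \<delta> C_nonneg by (intro mult_left_mono powr_mono2) auto
    finally show "(\<integral>\<omega>. ?D i j \<omega> \<partial>M) \<le> (1 + 8 * (C + (1 + C)\<^sup>2)) * real n powr (1 / (1 + \<delta> / 2))" .
  qed
  finally show "(\<integral>\<omega>. norm (U \<omega>) \<partial>M) \<le> lln_bound n" by (simp add: lln_bound_def power2_eq_square)
qed

lemma markov:
  assumes "integrable M Z" "\<And>\<omega>. 0 \<le> Z \<omega>" "(\<integral>\<omega>. Z \<omega> \<partial>M) \<le> b" "0 < c"
  shows "prob {\<omega> \<in> space M. c < Z \<omega>} \<le> b / c"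
proof -
  have m [measurable]: "Z \<in> borel_measurable M" using assms(1) by auto
  have "prob {\<omega> \<in> space M. c < Z \<omega>} \<le> prob {\<omega> \<in> space M. Z \<omega> \<ge> c}"
    by (intro finite_measure_mono) auto
  also have "\<dots> \<le> (\<integral>\<omega>. Z \<omega> \<partial>M) / c"
    by (rule integral_Markov_inequality_measure[where A="{}"]) (use assms in auto)
  also have "\<dots> \<le> b / c" using assms by (intro divide_right_mono) auto
  finally show ?thesis .
qed

text \<open>
  The self-normalised quantities of the model, for regressors bounded pathwise by \<open>L\<close> times the
  accumulated noise. The regressor lags \<open>Suc h\<close> periods behind the noise that it is multiplied with.
\<close>

lemma self_norm_bound:
  fixes X :: "nat \<Rightarrow> 'a \<Rightarrow> real^'d" and m h :: nat
  assumes XF: "\<And>t. X t \<in> borel_measurable (F t)"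
    and XL: "\<And>t \<omega>. \<omega> \<in> space M \<Longrightarrow> norm (X t \<omega>) \<le> L * (\<Sum>s=1..t. norm (\<epsilon> s \<omega>))" and L: "0 \<le> L"
  defines "q \<equiv> \<lambda>\<omega>. total_self_norm (\<lambda>s. X s \<omega>) (\<lambda>s. \<epsilon> (s + Suc h) \<omega>) m"
  shows "integrable M q"
    and "(\<integral>\<omega>. q \<omega> \<partial>M) \<le> (1 + C) * (ln (fact CARD('d)) + CARD('d) * ln (1 + L\<^sup>2 * (1 + C) * real m ^ 3))"
proof -
  have XM: "X t \<in> borel_measurable M" for t by (rule F_measurable_M[OF XF])
  have sq: "(norm (X t \<omega>))\<^sup>2 \<le> L\<^sup>2 * (real t * (\<Sum>s=1..t. (norm (\<epsilon> s \<omega>))\<^sup>2))" if "\<omega> \<in> space M" for t \<omega>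
  proof -
    have "(norm (X t \<omega>))\<^sup>2 \<le> (L * (\<Sum>s=1..t. norm (\<epsilon> s \<omega>)))\<^sup>2" by (intro power_mono XL that) simp
    also have "\<dots> = L\<^sup>2 * (\<Sum>s=1..t. 1 * norm (\<epsilon> s \<omega>))\<^sup>2" by (simp add: power_mult_distrib)
    also have "\<dots> \<le> L\<^sup>2 * ((\<Sum>s=1..t. 1\<^sup>2) * (\<Sum>s=1..t. (norm (\<epsilon> s \<omega>))\<^sup>2))"
      by (intro mult_left_mono Cauchy_Schwarz_ineq_sum) simp
    finally show ?thesis by simp
  qed
  have bi: "integrable M (\<lambda>\<omega>. L\<^sup>2 * (real t * (\<Sum>s=1..t. (norm (\<epsilon> s \<omega>))\<^sup>2)))" for t
    by (intro integrable_mult_right Bochner_Integration.integrable_sum square_integrable)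
  have X2: "integrable M (\<lambda>\<omega>. (norm (X t \<omega>))\<^sup>2)" for t
  proof (rule Bochner_Integration.integrable_bound[OF bi[of t]])
    show "(\<lambda>\<omega>. (norm (X t \<omega>))\<^sup>2) \<in> borel_measurable M" using XM[of t] by measurable
    show "AE \<omega> in M. norm ((norm (X t \<omega>))\<^sup>2) \<le> norm (L\<^sup>2 * (real t * (\<Sum>s=1..t. (norm (\<epsilon> s \<omega>))\<^sup>2)))"
      unfolding real_norm_def by (rule AE_I2, subst abs_of_nonneg, simp, rule order_trans[OF sq abs_ge_self])
  qed
  have X2e: "(\<integral>\<omega>. (norm (X t \<omega>))\<^sup>2 \<partial>M) \<le> L\<^sup>2 * (1 + C) * (real t)\<^sup>2" for t
  proof -
    have "(\<integral>\<omega>. (norm (X t \<omega>))\<^sup>2 \<partial>M) \<le> (\<integral>\<omega>. L\<^sup>2 * (real t * (\<Sum>s=1..t. (norm (\<epsilon> s \<omega>))\<^sup>2)) \<partial>M)"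
      by (intro integral_mono X2 bi sq)
    also have "\<dots> = L\<^sup>2 * (real t * (\<Sum>s=1..t. \<integral>\<omega>. (norm (\<epsilon> s \<omega>))\<^sup>2 \<partial>M))" by simp
    also have "\<dots> \<le> L\<^sup>2 * (real t * (\<Sum>s=1..t. 1 + C))"
      by (intro mult_left_mono sum_mono square_le) auto
    finally show ?thesis by (simp add: power2_eq_square mult_ac)
  qed
  let ?B = "L\<^sup>2 * (1 + C) * real m ^ 3"
  have B: "(\<Sum>t<m. \<integral>\<omega>. (norm (X t \<omega>))\<^sup>2 \<partial>M) \<le> ?B"
  proof -
    have "(\<Sum>t<m. \<integral>\<omega>. (norm (X t \<omega>))\<^sup>2 \<partial>M) \<le> (\<Sum>t<m. L\<^sup>2 * (1 + C) * (real m)\<^sup>2)"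
      using C_nonneg by (intro sum_mono order_trans[OF X2e] mult_left_mono power_mono) auto
    then show ?thesis by (simp add: power2_eq_square power3_eq_cube mult_ac)
  qed
  have comp: "integrable M (\<lambda>\<omega>. self_norm (\<lambda>s. X s \<omega>) (\<lambda>s. \<epsilon> (s + Suc h) \<omega> $ i) m)"
    "(\<integral>\<omega>. self_norm (\<lambda>s. X s \<omega>) (\<lambda>s. \<epsilon> (s + Suc h) \<omega> $ i) m \<partial>M) \<le> S $ i $ i * (ln (fact CARD('d)) + CARD('d) * ln (1 + ?B))" for i
  proof -
    let ?e = "\<lambda>s \<omega>. \<epsilon> (s + Suc h) \<omega> $ i"
    have p1: "subalgebra M (F (t + h))" for t by (rule F_subalgebra)
    have p2: "X s \<in> borel_measurable (F (t + h))" if "s \<le> t" for s t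
      by (rule measurable_from_subalg[OF F_mono XF[of s]]) (use that in simp)
    have p3: "?e s \<in> borel_measurable (F (t + h))" if "s < t" for s t
      using that by (intro borel_measurable_vec_nth_comp \<epsilon>_adapted) simp
    have p4: "integrable M (\<lambda>\<omega>. (?e t \<omega>)\<^sup>2)" for t by (rule coord_square_integrable)
    have p5: "(\<integral>\<omega>. Z \<omega> * ?e t \<omega> \<partial>M) = 0"
      if "Z \<in> borel_measurable (F (t + h))" "integrable M (\<lambda>\<omega>. Z \<omega> * ?e t \<omega>)" for Z t
      using that mean_orthogonal[of Z "t + h" i] by simp
    have p6: "(\<integral>\<omega>. Z \<omega> * (?e t \<omega>)\<^sup>2 \<partial>M) \<le> S $ i $ i * (\<integral>\<omega>. Z \<omega> \<partial>M)"
      if Z: "Z \<in> borel_measurable (F (t + h))" "\<And>\<omega>. 0 \<le> Z \<omega>" "\<And>\<omega>. Z \<omega> \<le> 1" for Z t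
    proof -
      have "\<bar>Z \<omega>\<bar> \<le> 1" for \<omega> using Z(2)[of \<omega>] Z(3)[of \<omega>] by simp
      then have "integrable M (\<lambda>\<omega>. Z \<omega> * (\<epsilon> (Suc (t + h)) \<omega> $ i * \<epsilon> (Suc (t + h)) \<omega> $ i))"
        by (rule bounded_mult_integrable[OF F_measurable_M[OF Z(1)] _ coord_prod_integrable])
      from covariance_eq[OF Z(1) this] show ?thesis by (simp add: power2_eq_square)
    qed
    note r = self_norm_expectation[where G="\<lambda>t. F (t + h)" and x=X and e="?e", OF p1 p2 p3 p4 p5 p6 S_diag_nonneg X2 B]
    show "integrable M (\<lambda>\<omega>. self_norm (\<lambda>s. X s \<omega>) (\<lambda>s. ?e s \<omega>) m)" by (rule r(1))
    show "(\<integral>\<omega>. self_norm (\<lambda>s. X s \<omega>) (\<lambda>s. ?e s \<omega>) m \<partial>M) \<le> S $ i $ i * (ln (fact CARD('d)) + CARD('d) * ln (1 + ?B))" by (rule r(2))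
  qed
  show "integrable M q" unfolding q_def total_self_norm_def by (intro Bochner_Integration.integrable_sum comp)
  let ?l = "ln (fact CARD('d)) + CARD('d) * ln (1 + ?B)"
  have l0: "0 \<le> ?l" using C_nonneg by (intro add_nonneg_nonneg mult_nonneg_nonneg ln_ge_zero) auto
  have "(\<integral>\<omega>. q \<omega> \<partial>M) = (\<Sum>i\<in>UNIV. \<integral>\<omega>. self_norm (\<lambda>s. X s \<omega>) (\<lambda>s. \<epsilon> (s + Suc h) \<omega> $ i) m \<partial>M)"
    unfolding q_def total_self_norm_def by (intro Bochner_Integration.integral_sum comp)
  also have "\<dots> \<le> (\<Sum>i\<in>UNIV. S $ i $ i * ?l)" by (intro sum_mono comp)
  also have "\<dots> = (\<Sum>i\<in>UNIV. S $ i $ i) * ?l" by (rule sum_distrib_right[symmetric])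
  also have "\<dots> \<le> (1 + C) * ?l" by (intro mult_right_mono trace_le l0)
  finally show "(\<integral>\<omega>. q \<omega> \<partial>M) \<le> (1 + C) * ?l" .
qed

end

section \<open>The characteristic function of the leading term\<close>

text \<open>
  The Lindeberg terms: \<open>a\<close> is the size of the current innovation and \<open>b\<close> that of the previous one. For
  \<open>b > B\<close> the square is used and a power of \<open>b\<close> is traded for a power of \<open>B\<close>; for \<open>b \<le> B\<close> the minimum is
  at most \<open>\<bar>z\<bar> powr (2 + \<delta>)\<close>, which is of smaller order than \<open>1 / n\<close>.
\<close>

lemma min_square_cube_le:
  fixes a b K B n \<delta> :: real
  assumes \<delta>: "0 < \<delta>" "\<delta> \<le> 1" and pos: "0 \<le> a" "0 \<le> b" "0 \<le> K" "0 < B" "0 < n"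
    and z: "\<bar>z\<bar> \<le> K * a * b / sqrt n"
  shows "min (z\<^sup>2) (\<bar>z\<bar> ^ 3) \<le> K\<^sup>2 * B powr (- \<delta>) / n * (b powr (2 + \<delta>) * a\<^sup>2)
    + (K * B) powr (2 + \<delta>) * n powr (- (1 + \<delta> / 2)) * a powr (2 + \<delta>)"
proof (cases "b \<le> B")
  case False
  have z2: "z\<^sup>2 \<le> (K * a * b / sqrt n)\<^sup>2" using power_mono[OF z, of 2] by simp
  have "b\<^sup>2 = b powr (2 + \<delta>) * b powr (- \<delta>)" using False pos by (simp add: powr_add[symmetric])
  also have "\<dots> \<le> b powr (2 + \<delta>) * B powr (- \<delta>)"
    using False pos \<delta> by (intro mult_left_mono powr_mono2') auto
  finally have b2: "b\<^sup>2 \<le> b powr (2 + \<delta>) * B powr (- \<delta>)" .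
  have "(K * a * b / sqrt n)\<^sup>2 = K\<^sup>2 * a\<^sup>2 / n * b\<^sup>2"
    using pos by (simp add: power_mult_distrib power_divide)
  also have "\<dots> \<le> K\<^sup>2 * a\<^sup>2 / n * (b powr (2 + \<delta>) * B powr (- \<delta>))"
    using pos by (intro mult_left_mono b2) auto
  also have "\<dots> = K\<^sup>2 * B powr (- \<delta>) / n * (b powr (2 + \<delta>) * a\<^sup>2)" by simp
  finally have "z\<^sup>2 \<le> K\<^sup>2 * B powr (- \<delta>) / n * (b powr (2 + \<delta>) * a\<^sup>2)" using z2 by linarith
  moreover have "0 \<le> (K * B) powr (2 + \<delta>) * n powr (- (1 + \<delta> / 2)) * a powr (2 + \<delta>)" by simp
  ultimately show ?thesis by linarith
next
  case True
  have 1: "min (z\<^sup>2) (\<bar>z\<bar> ^ 3) \<le> \<bar>z\<bar> powr (2 + \<delta>)"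
  proof (cases "z = 0")
    case False
    then have z0: "\<bar>z\<bar> > 0" by simp
    show ?thesis
    proof (cases "\<bar>z\<bar> \<le> 1")
      case True
      have "\<bar>z\<bar> powr 3 \<le> \<bar>z\<bar> powr (2 + \<delta>)" using True z0 \<delta> by (intro powr_mono') auto
      then show ?thesis using z0 by simp
    next
      case False
      have "\<bar>z\<bar> powr 2 \<le> \<bar>z\<bar> powr (2 + \<delta>)" using False \<delta> by (intro powr_mono) auto
      then show ?thesis using z0 by simp
    qed
  qed simp
  have "\<bar>z\<bar> \<le> K * B * a * n powr (- (1 / 2))"
  proof -
    have "K * a * b / sqrt n \<le> K * a * B / sqrt n"
      using pos True by (intro divide_right_mono mult_left_mono) auto
    also have "\<dots> = K * B * a * n powr (- (1 / 2))" 
    proof -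
      have "n powr (- (1 / 2)) = inverse (sqrt n)"
        using pos powr_half_sqrt[of n] by (simp only: powr_minus less_imp_le)
      then show ?thesis by (simp only: divide_inverse mult_ac)
    qed
    finally show ?thesis using z by linarith
  qed
  then have "\<bar>z\<bar> powr (2 + \<delta>) \<le> (K * B * a * n powr (- (1 / 2))) powr (2 + \<delta>)" using \<delta> by (intro powr_mono2) auto
  also have "\<dots> = (K * B) powr (2 + \<delta>) * a powr (2 + \<delta>) * (n powr (- (1 / 2))) powr (2 + \<delta>)"
    using pos by (simp add: powr_mult)
  also have "(n powr (- (1 / 2))) powr (2 + \<delta>) = n powr (- (1 + \<delta> / 2))"
    unfolding powr_powr by (rule arg_cong[of _ _ "\<lambda>x. n powr x"]) (simp add: field_simps)
  finally have 2: "\<bar>z\<bar> powr (2 + \<delta>) \<le> (K * B) powr (2 + \<delta>) * n powr (- (1 + \<delta> / 2)) * a powr (2 + \<delta>)"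
    by (simp add: mult_ac)
  have "0 \<le> K\<^sup>2 * B powr (- \<delta>) / n * (b powr (2 + \<delta>) * a\<^sup>2)" using pos by simp
  then show ?thesis using 1 2 by linarith
qed

text \<open>
  A conditional variance \<open>v\<close> of order \<open>1 / n\<close> has moments of order \<open>1 + \<delta> / 2\<close>; the remaining powers of the
  truncated variable are bounded by those of \<open>D\<close>.
\<close>

lemma square_min_le:
  fixes v D b n \<delta> E :: real
  assumes \<delta>: "0 < \<delta>" "\<delta> \<le> 1" and D: "1 \<le> D" and v: "0 \<le> v" "v \<le> E * b\<^sup>2 / n" and pos: "0 \<le> b" "0 < n" "0 \<le> E"
  shows "(min v D)\<^sup>2 \<le> D * E powr (1 + \<delta> / 2) * n powr (- (1 + \<delta> / 2)) * b powr (2 + \<delta>)"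
proof -
  let ?m = "min v D"
  have m0: "0 \<le> ?m" using v D by simp
  have "?m\<^sup>2 = ?m powr (1 - \<delta> / 2) * ?m powr (1 + \<delta> / 2)"
    using m0 by (cases "?m = 0") (auto simp: powr_add[symmetric])
  also have "\<dots> \<le> D powr 1 * v powr (1 + \<delta> / 2)"
  proof (intro mult_mono)
    have "?m powr (1 - \<delta> / 2) \<le> D powr (1 - \<delta> / 2)" using m0 \<delta> by (intro powr_mono2) auto
    also have "\<dots> \<le> D powr 1" using D \<delta> by (intro powr_mono) auto
    finally show "?m powr (1 - \<delta> / 2) \<le> D powr 1" .
    show "?m powr (1 + \<delta> / 2) \<le> v powr (1 + \<delta> / 2)" using m0 \<delta> by (intro powr_mono2) auto
  qed (use D in auto)
  finally have "?m\<^sup>2 \<le> D * v powr (1 + \<delta> / 2)" using D by simp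
  also have "v powr (1 + \<delta> / 2) \<le> (E * b\<^sup>2 * n powr (-1)) powr (1 + \<delta> / 2)"
  proof (rule powr_mono2)
    have "n powr (-1) = inverse n" using pos by (simp only: powr_minus powr_one less_imp_le)
    then show "v \<le> E * b\<^sup>2 * n powr (-1)" using v(2) by (simp only: divide_inverse)
  qed (use \<delta> v in auto)
  also have "\<dots> = E powr (1 + \<delta> / 2) * (b\<^sup>2) powr (1 + \<delta> / 2) * (n powr (-1)) powr (1 + \<delta> / 2)"
  proof -
    have pm: "(x * y * z) powr p = x powr p * y powr p * z powr p" if "0 \<le> x" "0 \<le> y" "0 \<le> z" for x y z p :: real
      using that by (simp add: powr_mult)
    show ?thesis by (rule pm) (use pos in auto)
  qed
  also have "(b\<^sup>2) powr (1 + \<delta> / 2) = b powr (2 + \<delta>)"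
  proof -
    have "(b\<^sup>2) powr (1 + \<delta> / 2) = (b powr 2) powr (1 + \<delta> / 2)" using pos by simp
    also have "\<dots> = b powr (2 + \<delta>)" unfolding powr_powr by (simp add: distrib_left)
    finally show ?thesis .
  qed
  also have "(n powr (-1)) powr (1 + \<delta> / 2) = n powr (- (1 + \<delta> / 2))" unfolding powr_powr by simp
  finally show ?thesis using D by (simp add: mult_ac)
qed

context noise
begin

lemma moment_products:
  "integrable M (\<lambda>\<omega>. norm (e1 s \<omega>) powr (2 + \<delta>) * (norm (e2 s \<omega>))\<^sup>2)"
  "(\<integral>\<omega>. norm (e1 s \<omega>) powr (2 + \<delta>) * (norm (e2 s \<omega>))\<^sup>2 \<partial>M) \<le> (1 + C) * C"
proof -
  have Z: "(\<lambda>\<omega>. norm (e1 s \<omega>) powr (2 + \<delta>)) \<in> borel_measurable (F (Suc s))"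
    using e_adapted(1)[of s s] by measurable
  have Zi: "integrable M (\<lambda>\<omega>. norm (e1 s \<omega>) powr (2 + \<delta>))" unfolding e1_def by (rule moment_integrable)
  note * = norm_sq_mult_le[OF Z _ Zi]
  show "integrable M (\<lambda>\<omega>. norm (e1 s \<omega>) powr (2 + \<delta>) * (norm (e2 s \<omega>))\<^sup>2)" unfolding e2_def by (rule *(1)) simp
  have "(\<integral>\<omega>. norm (e1 s \<omega>) powr (2 + \<delta>) * (norm (e2 s \<omega>))\<^sup>2 \<partial>M) \<le> (1 + C) * (\<integral>\<omega>. norm (e1 s \<omega>) powr (2 + \<delta>) \<partial>M)"
    unfolding e2_def by (rule *(2)) simp
  also have "\<dots> \<le> (1 + C) * C" unfolding e1_def by (intro mult_left_mono moment_le) (use C_nonneg in simp)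
  finally show "(\<integral>\<omega>. norm (e1 s \<omega>) powr (2 + \<delta>) * (norm (e2 s \<omega>))\<^sup>2 \<partial>M) \<le> (1 + C) * C" .
qed

text \<open>
  The moments available are unconditional, so the Lindeberg bound splits according to the size \<open>B\<close>
  of the lagged noise: beyond \<open>B\<close> its own moment is small, below \<open>B\<close> the current noise is.
\<close>

lemma noise_char_bound:
  fixes Q :: "real^'d^'d"
  assumes psd: "\<And>x. 0 \<le> x \<bullet> (S *v x)" and Q: "norm Q \<le> K" and S: "norm S \<le> \<sigma>"
    and \<tau>: "\<tau> = (transpose Q ** S ** Q) \<bullet> S" "0 \<le> \<tau>" "\<tau> + 1 \<le> D"
    and n: "n = m + 1" "1 \<le> m" and \<eta>: "0 < \<eta>" "\<eta> \<le> 1" and B: "0 < B"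
  shows "cmod ((CLINT \<omega>|M. iexp ((\<Sum>s<m. e2 s \<omega> \<bullet> (Q *v e1 s \<omega>)) / sqrt n)) - of_real (exp (- \<tau> / 2)))
    \<le> exp D * (K\<^sup>2 * B powr (- \<delta>) * ((1 + C) * C)
          + ((K * B) powr (2 + \<delta>) + D * (\<sigma> * K\<^sup>2) powr (1 + \<delta> / 2)) * C * real n powr (- (\<delta> / 2)))
      + \<eta> + (1 + exp D) * (\<sigma> * K\<^sup>2 * lln_bound n / (real n * \<eta>))"
proof -
  define h where "h s \<omega> = Q *v e1 s \<omega>" for s \<omega>
  define \<zeta> where "\<zeta> s \<omega> = (e2 s \<omega> \<bullet> h s \<omega>) / sqrt n" for s \<omega>
  define v where "v s \<omega> = (h s \<omega> \<bullet> (S *v h s \<omega>)) / n" for s \<omega>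
  have n0: "real n > 0" using n by simp
  have K: "0 \<le> K" using Q by (meson norm_ge_zero order_trans)
  have \<sigma>: "0 \<le> \<sigma>" using S by (meson norm_ge_zero order_trans)
  have D1: "1 \<le> D" using \<tau> by linarith
  have hle: "norm (h s \<omega>) \<le> K * norm (e1 s \<omega>)" for s \<omega>
    unfolding h_def using Q by (intro order_trans[OF norm_matrix_vector_le] mult_right_mono) auto
  have hF: "h s \<in> borel_measurable (F (Suc t))" if "s \<le> t" for s t
    unfolding h_def[abs_def] using e_adapted(1)[OF that] by (intro borel_measurable_matrix_vector_mult_comp) auto
  have \<zeta>F: "\<zeta> s \<in> borel_measurable (F (Suc t))" if "s < t" for s t
    unfolding \<zeta>_def[abs_def] using that
    by (intro borel_measurable_divide borel_measurable_inner hF e_adapted) auto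
  have vF: "v s \<in> borel_measurable (F (Suc t))" if "s \<le> t" for s t
    unfolding v_def[abs_def] using that
    by (intro borel_measurable_divide borel_measurable_inner borel_measurable_matrix_vector_mult_comp hF) auto
  have v0: "0 \<le> v s \<omega>" for s \<omega> unfolding v_def using psd by simp
  have \<zeta>le: "\<bar>\<zeta> s \<omega>\<bar> \<le> K * norm (e2 s \<omega>) * norm (e1 s \<omega>) / sqrt n" for s \<omega>
  proof -
    have "\<bar>e2 s \<omega> \<bullet> h s \<omega>\<bar> \<le> norm (e2 s \<omega>) * (K * norm (e1 s \<omega>))"
      by (rule order_trans[OF Cauchy_Schwarz_ineq2]) (intro mult_left_mono hle norm_ge_zero)
    then show ?thesis unfolding \<zeta>_def using n0 by (simp add: abs_mult divide_right_mono mult_ac)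
  qed
  have vle: "v s \<omega> \<le> \<sigma> * K\<^sup>2 * (norm (e1 s \<omega>))\<^sup>2 / n" for s \<omega>
  proof -
    have "h s \<omega> \<bullet> (S *v h s \<omega>) \<le> norm (h s \<omega>) * norm (S *v h s \<omega>)" by (rule norm_cauchy_schwarz)
    also have "\<dots> \<le> norm (h s \<omega>) * (\<sigma> * norm (h s \<omega>))"
      using S by (intro mult_left_mono order_trans[OF norm_matrix_vector_le] mult_right_mono) auto
    also have "\<dots> = \<sigma> * (norm (h s \<omega>))\<^sup>2" by (simp add: power2_eq_square)
    also have "\<dots> \<le> \<sigma> * (K * norm (e1 s \<omega>))\<^sup>2" using \<sigma> by (intro mult_left_mono power_mono hle) auto
    finally show ?thesis unfolding v_def using n0 by (simp add: divide_right_mono power_mult_distrib mult.assoc)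
  qed
  have \<zeta>m: "\<zeta> s \<in> borel_measurable M" for s by (rule F_measurable_M[OF \<zeta>F[of s "Suc s"]]) simp
  have vm: "v s \<in> borel_measurable M" for s by (rule F_measurable_M[OF vF[of s s]]) simp
  have \<zeta>2: "integrable M (\<lambda>\<omega>. (\<zeta> s \<omega>)\<^sup>2)" for s
  proof (rule Bochner_Integration.integrable_bound[OF integrable_mult_right[OF products_integrable[of s], of "K\<^sup>2 / n"]])
    show "(\<lambda>\<omega>. (\<zeta> s \<omega>)\<^sup>2) \<in> borel_measurable M" using \<zeta>m by measurable
    show "AE \<omega> in M. norm ((\<zeta> s \<omega>)\<^sup>2) \<le> norm (K\<^sup>2 / n * ((norm (e1 s \<omega>))\<^sup>2 * (norm (e2 s \<omega>))\<^sup>2))"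
    proof (rule AE_I2)
      fix \<omega>
      have "(\<zeta> s \<omega>)\<^sup>2 \<le> (K * norm (e2 s \<omega>) * norm (e1 s \<omega>) / sqrt n)\<^sup>2" using power_mono[OF \<zeta>le[of s \<omega>] abs_ge_zero, of 2] by simp
      also have "\<dots> = K\<^sup>2 / n * ((norm (e1 s \<omega>))\<^sup>2 * (norm (e2 s \<omega>))\<^sup>2)"
        using n0 by (simp add: power_mult_distrib power_divide mult_ac)
      finally show "norm ((\<zeta> s \<omega>)\<^sup>2) \<le> norm (K\<^sup>2 / n * ((norm (e1 s \<omega>))\<^sup>2 * (norm (e2 s \<omega>))\<^sup>2))" by simp
    qed
  qed
  have vi: "integrable M (v s)" for s
    by (rule Bochner_Integration.integrable_bound[OF integrable_mult_right[OF e1_sq_integrable[of s], of "\<sigma> * K\<^sup>2 / n"] vm])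
       (use v0 vle \<sigma> in \<open>auto intro!: AE_I2 simp: abs_of_nonneg\<close>)
  have hi: "integrable M (\<lambda>\<omega>. Z \<omega> * (h s \<omega> $ i * h s \<omega> $ j))"
    if Z: "Z \<in> borel_measurable M" "\<And>\<omega>. \<bar>Z \<omega>\<bar> \<le> b" for Z b s i j
  proof (rule bounded_mult_integrable[OF Z])
    have hm: "h s \<in> borel_measurable M" by (rule F_measurable_M[OF hF[of s s]]) simp
    show "integrable M (\<lambda>\<omega>. h s \<omega> $ i * h s \<omega> $ j)"
    proof (rule Bochner_Integration.integrable_bound[OF integrable_mult_right[OF e1_sq_integrable[of s], of "K\<^sup>2"]])
      show "(\<lambda>\<omega>. h s \<omega> $ i * h s \<omega> $ j) \<in> borel_measurable M" using hm by (intro borel_measurable_times borel_measurable_vec_nth_comp)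
      show "AE \<omega> in M. norm (h s \<omega> $ i * h s \<omega> $ j) \<le> norm (K\<^sup>2 * (norm (e1 s \<omega>))\<^sup>2)"
      proof (rule AE_I2)
        fix \<omega> show "norm (h s \<omega> $ i * h s \<omega> $ j) \<le> norm (K\<^sup>2 * (norm (e1 s \<omega>))\<^sup>2)"
          using order_trans[OF coord_prod_le[of "h s \<omega>" i j] power_mono[OF hle norm_ge_zero, of s \<omega> 2]]
          by (simp add: power_mult_distrib)
      qed
    qed
  qed
  have orth: "(\<integral>\<omega>. Z \<omega> * \<zeta> t \<omega> \<partial>M) = 0" if Z: "Z \<in> borel_measurable (F (Suc t))" "\<exists>b. \<forall>\<omega>. \<bar>Z \<omega>\<bar> \<le> b" for Z t
  proof -
    obtain b where b: "\<And>\<omega>. \<bar>Z \<omega>\<bar> \<le> b" using Z(2) by blast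
    have ZM: "Z \<in> borel_measurable M" by (rule F_measurable_M[OF Z(1)])
    have hm: "h t \<in> borel_measurable M" by (rule F_measurable_M[OF hF[of t t]]) simp
    have i: "integrable M (\<lambda>\<omega>. (Z \<omega> * h t \<omega> $ i) * e2 t \<omega> $ i)" for i
    proof -
      have "integrable M (\<lambda>\<omega>. h t \<omega> $ i * e2 t \<omega> $ i)"
      proof (rule Bochner_Integration.integrable_bound)
        show "integrable M (\<lambda>\<omega>. K * ((norm (e1 t \<omega>))\<^sup>2 + (norm (e2 t \<omega>))\<^sup>2))"
          by (intro integrable_mult_right Bochner_Integration.integrable_add) (simp_all add: e1_def e2_def)
        show "(\<lambda>\<omega>. h t \<omega> $ i * e2 t \<omega> $ i) \<in> borel_measurable M"
          using hm by (intro borel_measurable_times borel_measurable_vec_nth_comp e_measurable)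
        show "AE \<omega> in M. norm (h t \<omega> $ i * e2 t \<omega> $ i) \<le> norm (K * ((norm (e1 t \<omega>))\<^sup>2 + (norm (e2 t \<omega>))\<^sup>2))"
        proof (rule AE_I2)
          fix \<omega>
          have "\<bar>h t \<omega> $ i\<bar> * \<bar>e2 t \<omega> $ i\<bar> \<le> (K * norm (e1 t \<omega>)) * norm (e2 t \<omega>)"
            by (intro mult_mono order_trans[OF component_le_norm_cart hle] component_le_norm_cart) (auto simp: K)
          also have "\<dots> \<le> K * ((norm (e1 t \<omega>))\<^sup>2 + (norm (e2 t \<omega>))\<^sup>2)"
            using mult_left_mono[OF norm_cross_product_le[of "norm (e1 t \<omega>)" "norm (e2 t \<omega>)"] K] by (simp add: mult.assoc)
          finally show "norm (h t \<omega> $ i * e2 t \<omega> $ i) \<le> norm (K * ((norm (e1 t \<omega>))\<^sup>2 + (norm (e2 t \<omega>))\<^sup>2))"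
            using K by (simp add: abs_mult)
        qed
      qed
      from bounded_mult_integrable[OF ZM b this] show ?thesis by (simp add: mult.assoc)
    qed
    have "(\<integral>\<omega>. Z \<omega> * \<zeta> t \<omega> \<partial>M) = (\<integral>\<omega>. (\<Sum>i\<in>UNIV. (Z \<omega> * h t \<omega> $ i) * e2 t \<omega> $ i) / sqrt n \<partial>M)"
      by (simp add: \<zeta>_def inner_vec_def sum_distrib_left mult_ac)
    also have "\<dots> = (\<Sum>i\<in>UNIV. \<integral>\<omega>. (Z \<omega> * h t \<omega> $ i) * e2 t \<omega> $ i \<partial>M) / sqrt n"
      by (subst Bochner_Integration.integral_sum[OF i, symmetric]) simp
    also have "\<dots> = 0"
    proof -
      have "(\<integral>\<omega>. (Z \<omega> * h t \<omega> $ i) * e2 t \<omega> $ i \<partial>M) = 0" for i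
        unfolding e2_def
        by (rule mean_orthogonal) (use Z(1) hF[of t t] i[of i] in \<open>auto simp: e2_def intro!: borel_measurable_times borel_measurable_vec_nth_comp\<close>)
      then show ?thesis by simp
    qed
    finally show ?thesis .
  qed
  have var: "(\<integral>\<omega>. Z \<omega> * (\<zeta> t \<omega>)\<^sup>2 \<partial>M) = (\<integral>\<omega>. Z \<omega> * v t \<omega> \<partial>M)"
    if Z: "Z \<in> borel_measurable (F (Suc t))" "\<exists>b. \<forall>\<omega>. \<bar>Z \<omega>\<bar> \<le> b" for Z t
  proof -
    obtain b where b: "\<And>\<omega>. \<bar>Z \<omega>\<bar> \<le> b" using Z(2) by blast
    have ZM: "Z \<in> borel_measurable M" by (rule F_measurable_M[OF Z(1)])
    have hm: "h t \<in> borel_measurable M" by (rule F_measurable_M[OF hF[of t t]]) simp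
    let ?W = "\<lambda>i j \<omega>. Z \<omega> * (h t \<omega> $ i * h t \<omega> $ j)"
    have WF: "?W i j \<in> borel_measurable (F (Suc t))" for i j
      using Z(1) hF[of t t] by (intro borel_measurable_times borel_measurable_vec_nth_comp) auto
    have i: "integrable M (\<lambda>\<omega>. ?W i j \<omega> * (e2 t \<omega> $ i * e2 t \<omega> $ j))" for i j
    proof -
      have "integrable M (\<lambda>\<omega>. (h t \<omega> $ i * h t \<omega> $ j) * (e2 t \<omega> $ i * e2 t \<omega> $ j))"
      proof (rule Bochner_Integration.integrable_bound[OF integrable_mult_right[OF products_integrable[of t], of "K\<^sup>2"]])
        show "(\<lambda>\<omega>. (h t \<omega> $ i * h t \<omega> $ j) * (e2 t \<omega> $ i * e2 t \<omega> $ j)) \<in> borel_measurable M"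
          using hm by (intro borel_measurable_times borel_measurable_vec_nth_comp e_measurable)
        show "AE \<omega> in M. norm ((h t \<omega> $ i * h t \<omega> $ j) * (e2 t \<omega> $ i * e2 t \<omega> $ j)) \<le> norm (K\<^sup>2 * ((norm (e1 t \<omega>))\<^sup>2 * (norm (e2 t \<omega>))\<^sup>2))"
        proof (rule AE_I2)
          fix \<omega>
          have "\<bar>h t \<omega> $ i * h t \<omega> $ j\<bar> * \<bar>e2 t \<omega> $ i * e2 t \<omega> $ j\<bar> \<le> (K * norm (e1 t \<omega>))\<^sup>2 * (norm (e2 t \<omega>))\<^sup>2"
            by (intro mult_mono order_trans[OF coord_prod_le power_mono[OF hle]] coord_prod_le) auto
          then show "norm ((h t \<omega> $ i * h t \<omega> $ j) * (e2 t \<omega> $ i * e2 t \<omega> $ j)) \<le> norm (K\<^sup>2 * ((norm (e1 t \<omega>))\<^sup>2 * (norm (e2 t \<omega>))\<^sup>2))"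
            unfolding real_norm_def abs_mult[of "h t \<omega> $ i * h t \<omega> $ j"]
            by (intro order_trans[OF _ abs_ge_self]) (simp add: power_mult_distrib mult.assoc)
        qed
      qed
      from bounded_mult_integrable[OF ZM b this] show ?thesis by (simp add: mult.assoc)
    qed
    have Wi: "integrable M (?W i j)" for i j by (rule hi[OF ZM b])
    have "(\<integral>\<omega>. Z \<omega> * (\<zeta> t \<omega>)\<^sup>2 \<partial>M) = (\<integral>\<omega>. (\<Sum>i\<in>UNIV. \<Sum>j\<in>UNIV. ?W i j \<omega> * (e2 t \<omega> $ i * e2 t \<omega> $ j)) / n \<partial>M)"
    proof (rule Bochner_Integration.integral_cong[OF refl])
      fix \<omega>
      have "(e2 t \<omega> \<bullet> h t \<omega>)\<^sup>2 = (\<Sum>i\<in>UNIV. \<Sum>j\<in>UNIV. (h t \<omega> $ i * h t \<omega> $ j) * (e2 t \<omega> $ i * e2 t \<omega> $ j))"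
        unfolding inner_vec_def power2_eq_square sum_product by (simp add: mult_ac)
      then show "Z \<omega> * (\<zeta> t \<omega>)\<^sup>2 = (\<Sum>i\<in>UNIV. \<Sum>j\<in>UNIV. ?W i j \<omega> * (e2 t \<omega> $ i * e2 t \<omega> $ j)) / n"
        unfolding \<zeta>_def power_divide by (simp add: sum_distrib_left mult.assoc)
    qed
    also have "\<dots> = (\<Sum>i\<in>UNIV. \<Sum>j\<in>UNIV. \<integral>\<omega>. ?W i j \<omega> * (e2 t \<omega> $ i * e2 t \<omega> $ j) \<partial>M) / n"
    proof -
      have "(\<integral>\<omega>. (\<Sum>i\<in>UNIV. \<Sum>j\<in>UNIV. ?W i j \<omega> * (e2 t \<omega> $ i * e2 t \<omega> $ j)) \<partial>M)
         = (\<Sum>i\<in>UNIV. \<integral>\<omega>. (\<Sum>j\<in>UNIV. ?W i j \<omega> * (e2 t \<omega> $ i * e2 t \<omega> $ j)) \<partial>M)"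
        by (intro Bochner_Integration.integral_sum Bochner_Integration.integrable_sum i)
      also have "\<dots> = (\<Sum>i\<in>UNIV. \<Sum>j\<in>UNIV. \<integral>\<omega>. ?W i j \<omega> * (e2 t \<omega> $ i * e2 t \<omega> $ j) \<partial>M)"
        by (intro sum.cong refl Bochner_Integration.integral_sum i)
      finally show ?thesis by simp
    qed
    also have "\<dots> = (\<Sum>i\<in>UNIV. \<Sum>j\<in>UNIV. S $ i $ j * (\<integral>\<omega>. ?W i j \<omega> \<partial>M)) / n"
      using covariance_eq[OF WF i[unfolded e2_def]] by (simp only: e2_def)
    also have "\<dots> = (\<integral>\<omega>. (\<Sum>i\<in>UNIV. \<Sum>j\<in>UNIV. S $ i $ j * ?W i j \<omega>) / n \<partial>M)"
    proof -
      have "(\<integral>\<omega>. (\<Sum>i\<in>UNIV. \<Sum>j\<in>UNIV. S $ i $ j * ?W i j \<omega>) \<partial>M)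
         = (\<Sum>i\<in>UNIV. \<integral>\<omega>. (\<Sum>j\<in>UNIV. S $ i $ j * ?W i j \<omega>) \<partial>M)"
        by (intro Bochner_Integration.integral_sum Bochner_Integration.integrable_sum integrable_mult_right Wi)
      also have "\<dots> = (\<Sum>i\<in>UNIV. \<Sum>j\<in>UNIV. \<integral>\<omega>. S $ i $ j * ?W i j \<omega> \<partial>M)"
        by (intro sum.cong refl Bochner_Integration.integral_sum integrable_mult_right Wi)
      finally show ?thesis by simp
    qed
    also have "\<dots> = (\<integral>\<omega>. Z \<omega> * v t \<omega> \<partial>M)"
      unfolding v_def inner_vec_def matrix_vector_mult_def
      by (intro Bochner_Integration.integral_cong refl) (simp add: sum_distrib_left mult_ac)
    finally show ?thesis .
  qed
  have base: "cmod ((CLINT \<omega>|M. iexp (\<Sum>s<m. \<zeta> s \<omega>)) - of_real (exp (- \<tau> / 2)))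
    \<le> exp D * (\<Sum>s<m. (\<integral>\<omega>. min ((\<zeta> s \<omega>)\<^sup>2) (\<bar>\<zeta> s \<omega>\<bar> ^ 3) \<partial>M) + (\<integral>\<omega>. (min (v s \<omega>) D)\<^sup>2 \<partial>M))
      + \<eta> + (1 + exp D) * prob {\<omega> \<in> space M. \<bar>(\<Sum>s<m. v s \<omega>) - \<tau>\<bar> > \<eta>}"
    by (rule martingale_char_bound[where G="\<lambda>t. F (Suc t)", OF F_subalgebra \<zeta>F vF v0 \<zeta>2 vi orth var \<tau>(2,3) \<eta>])
  have eqS: "(\<Sum>s<m. \<zeta> s \<omega>) = (\<Sum>s<m. e2 s \<omega> \<bullet> (Q *v e1 s \<omega>)) / sqrt n" for \<omega>
    by (simp add: \<zeta>_def h_def sum_divide_distrib)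
  have sumle: "exp D * (\<Sum>s<m. (\<integral>\<omega>. min ((\<zeta> s \<omega>)\<^sup>2) (\<bar>\<zeta> s \<omega>\<bar> ^ 3) \<partial>M) + (\<integral>\<omega>. (min (v s \<omega>) D)\<^sup>2 \<partial>M))
    \<le> exp D * (K\<^sup>2 * B powr (- \<delta>) * ((1 + C) * C)
          + ((K * B) powr (2 + \<delta>) + D * (\<sigma> * K\<^sup>2) powr (1 + \<delta> / 2)) * C * real n powr (- (\<delta> / 2)))"
  proof (intro mult_left_mono)
    let ?a = "K\<^sup>2 * B powr (- \<delta>) / n" and ?b = "(K * B) powr (2 + \<delta>) * real n powr (- (1 + \<delta> / 2))"
    let ?c = "D * (\<sigma> * K\<^sup>2) powr (1 + \<delta> / 2) * real n powr (- (1 + \<delta> / 2))"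
    have i1: "integrable M (\<lambda>\<omega>. min ((\<zeta> s \<omega>)\<^sup>2) (\<bar>\<zeta> s \<omega>\<bar> ^ 3))" for s
      by (rule Bochner_Integration.integrable_bound[OF \<zeta>2[of s]]) (use \<zeta>m in auto)
    have i2: "integrable M (\<lambda>\<omega>. (min (v s \<omega>) D)\<^sup>2)" for s
    proof (rule integrable_const_bound[where B="D\<^sup>2"])
      show "AE \<omega> in M. norm ((min (v s \<omega>) D)\<^sup>2) \<le> D\<^sup>2"
        using v0 D1 by (intro AE_I2) (auto intro!: power_mono)
    qed (use vm in measurable)
    have m1: "integrable M (\<lambda>\<omega>. norm (e1 s \<omega>) powr (2 + \<delta>))" "(\<integral>\<omega>. norm (e1 s \<omega>) powr (2 + \<delta>) \<partial>M) \<le> C" for s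
      unfolding e1_def by (rule moment_integrable, rule moment_le)
    have m2: "integrable M (\<lambda>\<omega>. norm (e2 s \<omega>) powr (2 + \<delta>))" "(\<integral>\<omega>. norm (e2 s \<omega>) powr (2 + \<delta>) \<partial>M) \<le> C" for s
      unfolding e2_def by (rule moment_integrable, rule moment_le)
    have a0: "0 \<le> ?a" and b0: "0 \<le> ?b" and c0: "0 \<le> ?c" using n0 D1 by simp_all
    have t1: "(\<integral>\<omega>. min ((\<zeta> s \<omega>)\<^sup>2) (\<bar>\<zeta> s \<omega>\<bar> ^ 3) \<partial>M) \<le> ?a * ((1 + C) * C) + ?b * C" for s
    proof -
      have "(\<integral>\<omega>. min ((\<zeta> s \<omega>)\<^sup>2) (\<bar>\<zeta> s \<omega>\<bar> ^ 3) \<partial>M)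
        \<le> (\<integral>\<omega>. ?a * (norm (e1 s \<omega>) powr (2 + \<delta>) * (norm (e2 s \<omega>))\<^sup>2) + ?b * norm (e2 s \<omega>) powr (2 + \<delta>) \<partial>M)"
        using \<zeta>le \<delta> K B n0
        by (intro integral_mono i1 Bochner_Integration.integrable_add integrable_mult_right moment_products m2 min_square_cube_le) auto
      also have "\<dots> = ?a * (\<integral>\<omega>. norm (e1 s \<omega>) powr (2 + \<delta>) * (norm (e2 s \<omega>))\<^sup>2 \<partial>M) + ?b * (\<integral>\<omega>. norm (e2 s \<omega>) powr (2 + \<delta>) \<partial>M)"
        using moment_products(1)[of s] m2(1)[of s] by simp
      also have "\<dots> \<le> ?a * ((1 + C) * C) + ?b * C"
        by (intro add_mono mult_left_mono moment_products m2 a0 b0)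
      finally show ?thesis .
    qed
    have t2: "(\<integral>\<omega>. (min (v s \<omega>) D)\<^sup>2 \<partial>M) \<le> ?c * C" for s
    proof -
      have "(\<integral>\<omega>. (min (v s \<omega>) D)\<^sup>2 \<partial>M) \<le> (\<integral>\<omega>. ?c * norm (e1 s \<omega>) powr (2 + \<delta>) \<partial>M)"
        using v0 vle \<delta> D1 n0 \<sigma>
        by (intro integral_mono i2 integrable_mult_right m1 square_min_le) auto
      also have "\<dots> = ?c * (\<integral>\<omega>. norm (e1 s \<omega>) powr (2 + \<delta>) \<partial>M)" by simp
      also have "\<dots> \<le> ?c * C" by (intro mult_left_mono m1 c0)
      finally show ?thesis .
    qed
    have "(\<Sum>s<m. (\<integral>\<omega>. min ((\<zeta> s \<omega>)\<^sup>2) (\<bar>\<zeta> s \<omega>\<bar> ^ 3) \<partial>M) + (\<integral>\<omega>. (min (v s \<omega>) D)\<^sup>2 \<partial>M))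
       \<le> (\<Sum>s<m. ?a * ((1 + C) * C) + ?b * C + ?c * C)" by (intro sum_mono add_mono t1 t2)
    also have "\<dots> = real m * (?a * ((1 + C) * C) + ?b * C + ?c * C)" by simp
    also have "\<dots> \<le> real n * (?a * ((1 + C) * C) + ?b * C + ?c * C)"
      using n C_nonneg
      by (intro mult_right_mono add_nonneg_nonneg mult_nonneg_nonneg[OF a0] mult_nonneg_nonneg[OF b0]
          mult_nonneg_nonneg[OF c0]) auto
    also have "\<dots> = K\<^sup>2 * B powr (- \<delta>) * ((1 + C) * C)
          + ((K * B) powr (2 + \<delta>) + D * (\<sigma> * K\<^sup>2) powr (1 + \<delta> / 2)) * C * real n powr (- (\<delta> / 2))"
    proof -
      have p: "real n * real n powr (- (1 + \<delta> / 2)) = real n powr (- (\<delta> / 2))"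
      proof -
        have "real n * real n powr (- (1 + \<delta> / 2)) = real n powr 1 * real n powr (- (1 + \<delta> / 2))" using n0 by simp
        also have "\<dots> = real n powr (- (\<delta> / 2))" unfolding powr_add[symmetric] by simp
        finally show ?thesis .
      qed
      have "N * (k / N * x + b * p * c + d * e * p * c) = k * x + (b + d * e) * c * (N * p)" if "N \<noteq> 0" for N k x b p c d e :: real
        using that by (simp add: algebra_simps)
      from this[of "real n" "K\<^sup>2 * B powr (- \<delta>)" "(1 + C) * C" "(K * B) powr (2 + \<delta>)" "real n powr (- (1 + \<delta> / 2))" C D
          "(\<sigma> * K\<^sup>2) powr (1 + \<delta> / 2)"] n0
      show ?thesis unfolding p by simp
    qed
    finally show "(\<Sum>s<m. (\<integral>\<omega>. min ((\<zeta> s \<omega>)\<^sup>2) (\<bar>\<zeta> s \<omega>\<bar> ^ 3) \<partial>M) + (\<integral>\<omega>. (min (v s \<omega>) D)\<^sup>2 \<partial>M))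
      \<le> K\<^sup>2 * B powr (- \<delta>) * ((1 + C) * C)
          + ((K * B) powr (2 + \<delta>) + D * (\<sigma> * K\<^sup>2) powr (1 + \<delta> / 2)) * C * real n powr (- (\<delta> / 2))" .
  qed simp
  have proble: "prob {\<omega> \<in> space M. \<bar>(\<Sum>s<m. v s \<omega>) - \<tau>\<bar> > \<eta>} \<le> \<sigma> * K\<^sup>2 * lln_bound n / (real n * \<eta>)"
  proof -
    define U where "U \<omega> = cross (\<lambda>s. e1 s \<omega>) (\<lambda>s. e1 s \<omega>) m - real n *\<^sub>R S" for \<omega>
    have [measurable]: "U \<in> borel_measurable M" unfolding U_def cross_def[abs_def] by measurable
    have U: "integrable M (\<lambda>\<omega>. norm (U \<omega>))" "(\<integral>\<omega>. norm (U \<omega>) \<partial>M) \<le> lln_bound n"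
      unfolding U_def by (rule lln_cross; use n in simp)+
    let ?R = "transpose Q ** S ** Q"
    have R: "norm ?R \<le> \<sigma> * K\<^sup>2"
    proof -
      have "norm ?R \<le> norm (transpose Q) * norm S * norm Q"
        by (intro order_trans[OF norm_matrix_mult_le] mult_right_mono norm_matrix_mult_le) auto
      also have "\<dots> \<le> K * \<sigma> * K" using Q S K \<sigma> by (intro mult_mono) (auto simp: norm_transpose)
      finally show ?thesis by (simp add: power2_eq_square mult_ac)
    qed
    have eq: "(\<Sum>s<m. v s \<omega>) - \<tau> = (1 / n) * (?R \<bullet> U \<omega>)" for \<omega>
    proof -
      have vs: "h s \<omega> \<bullet> (S *v h s \<omega>) = ?R \<bullet> outer (e1 s \<omega>) (e1 s \<omega>)" for s
      proof -
        have "h s \<omega> \<bullet> (S *v h s \<omega>) = e1 s \<omega> \<bullet> (?R *v e1 s \<omega>)"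
          unfolding h_def using inner_transpose_matrix[of "e1 s \<omega>" Q "S *v (Q *v e1 s \<omega>)"]
          by (simp add: matrix_vector_mul_assoc matrix_mul_assoc)
        also have "\<dots> = ?R \<bullet> outer (e1 s \<omega>) (e1 s \<omega>)"
          by (simp add: inner_vec_def outer_def matrix_vector_mult_def sum_distrib_left mult_ac)
        finally show ?thesis .
      qed
      have "(\<Sum>s<m. v s \<omega>) = (1 / n) * (?R \<bullet> cross (\<lambda>s. e1 s \<omega>) (\<lambda>s. e1 s \<omega>) m)"
        by (simp add: v_def vs cross_def inner_sum_right sum_divide_distrib)
      then show ?thesis unfolding U_def \<tau>(1) using n0 by (simp add: inner_diff_right field_simps)
    qed
    have "{\<omega> \<in> space M. \<bar>(\<Sum>s<m. v s \<omega>) - \<tau>\<bar> > \<eta>} \<subseteq> {\<omega> \<in> space M. \<eta> < \<sigma> * K\<^sup>2 / n * norm (U \<omega>)}"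
    proof safe
      fix \<omega> assume "\<eta> < \<bar>(\<Sum>s<m. v s \<omega>) - \<tau>\<bar>"
      also have "\<dots> = (1 / n) * \<bar>?R \<bullet> U \<omega>\<bar>" unfolding eq using n0 by (simp add: abs_mult)
      also have "\<dots> \<le> (1 / n) * (\<sigma> * K\<^sup>2 * norm (U \<omega>))"
        using n0 R by (intro mult_left_mono order_trans[OF Cauchy_Schwarz_ineq2] mult_right_mono) auto
      finally show "\<eta> < \<sigma> * K\<^sup>2 / n * norm (U \<omega>)" by simp
    qed
    then have "prob {\<omega> \<in> space M. \<bar>(\<Sum>s<m. v s \<omega>) - \<tau>\<bar> > \<eta>} \<le> prob {\<omega> \<in> space M. \<eta> < \<sigma> * K\<^sup>2 / n * norm (U \<omega>)}"
      by (intro finite_measure_mono) measurable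
    also have "\<dots> \<le> (\<sigma> * K\<^sup>2 / n * lln_bound n) / \<eta>"
    proof (rule markov)
      show "(\<integral>\<omega>. \<sigma> * K\<^sup>2 / n * norm (U \<omega>) \<partial>M) \<le> \<sigma> * K\<^sup>2 / n * lln_bound n"
        using U(2) \<sigma> n0 by (subst integral_mult_right_zero) (intro mult_left_mono, auto)
    qed (use U \<sigma> n0 \<eta> in auto)
    finally show ?thesis using n0 by (simp add: mult_ac)
  qed
  have "(1 + exp D) * prob {\<omega> \<in> space M. \<bar>(\<Sum>s<m. v s \<omega>) - \<tau>\<bar> > \<eta>}
    \<le> (1 + exp D) * (\<sigma> * K\<^sup>2 * lln_bound n / (real n * \<eta>))"
    by (intro mult_left_mono proble) (simp add: add_nonneg_nonneg)
  then show ?thesis using base sumle unfolding eqS by linarith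
qed

end

section \<open>Stacked matrices\<close>

lemma inner_col_stack: "col_stack A \<bullet> col_stack B = A \<bullet> (B :: real^'n^'m)"
proof -
  have "col_stack A \<bullet> col_stack B = (\<Sum>j\<in>UNIV. \<Sum>i\<in>UNIV. A $ i $ j * B $ i $ j)"
    by (simp add: inner_vec_def col_stack_def UNIV_Times_UNIV[symmetric] sum.cartesian_product' del: UNIV_Times_UNIV)
  also have "\<dots> = A \<bullet> B" unfolding inner_vec_def by (simp add: sum.swap[of _ "UNIV::'n set"])
  finally show ?thesis .
qed

lemma norm_col_stack: "norm (col_stack A) = norm (A :: real^'n^'m)"
  by (simp add: norm_eq_sqrt_inner inner_col_stack)

lemma col_stack_diff: "col_stack (A - B) = col_stack A - col_stack (B :: real^'n^'m)"
  by (simp add: vec_eq_iff col_stack_def)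

lemma col_stack_scaleR: "col_stack (c *\<^sub>R A) = c *\<^sub>R col_stack (A :: real^'n^'m)"
  by (simp add: vec_eq_iff col_stack_def)

lemma col_stack_surj: "\<exists>U :: real^'n^'m. u = col_stack U"
  by (rule exI[of _ "\<chi> i j. u $ (j, i)"]) (simp add: vec_eq_iff col_stack_def)

lemma kronecker_col_stack: "kronecker B A *v col_stack U = col_stack (A ** U ** transpose B)"
proof (subst vec_eq_iff, rule allI)
  fix r
  have "(kronecker B A *v col_stack U) $ r
     = (\<Sum>l\<in>UNIV. \<Sum>k\<in>UNIV. B $ fst r $ l * A $ snd r $ k * U $ k $ l)"
    by (simp add: matrix_vector_mult_def kronecker_def col_stack_def UNIV_Times_UNIV[symmetric] sum.cartesian_product' del: UNIV_Times_UNIV)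
  also have "\<dots> = (\<Sum>l\<in>UNIV. (\<Sum>k\<in>UNIV. A $ snd r $ k * U $ k $ l) * B $ fst r $ l)"
    unfolding sum_distrib_right by (intro sum.cong refl) simp
  also have "\<dots> = col_stack (A ** U ** transpose B) $ r"
    by (simp add: col_stack_def matrix_matrix_mult_def transpose_def)
  finally show "(kronecker B A *v col_stack U) $ r = col_stack (A ** U ** transpose B) $ r" .
qed

lemma borel_measurable_col_stack [measurable]:
  fixes f :: "'a \<Rightarrow> real^'n^'m"
  assumes [measurable]: "f \<in> borel_measurable M"
  shows "(\<lambda>x. col_stack (f x)) \<in> borel_measurable M"
  by (intro borel_measurable_vecI) (simp add: col_stack_def)

lemma inner_matrix_mult_left: "(A ** B) \<bullet> C = B \<bullet> (transpose A ** C)" for A :: "real^'k^'m" and B :: "real^'n^'k"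
proof -
  let ?f = "\<lambda>i j k. A $ i $ k * B $ k $ j * C $ i $ j"
  have "(A ** B) \<bullet> C = (\<Sum>i\<in>UNIV. \<Sum>j\<in>UNIV. \<Sum>k\<in>UNIV. ?f i j k)"
    by (simp add: inner_vec_def matrix_matrix_mult_def sum_distrib_right)
  also have "\<dots> = (\<Sum>i\<in>UNIV. \<Sum>k\<in>UNIV. \<Sum>j\<in>UNIV. ?f i j k)"
    by (rule sum.cong[OF refl]) (rule sum.swap)
  also have "\<dots> = (\<Sum>k\<in>UNIV. \<Sum>i\<in>UNIV. \<Sum>j\<in>UNIV. ?f i j k)"
    by (rule sum.swap)
  also have "\<dots> = (\<Sum>k\<in>UNIV. \<Sum>j\<in>UNIV. \<Sum>i\<in>UNIV. ?f i j k)"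
    by (rule sum.cong[OF refl]) (rule sum.swap)
  also have "\<dots> = (\<Sum>k\<in>UNIV. \<Sum>j\<in>UNIV. B $ k $ j * (\<Sum>i\<in>UNIV. A $ i $ k * C $ i $ j))"
    unfolding sum_distrib_left by (intro sum.cong refl) simp
  also have "\<dots> = B \<bullet> (transpose A ** C)"
    by (simp add: inner_vec_def matrix_matrix_mult_def transpose_def)
  finally show ?thesis .
qed

lemma inner_matrix_mult_right: "(A ** B) \<bullet> C = A \<bullet> (C ** transpose B)" for A :: "real^'k^'m" and B :: "real^'n^'k"
proof -
  let ?f = "\<lambda>i j k. A $ i $ k * B $ k $ j * C $ i $ j"
  have "(A ** B) \<bullet> C = (\<Sum>i\<in>UNIV. \<Sum>j\<in>UNIV. \<Sum>k\<in>UNIV. ?f i j k)"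
    by (simp add: inner_vec_def matrix_matrix_mult_def sum_distrib_right)
  also have "\<dots> = (\<Sum>i\<in>UNIV. \<Sum>k\<in>UNIV. \<Sum>j\<in>UNIV. ?f i j k)"
    by (rule sum.cong[OF refl]) (rule sum.swap)
  also have "\<dots> = (\<Sum>i\<in>UNIV. \<Sum>k\<in>UNIV. A $ i $ k * (\<Sum>j\<in>UNIV. C $ i $ j * B $ k $ j))"
    unfolding sum_distrib_left by (intro sum.cong refl) simp
  also have "\<dots> = A \<bullet> (C ** transpose B)"
    by (simp add: inner_vec_def matrix_matrix_mult_def transpose_def)
  finally show ?thesis .
qed

lemma inner_outer: "A \<bullet> outer x y = x \<bullet> (A *v y)"
  by (simp add: inner_vec_def outer_def matrix_vector_mult_def sum_distrib_left mult_ac)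

section \<open>Approximation of the estimator by its leading term\<close>

text \<open>
  Where the two variables are \<open>\<xi>\<close>-close the Lipschitz property applies, and elsewhere the bound on \<open>f\<close>.
\<close>

lemma (in prob_space) BL_expectation_diff:
  fixes X Y :: "'a \<Rightarrow> 'b::euclidean_space" and f :: "'b \<Rightarrow> real"
  assumes [measurable]: "X \<in> borel_measurable M" "Y \<in> borel_measurable M"
    and f: "\<And>x. \<bar>f x\<bar> \<le> 1" "1-lipschitz_on UNIV f" and \<xi>: "0 \<le> \<xi>"
  shows "\<bar>(\<integral>\<omega>. f (X \<omega>) \<partial>M) - (\<integral>\<omega>. f (Y \<omega>) \<partial>M)\<bar> \<le> \<xi> + 2 * prob {\<omega> \<in> space M. \<xi> < norm (X \<omega> - Y \<omega>)}"
proof -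
  have fm [measurable]: "f \<in> borel_measurable borel"
    using f(2) by (intro borel_measurable_continuous_onI lipschitz_on_continuous_on)
  define A where "A = {\<omega> \<in> space M. \<xi> < norm (X \<omega> - Y \<omega>)}"
  have [measurable]: "A \<in> sets M" unfolding A_def by measurable
  have i: "integrable M (\<lambda>\<omega>. f (X \<omega>))" "integrable M (\<lambda>\<omega>. f (Y \<omega>))"
    using f(1) by (auto intro!: integrable_const_bound[where B=1])
  have iA: "integrable M (indicator A :: 'a \<Rightarrow> real)"
    by (rule integrable_const_bound[where B=1]) (auto simp: indicator_def)
  have le: "\<bar>f (X \<omega>) - f (Y \<omega>)\<bar> \<le> \<xi> + 2 * indicator A \<omega>" if "\<omega> \<in> space M" for \<omega>
  proof (cases "\<omega> \<in> A")
    case True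
    then show ?thesis using f(1)[of "X \<omega>"] f(1)[of "Y \<omega>"] \<xi> by simp
  next
    case False
    have "\<bar>f (X \<omega>) - f (Y \<omega>)\<bar> \<le> norm (X \<omega> - Y \<omega>)"
      using lipschitz_onD[OF f(2), of "X \<omega>" "Y \<omega>"] by (simp add: dist_norm)
    then show ?thesis using False that by (simp add: A_def)
  qed
  have "\<bar>(\<integral>\<omega>. f (X \<omega>) \<partial>M) - (\<integral>\<omega>. f (Y \<omega>) \<partial>M)\<bar> = \<bar>\<integral>\<omega>. f (X \<omega>) - f (Y \<omega>) \<partial>M\<bar>"
    using i by simp
  also have "\<dots> \<le> (\<integral>\<omega>. \<bar>f (X \<omega>) - f (Y \<omega>)\<bar> \<partial>M)" by (rule integral_abs_bound)
  also have "\<dots> \<le> (\<integral>\<omega>. \<xi> + 2 * indicator A \<omega> \<partial>M)"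
    using i iA le by (intro integral_mono) auto
  also have "\<dots> = \<xi> + 2 * prob A" using prob_space iA by (simp add: Int_absorb2[OF sets.sets_into_space])
  finally show ?thesis by (simp add: A_def)
qed

text \<open>
  The model together with the constants that control it uniformly: \<open>L\<close> bounds the growth of the
  process, \<open>c\<close> the covariance from below, and \<open>G\<close> the transposed coefficient matrix.
\<close>

locale lag_model = noise M \<epsilon> S C \<delta>
  for M :: "'a measure" and \<epsilon> :: "nat \<Rightarrow> 'a \<Rightarrow> real^'d" and S :: "real^'d^'d" and C \<delta> :: real +
  fixes X :: "nat \<Rightarrow> 'a \<Rightarrow> real^'d" and \<Gamma> :: "real^'d^'d" and c L G :: real
  assumes X_adapted: "\<And>t. X t \<in> borel_measurable (F t)"
    and X_rec: "\<And>t \<omega>. \<omega> \<in> space M \<Longrightarrow> X (Suc t) \<omega> = \<Gamma> *v X t \<omega> + \<epsilon> (Suc t) \<omega>"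
    and X_le: "\<And>t \<omega>. \<omega> \<in> space M \<Longrightarrow> norm (X t \<omega>) \<le> L * (\<Sum>s=1..t. norm (\<epsilon> s \<omega>))"
    and L: "0 \<le> L" and c: "0 < c" and S_form: "\<And>x. c * (x \<bullet> x) \<le> x \<bullet> (S *v x)"
    and \<Gamma>_le: "\<And>v. norm (transpose \<Gamma> *v v) \<le> G * norm v"
begin

lemma X_measurable [measurable]: "X t \<in> borel_measurable M"
  by (rule F_measurable_M[OF X_adapted])

definition estimator :: "nat \<Rightarrow> 'a \<Rightarrow> real^('d \<times> 'd)" where
  "estimator n \<omega> = sqrt n *\<^sub>R col_stack (Gamma_LA n (\<lambda>t. X t \<omega>) - \<Gamma>)"

text \<open>
  The regression has \<open>n - 1\<close> observations, at the times from \<open>2\<close> to \<open>n\<close>.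
\<close>

definition leading_term :: "nat \<Rightarrow> 'a \<Rightarrow> real^('d \<times> 'd)" where
  "leading_term n \<omega> = (1 / sqrt n) *\<^sub>R col_stack (cross (\<lambda>s. e2 s \<omega>) (\<lambda>s. e1 s \<omega>) (n - 1) ** matrix_inv S)"

lemma leading_term_measurable [measurable]: "leading_term n \<in> borel_measurable M"
  unfolding leading_term_def[abs_def] cross_def[abs_def] by measurable

lemma estimator_measurable [measurable]: "estimator n \<in> borel_measurable M"
proof -
  have [measurable]: "(\<lambda>\<omega>. lagged (\<lambda>t. X t \<omega>) t) \<in> borel_measurable M" for t
  proof (rule borel_measurable_vecI)
    fix k :: "'d + 'd"
    show "(\<lambda>\<omega>. lagged (\<lambda>t. X t \<omega>) t $ k) \<in> borel_measurable M"
      by (cases k) (simp_all add: lagged_def)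
  qed
  show ?thesis unfolding estimator_def[abs_def] Gamma_LA_def Pi_LA_def by measurable
qed

definition self_norm_rate :: "nat \<Rightarrow> real" where
  "self_norm_rate n = (1 + C) * (ln (fact CARD('d)) + CARD('d) * ln (1 + L\<^sup>2 * (1 + C) * real n ^ 3))"

lemma self_norm_prob:
  assumes "m \<le> n" "0 < n" "0 < \<kappa>"
  shows "prob {\<omega> \<in> space M. \<kappa> * sqrt n < total_self_norm (\<lambda>s. X s \<omega>) (\<lambda>s. \<epsilon> (s + Suc h) \<omega>) m} \<le> self_norm_rate n / (\<kappa> * sqrt n)"
proof (rule markov)
  note b = self_norm_bound[OF X_adapted X_le L, of h m]
  show "integrable M (\<lambda>\<omega>. total_self_norm (\<lambda>s. X s \<omega>) (\<lambda>s. \<epsilon> (s + Suc h) \<omega>) m)" by (rule b(1))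
  have "ln (1 + L\<^sup>2 * (1 + C) * real m ^ 3) \<le> ln (1 + L\<^sup>2 * (1 + C) * real n ^ 3)"
    using assms C_nonneg by (intro ln_mono add_left_mono mult_left_mono power_mono add_pos_nonneg) auto
  then show "(\<integral>\<omega>. total_self_norm (\<lambda>s. X s \<omega>) (\<lambda>s. \<epsilon> (s + Suc h) \<omega>) m \<partial>M) \<le> self_norm_rate n"
    using C_nonneg by (intro order_trans[OF b(2)]) (auto simp: self_norm_rate_def intro!: mult_left_mono add_left_mono)
qed (use assms total_self_norm_nonneg in auto)

text \<open>
  The event on which the deterministic error bound applies fails with small probability: Markov's
  inequality is applied to three self-normalised quantities, to two sample covariances and to one
  cross product.
\<close>

lemma leading_term_approximation:
  assumes nm: "n = m + 1" "m = k + 1" "1 \<le> k"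
    and \<eta>: "0 < \<eta>" "\<eta> \<le> c / 4" and \<kappa>: "0 < \<kappa>" "8 * (\<kappa> * sqrt n) \<le> c * n" and a: "0 < a"
    and large: "4 * (G\<^sup>2 + 1) \<le> c * n" "2 * (a + 2 * \<kappa>) \<le> c * sqrt n"
  shows "prob {\<omega> \<in> space M. real CARD('d) * ((4 * \<kappa> + 2 * \<eta> * (a + 2 * \<kappa>) / c) / c) < norm (estimator n \<omega> - leading_term n \<omega>)}
    \<le> 3 * (self_norm_rate n / (\<kappa> * sqrt n)) + 2 * (lln_bound n / (n * \<eta>)) + (real CARD('d))\<^sup>2 * (1 + C)\<^sup>2 / a\<^sup>2"
proof -
  let ?\<xi> = "real CARD('d) * ((4 * \<kappa> + 2 * \<eta> * (a + 2 * \<kappa>) / c) / c)"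
  have n0: "real n > 0" using nm by simp
  define q where "q h m \<omega> = total_self_norm (\<lambda>s. X s \<omega>) (\<lambda>s. \<epsilon> (s + Suc h) \<omega>) m" for h m \<omega>
  define U where "U m \<omega> = norm (cross (\<lambda>s. e1 s \<omega>) (\<lambda>s. e1 s \<omega>) m - real n *\<^sub>R S)" for m \<omega>
  define A where "A \<omega> = (norm (cross (\<lambda>s. e2 s \<omega>) (\<lambda>s. e1 s \<omega>) m))\<^sup>2" for \<omega>
  have q_int: "integrable M (q h m)" for h m
    unfolding q_def[abs_def] by (rule self_norm_bound(1)[OF X_adapted X_le L])
  have U_int: "integrable M (U m)" "integrable M (U k)" and U_le: "(\<integral>\<omega>. U m \<omega> \<partial>M) \<le> lln_bound n" "(\<integral>\<omega>. U k \<omega> \<partial>M) \<le> lln_bound n"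
    unfolding U_def[abs_def] by (rule lln_cross; use nm in simp)+
  have A_int: "integrable M A" and A_le: "(\<integral>\<omega>. A \<omega> \<partial>M) \<le> (real CARD('d))\<^sup>2 * (real n * (1 + C)\<^sup>2)"
    unfolding A_def[abs_def]
    by (rule second_moment_cross, rule order_trans[OF second_moment_cross(2)])
       (use nm in \<open>auto intro!: mult_left_mono mult_right_mono\<close>)
  note [measurable] = q_int[THEN borel_measurable_integrable] U_int[THEN borel_measurable_integrable] A_int[THEN borel_measurable_integrable]
  let ?E1 = "{\<omega> \<in> space M. \<kappa> * sqrt n < q 0 m \<omega>}" and ?E2 = "{\<omega> \<in> space M. \<kappa> * sqrt n < q 0 k \<omega>}"
  let ?E3 = "{\<omega> \<in> space M. \<kappa> * sqrt n < q 1 m \<omega>}"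
  let ?E4 = "{\<omega> \<in> space M. n * \<eta> < U m \<omega>}" and ?E5 = "{\<omega> \<in> space M. n * \<eta> < U k \<omega>}"
  let ?E6 = "{\<omega> \<in> space M. a\<^sup>2 * n < A \<omega>}"
  have sub: "{\<omega> \<in> space M. ?\<xi> < norm (estimator n \<omega> - leading_term n \<omega>)} \<subseteq> (?E1 \<union> ?E2 \<union> ?E3) \<union> (?E4 \<union> ?E5) \<union> ?E6"
  proof (rule subsetI, rule ccontr)
    fix \<omega> assume \<omega>: "\<omega> \<in> {\<omega> \<in> space M. ?\<xi> < norm (estimator n \<omega> - leading_term n \<omega>)}"
      and "\<omega> \<notin> (?E1 \<union> ?E2 \<union> ?E3) \<union> (?E4 \<union> ?E5) \<union> ?E6"
    then have sp: "\<omega> \<in> space M" and good: "q 0 m \<omega> \<le> \<kappa> * sqrt n" "q 0 k \<omega> \<le> \<kappa> * sqrt n" "q 1 m \<omega> \<le> \<kappa> * sqrt n"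
      "U m \<omega> \<le> n * \<eta>" "U k \<omega> \<le> n * \<eta>" "A \<omega> \<le> a\<^sup>2 * n" by auto
    have sh: "(\<lambda>s. \<epsilon> (s + 1) \<omega>) = (\<lambda>s. e1 s \<omega>)" "(\<lambda>s. \<epsilon> (s + 2) \<omega>) = (\<lambda>s. e2 s \<omega>)"
      by (simp_all add: e1_def e2_def)
    have A': "norm (cross (\<lambda>s. e2 s \<omega>) (\<lambda>s. e1 s \<omega>) m) \<le> a * sqrt n"
    proof (rule power2_le_imp_le)
      show "(norm (cross (\<lambda>s. e2 s \<omega>) (\<lambda>s. e1 s \<omega>) m))\<^sup>2 \<le> (a * sqrt n)\<^sup>2"
        using good(6) n0 by (simp add: A_def power_mult_distrib)
    qed (use a n0 in simp)
    have "norm (sqrt n *\<^sub>R (Gamma_LA n (\<lambda>t. X t \<omega>) - \<Gamma>)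
       - (1 / sqrt n) *\<^sub>R (cross (\<lambda>s. \<epsilon> (s + 2) \<omega>) (\<lambda>s. \<epsilon> (s + 1) \<omega>) m ** matrix_inv S)) \<le> ?\<xi>"
    proof (rule lag_augmented_error[where G=G and k=k])
      show "X (Suc t) \<omega> = \<Gamma> *v X t \<omega> + \<epsilon> (Suc t) \<omega>" for t by (rule X_rec[OF sp])
      show "norm (cross (\<lambda>s. \<epsilon> (s + 1) \<omega>) (\<lambda>s. \<epsilon> (s + 1) \<omega>) m - real n *\<^sub>R S) \<le> real n * \<eta>"
        "norm (cross (\<lambda>s. \<epsilon> (s + 1) \<omega>) (\<lambda>s. \<epsilon> (s + 1) \<omega>) k - real n *\<^sub>R S) \<le> real n * \<eta>"
        using good(4,5) unfolding sh U_def by auto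
      show "total_self_norm (\<lambda>t. X t \<omega>) (\<lambda>s. \<epsilon> (s + 1) \<omega>) m \<le> \<kappa> * sqrt n"
        "total_self_norm (\<lambda>t. X t \<omega>) (\<lambda>s. \<epsilon> (s + 1) \<omega>) k \<le> \<kappa> * sqrt n"
        "total_self_norm (\<lambda>t. X t \<omega>) (\<lambda>s. \<epsilon> (s + 2) \<omega>) m \<le> \<kappa> * sqrt n"
        using good(1,2,3) by (simp_all add: q_def)
      show "norm (cross (\<lambda>s. \<epsilon> (s + 2) \<omega>) (\<lambda>s. \<epsilon> (s + 1) \<omega>) m) \<le> a * sqrt n" unfolding sh by (rule A')
    qed (use nm S_sym c S_form \<Gamma>_le \<eta> \<kappa> large in auto)
    moreover have "estimator n \<omega> - leading_term n \<omega> = col_stack (sqrt n *\<^sub>R (Gamma_LA n (\<lambda>t. X t \<omega>) - \<Gamma>)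
       - (1 / sqrt n) *\<^sub>R (cross (\<lambda>s. \<epsilon> (s + 2) \<omega>) (\<lambda>s. \<epsilon> (s + 1) \<omega>) m ** matrix_inv S))"
      unfolding sh estimator_def leading_term_def col_stack_diff col_stack_scaleR using nm by simp
    ultimately show False using \<omega> by (simp add: norm_col_stack)
  qed
  have u: "prob (P \<union> R) \<le> p + r" if "P \<in> sets M" "R \<in> sets M" "prob P \<le> p" "prob R \<le> r" for P R p r
    using measure_Un_le[OF that(1,2)] that(3,4) by linarith
  have s1: "?E1 \<in> sets M" "?E2 \<in> sets M" "?E3 \<in> sets M" "?E4 \<in> sets M" "?E5 \<in> sets M" "?E6 \<in> sets M"
    by measurable
  have p1: "prob ?E1 \<le> self_norm_rate n / (\<kappa> * sqrt n)" "prob ?E2 \<le> self_norm_rate n / (\<kappa> * sqrt n)" "prob ?E3 \<le> self_norm_rate n / (\<kappa> * sqrt n)"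
    unfolding q_def by (rule self_norm_prob; use nm \<kappa> in simp)+
  have nn: "0 \<le> U m \<omega>" "0 < real n * \<eta>" for m \<omega> using n0 \<eta> by (simp_all add: U_def)
  have p4: "prob ?E4 \<le> lln_bound n / (n * \<eta>)" "prob ?E5 \<le> lln_bound n / (n * \<eta>)"
    by (rule markov[OF U_int(1) nn(1) U_le(1) nn(2)], rule markov[OF U_int(2) nn(1) U_le(2) nn(2)])
  have p6: "prob ?E6 \<le> (real CARD('d))\<^sup>2 * (1 + C)\<^sup>2 / a\<^sup>2"
  proof -
    have "prob ?E6 \<le> (real CARD('d))\<^sup>2 * (real n * (1 + C)\<^sup>2) / (a\<^sup>2 * n)"
      by (rule markov[OF A_int _ A_le]) (use n0 a in \<open>auto simp: A_def\<close>)
    also have "\<dots> = (real CARD('d))\<^sup>2 * (1 + C)\<^sup>2 / a\<^sup>2" using n0 by simp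
    finally show ?thesis .
  qed
  have "prob {\<omega> \<in> space M. ?\<xi> < norm (estimator n \<omega> - leading_term n \<omega>)} \<le> prob ((?E1 \<union> ?E2 \<union> ?E3) \<union> (?E4 \<union> ?E5) \<union> ?E6)"
    using s1 by (intro finite_measure_mono[OF sub]) auto
  also have "\<dots> \<le> ((self_norm_rate n / (\<kappa> * sqrt n) + self_norm_rate n / (\<kappa> * sqrt n)) + self_norm_rate n / (\<kappa> * sqrt n))
     + (lln_bound n / (n * \<eta>) + lln_bound n / (n * \<eta>)) + (real CARD('d))\<^sup>2 * (1 + C)\<^sup>2 / a\<^sup>2"
    by (intro u p1 p4 p6 sets.Un s1)
  finally have le: "prob {\<omega> \<in> space M. ?\<xi> < norm (estimator n \<omega> - leading_term n \<omega>)} \<le> \<dots>" .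
  have "((x + x) + x) + (y + y) + z = 3 * x + 2 * y + z" for x y z :: real by simp
  from le[unfolded this] show ?thesis .
qed

lemma S_invertible: "invertible S"
  using S_form c by (intro invertible_if_form_pos) (metis inner_gt_zero_iff less_le_trans mult_pos_pos)

lemma S_inv_sym: "transpose (matrix_inv S) = matrix_inv S"
  by (rule matrix_inv_transpose_sym[OF S_invertible S_sym])

lemma norm_S_inv: "norm (matrix_inv S) \<le> real CARD('d) / c"
proof -
  have "norm (transpose (matrix_inv S) *v b) \<le> (1 / c) * norm b" for b
  proof -
    let ?y = "matrix_inv S *v b"
    have Sy: "S *v ?y = b" by (simp add: matrix_vector_mul_assoc matrix_inv_mult[OF S_invertible])
    have "c * (norm ?y * norm ?y) \<le> norm ?y * norm b"
      using S_form[of ?y] Cauchy_Schwarz_ineq2[of ?y b] unfolding Sy by (simp add: power2_norm_eq_inner[symmetric] power2_eq_square)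
    then have "norm ?y * (c * norm ?y) \<le> norm ?y * norm b" by (simp add: mult_ac)
    then have "c * norm ?y \<le> norm b" by (cases "?y = 0") auto
    then show ?thesis unfolding S_inv_sym using c by (simp add: field_simps)
  qed
  from norm_matrix_le_transpose_mult[OF this] show ?thesis by simp
qed

lemma norm_S: "norm S \<le> (real CARD('d))\<^sup>2 * (1 + C)"
proof -
  have "norm S \<le> (\<Sum>i\<in>UNIV. \<Sum>j\<in>UNIV. \<bar>S $ i $ j\<bar>)" by (rule norm_matrix_le_entries)
  also have "\<dots> \<le> (\<Sum>i\<in>(UNIV::'d set). \<Sum>j\<in>(UNIV::'d set). 1 + C)" by (intro sum_mono S_entry_le)
  finally show ?thesis by (simp add: power2_eq_square)
qed

lemma leading_term_second_moment:
  assumes "0 < n"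
  shows "integrable M (\<lambda>\<omega>. (norm (leading_term n \<omega>))\<^sup>2)"
    "(\<integral>\<omega>. (norm (leading_term n \<omega>))\<^sup>2 \<partial>M) \<le> (real CARD('d) / c)\<^sup>2 * ((real CARD('d))\<^sup>2 * (1 + C)\<^sup>2)"
proof -
  let ?A = "\<lambda>\<omega>. cross (\<lambda>s. e2 s \<omega>) (\<lambda>s. e1 s \<omega>) (n - 1)"
  let ?k = "(real CARD('d) / c)\<^sup>2"
  have le: "(norm (leading_term n \<omega>))\<^sup>2 \<le> ?k / n * (norm (?A \<omega>))\<^sup>2" for \<omega>
  proof -
    have "norm (?A \<omega> ** matrix_inv S) \<le> norm (?A \<omega>) * (real CARD('d) / c)"
      by (rule order_trans[OF norm_matrix_mult_le mult_left_mono[OF norm_S_inv norm_ge_zero]])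
    then have "norm (leading_term n \<omega>) \<le> (1 / sqrt n) * (norm (?A \<omega>) * (real CARD('d) / c))"
      by (simp only: leading_term_def norm_scaleR norm_col_stack) (intro mult_mono, auto)
    then have "(norm (leading_term n \<omega>))\<^sup>2 \<le> ((1 / sqrt n) * (norm (?A \<omega>) * (real CARD('d) / c)))\<^sup>2"
      by (intro power_mono) auto
    also have "\<dots> = ?k / n * (norm (?A \<omega>))\<^sup>2" using assms by (simp add: power_mult_distrib power_divide mult.commute)
    finally show ?thesis .
  qed
  have bi: "integrable M (\<lambda>\<omega>. ?k / n * (norm (?A \<omega>))\<^sup>2)" by (intro integrable_mult_right second_moment_cross)
  show i: "integrable M (\<lambda>\<omega>. (norm (leading_term n \<omega>))\<^sup>2)"
    by (rule Bochner_Integration.integrable_bound[OF bi]) (measurable, use le in \<open>auto intro!: AE_I2 intro: order_trans[OF le abs_ge_self]\<close>)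
  have "(\<integral>\<omega>. (norm (leading_term n \<omega>))\<^sup>2 \<partial>M) \<le> (\<integral>\<omega>. ?k / n * (norm (?A \<omega>))\<^sup>2 \<partial>M)"
    by (intro integral_mono i bi le)
  also have "\<dots> = ?k / n * (\<integral>\<omega>. (norm (?A \<omega>))\<^sup>2 \<partial>M)" by simp
  also have "\<dots> \<le> ?k / n * ((real CARD('d))\<^sup>2 * (real (n - 1) * (1 + C)\<^sup>2))"
    by (intro mult_left_mono second_moment_cross) simp
  also have "\<dots> \<le> ?k / n * ((real CARD('d))\<^sup>2 * (real n * (1 + C)\<^sup>2))"
    by (intro mult_left_mono mult_right_mono) auto
  also have "\<dots> = ?k * ((real CARD('d))\<^sup>2 * (1 + C)\<^sup>2)" using assms by simp
  finally show "(\<integral>\<omega>. (norm (leading_term n \<omega>))\<^sup>2 \<partial>M) \<le> ?k * ((real CARD('d))\<^sup>2 * (1 + C)\<^sup>2)" .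
qed

definition target :: "(real^('d \<times> 'd)) measure" where
  "target = multivariate_normal 0 (kronecker (matrix_inv S) S)"

lemma target_factor:
  obtains B :: "real^('d \<times> 'd)^('d \<times> 'd)" where "invertible B" "kronecker (matrix_inv S) S = B ** transpose B" "target = distr std_gauss borel (\<lambda>x. B *v x)"
proof -
  have pos: "0 < x \<bullet> (S *v x)" if "x \<noteq> 0" for x
    using S_form[of x] c that by (metis inner_gt_zero_iff less_le_trans mult_pos_pos)
  obtain B :: "real^('d \<times> 'd)^('d \<times> 'd)" where B: "invertible B" "kronecker (matrix_inv S) S = B ** transpose B"
    by (rule kronecker_inv_factor[OF S_sym pos])
  show thesis
    by (rule that[OF B]) (simp only: target_def B(2) multivariate_normal_eq_distr[OF B(1)])
qed

lemma sets_target: "sets target = sets borel"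
  by (simp add: target_def multivariate_normal_def)

lemma prob_space_target: "prob_space target"
proof -
  obtain B :: "real^('d \<times> 'd)^('d \<times> 'd)" where "target = distr std_gauss borel (\<lambda>x. B *v x)" by (rule target_factor)
  then show ?thesis using prob_space.prob_space_distr[OF prob_space_std_gauss, of "\<lambda>x. B *v x" borel] by simp
qed

lemma target_char: "char_vec target u = of_real (exp (- (u \<bullet> (kronecker (matrix_inv S) S *v u)) / 2))"
proof -
  obtain B :: "real^('d \<times> 'd)^('d \<times> 'd)" where B: "kronecker (matrix_inv S) S = B ** transpose B" "target = distr std_gauss borel (\<lambda>x. B *v x)"
    by (rule target_factor)
  have "char_vec target u = (CLINT x|std_gauss. iexp ((transpose B *v u) \<bullet> x))"
  proof -
    have "u \<bullet> (B *v x) = (transpose B *v u) \<bullet> x" for x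
      using inner_transpose_matrix[of x B u] by (simp add: inner_commute)
    then show ?thesis unfolding B(2) by (subst integral_distr) simp_all
  qed
  also have "\<dots> = of_real (exp (- ((transpose B *v u) \<bullet> (transpose B *v u)) / 2))" by (rule char_std_gauss)
  also have "(transpose B *v u) \<bullet> (transpose B *v u) = u \<bullet> (kronecker (matrix_inv S) S *v u)"
    unfolding B(1) using inner_transpose_matrix[of u "transpose B" "transpose B *v u"]
    by (simp only: matrix_vector_mul_assoc transpose_transpose)
  finally show ?thesis .
qed

lemma target_second_moment:
  "integrable target (\<lambda>x. (norm x)\<^sup>2)"
  "(\<integral>x. (norm x)\<^sup>2 \<partial>target) \<le> real CARD('d \<times> 'd) * (real CARD('d \<times> 'd) * (real CARD('d) / c * ((real CARD('d))\<^sup>2 * (1 + C))))"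
proof -
  obtain B :: "real^('d \<times> 'd)^('d \<times> 'd)" where B: "kronecker (matrix_inv S) S = B ** transpose B" "target = distr std_gauss borel (\<lambda>x. B *v x)"
    by (rule target_factor)
  let ?t = "real CARD('d) / c * ((real CARD('d))\<^sup>2 * (1 + C))"
  have B2: "(norm B)\<^sup>2 \<le> real CARD('d \<times> 'd) * ?t"
  proof -
    \<comment> \<open>The squared norm is the trace of the covariance, whose diagonal entries are products of diagonal
      entries of the two factors.\<close>
    have "(norm B)\<^sup>2 = (\<Sum>p\<in>UNIV. (B ** transpose B) $ p $ p)"
      unfolding power2_norm_eq_inner inner_vec_def by (simp add: matrix_matrix_mult_def transpose_def)
    also have "\<dots> \<le> (\<Sum>p\<in>(UNIV::('d \<times> 'd) set). ?t)"
    proof (rule sum_mono)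
      fix p :: "'d \<times> 'd"
      have e: "\<bar>A $ i $ i\<bar> \<le> norm A" for A :: "real^'d^'d" and i
        using order_trans[OF component_le_norm_cart[of "A $ i" i] Finite_Cartesian_Product.norm_nth_le[of A i]] .
      have "(B ** transpose B) $ p $ p \<le> \<bar>matrix_inv S $ fst p $ fst p\<bar> * \<bar>S $ snd p $ snd p\<bar>"
        unfolding B(1)[symmetric] kronecker_def by (simp add: abs_mult[symmetric])
      also have "\<dots> \<le> ?t"
        by (intro mult_mono order_trans[OF e norm_S_inv] order_trans[OF e norm_S]) (use c in auto)
      finally show "(B ** transpose B) $ p $ p \<le> ?t" .
    qed
    finally show ?thesis by simp
  qed
  have le: "(norm (B *v x))\<^sup>2 \<le> (norm B)\<^sup>2 * (norm x)\<^sup>2" for x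
    using power_mono[OF norm_matrix_vector_le[of B x] norm_ge_zero, of 2] by (simp add: power_mult_distrib)
  have bi: "integrable std_gauss (\<lambda>x. (norm B)\<^sup>2 * (norm x)\<^sup>2)" for B :: "real^('d \<times> 'd)^('d \<times> 'd)"
    using second_moment_std_gauss(1) by (rule integrable_mult_right)
  have i: "integrable std_gauss (\<lambda>x. (norm (B *v x))\<^sup>2)"
  proof (rule Bochner_Integration.integrable_bound[OF bi[of B]])
    show "AE x in std_gauss. norm ((norm (B *v x))\<^sup>2) \<le> norm ((norm B)\<^sup>2 * (norm x)\<^sup>2)"
      using le by (intro AE_I2) simp
  qed simp
  show "integrable target (\<lambda>x. (norm x)\<^sup>2)" unfolding B(2) using i by (subst integrable_distr_eq) simp_all
  have "(\<integral>x. (norm x)\<^sup>2 \<partial>target) = (\<integral>x. (norm (B *v x))\<^sup>2 \<partial>std_gauss)"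
    unfolding B(2) by (subst integral_distr) simp_all
  also have "\<dots> \<le> (\<integral>x. (norm B)\<^sup>2 * (norm x)\<^sup>2 \<partial>(std_gauss :: (real^('d \<times> 'd)) measure))"
    by (rule integral_mono[OF i bi]) (rule le)
  also have "\<dots> = (norm B)\<^sup>2 * real CARD('d \<times> 'd)" using second_moment_std_gauss(2)[where 'n="'d \<times> 'd"] by simp
  also have "\<dots> \<le> real CARD('d \<times> 'd) * ?t * real CARD('d \<times> 'd)" by (intro mult_right_mono B2) simp
  finally show "(\<integral>x. (norm x)\<^sup>2 \<partial>target) \<le> real CARD('d \<times> 'd) * (real CARD('d \<times> 'd) * ?t)" by (simp only: mult_ac)
qed

text \<open>
  Tested with the stacked matrix \<open>U\<close>, the leading term is a sum of products \<open>e2 s \<bullet> Q e1 s\<close> with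
  \<open>Q = U S\<^sup>-\<^sup>1\<close>, and the limiting variance \<open>\<tau>\<close> of that sum is the form of the Kronecker product at \<open>u\<close>.
\<close>

lemma char_leading_term:
  assumes u: "norm u \<le> K" and K: "0 \<le> K" and n: "2 \<le> n" and \<eta>: "0 < \<eta>" "\<eta> \<le> 1" and B: "0 < B"
  defines "Kd \<equiv> K * (real CARD('d) / c)" and "\<sigma> \<equiv> (real CARD('d))\<^sup>2 * (1 + C)"
  defines "D \<equiv> \<sigma> * Kd\<^sup>2 * \<sigma> + 1"
  shows "cmod (char_vec (distr M borel (leading_term n)) u - char_vec target u)
    \<le> exp D * (Kd\<^sup>2 * B powr (- \<delta>) * ((1 + C) * C)
          + ((Kd * B) powr (2 + \<delta>) + D * (\<sigma> * Kd\<^sup>2) powr (1 + \<delta> / 2)) * C * real n powr (- (\<delta> / 2)))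
      + \<eta> + (1 + exp D) * (\<sigma> * Kd\<^sup>2 * lln_bound n / (real n * \<eta>))"
proof -
  obtain U :: "real^'d^'d" where U: "u = col_stack U" using col_stack_surj[of u] by blast
  define Q where "Q = U ** matrix_inv S"
  define \<tau> where "\<tau> = (transpose Q ** S ** Q) \<bullet> S"
  have psd: "0 \<le> x \<bullet> (S *v x)" for x using S_form[of x] c by (smt (verit) inner_ge_zero mult_nonneg_nonneg)
  have \<sigma>0: "0 \<le> \<sigma>" using C_nonneg by (simp add: \<sigma>_def)
  have Q: "norm Q \<le> Kd"
  proof -
    have "norm Q \<le> norm U * norm (matrix_inv S)" unfolding Q_def by (rule norm_matrix_mult_le)
    also have "\<dots> \<le> K * (real CARD('d) / c)" using u K by (intro mult_mono norm_S_inv) (auto simp: U norm_col_stack)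
    finally show ?thesis by (simp add: Kd_def)
  qed
  have Kd: "0 \<le> Kd" using Q by (meson norm_ge_zero order_trans)
  have S: "norm S \<le> \<sigma>" unfolding \<sigma>_def by (rule norm_S)
  have QS: "Q ** S = U" by (simp add: Q_def matrix_mul_assoc[symmetric] matrix_inv_mult[OF S_invertible])
  have \<tau>u: "\<tau> = u \<bullet> (kronecker (matrix_inv S) S *v u)"
  proof -
    have "\<tau> = (transpose Q ** (S ** Q)) \<bullet> S" by (simp add: \<tau>_def matrix_mul_assoc)
    also have "\<dots> = (S ** Q) \<bullet> (Q ** S)" by (simp add: inner_matrix_mult_left)
    also have "\<dots> = U \<bullet> (S ** U ** matrix_inv S)" unfolding QS by (simp add: Q_def matrix_mul_assoc inner_commute)
    also have "\<dots> = u \<bullet> (kronecker (matrix_inv S) S *v u)"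
      unfolding U kronecker_col_stack inner_col_stack S_inv_sym ..
    finally show ?thesis .
  qed
  have \<tau>0: "0 \<le> \<tau>"
  proof -
    obtain B :: "real^('d \<times> 'd)^('d \<times> 'd)" where B: "kronecker (matrix_inv S) S = B ** transpose B" by (rule target_factor)
    show ?thesis unfolding \<tau>u B using inner_transpose_matrix[of u "transpose B" "transpose B *v u"]
      by (simp add: matrix_vector_mul_assoc[symmetric])
  qed
  have \<tau>D: "\<tau> + 1 \<le> D"
  proof -
    have "\<tau> \<le> norm (transpose Q ** S ** Q) * norm S" unfolding \<tau>_def by (rule norm_cauchy_schwarz)
    also have "norm (transpose Q ** S ** Q) \<le> norm (transpose Q) * norm S * norm Q"
      by (intro order_trans[OF norm_matrix_mult_le] mult_right_mono norm_matrix_mult_le) auto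
    also have "\<dots> \<le> Kd * \<sigma> * Kd" using Q S Kd \<sigma>0 by (intro mult_mono) (auto simp: norm_transpose)
    also have "Kd * \<sigma> * Kd * norm S \<le> Kd * \<sigma> * Kd * \<sigma>" using S Kd \<sigma>0 by (intro mult_left_mono) auto
    finally show ?thesis by (simp add: D_def power2_eq_square mult_ac mult_right_mono)
  qed
  have lt: "u \<bullet> leading_term n \<omega> = (\<Sum>s<n - 1. e2 s \<omega> \<bullet> (Q *v e1 s \<omega>)) / sqrt n" for \<omega>
  proof -
    have "u \<bullet> leading_term n \<omega> = (U \<bullet> (cross (\<lambda>s. e2 s \<omega>) (\<lambda>s. e1 s \<omega>) (n - 1) ** matrix_inv S)) / sqrt n"
      by (simp add: leading_term_def U inner_col_stack)
    also have "U \<bullet> (cross (\<lambda>s. e2 s \<omega>) (\<lambda>s. e1 s \<omega>) (n - 1) ** matrix_inv S) = cross (\<lambda>s. e2 s \<omega>) (\<lambda>s. e1 s \<omega>) (n - 1) \<bullet> Q"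
      by (subst inner_commute, subst inner_matrix_mult_right) (simp add: S_inv_sym Q_def)
    also have "\<dots> = (\<Sum>s<n - 1. e2 s \<omega> \<bullet> (Q *v e1 s \<omega>))"
      by (subst inner_commute) (simp add: cross_def inner_sum_right inner_outer)
    finally show ?thesis .
  qed
  have "char_vec (distr M borel (leading_term n)) u = (CLINT \<omega>|M. iexp ((\<Sum>s<n - 1. e2 s \<omega> \<bullet> (Q *v e1 s \<omega>)) / sqrt n))"
    by (subst integral_distr) (simp_all add: lt)
  then show ?thesis
    unfolding target_char \<tau>u[symmetric]
    using noise_char_bound[OF psd Q S \<tau>_def \<tau>0 \<tau>D _ _ \<eta> B, of n "n - 1"] n by simp
qed

end

section \<open>The uniform limit\<close>

lemma (in lag_model) BL_bound:
  fixes f :: "real^('d \<times> 'd) \<Rightarrow> real"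
  assumes f: "\<And>x. \<bar>f x\<bar> \<le> 1" "1-lipschitz_on UNIV f" and \<xi>: "0 \<le> \<xi>"
    and p: "prob {\<omega> \<in> space M. \<xi> < norm (estimator n \<omega> - leading_term n \<omega>)} \<le> p"
    and l: "\<bar>(\<integral>x. f x \<partial>distr M borel (leading_term n)) - (\<integral>x. f x \<partial>target)\<bar> \<le> r"
  shows "\<bar>(\<integral>x. f x \<partial>distr M borel (estimator n)) - (\<integral>x. f x \<partial>target)\<bar> \<le> \<xi> + 2 * p + r"
proof -
  have [measurable]: "f \<in> borel_measurable borel"
    using f(2) by (intro borel_measurable_continuous_onI lipschitz_on_continuous_on)
  have "\<bar>(\<integral>\<omega>. f (estimator n \<omega>) \<partial>M) - (\<integral>\<omega>. f (leading_term n \<omega>) \<partial>M)\<bar> \<le> \<xi> + 2 * p"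
    using BL_expectation_diff[OF estimator_measurable leading_term_measurable f \<xi>, of n n] p by linarith
  moreover have "(\<integral>x. f x \<partial>distr M borel (estimator n)) = (\<integral>\<omega>. f (estimator n \<omega>) \<partial>M)"
    "(\<integral>x. f x \<partial>distr M borel (leading_term n)) = (\<integral>\<omega>. f (leading_term n \<omega>) \<partial>M)"
    by (simp_all add: integral_distr)
  ultimately show ?thesis using l by linarith
qed

text \<open>
  The constants are chosen one after the other: \<open>\<delta>'\<close> and \<open>K\<close> for the passage from characteristic
  functions to test functions, \<open>\<eta>\<close> and \<open>B\<close> for the central limit theorem, \<open>a\<close> and then \<open>\<kappa>\<close> for the error of
  the approximation, and \<open>n\<close> last. No choice involves the probability space, the process or the
  covariance, which are therefore quantified inside.
\<close>

lemma uniform_BL_limit: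
  fixes C \<delta> c L G e :: real
  assumes C: "0 \<le> C" and \<delta>: "0 < \<delta>" and c: "0 < c" and L: "0 \<le> L" and e: "0 < e"
  shows "\<forall>\<^sub>F n in sequentially. \<forall>(M::'w measure) \<epsilon> (S::real^'d^'d) X \<Gamma> f.
    lag_model M \<epsilon> S C \<delta> X \<Gamma> c L G \<longrightarrow> (\<forall>x. \<bar>f x\<bar> \<le> 1) \<longrightarrow> 1-lipschitz_on UNIV f \<longrightarrow>
    \<bar>(\<integral>x. f x \<partial>distr M borel (\<lambda>\<omega>. sqrt n *\<^sub>R col_stack (Gamma_LA n (\<lambda>t. X t \<omega>) - \<Gamma>)))
      - (\<integral>x. f x \<partial>multivariate_normal 0 (kronecker (matrix_inv S) S))\<bar> \<le> e"
proof -
  let ?d = "real CARD('d)"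
  define \<sigma> where "\<sigma> = ?d\<^sup>2 * (1 + C)"
  define m2 where "m2 = max ((?d / c)\<^sup>2 * (?d\<^sup>2 * (1 + C)\<^sup>2)) (real CARD('d \<times> 'd) * (real CARD('d \<times> 'd) * (?d / c * \<sigma>)))"
  define l where "l n = ?d\<^sup>2 * (1 + 8 * (C + (1 + C)\<^sup>2)) * real n powr (1 / (1 + \<delta> / 2)) + 2 * \<sigma>" for n
  define q where "q n = (1 + C) * (ln (fact CARD('d)) + CARD('d) * ln (1 + L\<^sup>2 * (1 + C) * real n ^ 3))" for n
  have l_lim: "(\<lambda>n. l n / n) \<longlonglongrightarrow> 0"
    unfolding l_def using \<delta> by real_asymp
  have q_lim: "(\<lambda>n. q n / sqrt n) \<longlonglongrightarrow> 0"
  proof (cases "L = 0")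
    case True
    then show ?thesis unfolding q_def by simp real_asymp
  next
    case False
    then have "0 < L\<^sup>2 * (1 + C)" using C by simp
    then show ?thesis unfolding q_def by real_asymp
  qed
  have pw_lim: "(\<lambda>n. real n powr (- (\<delta> / 2))) \<longlonglongrightarrow> 0" using \<delta> by real_asymp
  have m2: "0 \<le> m2" unfolding m2_def by (simp add: le_max_iff_disj)
  have e2: "0 < e / 2" using e by simp
  obtain \<delta>' K where \<delta>': "0 < \<delta>'" and K: "0 < K"
    and close: "\<And>(P::(real^('d \<times> 'd)) measure) Q f. prob_space P \<Longrightarrow> sets P = sets borel \<Longrightarrow> prob_space Q \<Longrightarrow> sets Q = sets borel
      \<Longrightarrow> integrable P (\<lambda>x. (norm x)\<^sup>2) \<Longrightarrow> (\<integral>x. (norm x)\<^sup>2 \<partial>P) \<le> m2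
      \<Longrightarrow> integrable Q (\<lambda>x. (norm x)\<^sup>2) \<Longrightarrow> (\<integral>x. (norm x)\<^sup>2 \<partial>Q) \<le> m2
      \<Longrightarrow> (\<And>u. norm u \<le> K \<Longrightarrow> cmod (char_vec P u - char_vec Q u) \<le> \<delta>')
      \<Longrightarrow> (\<And>x. \<bar>f x\<bar> \<le> 1) \<Longrightarrow> 1-lipschitz_on UNIV f
      \<Longrightarrow> \<bar>(\<integral>x. f x \<partial>P) - (\<integral>x. f x \<partial>Q)\<bar> \<le> e / 2"
    using char_close_imp_BL_close[OF e2 m2, where 'k="'d \<times> 'd"] by metis
  define Kd where "Kd = K * (?d / c)"
  define D where "D = \<sigma> * Kd\<^sup>2 * \<sigma> + 1"
  define \<eta> where "\<eta> = min 1 (\<delta>' / 3)"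
  have \<eta>: "0 < \<eta>" "\<eta> \<le> 1" "\<eta> \<le> \<delta>' / 3" using \<delta>' by (auto simp: \<eta>_def)
  obtain B where B: "0 < B" "exp D * (Kd\<^sup>2 * B powr (- \<delta>) * ((1 + C) * C)) < \<delta>' / 6"
  proof -
    have "((\<lambda>B. exp D * (Kd\<^sup>2 * B powr (- \<delta>) * ((1 + C) * C))) \<longlongrightarrow> exp D * (Kd\<^sup>2 * 0 * ((1 + C) * C))) at_top"
      using \<delta> by (intro tendsto_intros tendsto_neg_powr filterlim_ident) auto
    then have "\<forall>\<^sub>F B in at_top. exp D * (Kd\<^sup>2 * B powr (- \<delta>) * ((1 + C) * C)) < \<delta>' / 6"
      using \<delta>' by (intro order_tendstoD(2)[where y="exp D * (Kd\<^sup>2 * 0 * ((1 + C) * C))"]) auto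
    with eventually_gt_at_top[of 0] have "\<forall>\<^sub>F B in at_top. 0 < B \<and> exp D * (Kd\<^sup>2 * B powr (- \<delta>) * ((1 + C) * C)) < \<delta>' / 6"
      by (rule eventually_conj)
    from eventually_happens'[OF trivial_limit_at_top_linorder this] that show thesis by blast
  qed
  define a where "a = 4 * ?d * (1 + C) / sqrt e"
  have a: "0 < a" using C e by (simp add: a_def)
  have a2: "?d\<^sup>2 * (1 + C)\<^sup>2 / a\<^sup>2 = e / 16"
    using C e by (simp add: a_def power_mult_distrib power_divide)
  define \<xi> where "\<xi> t = ?d * ((4 * t + 2 * t * (a + 2 * t) / c) / c)" for t
  \<comment> \<open>The number \<open>\<kappa>\<close> bounds both the self-normalised quantities, relative to \<open>sqrt n\<close>, and the relative
    error of the sample covariance.\<close>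
  obtain \<kappa> where \<kappa>: "0 < \<kappa>" "\<kappa> < c / 4" "\<xi> \<kappa> < e / 4"
  proof -
    have "(\<xi> \<longlongrightarrow> ?d * ((4 * 0 + 2 * 0 * (a + 2 * 0) / c) / c)) (at_right 0)"
      unfolding \<xi>_def using c by (intro tendsto_intros) auto
    then have "\<forall>\<^sub>F t in at_right 0. \<xi> t < e / 4"
      using e by (intro order_tendstoD(2)[where y="?d * ((4 * 0 + 2 * 0 * (a + 2 * 0) / c) / c)"]) auto
    moreover have "\<forall>\<^sub>F t in at_right 0. 0 < t \<and> t < c / 4"
      using eventually_at_right_less[of "0::real"] order_tendstoD(2)[OF tendsto_ident_at, of 0 "c / 4" "{0<..}"] c
      by (auto elim: eventually_elim2)
    ultimately have "\<forall>\<^sub>F t in at_right 0. \<xi> t < e / 4 \<and> 0 < t \<and> t < c / 4" by (rule eventually_conj)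
    from eventually_happens'[OF _ this] that show thesis by auto
  qed
  have \<xi>0: "0 \<le> \<xi> \<kappa>" using \<kappa> a c by (simp add: \<xi>_def)
  define E where "E = (Kd * B) powr (2 + \<delta>) + D * (\<sigma> * Kd\<^sup>2) powr (1 + \<delta> / 2)"
  have l1: "(\<lambda>n. exp D * (E * C * real n powr (- (\<delta> / 2)))) \<longlonglongrightarrow> 0"
    using tendsto_mult_right_zero[OF pw_lim, of "exp D * (E * C)"] by (simp add: mult.assoc)
  have l2: "(\<lambda>n. (1 + exp D) * (\<sigma> * Kd\<^sup>2 / \<eta>) * (l n / n)) \<longlonglongrightarrow> 0"
    by (rule tendsto_mult_right_zero[OF l_lim])
  have "\<forall>\<^sub>F n in sequentially. 8 * \<kappa> / c < sqrt n"
    "\<forall>\<^sub>F n in sequentially. 4 * (G\<^sup>2 + 1) < c * real n"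
    "\<forall>\<^sub>F n in sequentially. 2 * (a + 2 * \<kappa>) < c * sqrt n"
    using c by real_asymp+
  moreover have "\<forall>\<^sub>F n in sequentially. exp D * (E * C * real n powr (- (\<delta> / 2))) < \<delta>' / 6"
    "\<forall>\<^sub>F n in sequentially. (1 + exp D) * (\<sigma> * Kd\<^sup>2 / \<eta>) * (l n / n) < \<delta>' / 3"
    "\<forall>\<^sub>F n in sequentially. q n / sqrt n < \<kappa> * (e / 96)"
    "\<forall>\<^sub>F n in sequentially. l n / n < \<kappa> * (e / 64)"
    by (rule order_tendstoD(2)[OF l1] order_tendstoD(2)[OF l2] order_tendstoD(2)[OF q_lim] order_tendstoD(2)[OF l_lim],
        use \<delta>' \<kappa> e in simp)+
  moreover note eventually_ge_at_top[of 3]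
  ultimately show ?thesis
  proof (eventually_elim, intro allI impI)
    fix n and M :: "'w measure" and \<epsilon> X :: "nat \<Rightarrow> 'w \<Rightarrow> real^'d" and S \<Gamma> :: "real^'d^'d"
      and f :: "real^('d \<times> 'd) \<Rightarrow> real"
    assume elim: "8 * \<kappa> / c < sqrt n" "4 * (G\<^sup>2 + 1) < c * real n" "2 * (a + 2 * \<kappa>) < c * sqrt n"
      "exp D * (E * C * real n powr (- (\<delta> / 2))) < \<delta>' / 6"
      "(1 + exp D) * (\<sigma> * Kd\<^sup>2 / \<eta>) * (l n / n) < \<delta>' / 3"
      "q n / sqrt n < \<kappa> * (e / 96)" "l n / n < \<kappa> * (e / 64)" "3 \<le> n"
      and lm: "lag_model M \<epsilon> S C \<delta> X \<Gamma> c L G" and f': "\<forall>x. \<bar>f x\<bar> \<le> 1" and f2: "1-lipschitz_on UNIV f"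
    interpret lag_model M \<epsilon> S C \<delta> X \<Gamma> c L G by (rule lm)
    have n: "0 < real n" "0 < sqrt n" using elim by auto
    have f: "\<And>x. \<bar>f x\<bar> \<le> 1" "1-lipschitz_on UNIV f" using f' f2 by auto
    have l: "lln_bound n \<le> l n" using norm_S by (simp add: lln_bound_def l_def \<sigma>_def)
    have q: "self_norm_rate n = q n" by (simp add: self_norm_rate_def q_def)
    have "\<bar>(\<integral>x. f x \<partial>distr M borel (estimator n)) - (\<integral>x. f x \<partial>target)\<bar> \<le> \<xi> \<kappa> + 2 * (e / 8) + e / 2"
    proof (rule BL_bound[OF f \<xi>0])
      have "8 * \<kappa> < c * sqrt n" using elim c by (simp add: field_simps)
      then have "8 * \<kappa> * sqrt n \<le> c * sqrt n * sqrt n" using n by (intro mult_right_mono) auto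
      then have \<kappa>n: "8 * (\<kappa> * sqrt n) \<le> c * n" by (simp only: mult.assoc real_sqrt_mult_self abs_of_nat)
      have "prob {\<omega> \<in> space M. \<xi> \<kappa> < norm (estimator n \<omega> - leading_term n \<omega>)}
        \<le> 3 * (q n / (\<kappa> * sqrt n)) + 2 * (lln_bound n / (n * \<kappa>)) + ?d\<^sup>2 * (1 + C)\<^sup>2 / a\<^sup>2"
        unfolding \<xi>_def q[symmetric]
        by (rule leading_term_approximation[where m="n - 1" and k="n - 2"]) (use elim \<kappa> \<kappa>n a in auto)
      moreover have "3 * (q n / (\<kappa> * sqrt n)) \<le> e / 32"
      proof -
        have "q n / (\<kappa> * sqrt n) = (q n / sqrt n) / \<kappa>" by simp
        also have "\<dots> \<le> e / 96"
          using less_imp_le[OF elim(6)] by (simp only: pos_divide_le_eq[OF \<kappa>(1)] mult.commute[of \<kappa>])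
        finally show ?thesis by linarith
      qed
      moreover have "2 * (lln_bound n / (n * \<kappa>)) \<le> e / 32"
      proof -
        have "lln_bound n / (n * \<kappa>) \<le> (l n / n) / \<kappa>" using l n \<kappa> by (simp add: divide_right_mono)
        also have "\<dots> \<le> e / 64"
          using less_imp_le[OF elim(7)] by (simp only: pos_divide_le_eq[OF \<kappa>(1)] mult.commute[of \<kappa>])
        finally show ?thesis by linarith
      qed
      ultimately show "prob {\<omega> \<in> space M. \<xi> \<kappa> < norm (estimator n \<omega> - leading_term n \<omega>)} \<le> e / 8"
        unfolding a2 by linarith
      show "\<bar>(\<integral>x. f x \<partial>distr M borel (leading_term n)) - (\<integral>x. f x \<partial>target)\<bar> \<le> e / 2"
      proof (rule close[OF prob_space_distr _ prob_space_target sets_target _ _ target_second_moment(1) _ _ f])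
        have n0: "0 < n" using elim by simp
        show "integrable (distr M borel (leading_term n)) (\<lambda>x. (norm x)\<^sup>2)"
          using leading_term_second_moment(1)[OF n0] by (subst integrable_distr_eq) simp_all
        have "(\<integral>x. (norm x)\<^sup>2 \<partial>distr M borel (leading_term n)) = (\<integral>\<omega>. (norm (leading_term n \<omega>))\<^sup>2 \<partial>M)"
          by (subst integral_distr) simp_all
        then show "(\<integral>x. (norm x)\<^sup>2 \<partial>distr M borel (leading_term n)) \<le> m2"
          using leading_term_second_moment(2)[OF n0] unfolding m2_def by (simp add: le_max_iff_disj)
        show "(\<integral>x. (norm x)\<^sup>2 \<partial>target) \<le> m2"
          by (rule order_trans[OF target_second_moment(2)]) (unfold m2_def \<sigma>_def, rule max.cobounded2)
        fix u :: "real^('d \<times> 'd)" assume u: "norm u \<le> K"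
        have "cmod (char_vec (distr M borel (leading_term n)) u - char_vec target u)
          \<le> exp D * (Kd\<^sup>2 * B powr (- \<delta>) * ((1 + C) * C) + E * C * real n powr (- (\<delta> / 2)))
            + \<eta> + (1 + exp D) * (\<sigma> * Kd\<^sup>2 * lln_bound n / (real n * \<eta>))"
          unfolding E_def D_def Kd_def \<sigma>_def
          by (rule char_leading_term[OF u less_imp_le[OF K] _ \<eta>(1,2) B(1)]) (use elim in simp)
        also have "(1 + exp D) * (\<sigma> * Kd\<^sup>2 * lln_bound n / (real n * \<eta>)) \<le> (1 + exp D) * (\<sigma> * Kd\<^sup>2 * l n / (real n * \<eta>))"
          using l n \<eta> C by (intro mult_left_mono divide_right_mono) (auto simp: \<sigma>_def add_nonneg_nonneg)
        also have "\<dots> = (1 + exp D) * (\<sigma> * Kd\<^sup>2 / \<eta>) * (l n / n)" by (simp add: mult.commute)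
        also have "exp D * (Kd\<^sup>2 * B powr (- \<delta>) * ((1 + C) * C) + E * C * real n powr (- (\<delta> / 2)))
          + \<eta> + (1 + exp D) * (\<sigma> * Kd\<^sup>2 / \<eta>) * (l n / n) \<le> \<delta>'"
          unfolding distrib_left[of "exp D"] using elim(4,5) B(2) \<eta>(3) by linarith
        finally show "cmod (char_vec (distr M borel (leading_term n)) u - char_vec target u) \<le> \<delta>'" by simp
      qed simp_all
    qed
    then show "\<bar>(\<integral>x. f x \<partial>distr M borel (\<lambda>\<omega>. sqrt n *\<^sub>R col_stack (Gamma_LA n (\<lambda>t. X t \<omega>) - \<Gamma>)))
      - (\<integral>x. f x \<partial>multivariate_normal 0 (kronecker (matrix_inv S) S))\<bar> \<le> e"
      using \<kappa> unfolding estimator_def[abs_def] target_def by linarith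
  qed
qed

section \<open>Uniform constants\<close>

text \<open>
  The exponent is capped at three, for which the third-order expansion of the exponential is made;
  lowering it costs at most one in the moment.
\<close>

lemma noise_of_assumption_M:
  fixes \<epsilon> X :: "'d param \<Rightarrow> nat \<Rightarrow> 'w \<Rightarrow> real^'d::{finite,linorder}"
  assumes M: "assumption_M M \<Theta> \<epsilon> X" and \<theta>: "\<theta> \<in> \<Theta>"
    and \<delta>0: "0 < \<delta>\<^sub>0" and mom: "\<And>t. (\<integral>\<^sup>+\<omega>. ennreal (norm (\<epsilon> \<theta> t \<omega>) powr (2 + \<delta>\<^sub>0)) \<partial>M) \<le> ennreal (cc \<theta>)"
    and C: "0 \<le> C" "ennreal (cc \<theta>) \<le> ennreal C"
  shows "noise M (\<epsilon> \<theta>) (Sig \<theta>) (1 + C) (min 1 \<delta>\<^sub>0)"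
proof -
  interpret prob_space M using M by (simp add: assumption_M_def)
  have \<epsilon> [measurable]: "\<epsilon> \<theta> t \<in> borel_measurable M" for t using M \<theta> by (simp add: assumption_M_def)
  have md: "\<forall>\<theta>\<in>\<Theta>. \<forall>t\<ge>1. AE \<omega> in M.
        cond_exp_vector M (generated_filtration M (\<epsilon> \<theta>) (t - 1)) (\<epsilon> \<theta> t) \<omega> = 0"
    and cv: "\<forall>\<theta>\<in>\<Theta>. \<forall>t\<ge>1. AE \<omega> in M.
        cond_exp_matrix M (generated_filtration M (\<epsilon> \<theta>) (t - 1))
          (\<lambda>\<omega>. outer (\<epsilon> \<theta> t \<omega>) (\<epsilon> \<theta> t \<omega>)) \<omega> = Sig \<theta>"
    using M unfolding assumption_M_def by blast+
  show ?thesis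
  proof
    show "\<epsilon> \<theta> t \<in> borel_measurable M" for t by (rule \<epsilon>)
    fix t i
    have "AE \<omega> in M. cond_exp_vector M (generated_filtration M (\<epsilon> \<theta>) (Suc t - 1)) (\<epsilon> \<theta> (Suc t)) \<omega> = 0"
      by (rule md[rule_format, OF \<theta>]) simp
    then show "AE \<omega> in M. real_cond_exp M (generated_filtration M (\<epsilon> \<theta>) t) (\<lambda>\<omega>. \<epsilon> \<theta> (Suc t) \<omega> $ i) \<omega> = 0"
      by eventually_elim (simp add: cond_exp_vector_def vec_eq_iff)
    fix j
    have "AE \<omega> in M. cond_exp_matrix M (generated_filtration M (\<epsilon> \<theta>) (Suc t - 1))
        (\<lambda>\<omega>. outer (\<epsilon> \<theta> (Suc t) \<omega>) (\<epsilon> \<theta> (Suc t) \<omega>)) \<omega> = Sig \<theta>"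
      by (rule cv[rule_format, OF \<theta>]) simp
    then show "AE \<omega> in M. real_cond_exp M (generated_filtration M (\<epsilon> \<theta>) t)
        (\<lambda>\<omega>. \<epsilon> \<theta> (Suc t) \<omega> $ i * \<epsilon> \<theta> (Suc t) \<omega> $ j) \<omega> = Sig \<theta> $ i $ j"
      by eventually_elim (simp add: cond_exp_matrix_def vec_eq_iff outer_def)
  next
    fix t
    have le: "x powr (2 + min 1 \<delta>\<^sub>0) \<le> 1 + x powr (2 + \<delta>\<^sub>0)" if "0 \<le> x" for x :: real
    proof (cases "x \<le> 1")
      case True
      then have "x powr (2 + min 1 \<delta>\<^sub>0) \<le> 1" using that \<delta>0 by (intro powr_le1) auto
      then show ?thesis using powr_ge_zero[of x "2 + \<delta>\<^sub>0"] by linarith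
    next
      case False
      then have "x powr (2 + min 1 \<delta>\<^sub>0) \<le> x powr (2 + \<delta>\<^sub>0)" by (intro powr_mono) auto
      then show ?thesis by simp
    qed
    have "(\<integral>\<^sup>+\<omega>. ennreal (norm (\<epsilon> \<theta> t \<omega>) powr (2 + min 1 \<delta>\<^sub>0)) \<partial>M)
        \<le> (\<integral>\<^sup>+\<omega>. 1 + ennreal (norm (\<epsilon> \<theta> t \<omega>) powr (2 + \<delta>\<^sub>0)) \<partial>M)"
      using le by (intro nn_integral_mono) (simp add: ennreal_1[symmetric] ennreal_plus[symmetric] del: ennreal_1 ennreal_plus)
    also have "\<dots> = 1 + (\<integral>\<^sup>+\<omega>. ennreal (norm (\<epsilon> \<theta> t \<omega>) powr (2 + \<delta>\<^sub>0)) \<partial>M)"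
      by (subst nn_integral_add) (simp_all add: emeasure_space_1)
    also have "\<dots> \<le> 1 + ennreal C" using mom[of t] C(2) by (intro add_left_mono) (rule order_trans)
    also have "\<dots> = ennreal (1 + C)" using C(1) by (simp add: ennreal_plus)
    finally show "(\<integral>\<^sup>+\<omega>. ennreal (norm (\<epsilon> \<theta> t \<omega>) powr (2 + min 1 \<delta>\<^sub>0)) \<partial>M) \<le> ennreal (1 + C)" .
  qed (use C \<delta>0 in auto)
qed

text \<open>
  In the coordinates \<open>y = F\<^sup>-\<^sup>1 x\<close> the recursion is Jordan-like, and its diagonal entries are eigenvalues
  of \<open>\<Gamma>\<close>. The change of coordinates and its inverse cost a factor \<open>K\<close> each.
\<close>

lemma autoregression_growth:
  fixes \<Gamma> :: "real^('d::{finite,linorder})^('d::{finite,linorder})" and x e :: "nat \<Rightarrow> real^('d::{finite,linorder})"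
  assumes F: "invertible F" "matrix_inv F ** complex_matrix \<Gamma> ** F = J" and J: "J \<in> jordan_like (1 - \<alpha>)"
    and \<alpha>: "0 < \<alpha>" "\<alpha> < 1" and ev: "\<And>l. l \<in> eigenvalues (complex_matrix \<Gamma>) \<Longrightarrow> cmod l \<le> 1"
    and K: "0 < K" "sigma_max F \<le> K" "1 / K \<le> sigma_min F"
    and x: "x 0 = 0" "\<And>t. x (Suc t) = \<Gamma> *v x t + e (Suc t)"
  shows "norm (x t) \<le> K * (real CARD('d) * (1 / \<alpha>) ^ CARD('d)) * K * (\<Sum>s=1..t. norm (e s))"
proof -
  let ?W = "real CARD('d) * (1 / \<alpha>) ^ CARD('d)"
  define y where "y t = matrix_inv F *v complex_vector (x t)" for t
  define g where "g t = matrix_inv F *v complex_vector (e t)" for t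
  note FI = matrix_inv_mult[OF F(1)]
  have Fy: "F *v (matrix_inv F *v v) = v" for v by (simp add: matrix_vector_mul_assoc FI)
  have JF: "J *v (matrix_inv F *v v) = matrix_inv F *v (complex_matrix \<Gamma> *v v)" for v
    unfolding F(2)[symmetric] by (simp add: matrix_vector_mul_assoc[symmetric] Fy)
  have inv_le: "norm (matrix_inv F *v v) \<le> K * norm v" for v
  proof -
    have "1 / K * norm (matrix_inv F *v v) \<le> sigma_min F * norm (matrix_inv F *v v)"
      by (intro mult_right_mono K) simp
    also have "\<dots> \<le> norm v" using singular_value_bounds(2)[of F "matrix_inv F *v v"] by (simp add: Fy)
    finally show ?thesis using K(1) by (simp add: field_simps)
  qed
  have diag: "cmod (J $ i $ i) \<le> 1" for i
  proof -
    have "J $ i $ i \<in> eigenvalues J" by (rule upper_triangular_eigenvalue) (rule jordan_like_cases(1)[OF J])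
    then obtain v where v: "v \<noteq> 0" "J *v v = J $ i $ i *s v" by (auto simp: eigenvalues_def)
    have "complex_matrix \<Gamma> *v (F *v v) = F *v (J *v v)"
      unfolding F(2)[symmetric] by (simp add: matrix_vector_mul_assoc[symmetric] Fy)
    also have "\<dots> = J $ i $ i *s (F *v v)" by (simp add: v(2) vector_scalar_commute)
    finally have "complex_matrix \<Gamma> *v (F *v v) = J $ i $ i *s (F *v v)" .
    moreover have "F *v v \<noteq> 0"
    proof
      assume "F *v v = 0"
      then have "matrix_inv F *v (F *v v) = 0" by simp
      then show False using v(1) by (simp add: matrix_vector_mul_assoc FI)
    qed
    ultimately show ?thesis by (intro ev) (auto simp: eigenvalues_def)
  qed
  have "norm (y t) \<le> ?W * (\<Sum>s=1..t. norm (g s))"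
  proof (rule jordan_like_recursion_bound[OF J \<alpha> diag])
    show "y 0 = 0" by (simp add: y_def x(1) complex_vector_def vec_eq_iff matrix_vector_mult_def)
    show "y (Suc t) = J *v y t + g (Suc t)" for t
      unfolding y_def g_def JF x(2) complex_vector_add complex_vector_mult by (rule matrix_vector_right_distrib)
  qed
  also have "\<dots> \<le> ?W * (\<Sum>s=1..t. K * norm (e s))"
    using \<alpha> by (intro mult_left_mono sum_mono) (auto simp: g_def intro!: order_trans[OF inv_le] simp: norm_complex_vector)
  finally have y: "norm (y t) \<le> ?W * (\<Sum>s=1..t. K * norm (e s))" .
  have "norm (x t) = norm (F *v y t)" by (simp add: y_def Fy norm_complex_vector)
  also have "\<dots> \<le> sigma_max F * norm (y t)" by (rule singular_value_bounds)
  also have "\<dots> \<le> K * (?W * (\<Sum>s=1..t. K * norm (e s)))" using K y by (intro mult_mono) auto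
  finally show ?thesis by (simp add: sum_distrib_left[symmetric] mult_ac)
qed

text \<open>
  The similarity bounds \<open>\<Gamma>\<close> itself, and \<open>\<parallel>\<Gamma>\<^sup>T v\<parallel>\<^sup>2 = v \<bullet> \<Gamma> (\<Gamma>\<^sup>T v)\<close> carries the bound over to the transpose.
\<close>

lemma norm_transpose_mult_le_similar:
  fixes \<Gamma> :: "real^('d::{finite,linorder})^('d::{finite,linorder})"
  assumes F: "invertible F" "matrix_inv F ** complex_matrix \<Gamma> ** F = J"
    and K: "0 < K" "sigma_max F \<le> K" "1 / K \<le> sigma_min F" "sigma_max J \<le> K"
  shows "norm (transpose \<Gamma> *v v) \<le> K ^ 3 * norm v"
proof -
  note FI = matrix_inv_mult[OF F(1)]
  have Fy: "F *v (matrix_inv F *v v) = v" for v by (simp add: matrix_vector_mul_assoc FI)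
  have le: "norm (\<Gamma> *v x) \<le> K ^ 3 * norm x" for x
  proof -
    let ?z = "matrix_inv F *v complex_vector x"
    have "1 / K * norm ?z \<le> sigma_min F * norm ?z" by (intro mult_right_mono K) simp
    also have "\<dots> \<le> norm x" using singular_value_bounds(2)[of F ?z] by (simp add: Fy norm_complex_vector)
    finally have z: "norm ?z \<le> K * norm x" using K(1) by (simp add: field_simps)
    have Jz: "norm (J *v ?z) \<le> K * (K * norm x)"
      by (rule order_trans[OF singular_value_bounds(1)]) (use K z in \<open>intro mult_mono; auto\<close>)
    have "complex_vector (\<Gamma> *v x) = F *v (J *v ?z)"
      unfolding F(2)[symmetric] by (simp add: matrix_vector_mul_assoc[symmetric] Fy complex_vector_mult)
    then have "norm (\<Gamma> *v x) = norm (F *v (J *v ?z))" by (metis norm_complex_vector)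
    also have "\<dots> \<le> sigma_max F * norm (J *v ?z)" by (rule singular_value_bounds)
    also have "\<dots> \<le> K * (K * (K * norm x))" using K Jz by (intro mult_mono) auto
    finally show ?thesis by (simp add: power3_eq_cube mult_ac)
  qed
  let ?w = "transpose \<Gamma> *v v"
  have "norm ?w * norm ?w = v \<bullet> (\<Gamma> *v ?w)"
    using inner_transpose_matrix[of ?w \<Gamma> v] by (simp add: inner_commute power2_norm_eq_inner[symmetric] power2_eq_square)
  also have "\<dots> \<le> norm v * (K ^ 3 * norm ?w)"
    by (rule order_trans[OF norm_cauchy_schwarz]) (intro mult_left_mono le norm_ge_zero)
  finally have "norm ?w * norm ?w \<le> norm ?w * (K ^ 3 * norm v)" by (simp add: mult_ac)
  then show ?thesis using K(1) by (cases "?w = 0") auto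
qed

lemma inverse_ennreal_le_imp:
  assumes "inverse (ennreal b) \<le> ennreal K" "0 < K"
  shows "1 / K \<le> b"
proof (cases "0 < b")
  case True
  then have "inverse b \<le> K" using assms by (simp add: inverse_ennreal ennreal_le_iff)
  then show ?thesis using True assms(2) by (simp add: field_simps)
next
  case False
  then have "inverse (ennreal b) = top" by (simp add: ennreal_neg)
  then show ?thesis using assms by (simp add: top_unique)
qed

lemma SUP_ennreal_less_top_bound:
  fixes f :: "'a \<Rightarrow> ennreal"
  assumes "(SUP x\<in>A. f x) < \<infinity>"
  obtains K where "0 < K" "\<And>x. x \<in> A \<Longrightarrow> f x \<le> ennreal K"
proof
  show "0 < enn2real (SUP x\<in>A. f x) + 1" using enn2real_nonneg[of "SUP x\<in>A. f x"] by linarith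
  fix x assume "x \<in> A"
  then have "f x \<le> (SUP x\<in>A. f x)" by (rule SUP_upper)
  also have "\<dots> = ennreal (enn2real (SUP x\<in>A. f x))" using assms by simp
  also have "\<dots> \<le> ennreal (enn2real (SUP x\<in>A. f x) + 1)" by (intro ennreal_leI) simp
  finally show "f x \<le> ennreal (enn2real (SUP x\<in>A. f x) + 1)" .
qed

lemma (in noise) autoregression_adapted:
  fixes X :: "nat \<Rightarrow> 'a \<Rightarrow> real^'d" and \<Gamma> :: "real^'d^'d"
  assumes X: "\<And>\<omega>. \<omega> \<in> space M \<Longrightarrow> X 0 \<omega> = 0" "\<And>t \<omega>. \<omega> \<in> space M \<Longrightarrow> X (Suc t) \<omega> = \<Gamma> *v X t \<omega> + \<epsilon> (Suc t) \<omega>"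
  shows "X t \<in> borel_measurable (F t)"
proof (induction t)
  case 0
  have "X 0 \<in> borel_measurable (F 0) \<longleftrightarrow> (\<lambda>_. 0 :: real^'d) \<in> borel_measurable (F 0)"
    by (rule measurable_cong) (simp add: X(1))
  then show ?case by simp
next
  case (Suc t)
  have [measurable]: "X t \<in> borel_measurable (F (Suc t))"
    by (rule measurable_from_subalg[OF F_mono Suc.IH]) simp
  have [measurable]: "\<epsilon> (Suc t) \<in> borel_measurable (F (Suc t))" by (rule \<epsilon>_adapted) simp
  have "X (Suc t) \<in> borel_measurable (F (Suc t)) \<longleftrightarrow> (\<lambda>\<omega>. \<Gamma> *v X t \<omega> + \<epsilon> (Suc t) \<omega>) \<in> borel_measurable (F (Suc t))"
    by (rule measurable_cong) (simp add: X(2))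
  then show ?case by simp
qed

theorem lemmaF1:
  fixes M :: "'w measure"
    and \<Theta> :: "'d::{finite,linorder} param set"
    and \<epsilon> X :: "'d param \<Rightarrow> nat \<Rightarrow> 'w \<Rightarrow> real^('d::{finite,linorder})"
  assumes "parameter_space \<Theta>"
    and "assumption_M M \<Theta> \<epsilon> X"
    and "assumption_U \<Theta>"
  shows "uniformly_weakly_converges \<Theta>
    (\<lambda>n \<theta>. distr M borel
       (\<lambda>\<omega>. sqrt (real n) *\<^sub>R col_stack (Gamma_LA n (\<lambda>t. X \<theta> t \<omega>) - Gam \<theta>)))
    (\<lambda>n \<theta>. multivariate_normal 0 (kronecker (matrix_inv (Sig \<theta>)) (Sig \<theta>)))"
proof -
  have fin1: "(SUP \<theta>\<in>\<Theta>. ennreal (cc \<theta>)) < \<infinity>" and fin2: "(SUP \<theta>\<in>\<Theta>. ennreal (sigma_max (complex_matrix (Sig \<theta>)))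
        + inverse (ennreal (sigma_min (complex_matrix (Sig \<theta>))))) < \<infinity>"
    using assms(3) unfolding assumption_U_def by blast+
  obtain C where C: "0 < C" "\<And>\<theta>. \<theta> \<in> \<Theta> \<Longrightarrow> ennreal (cc \<theta>) \<le> ennreal C"
    by (rule SUP_ennreal_less_top_bound[OF fin1], rule that)
  obtain K\<^sub>1 where K\<^sub>1: "0 < K\<^sub>1" "\<And>\<theta>. \<theta> \<in> \<Theta> \<Longrightarrow> ennreal (sigma_max (complex_matrix (Sig \<theta>)))
        + inverse (ennreal (sigma_min (complex_matrix (Sig \<theta>)))) \<le> ennreal K\<^sub>1"
    by (rule SUP_ennreal_less_top_bound[OF fin2], rule that)
  obtain \<alpha> F J where \<alpha>: "0 < \<alpha>" "\<alpha> < 1"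
    and ev': "\<forall>\<theta>\<in>\<Theta>. \<forall>l\<in>eigenvalues (complex_matrix (Gam \<theta>)).
      cmod l \<le> 1 \<and> cmod l * cmod (1 - l) \<le> ((1 - \<alpha>) * (2 - \<alpha>) / \<alpha>) * (1 - cmod l)"
    and FJ': "\<forall>\<theta>\<in>\<Theta>. invertible (F \<theta>) \<and> J \<theta> \<in> jordan_like (1 - \<alpha>) \<and>
      matrix_inv (F \<theta>) ** complex_matrix (Gam \<theta>) ** F \<theta> = J \<theta>"
    and fin: "(SUP \<theta>\<in>\<Theta>. ennreal (sigma_max (F \<theta>)) + inverse (ennreal (sigma_min (F \<theta>)))
              + ennreal (sigma_max (J \<theta>))) < \<infinity>"
    using assms(3) unfolding assumption_U_def by (elim conjE exE) (rule that)
  have ev: "cmod l \<le> 1" if "\<theta> \<in> \<Theta>" "l \<in> eigenvalues (complex_matrix (Gam \<theta>))" for \<theta> l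
    using ev' that by blast
  have F: "invertible (F \<theta>)" and J: "J \<theta> \<in> jordan_like (1 - \<alpha>)"
    and FJ: "matrix_inv (F \<theta>) ** complex_matrix (Gam \<theta>) ** F \<theta> = J \<theta>" if "\<theta> \<in> \<Theta>" for \<theta>
    using FJ' that by simp_all
  obtain K where K: "0 < K" and K_le: "\<And>\<theta>. \<theta> \<in> \<Theta> \<Longrightarrow> ennreal (sigma_max (F \<theta>)) + inverse (ennreal (sigma_min (F \<theta>)))
              + ennreal (sigma_max (J \<theta>)) \<le> ennreal K"
    by (rule SUP_ennreal_less_top_bound[OF fin], rule that)
  have "\<exists>\<delta>>0. \<forall>\<theta>\<in>\<Theta>. \<forall>t. (\<integral>\<^sup>+\<omega>. ennreal (norm (\<epsilon> \<theta> t \<omega>) powr (2 + \<delta>)) \<partial>M) \<le> ennreal (cc \<theta>)"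
    and rec: "\<forall>\<theta>\<in>\<Theta>. \<forall>\<omega>\<in>space M. X \<theta> 0 \<omega> = 0 \<and> (\<forall>t\<ge>1. X \<theta> t \<omega> = Gam \<theta> *v X \<theta> (t - 1) \<omega> + \<epsilon> \<theta> t \<omega>)"
    using assms(2) unfolding assumption_M_def by blast+
  then obtain \<delta>\<^sub>0 where \<delta>\<^sub>0: "0 < \<delta>\<^sub>0" and mom: "\<And>\<theta> t. \<theta> \<in> \<Theta> \<Longrightarrow>
      (\<integral>\<^sup>+\<omega>. ennreal (norm (\<epsilon> \<theta> t \<omega>) powr (2 + \<delta>\<^sub>0)) \<partial>M) \<le> ennreal (cc \<theta>)"
    by blast
  define L where "L = K * (real CARD('d) * (1 / \<alpha>) ^ CARD('d)) * K"
  have lag: "lag_model M (\<epsilon> \<theta>) (Sig \<theta>) (1 + C) (min 1 \<delta>\<^sub>0) (X \<theta>) (Gam \<theta>) (1 / K\<^sub>1) L (K ^ 3)" if \<theta>: "\<theta> \<in> \<Theta>" for \<theta>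
  proof -
    interpret noise M "\<epsilon> \<theta>" "Sig \<theta>" "1 + C" "min 1 \<delta>\<^sub>0"
      using noise_of_assumption_M[OF assms(2) \<theta> \<delta>\<^sub>0 mom[OF \<theta>]] C \<theta> by simp
    have X: "\<omega> \<in> space M \<Longrightarrow> X \<theta> 0 \<omega> = 0"
      "\<omega> \<in> space M \<Longrightarrow> X \<theta> (Suc t) \<omega> = Gam \<theta> *v X \<theta> t \<omega> + \<epsilon> \<theta> (Suc t) \<omega>" for t \<omega>
      using rec[rule_format, OF \<theta>, of \<omega>] by auto
    have "Sig \<theta> \<in> psd_matrices" using assms(1) \<theta> by (auto simp: parameter_space_def Sig_def)
    note psd = psd_form_ge_sigma_min[OF this]
    have "inverse (ennreal (sigma_min (complex_matrix (Sig \<theta>)))) \<le> ennreal K\<^sub>1"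
      by (rule order_trans[OF _ K\<^sub>1(2)[OF \<theta>]]) (rule add_increasing, simp_all)
    from inverse_ennreal_le_imp[OF this K\<^sub>1(1)] have c: "1 / K\<^sub>1 \<le> sigma_min (complex_matrix (Sig \<theta>))" .
    have "inverse (ennreal (sigma_min (F \<theta>))) \<le> ennreal K"
      by (rule order_trans[OF _ K_le[OF \<theta>]]) (rule add_increasing2, simp, rule add_increasing, simp_all)
    from inverse_ennreal_le_imp[OF this K] have Fmin: "1 / K \<le> sigma_min (F \<theta>)" .
    have "ennreal (sigma_max (F \<theta>)) \<le> ennreal K"
      by (rule order_trans[OF _ K_le[OF \<theta>]]) (rule add_increasing2, simp, rule add_increasing2, simp_all)
    then have Fmax: "sigma_max (F \<theta>) \<le> K" using K by (simp add: ennreal_le_iff)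
    have "ennreal (sigma_max (J \<theta>)) \<le> ennreal K"
      by (rule order_trans[OF _ K_le[OF \<theta>]]) (rule add_increasing, simp_all)
    then have Jmax: "sigma_max (J \<theta>) \<le> K" using K by (simp add: ennreal_le_iff)
    show ?thesis
    proof (intro lag_model.intro lag_model_axioms.intro noise_axioms)
      show "X \<theta> t \<in> borel_measurable (generated_filtration M (\<epsilon> \<theta>) t)" for t
        by (rule autoregression_adapted[OF X])
      show "norm (X \<theta> t \<omega>) \<le> L * (\<Sum>s=1..t. norm (\<epsilon> \<theta> s \<omega>))" if "\<omega> \<in> space M" for t \<omega>
        unfolding L_def
        by (rule autoregression_growth[OF F[OF \<theta>] FJ[OF \<theta>] J[OF \<theta>] \<alpha> ev[OF \<theta>] K Fmax Fmin])
           (use X that in auto)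
      show "1 / K\<^sub>1 * (x \<bullet> x) \<le> x \<bullet> (Sig \<theta> *v x)" for x
        by (rule order_trans[OF mult_right_mono[OF c] psd]) simp
      show "norm (transpose (Gam \<theta>) *v v) \<le> K ^ 3 * norm v" for v
        by (rule norm_transpose_mult_le_similar[OF F[OF \<theta>] FJ[OF \<theta>] K Fmax Fmin Jmax])
    qed (use X(2) C \<theta> K\<^sub>1(1) K \<alpha> in \<open>auto simp: L_def\<close>)
  qed
  show ?thesis
    unfolding uniformly_weakly_converges_def
  proof (rule order_tendstoI)
    fix a :: ennreal assume "0 < a"
    then obtain b where b: "0 < b" "b < a" using dense by blast
    define e where "e = enn2real b"
    have be: "b = ennreal e" using b(2) by (simp add: e_def less_top order_less_le_trans)
    have e: "0 < e" using b(1) be by simp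
    have "\<forall>\<^sub>F n in sequentially. \<forall>(M::'w measure) \<epsilon> (S::real^('d::{finite,linorder})^('d::{finite,linorder})) X \<Gamma> f.
      lag_model M \<epsilon> S (1 + C) (min 1 \<delta>\<^sub>0) X \<Gamma> (1 / K\<^sub>1) L (K ^ 3) \<longrightarrow> (\<forall>x. \<bar>f x\<bar> \<le> 1) \<longrightarrow> 1-lipschitz_on UNIV f \<longrightarrow>
      \<bar>(\<integral>x. f x \<partial>distr M borel (\<lambda>\<omega>. sqrt n *\<^sub>R col_stack (Gamma_LA n (\<lambda>t. X t \<omega>) - \<Gamma>)))
        - (\<integral>x. f x \<partial>multivariate_normal 0 (kronecker (matrix_inv S) S))\<bar> \<le> e"
      using C K\<^sub>1(1) K \<alpha> \<delta>\<^sub>0 e by (intro uniform_BL_limit) (auto simp: L_def)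
    then show "\<forall>\<^sub>F n in sequentially. (SUP \<theta>\<in>\<Theta>. ennreal (d_BL (distr M borel
        (\<lambda>\<omega>. sqrt (real n) *\<^sub>R col_stack (Gamma_LA n (\<lambda>t. X \<theta> t \<omega>) - Gam \<theta>)))
        (multivariate_normal 0 (kronecker (matrix_inv (Sig \<theta>)) (Sig \<theta>))))) < a"
    proof eventually_elim
      case (elim n)
      have "d_BL (distr M borel (\<lambda>\<omega>. sqrt (real n) *\<^sub>R col_stack (Gamma_LA n (\<lambda>t. X \<theta> t \<omega>) - Gam \<theta>)))
        (multivariate_normal 0 (kronecker (matrix_inv (Sig \<theta>)) (Sig \<theta>))) \<le> e" if "\<theta> \<in> \<Theta>" for \<theta>
        unfolding d_BL_def
      proof (rule cSUP_least)
        have "(\<lambda>_. 0) \<in> {f :: real^(('d::{finite,linorder}) \<times> ('d::{finite,linorder})) \<Rightarrow> real. range f \<subseteq> {-1..1} \<and> 1-lipschitz_on UNIV f}"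
          by (auto simp: lipschitz_on_def)
        then show "{f :: real^(('d::{finite,linorder}) \<times> ('d::{finite,linorder})) \<Rightarrow> real. range f \<subseteq> {-1..1} \<and> 1-lipschitz_on UNIV f} \<noteq> {}" by blast
        fix f :: "real^(('d::{finite,linorder}) \<times> ('d::{finite,linorder})) \<Rightarrow> real" assume f: "f \<in> {f. range f \<subseteq> {-1..1} \<and> 1-lipschitz_on UNIV f}"
        then have "\<bar>f x\<bar> \<le> 1" for x by (auto simp: abs_le_iff image_subset_iff)
        then show "\<bar>(\<integral>x. f x \<partial>distr M borel (\<lambda>\<omega>. sqrt (real n) *\<^sub>R col_stack (Gamma_LA n (\<lambda>t. X \<theta> t \<omega>) - Gam \<theta>)))
          - (\<integral>x. f x \<partial>multivariate_normal 0 (kronecker (matrix_inv (Sig \<theta>)) (Sig \<theta>)))\<bar> \<le> e"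
          using elim[rule_format, OF lag[OF that]] f by blast
      qed
      then have "(SUP \<theta>\<in>\<Theta>. ennreal (d_BL (distr M borel
        (\<lambda>\<omega>. sqrt (real n) *\<^sub>R col_stack (Gamma_LA n (\<lambda>t. X \<theta> t \<omega>) - Gam \<theta>)))
        (multivariate_normal 0 (kronecker (matrix_inv (Sig \<theta>)) (Sig \<theta>))))) \<le> ennreal e"
        by (intro SUP_least ennreal_leI)
      then show ?case using b(2) be by simp
    qed
  qed simp
qed

end
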